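(* Let $\nu>0$, $M>0$, and let $f\in X$ satisfy Assumption (A) with some $\rho_0>0$. Then there exists a constant $C(\rho_0,\nu,M)>0$ such that if $\|f\|_X\le C(\rho_0,\nu,M)$, the following hold: (i) The steady-state Navier–Stokes equation $$U\cdot\nabla U+\nabla p=\nu\Delta U+f,\qquad \nabla\cdot U=0 \quad\text{in }\mathbb{R}^3$$ has a weak solution $U\in H^1_\sigma$, in the sense that for every $\phi\in\mathcal V$, $$\langle U\cdot\nabla U,\phi\rangle+\nu\langle\nabla U,\nabla\phi\rangle=\langle f,\phi\rangle .$$ (ii) This solution satisfies $\|U\|_2\le M$ and $\|\nabla U\|_2\le \nu^{-1}\|f\|_X$. (iii) This solution is unique among all weak solutions (in the sense of (i)) which have finite $L^2$ norm and satisfy $\|\nabla U\|_2\le\nu^{-1}\|f\|_X$.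
   Context: All functions are defined on $\mathbb{R}^3$ (vector-valued), and all integrals are over $\mathbb{R}^3$. $\langle f,g\rangle=\int f\cdot g$. $\mathcal V=\{\phi\in C_0^\infty(\mathbb{R}^3;\mathbb{R}^3):\nabla\cdot\phi=0\}$. $L^2_\sigma$ is the completion of $\mathcal V$ in $\|\cdot\|_2$; $\mathring H^1_\sigma$ is the completion of $\mathcal V$ in the norm $\|\nabla\cdot\|_2$; $H^1_\sigma=L^2_\sigma\cap\mathring H^1_\sigma$; $(\mathring H^1_\sigma)'$ is the dual of $\mathring H^1_\sigma$; $X=L^2_\sigma\cap(\mathring H^1_\sigma)'$ with $\|f\|_X=\max\{\|f\|_2,\|f\|_{(\mathring H^1_\sigma)'}\}$. The Fourier transform is $\hat f(\xi)=\int f(x)e^{-2\pi i x\cdot\xi}dx$. Assumption (A) on $f$: $f\in X$ and there exists $\rho_0>0$ such that $\hat f(\xi)=0$ for almost every $|\xi|<\rho_0$. *)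

theory Defs
  imports "HOL-Analysis.Analysis"
begin

type_synonym R3 = "real^3"

definition pd :: "3 \<Rightarrow> (R3 \<Rightarrow> 'b::real_normed_vector) \<Rightarrow> R3 \<Rightarrow> 'b" where
  "pd j f x = frechet_derivative f (at x) (axis j 1)"

text \<open>C-infinity: differentiable everywhere, and all partial derivatives are again C-infinity
  (greatest fixed point, i.e. all iterated partial derivatives exist everywhere).\<close>
coinductive smooth :: "(R3 \<Rightarrow> 'b::real_normed_vector) \<Rightarrow> bool" where
  "(\<forall>x. f differentiable (at x)) \<Longrightarrow> (\<forall>j. smooth (pd j f)) \<Longrightarrow> smooth f"

definition compact_supp :: "(R3 \<Rightarrow> 'b::real_normed_vector) \<Rightarrow> bool" where
  "compact_supp f \<longleftrightarrow> compact (closure {x. f x \<noteq> 0})"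

definition test_fun :: "(R3 \<Rightarrow> real) set" where
  "test_fun = {\<psi>. smooth \<psi> \<and> compact_supp \<psi>}"

definition grad :: "(R3 \<Rightarrow> R3) \<Rightarrow> R3 \<Rightarrow> real^3^3" where
  "grad u x = (\<chi> i j. pd j u x $ i)"

definition divergence :: "(R3 \<Rightarrow> R3) \<Rightarrow> R3 \<Rightarrow> real" where
  "divergence u x = (\<Sum>i\<in>UNIV. pd i u x $ i)"

definition Vsp :: "(R3 \<Rightarrow> R3) set" where
  "Vsp = {\<phi>. smooth \<phi> \<and> compact_supp \<phi> \<and> (\<forall>x. divergence \<phi> x = 0)}"

definition Lp_int :: "real \<Rightarrow> (R3 \<Rightarrow> 'b::real_normed_vector) \<Rightarrow> ennreal" where
  "Lp_int p u = (\<integral>\<^sup>+ x. ennreal (norm (u x) powr p) \<partial>lborel)"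

definition L2 :: "(R3 \<Rightarrow> 'b::real_normed_vector) set" where
  "L2 = {u. u \<in> borel_measurable lborel \<and> Lp_int 2 u < \<infinity>}"

definition L2_norm :: "(R3 \<Rightarrow> 'b::real_normed_vector) \<Rightarrow> real" where
  "L2_norm u = sqrt (enn2real (Lp_int 2 u))"

definition weak_grad :: "(R3 \<Rightarrow> R3) \<Rightarrow> (R3 \<Rightarrow> real^3^3) \<Rightarrow> bool" where
  "weak_grad u G \<longleftrightarrow> u \<in> borel_measurable lborel \<and> G \<in> borel_measurable lborel \<and>
     (\<forall>\<psi>\<in>test_fun. \<forall>i j.
        integrable lborel (\<lambda>x. u x $ i * pd j \<psi> x) \<and>
        integrable lborel (\<lambda>x. G x $ i $ j * \<psi> x) \<and>
        (\<integral>x. u x $ i * pd j \<psi> x \<partial>lborel) = - (\<integral>x. G x $ i $ j * \<psi> x \<partial>lborel))"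

definition L2sig :: "(R3 \<Rightarrow> R3) set" where
  "L2sig = {u. u \<in> L2 \<and> (\<exists>\<phi>. (\<forall>n. \<phi> n \<in> Vsp) \<and>
              (\<lambda>n. Lp_int 2 (\<lambda>x. \<phi> n x - u x)) \<longlonglongrightarrow> 0)}"

text \<open>Homogeneous space: completion of V in the norm of the gradient in L^2, realized
  (via the Sobolev inequality) as functions: limits of V in L^6 whose gradients converge in L^2.\<close>
definition Hdot1sig :: "(R3 \<Rightarrow> R3) set" where
  "Hdot1sig = {u. \<exists>G. weak_grad u G \<and> G \<in> L2 \<and>
      (\<exists>\<phi>. (\<forall>n. \<phi> n \<in> Vsp) \<and>
         (\<lambda>n. Lp_int 2 (\<lambda>x. grad (\<phi> n) x - G x)) \<longlonglongrightarrow> 0 \<and>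
         (\<lambda>n. Lp_int 6 (\<lambda>x. \<phi> n x - u x)) \<longlonglongrightarrow> 0)}"

definition H1sig :: "(R3 \<Rightarrow> R3) set" where
  "H1sig = L2sig \<inter> Hdot1sig"

definition pair :: "(R3 \<Rightarrow> R3) \<Rightarrow> (R3 \<Rightarrow> R3) \<Rightarrow> real" where
  "pair f g = (\<integral>x. f x \<bullet> g x \<partial>lborel)"

text \<open>f defines a bounded functional on the homogeneous space (V dense in it).\<close>
definition in_Hdual :: "(R3 \<Rightarrow> R3) \<Rightarrow> bool" where
  "in_Hdual f \<longleftrightarrow> (\<exists>K. \<forall>\<phi>\<in>Vsp. \<bar>pair f \<phi>\<bar> \<le> K * L2_norm (grad \<phi>))"

definition Hdual_norm :: "(R3 \<Rightarrow> R3) \<Rightarrow> real" where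
  "Hdual_norm f = Sup {\<bar>pair f \<phi>\<bar> | \<phi>. \<phi> \<in> Vsp \<and> L2_norm (grad \<phi>) \<le> 1}"

definition Xsp :: "(R3 \<Rightarrow> R3) set" where
  "Xsp = {f. f \<in> L2sig \<and> in_Hdual f}"

definition X_norm :: "(R3 \<Rightarrow> R3) \<Rightarrow> real" where
  "X_norm f = max (L2_norm f) (Hdual_norm f)"

definition trunc_fourier :: "(R3 \<Rightarrow> R3) \<Rightarrow> 3 \<Rightarrow> real \<Rightarrow> R3 \<Rightarrow> complex" where
  "trunc_fourier f i R \<xi> =
     (\<integral>x. (indicator (cball 0 R) x * f x $ i) *\<^sub>R cis (- 2 * pi * (x \<bullet> \<xi>)) \<partial>lborel)"

definition is_fourier_L2 :: "(R3 \<Rightarrow> R3) \<Rightarrow> (3 \<Rightarrow> R3 \<Rightarrow> complex) \<Rightarrow> bool" where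
  "is_fourier_L2 f F \<longleftrightarrow> (\<forall>i. F i \<in> borel_measurable lborel \<and>
     ((\<lambda>R. Lp_int 2 (\<lambda>\<xi>. trunc_fourier f i R \<xi> - F i \<xi>)) \<longlongrightarrow> 0) at_top)"

definition assumptionA :: "real \<Rightarrow> (R3 \<Rightarrow> R3) \<Rightarrow> bool" where
  "assumptionA \<rho>0 f \<longleftrightarrow> f \<in> Xsp \<and> \<rho>0 > 0 \<and>
     (\<exists>F. is_fourier_L2 f F \<and> (AE \<xi> in lborel. norm \<xi> < \<rho>0 \<longrightarrow> (\<forall>i. F i \<xi> = 0)))"

text \<open>U (with weak gradient G) is a weak solution: for all phi in V,
  <U . grad U, phi> + nu <grad U, grad phi> = <f, phi>.
  Note (G x *v U x) $ i = sum_j U_j d_j U_i.\<close>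
definition weak_solution :: "real \<Rightarrow> (R3 \<Rightarrow> R3) \<Rightarrow> (R3 \<Rightarrow> R3) \<Rightarrow> (R3 \<Rightarrow> real^3^3) \<Rightarrow> bool" where
  "weak_solution \<nu> f U G \<longleftrightarrow> weak_grad U G \<and>
     (\<forall>\<phi>\<in>Vsp. (\<integral>x. (G x *v U x) \<bullet> \<phi> x \<partial>lborel) + \<nu> * (\<integral>x. G x \<bullet> grad \<phi> x \<partial>lborel)
              = pair f \<phi>)"

end

theory Submission
  imports Defs
begin

text \<open>
  The solution is the fixed point, in the closure of the solenoidal test fields in \<open>H\<^sup>1\<close>, of the map that
  sends \<open>a\<close> to the solution \<open>u\<close> of the linear Stokes problem with right-hand side \<open>f - a \<cdot> \<nabla>a\<close>. The gradient
  of \<open>u\<close> is controlled by testing with \<open>u\<close>. Its $L^2$ norm is controlled by duality: the solution \<open>v\<close> of the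
  dual problem with right-hand side \<open>u\<close> has second derivatives bounded in $L^2$ by \<open>u\<close>, hence gradient bounded
  in $L^6$, which is paired with \<open>a \<otimes> a\<close> after moving the derivative from \<open>a\<close> to \<open>v\<close>. For the pairing of \<open>f\<close>
  with \<open>v\<close> the spectral gap enters: there is an even kernel with finite second moments and positive mass whose
  convolution with \<open>f\<close> vanishes, so that \<open>v\<close> may be replaced by its difference from an even average, which is
  of second order. All bounds are quadratic in \<open>a\<close> and linear in \<open>f\<close>, so the map is a contraction of a small
  ball. Uniqueness follows by testing the equation for the difference \<open>W\<close> of two solutions with \<open>W\<close> and
  using that the solution constructed is small in $L^3$.\<close>

section \<open>Square-integrable functions\<close>

text \<open>The obstacle is at low frequencies: testing the Stokes problem with its own solution
  controls the gradient and says nothing about the L^2 norm on the whole space. Duality trades this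
  for a bound on pairings with a field \<open>v\<close> of which only second derivatives are
  controlled. The forcing must therefore not see \<open>v\<close> up to first order; evenness of the
  kernel removes the linear part, and its positive mass allows solving for the pairing. To have
  \<open>v\<close> at all, a zero-order term with factor \<epsilon> is added to both problems; every
  bound is independent of \<epsilon>, so it can be removed. The pressure never appears, because all
  equations are tested with solenoidal fields. The competitor in the uniqueness statement is a limit
  of test fields only in L^6, with gradients in L^2, and its weak gradient is supplied separately;
  hence antisymmetry is proved for such limits, and weak gradients are shown to be unique. Origin of
  the constants: 7 is the Sobolev constant, 70 bounds a gradient in L^6, 490 = 7 * 70, 980 = 2 *
  490, 3920 = 4 * 980.\<close>

lemma Lp_int_2: "Lp_int 2 u = (\<integral>\<^sup>+x. ennreal ((norm (u x))\<^sup>2) \<partial>lborel)"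
  by (simp add: Lp_int_def)

lemma Lp_int_6: "Lp_int 6 u = (\<integral>\<^sup>+x. ennreal ((norm (u x)) ^ 6) \<partial>lborel)"
  by (simp add: Lp_int_def)

lemma Lp_int_mono:
  assumes "AE x in lborel. norm (u x) \<le> norm (v x)" "p \<ge> 0"
  shows "Lp_int p u \<le> Lp_int p v"
  unfolding Lp_int_def
  by (intro nn_integral_mono_AE eventually_mono[OF assms(1)] ennreal_leI powr_mono2) (use assms(2) in auto)

lemma Lp_int_cong_AE:
  assumes "AE x in lborel. norm (u x) = norm (v x)"
  shows "Lp_int p u = Lp_int p v"
  unfolding Lp_int_def by (intro nn_integral_cong_AE eventually_mono[OF assms]) auto

lemma Lp_int_minus_commute: "Lp_int p (\<lambda>x. u x - v x) = Lp_int p (\<lambda>x. v x - u x)"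
  by (intro Lp_int_cong_AE) (simp add: norm_minus_commute)

lemma L2_iff:
  fixes u :: "R3 \<Rightarrow> 'b::euclidean_space"
  shows "u \<in> L2 \<longleftrightarrow> u \<in> borel_measurable lborel \<and> integrable lborel (\<lambda>x. (norm (u x))\<^sup>2)"
proof -
  have "Lp_int 2 u < \<infinity> \<longleftrightarrow> integrable lborel (\<lambda>x. (norm (u x))\<^sup>2)"
    if [measurable]: "u \<in> borel_measurable lborel"
    unfolding Lp_int_2 by (subst integrable_iff_bounded) auto
  then show ?thesis by (auto simp: L2_def)
qed

lemma L2_measurable: "u \<in> L2 \<Longrightarrow> u \<in> borel_measurable borel"
  by (simp add: L2_def)

lemma L2_measurable_lborel: "u \<in> L2 \<Longrightarrow> u \<in> borel_measurable lborel"
  by (simp add: L2_def)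

lemma L2_integrable:
  fixes u :: "R3 \<Rightarrow> 'b::euclidean_space"
  shows "u \<in> L2 \<Longrightarrow> integrable lborel (\<lambda>x. (norm (u x))\<^sup>2)"
  by (simp add: L2_iff)

lemma L2_norm_sq:
  fixes u :: "R3 \<Rightarrow> 'b::euclidean_space"
  assumes "u \<in> borel_measurable lborel"
  shows "(L2_norm u)\<^sup>2 = (\<integral>x. (norm (u x))\<^sup>2 \<partial>lborel)"
  unfolding L2_norm_def Lp_int_2 using assms
  by (subst integral_eq_nn_integral) (auto)

lemma L2_norm_nonneg [simp]: "L2_norm u \<ge> 0"
  by (simp add: L2_norm_def)

lemma Lp_int_2_eq: "u \<in> L2 \<Longrightarrow> Lp_int 2 u = ennreal ((L2_norm u)\<^sup>2)"
  by (simp add: L2_def L2_norm_def)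

text \<open>Bounds obtained in the extended reals, for instance from Fatou's lemma, become
  membership and a norm bound in one step.\<close>

lemma L2_norm_le_iff:
  assumes "u \<in> borel_measurable lborel" "c \<ge> 0"
  shows "Lp_int 2 u \<le> ennreal (c\<^sup>2) \<longleftrightarrow> u \<in> L2 \<and> L2_norm u \<le> c"
proof
  assume *: "Lp_int 2 u \<le> ennreal (c\<^sup>2)"
  then have "Lp_int 2 u < \<infinity>" by (metis ennreal_less_top infinity_ennreal_def order_le_less_trans)
  then have u: "u \<in> L2" using assms by (auto simp: L2_def)
  with * have "(L2_norm u)\<^sup>2 \<le> c\<^sup>2" by (simp add: Lp_int_2_eq)
  then show "u \<in> L2 \<and> L2_norm u \<le> c" using u assms by (auto intro: power2_le_imp_le)
next
  assume "u \<in> L2 \<and> L2_norm u \<le> c"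
  then show "Lp_int 2 u \<le> ennreal (c\<^sup>2)"
    by (auto simp: Lp_int_2_eq intro!: ennreal_leI power_mono)
qed

lemma L2_dominated:
  fixes u :: "R3 \<Rightarrow> 'b::euclidean_space" and v :: "R3 \<Rightarrow> 'c::euclidean_space"
  assumes "v \<in> L2" "u \<in> borel_measurable lborel" "c \<ge> 0"
    "AE x in lborel. norm (u x) \<le> c * norm (v x)"
  shows "u \<in> L2 \<and> L2_norm u \<le> c * L2_norm v"
proof -
  have "Lp_int 2 u \<le> (\<integral>\<^sup>+x. ennreal (c\<^sup>2) * ennreal ((norm (v x))\<^sup>2) \<partial>lborel)"
    unfolding Lp_int_2
    by (intro nn_integral_mono_AE eventually_mono[OF assms(4)])
       (metis assms(3) ennreal_leI ennreal_mult' norm_ge_zero power_mono power_mult_distrib zero_le_power2)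
  also have "\<dots> = ennreal (c\<^sup>2) * Lp_int 2 v"
    unfolding Lp_int_2 using L2_measurable_lborel[OF assms(1)] by (intro nn_integral_cmult) auto
  also have "\<dots> = ennreal ((c * L2_norm v)\<^sup>2)"
    by (simp add: Lp_int_2_eq[OF assms(1)] power_mult_distrib ennreal_mult')
  finally show ?thesis
    using assms by (subst (asm) L2_norm_le_iff) auto
qed

lemma L2_add:
  fixes u :: "R3 \<Rightarrow> 'b::euclidean_space"
  assumes "u \<in> L2" "v \<in> L2" shows "(\<lambda>x. u x + v x) \<in> L2"
proof -
  note [measurable] = assms[THEN L2_measurable]
  have "(norm (a + b))\<^sup>2 \<le> 2 * (norm a)\<^sup>2 + 2 * (norm b)\<^sup>2" for a b :: 'b
  proof -
    have "(norm (a + b))\<^sup>2 \<le> (norm a + norm b)\<^sup>2" by (intro power_mono norm_triangle_ineq) auto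
    also have "\<dots> \<le> 2 * (norm a)\<^sup>2 + 2 * (norm b)\<^sup>2"
      using sum_squares_bound[of "norm a" "norm b"] by (simp add: power2_sum)
    finally show ?thesis .
  qed
  note * = this
  have "integrable lborel (\<lambda>x. (norm (u x + v x))\<^sup>2)"
  proof (rule Bochner_Integration.integrable_bound)
    show "integrable lborel (\<lambda>x. 2 * (norm (u x))\<^sup>2 + 2 * (norm (v x))\<^sup>2)"
      by (intro Bochner_Integration.integrable_add integrable_mult_right assms[THEN L2_integrable])
    show "AE x in lborel. norm ((norm (u x + v x))\<^sup>2) \<le> norm (2 * (norm (u x))\<^sup>2 + 2 * (norm (v x))\<^sup>2)"
      using * by (intro AE_I2) (simp only: real_norm_def abs_of_nonneg add_nonneg_nonneg zero_le_power2 mult_nonneg_nonneg zero_le_numeral)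
  qed measurable
  then show ?thesis by (auto simp: L2_iff)
qed

lemma L2_scale:
  fixes u :: "R3 \<Rightarrow> 'b::euclidean_space"
  assumes "u \<in> L2" shows "(\<lambda>x. c *\<^sub>R u x) \<in> L2"
  using assms by (auto simp: L2_iff power_mult_distrib)

lemma L2_diff:
  fixes u :: "R3 \<Rightarrow> 'b::euclidean_space"
  assumes "u \<in> L2" "v \<in> L2" shows "(\<lambda>x. u x - v x) \<in> L2"
  using L2_add[OF assms(1) L2_scale[OF assms(2), of "-1"]] by simp

lemma L2_norm_zero [simp]: "L2_norm (\<lambda>x. 0) = 0"
  by (simp add: L2_norm_def Lp_int_def)

lemma L2_norm_cong_AE:
  assumes "AE x in lborel. norm (u x) = norm (v x)"
  shows "L2_norm u = L2_norm v"
  unfolding L2_norm_def using Lp_int_cong_AE[OF assms] by simp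

lemma L2_norm_minus_commute: "L2_norm (\<lambda>x. u x - v x) = L2_norm (\<lambda>x. v x - u x)"
  using Lp_int_minus_commute[of 2 u v] by (simp add: L2_norm_def)

lemma L2_inner_norm_integrable:
  fixes u :: "R3 \<Rightarrow> 'b::euclidean_space" and v :: "R3 \<Rightarrow> 'c::euclidean_space"
  assumes "u \<in> L2" "v \<in> L2"
  shows "integrable lborel (\<lambda>x. norm (u x) * norm (v x))"
proof -
  note [measurable] = assms[THEN L2_measurable]
  show ?thesis
  proof (rule Bochner_Integration.integrable_bound[of lborel "\<lambda>x. (norm (u x))\<^sup>2 + (norm (v x))\<^sup>2"])
    have "norm a * norm b \<le> (norm a)\<^sup>2 + (norm b)\<^sup>2" for a :: 'b and b :: 'c
      using sum_squares_bound[of "norm a" "norm b"] mult_nonneg_nonneg[OF norm_ge_zero[of a] norm_ge_zero[of b]] by linarith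
    then show "AE x in lborel. norm (norm (u x) * norm (v x)) \<le> norm ((norm (u x))\<^sup>2 + (norm (v x))\<^sup>2)"
      by (intro AE_I2) simp
  qed (use assms[THEN L2_integrable] in auto)
qed

lemma L2_inner_norm_bound:
  fixes u :: "R3 \<Rightarrow> 'b::euclidean_space" and v :: "R3 \<Rightarrow> 'c::euclidean_space"
  assumes "u \<in> L2" "v \<in> L2"
  shows "(\<integral>x. norm (u x) * norm (v x) \<partial>lborel) \<le> L2_norm u * L2_norm v"
proof -
  note [measurable] = assms[THEN L2_measurable]
  have "ennreal ((\<integral>x. norm (u x) * norm (v x) \<partial>lborel)\<^sup>2) = (\<integral>\<^sup>+x. ennreal (norm (u x)) * ennreal (norm (v x)) \<partial>lborel)\<^sup>2"
    using nn_integral_eq_integral[OF L2_inner_norm_integrable[OF assms]]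
    by (simp add: ennreal_power ennreal_mult')
  also have "\<dots> \<le> Lp_int 2 u * Lp_int 2 v"
    unfolding Lp_int_2 by (rule order_trans[OF Cauchy_Schwarz_nn_integral]) (auto simp: ennreal_power)
  also have "\<dots> = ennreal ((L2_norm u * L2_norm v)\<^sup>2)"
    by (simp add: assms Lp_int_2_eq power_mult_distrib ennreal_mult')
  finally have "(\<integral>x. norm (u x) * norm (v x) \<partial>lborel)\<^sup>2 \<le> (L2_norm u * L2_norm v)\<^sup>2" by simp
  then show ?thesis by (rule power2_le_imp_le) simp
qed

lemma L2_inner_integrable:
  fixes u v :: "R3 \<Rightarrow> 'b::euclidean_space"
  assumes "u \<in> L2" "v \<in> L2"
  shows "integrable lborel (\<lambda>x. u x \<bullet> v x)"
proof -
  note [measurable] = assms[THEN L2_measurable]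
  show ?thesis
    by (rule Bochner_Integration.integrable_bound[OF L2_inner_norm_integrable[OF assms]])
       (auto simp: Cauchy_Schwarz_ineq2)
qed

lemma L2_Cauchy_Schwarz:
  fixes u v :: "R3 \<Rightarrow> 'b::euclidean_space"
  assumes "u \<in> L2" "v \<in> L2"
  shows "\<bar>\<integral>x. u x \<bullet> v x \<partial>lborel\<bar> \<le> L2_norm u * L2_norm v"
proof -
  have "\<bar>\<integral>x. u x \<bullet> v x \<partial>lborel\<bar> \<le> (\<integral>x. \<bar>u x \<bullet> v x\<bar> \<partial>lborel)" by (rule integral_abs_bound)
  also have "\<dots> \<le> (\<integral>x. norm (u x) * norm (v x) \<partial>lborel)"
    by (intro integral_mono integrable_abs L2_inner_integrable L2_inner_norm_integrable assms Cauchy_Schwarz_ineq2)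
  finally show ?thesis using L2_inner_norm_bound[OF assms] by simp
qed

lemma L2_norm_sq_inner:
  fixes u :: "R3 \<Rightarrow> 'b::euclidean_space"
  assumes "u \<in> L2"
  shows "(L2_norm u)\<^sup>2 = (\<integral>x. u x \<bullet> u x \<partial>lborel)"
  using L2_norm_sq[of u] assms by (simp add: L2_measurable power2_norm_eq_inner)

lemma L2_norm_sq_add:
  fixes u v :: "R3 \<Rightarrow> 'b::euclidean_space"
  assumes "u \<in> L2" "v \<in> L2"
  shows "(L2_norm (\<lambda>x. u x + v x))\<^sup>2 = (L2_norm u)\<^sup>2 + 2 * (\<integral>x. u x \<bullet> v x \<partial>lborel) + (L2_norm v)\<^sup>2"
proof -
  have "(u x + v x) \<bullet> (u x + v x) = u x \<bullet> u x + 2 * (u x \<bullet> v x) + v x \<bullet> v x" for x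
    by (simp add: inner_add_left inner_add_right inner_commute)
  then show ?thesis
    using assms by (simp add: L2_norm_sq_inner L2_add L2_inner_integrable)
qed

lemma L2_norm_scale:
  fixes u :: "R3 \<Rightarrow> 'b::euclidean_space"
  assumes "u \<in> L2"
  shows "L2_norm (\<lambda>x. c *\<^sub>R u x) = \<bar>c\<bar> * L2_norm u"
proof -
  have "(L2_norm (\<lambda>x. c *\<^sub>R u x))\<^sup>2 = (\<bar>c\<bar> * L2_norm u)\<^sup>2"
    using L2_measurable_lborel[OF assms] by (simp add: L2_norm_sq power_mult_distrib)
  then show ?thesis by (simp add: power2_eq_iff_nonneg)
qed

lemma L2_norm_triangle:
  fixes u :: "R3 \<Rightarrow> 'b::euclidean_space"
  assumes "u \<in> L2" "v \<in> L2"
  shows "L2_norm (\<lambda>x. u x + v x) \<le> L2_norm u + L2_norm v"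
proof (rule power2_le_imp_le)
  show "(L2_norm (\<lambda>x. u x + v x))\<^sup>2 \<le> (L2_norm u + L2_norm v)\<^sup>2"
    using L2_Cauchy_Schwarz[OF assms] by (simp add: L2_norm_sq_add[OF assms] power2_sum)
qed simp

lemma L2_norm_uminus: "L2_norm (\<lambda>x. - u x) = L2_norm u"
  by (rule L2_norm_cong_AE) simp

lemma L2_norm_triangle3:
  fixes u :: "R3 \<Rightarrow> 'b::euclidean_space"
  assumes "u \<in> L2" "v \<in> L2" "w \<in> L2"
  shows "L2_norm (\<lambda>x. u x - w x) \<le> L2_norm (\<lambda>x. u x - v x) + L2_norm (\<lambda>x. v x - w x)"
  using L2_norm_triangle[OF L2_diff[OF assms(1,2)] L2_diff[OF assms(2,3)]] by simp

lemma L2_norm_diff_le: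
  fixes u :: "R3 \<Rightarrow> 'b::euclidean_space"
  assumes "u \<in> L2" "v \<in> L2"
  shows "\<bar>L2_norm u - L2_norm v\<bar> \<le> L2_norm (\<lambda>x. u x - v x)"
  using L2_norm_triangle[OF L2_diff[OF assms] assms(2)]
        L2_norm_triangle[OF L2_diff[OF assms(2,1)] assms(1)]
  by (simp add: L2_norm_minus_commute[of v u])

lemma L2_norm_eq_0:
  fixes u :: "R3 \<Rightarrow> 'b::euclidean_space"
  assumes "u \<in> L2" "L2_norm u = 0"
  shows "AE x in lborel. u x = 0"
proof -
  note [measurable] = assms(1)[THEN L2_measurable]
  have "Lp_int 2 u = 0" using assms by (simp add: Lp_int_2_eq)
  then show ?thesis unfolding Lp_int_2 by (subst (asm) nn_integral_0_iff_AE) auto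
qed

lemma L2_tendsto_iff:
  fixes u :: "nat \<Rightarrow> R3 \<Rightarrow> 'b::euclidean_space"
  assumes "\<And>n. u n \<in> L2" "v \<in> L2"
  shows "(\<lambda>n. Lp_int 2 (\<lambda>x. u n x - v x)) \<longlonglongrightarrow> 0 \<longleftrightarrow> (\<lambda>n. L2_norm (\<lambda>x. u n x - v x)) \<longlonglongrightarrow> 0"
proof -
  have "(\<lambda>n. Lp_int 2 (\<lambda>x. u n x - v x)) = (\<lambda>n. ennreal ((L2_norm (\<lambda>x. u n x - v x))\<^sup>2))"
    by (intro ext Lp_int_2_eq L2_diff assms)
  moreover have "(\<lambda>n. ennreal ((L2_norm (\<lambda>x. u n x - v x))\<^sup>2)) \<longlonglongrightarrow> 0 \<longleftrightarrow> (\<lambda>n. (L2_norm (\<lambda>x. u n x - v x))\<^sup>2) \<longlonglongrightarrow> 0"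
    by (subst ennreal_0[symmetric], subst tendsto_ennreal_iff) auto
  ultimately show ?thesis by (simp)
qed

lemma L2_inner_tendsto:
  fixes u :: "nat \<Rightarrow> R3 \<Rightarrow> 'b::euclidean_space"
  assumes "\<And>n. u n \<in> L2" "U \<in> L2" "(\<lambda>n. L2_norm (\<lambda>x. u n x - U x)) \<longlonglongrightarrow> 0"
    and "\<And>n. v n \<in> L2" "V \<in> L2" "(\<lambda>n. L2_norm (\<lambda>x. v n x - V x)) \<longlonglongrightarrow> 0"
  shows "(\<lambda>n. \<integral>x. u n x \<bullet> v n x \<partial>lborel) \<longlonglongrightarrow> (\<integral>x. U x \<bullet> V x \<partial>lborel)"
proof (rule LIM_zero_cancel, rule tendsto_rabs_zero_cancel, rule tendsto_sandwich[OF _ _ tendsto_const])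
  let ?d = "\<lambda>n. L2_norm (\<lambda>x. u n x - U x)" and ?e = "\<lambda>n. L2_norm (\<lambda>x. v n x - V x)"
  show "(\<lambda>n. ?d n * (?e n + L2_norm V) + L2_norm U * ?e n) \<longlonglongrightarrow> 0"
    using tendsto_add[OF tendsto_mult[OF assms(3) tendsto_add[OF assms(6) tendsto_const[of "L2_norm V"]]]
       tendsto_mult[OF tendsto_const[of "L2_norm U"] assms(6)]] by simp
  show "\<forall>\<^sub>F n in sequentially. \<bar>(\<integral>x. u n x \<bullet> v n x \<partial>lborel) - (\<integral>x. U x \<bullet> V x \<partial>lborel)\<bar>
      \<le> ?d n * (?e n + L2_norm V) + L2_norm U * ?e n"
  proof (rule always_eventually, rule allI)
    fix n
    have "(\<integral>x. u n x \<bullet> v n x \<partial>lborel) - (\<integral>x. U x \<bullet> V x \<partial>lborel)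
       = (\<integral>x. u n x \<bullet> v n x - U x \<bullet> V x \<partial>lborel)"
      by (intro Bochner_Integration.integral_diff[symmetric] L2_inner_integrable assms)
    also have "\<dots> = (\<integral>x. (u n x - U x) \<bullet> v n x + U x \<bullet> (v n x - V x) \<partial>lborel)"
      by (simp add: inner_diff_left inner_diff_right)
    also have "\<dots> = (\<integral>x. (u n x - U x) \<bullet> v n x \<partial>lborel) + (\<integral>x. U x \<bullet> (v n x - V x) \<partial>lborel)"
      by (intro Bochner_Integration.integral_add L2_inner_integrable L2_diff assms)
    finally have "\<bar>(\<integral>x. u n x \<bullet> v n x \<partial>lborel) - (\<integral>x. U x \<bullet> V x \<partial>lborel)\<bar>
       \<le> ?d n * L2_norm (v n) + L2_norm U * ?e n"
      using L2_Cauchy_Schwarz[OF L2_diff[OF assms(1,2)] assms(4), of n n]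
        L2_Cauchy_Schwarz[OF assms(2) L2_diff[OF assms(4,5)], of n] by linarith
    moreover have "?d n * L2_norm (v n) \<le> ?d n * (?e n + L2_norm V)"
      using L2_norm_triangle[OF L2_diff[OF assms(4,5)] assms(5), of n] by (intro mult_left_mono) auto
    ultimately show "\<bar>(\<integral>x. u n x \<bullet> v n x \<partial>lborel) - (\<integral>x. U x \<bullet> V x \<partial>lborel)\<bar>
      \<le> ?d n * (?e n + L2_norm V) + L2_norm U * ?e n" by linarith
  qed
qed auto

lemma L2_norm_tendsto:
  fixes u :: "nat \<Rightarrow> R3 \<Rightarrow> 'b::euclidean_space"
  assumes "\<And>n. u n \<in> L2" "U \<in> L2" "(\<lambda>n. L2_norm (\<lambda>x. u n x - U x)) \<longlonglongrightarrow> 0"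
  shows "(\<lambda>n. L2_norm (u n)) \<longlonglongrightarrow> L2_norm U"
proof (rule LIM_zero_cancel, rule tendsto_rabs_zero_cancel, rule tendsto_sandwich[OF _ _ tendsto_const assms(3)])
  show "\<forall>\<^sub>F n in sequentially. \<bar>L2_norm (u n) - L2_norm U\<bar> \<le> L2_norm (\<lambda>x. u n x - U x)"
    by (intro always_eventually allI L2_norm_diff_le assms)
qed auto

section \<open>Limits: Fatou's lemma, almost everywhere convergent subsequences,
  completeness\<close>

lemma Lp_int_Fatou:
  fixes u :: "nat \<Rightarrow> R3 \<Rightarrow> 'b::euclidean_space"
  assumes "\<And>n. u n \<in> borel_measurable lborel" "AE x in lborel. (\<lambda>n. u n x) \<longlonglongrightarrow> v x"
    "\<And>n. Lp_int p (u n) \<le> c" "p > 0"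
  shows "Lp_int p v \<le> c"
proof -
  note [measurable] = assms(1)
  have "Lp_int p v = (\<integral>\<^sup>+x. liminf (\<lambda>n. ennreal (norm (u n x) powr p)) \<partial>lborel)"
    unfolding Lp_int_def
  proof (intro nn_integral_cong_AE eventually_mono[OF assms(2)])
    fix x assume "(\<lambda>n. u n x) \<longlonglongrightarrow> v x"
    then have "(\<lambda>n. norm (u n x) powr p) \<longlonglongrightarrow> norm (v x) powr p"
      using assms(4) by (intro tendsto_powr2 tendsto_norm tendsto_const) auto
    then have "(\<lambda>n. ennreal (norm (u n x) powr p)) \<longlonglongrightarrow> ennreal (norm (v x) powr p)"
      by (rule tendsto_ennrealI)
    then show "ennreal (norm (v x) powr p) = liminf (\<lambda>n. ennreal (norm (u n x) powr p))"
      by (intro lim_imp_Liminf[symmetric]) auto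
  qed
  also have "\<dots> \<le> liminf (\<lambda>n. Lp_int p (u n))"
    unfolding Lp_int_def by (intro nn_integral_liminf) auto
  also have "\<dots> \<le> c"
    by (metis (mono_tags) Liminf_bounded Liminf_const assms(3) Liminf_mono always_eventually sequentially_bot)
  finally show ?thesis .
qed

lemma Lp_int_AE_subseq:
  fixes u :: "nat \<Rightarrow> R3 \<Rightarrow> 'b::euclidean_space"
  assumes "\<And>n. u n \<in> borel_measurable lborel" "v \<in> borel_measurable lborel"
    "(\<lambda>n. Lp_int p (\<lambda>x. u n x - v x)) \<longlonglongrightarrow> 0" "p > 0"
  shows "\<exists>r. strict_mono r \<and> (AE x in lborel. (\<lambda>n. u (r n) x) \<longlonglongrightarrow> v x)"
proof -
  note [measurable] = assms(1,2)
  let ?g = "\<lambda>n x. norm (u n x - v x) powr p"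
  have "\<forall>\<^sub>F n in sequentially. Lp_int p (\<lambda>x. u n x - v x) < \<infinity>"
    using order_tendstoD(2)[OF assms(3), of \<infinity>] by simp
  \<comment> \<open>Convergence in the extended reals allows finitely many infinite terms; from
    \<open>N\<close> on the powers are integrable, and convergence in L^1 yields the
    subsequence.\<close>
  then obtain N where N: "\<And>n. n \<ge> N \<Longrightarrow> Lp_int p (\<lambda>x. u n x - v x) < \<infinity>"
    by (auto simp: eventually_sequentially)
  have int: "integrable lborel (?g (n + N))" for n
    using N[of "n+N"] unfolding Lp_int_def by (subst integrable_iff_bounded) auto
  have "(\<lambda>n. \<integral>\<^sup>+x. norm (?g (n + N) x) \<partial>lborel) \<longlonglongrightarrow> 0"
    using LIMSEQ_ignore_initial_segment[OF assms(3), of N] by (simp add: Lp_int_def)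
  then have "(\<lambda>n. \<integral>x. norm (?g (n + N) x) \<partial>lborel) \<longlonglongrightarrow> 0"
    by (subst (asm) nn_integral_eq_integral[OF integrable_norm[OF int]])
       (auto simp: tendsto_ennreal_iff simp flip: ennreal_0)
  from tendsto_L1_AE_subseq[OF int this] obtain r where
    r: "strict_mono r" "AE x in lborel. (\<lambda>n. ?g (r n + N) x) \<longlonglongrightarrow> 0" by blast
  have "AE x in lborel. (\<lambda>n. u (r n + N) x) \<longlonglongrightarrow> v x"
    using r(2)
  proof eventually_elim
    fix x assume "(\<lambda>n. ?g (r n + N) x) \<longlonglongrightarrow> 0"
    then have "(\<lambda>n. (?g (r n + N) x) powr (1/p)) \<longlonglongrightarrow> 0 powr (1/p)"
      using assms(4) by (intro tendsto_powr2 tendsto_const) auto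
    then have "(\<lambda>n. norm (u (r n + N) x - v x)) \<longlonglongrightarrow> 0"
      using assms(4) by (simp add: powr_powr)
    then show "(\<lambda>n. u (r n + N) x) \<longlonglongrightarrow> v x"
      by (simp add: tendsto_norm_zero_iff LIM_zero_iff)
  qed
  moreover have "strict_mono (\<lambda>n. r n + N)" using r(1) by (simp add: strict_mono_def)
  ultimately show ?thesis by blast
qed

text \<open>The Riesz-Fischer argument. Along the subsequence \<open>N\<close> the squared
  increments have integrals at most 4^-k, so that even with the weight 2^k their sum is integrable.
  The weight forces the increments to be eventually below (sqrt (1/2))^k at almost every point, and
  they can be summed pointwise.\<close>

lemma L2_complete:
  fixes u :: "nat \<Rightarrow> R3 \<Rightarrow> 'b::euclidean_space"
  assumes u: "\<And>n. u n \<in> L2"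
    and C: "\<And>e. e > 0 \<Longrightarrow> \<exists>N. \<forall>m\<ge>N. \<forall>n\<ge>N. L2_norm (\<lambda>x. u m x - u n x) < e"
  shows "\<exists>v\<in>L2. (\<lambda>n. L2_norm (\<lambda>x. u n x - v x)) \<longlonglongrightarrow> 0"
proof -
  note [measurable] = u[THEN L2_measurable]
  have "\<exists>N. \<forall>k. (\<forall>m\<ge>N k. \<forall>n\<ge>N k. L2_norm (\<lambda>x. u m x - u n x) < (1/2)^k) \<and> N k < N (Suc k)"
  proof (rule dependent_nat_choice)
    show "\<exists>N. \<forall>m\<ge>N. \<forall>n\<ge>N. L2_norm (\<lambda>x. u m x - u n x) < (1/2)^0" using C[of 1] by simp
    fix N :: nat and k
    obtain N' where "\<forall>m\<ge>N'. \<forall>n\<ge>N'. L2_norm (\<lambda>x. u m x - u n x) < (1/2)^Suc k"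
      using C[of "(1/2)^Suc k"] by auto
    then show "\<exists>y. (\<forall>m\<ge>y. \<forall>n\<ge>y. L2_norm (\<lambda>x. u m x - u n x) < (1/2)^Suc k) \<and> N < y"
      by (intro exI[of _ "max N' (Suc N)"]) auto
  qed
  then obtain N where N: "\<And>k m n. m \<ge> N k \<Longrightarrow> n \<ge> N k \<Longrightarrow> L2_norm (\<lambda>x. u m x - u n x) < (1/2)^k"
    and Nm: "\<And>k. N k < N (Suc k)" by blast
  have Nm': "strict_mono N" using Nm by (simp add: strict_mono_Suc_iff)
  let ?d = "\<lambda>k x. u (N (Suc k)) x - u (N k) x"
  have dL: "?d k \<in> L2" for k by (intro L2_diff u)
  have d: "L2_norm (?d k) \<le> (1/2)^k" for k
    using N[of k "N (Suc k)" "N k"] Nm[of k] by simp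
  have "(\<integral>\<^sup>+x. (\<Sum>k. ennreal (2^k * (norm (?d k x))\<^sup>2)) \<partial>lborel)
      = (\<Sum>k. \<integral>\<^sup>+x. ennreal (2^k * (norm (?d k x))\<^sup>2) \<partial>lborel)"
    by (intro nn_integral_suminf) auto
  also have "\<dots> \<le> (\<Sum>k. ennreal ((1/2)^k))"
  proof (intro suminf_le)
    fix k
    have "(\<integral>\<^sup>+x. ennreal (2^k * (norm (?d k x))\<^sup>2) \<partial>lborel) = ennreal (2^k) * Lp_int 2 (?d k)"
      unfolding Lp_int_2 by (subst nn_integral_cmult[symmetric]) (auto simp: ennreal_mult')
    also have "\<dots> = ennreal (2^k * (L2_norm (?d k))\<^sup>2)"
      by (simp add: Lp_int_2_eq[OF dL] ennreal_mult')
    also have "\<dots> \<le> ennreal (2^k * ((1/2)^k)\<^sup>2)"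
      by (intro ennreal_leI mult_left_mono power_mono d) auto
    also have "2^k * ((1/2)^k)\<^sup>2 = ((1/2::real)^k)"
      by (simp add: power2_eq_square power_divide)
    finally show "(\<integral>\<^sup>+x. ennreal (2^k * (norm (?d k x))\<^sup>2) \<partial>lborel) \<le> ennreal ((1/2)^k)" .
  qed auto
  also have "\<dots> < \<infinity>"
    using summable_geometric[of "1/2::real"] by (subst suminf_ennreal2) (auto)
  finally have "AE x in lborel. (\<Sum>k. ennreal (2^k * (norm (?d k x))\<^sup>2)) \<noteq> \<infinity>"
    by (intro nn_integral_PInf_AE) auto
  then have conv: "AE x in lborel. convergent (\<lambda>k. u (N k) x)"
  proof eventually_elim
    fix x assume "(\<Sum>k. ennreal (2^k * (norm (?d k x))\<^sup>2)) \<noteq> \<infinity>"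
    then have "summable (\<lambda>k. 2^k * (norm (?d k x))\<^sup>2)"
      by (intro summable_suminf_not_top) auto
    then have "(\<lambda>k. 2^k * (norm (?d k x))\<^sup>2) \<longlonglongrightarrow> 0" by (rule summable_LIMSEQ_zero)
    then have "\<forall>\<^sub>F k in sequentially. 2^k * (norm (?d k x))\<^sup>2 < 1"
      by (rule order_tendstoD) simp
    then have "\<forall>\<^sub>F k in sequentially. norm (?d k x) \<le> (sqrt (1/2))^k"
    proof eventually_elim
      fix k assume *: "2^k * (norm (?d k x))\<^sup>2 < 1"
      have "((sqrt (1/2))^k)\<^sup>2 = (1/2)^k"
        by (metis power_commutes power_mult real_sqrt_pow2 zero_le_divide_1_iff zero_le_numeral mult.commute)
      moreover have "(norm (?d k x))\<^sup>2 \<le> (1/2)^k" using * by (simp add: field_simps power_divide)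
      ultimately have "(norm (?d k x))\<^sup>2 \<le> ((sqrt (1/2))^k)\<^sup>2" by simp
      then show "norm (?d k x) \<le> (sqrt (1/2))^k" by (rule power2_le_imp_le) simp
    qed
    then have "summable (\<lambda>k. ?d k x)"
      by (rule summable_comparison_test_ev) (auto intro!: summable_geometric simp: real_sqrt_divide)
    then have "convergent (\<lambda>n. \<Sum>k<n. ?d k x)" by (simp add: summable_iff_convergent)
    moreover have "(\<Sum>k<n. ?d k x) = u (N n) x - u (N 0) x" for n
      by (induction n) auto
    ultimately have "convergent (\<lambda>n. u (N n) x - u (N 0) x)" by simp
    then show "convergent (\<lambda>k. u (N k) x)"
      using convergent_add[OF _ convergent_const[of "u (N 0) x"]] by fastforce
  qed
  define v where "v = (\<lambda>x. lim (\<lambda>k. u (N k) x))"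
  have vm: "v \<in> borel_measurable lborel" unfolding v_def by (intro borel_measurable_lim_metric) simp
  have lim: "AE x in lborel. (\<lambda>k. u (N k) x) \<longlonglongrightarrow> v x"
    using conv by eventually_elim (simp add: v_def convergent_LIMSEQ_iff)
  \<comment> \<open>Fatou's lemma in the second index turns the Cauchy bound into a distance to
    \<open>v\<close>, for the whole sequence and not only along \<open>N\<close>.\<close>
  have ev: "(\<lambda>x. u n x - v x) \<in> L2 \<and> L2_norm (\<lambda>x. u n x - v x) \<le> (1/2)^k" if "n \<ge> N k" for n k
  proof (subst L2_norm_le_iff[symmetric])
    show "Lp_int 2 (\<lambda>x. u n x - v x) \<le> ennreal (((1/2)^k)\<^sup>2)"
    proof (rule Lp_int_Fatou[where u = "\<lambda>j x. u n x - u (N (j + k)) x"])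
      show "AE x in lborel. (\<lambda>j. u n x - u (N (j + k)) x) \<longlonglongrightarrow> u n x - v x"
        using lim by eventually_elim (intro tendsto_diff tendsto_const LIMSEQ_ignore_initial_segment[of "\<lambda>k. u (N k) _" _ k])
      fix j
      have "N (j + k) \<ge> N k" using Nm' by (simp add: strict_mono_less_eq)
      then have "L2_norm (\<lambda>x. u n x - u (N (j + k)) x) \<le> (1/2)^k" using N[OF that] by (simp add: less_imp_le)
      then show "Lp_int 2 (\<lambda>x. u n x - u (N (j + k)) x) \<le> ennreal (((1/2)^k)\<^sup>2)"
        by (subst L2_norm_le_iff) (auto intro!: L2_diff u)
    qed auto
  qed (use vm in auto)
  have "v \<in> L2"
    using L2_diff[OF u[of "N 0"] conjunct1[OF ev[of 0 "N 0"]]] by simp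
  moreover have "(\<lambda>n. L2_norm (\<lambda>x. u n x - v x)) \<longlonglongrightarrow> 0"
  proof (rule LIMSEQ_I)
    fix e :: real assume "e > 0"
    then obtain k where "(1/2)^k < e" using real_arch_pow_inv[of e "1/2"] by auto
    then show "\<exists>no. \<forall>n\<ge>no. norm (L2_norm (\<lambda>x. u n x - v x) - 0) < e"
      using ev by (intro exI[of _ "N k"]) (fastforce)
  qed
  ultimately show ?thesis by blast
qed

section \<open>Smooth functions of compact support\<close>

lemma nn_integral_lborel_translate:
  fixes g :: "R3 \<Rightarrow> ennreal"
  assumes [measurable]: "g \<in> borel_measurable borel"
  shows "(\<integral>\<^sup>+x. g (x + h) \<partial>lborel) = (\<integral>\<^sup>+x. g x \<partial>lborel)"
proof -
  have "(\<integral>\<^sup>+x. g x \<partial>lborel) = (\<integral>\<^sup>+x. g x \<partial>distr lborel borel ((+) h))"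
    by (simp add: lborel_distr_plus)
  also have "\<dots> = (\<integral>\<^sup>+x. g (x + h) \<partial>lborel)"
    by (subst nn_integral_distr) (auto simp: add.commute)
  finally show ?thesis by simp
qed

lemma integral_lborel_translate:
  fixes g :: "R3 \<Rightarrow> 'b::euclidean_space"
  assumes [measurable]: "g \<in> borel_measurable borel"
  shows "(\<integral>x. g (x + h) \<partial>lborel) = (\<integral>x. g x \<partial>lborel)"
proof -
  have "(\<integral>x. g x \<partial>lborel) = (\<integral>x. g x \<partial>distr lborel borel ((+) h))"
    by (simp add: lborel_distr_plus)
  also have "\<dots> = (\<integral>x. g (x + h) \<partial>lborel)"
    by (subst integral_distr) (auto simp: add.commute)
  finally show ?thesis by simp
qed

lemma integrable_lborel_translate:
  fixes g :: "R3 \<Rightarrow> 'b::euclidean_space"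
  assumes "integrable lborel g"
  shows "integrable lborel (\<lambda>x. g (x + h))"
proof -
  have "integrable (distr lborel borel ((+) h)) g" using assms by (simp add: lborel_distr_plus)
  then have "integrable lborel (\<lambda>x. g (h + x))" by (rule integrable_distr[rotated]) simp
  then show ?thesis by (simp add: add.commute)
qed

lemma Lp_int_translate:
  fixes u :: "R3 \<Rightarrow> 'b::euclidean_space"
  assumes [measurable]: "u \<in> borel_measurable borel"
  shows "Lp_int p (\<lambda>x. u (x + h)) = Lp_int p u"
  unfolding Lp_int_def by (rule nn_integral_lborel_translate[of "\<lambda>x. ennreal (norm (u x) powr p)"]) simp

lemma L2_translate:
  fixes u :: "R3 \<Rightarrow> 'b::euclidean_space"
  assumes "u \<in> L2"
  shows "(\<lambda>x. u (x + h)) \<in> L2" "L2_norm (\<lambda>x. u (x + h)) = L2_norm u"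
proof -
  have [measurable]: "u \<in> borel_measurable borel" using assms by (rule L2_measurable)
  show "(\<lambda>x. u (x + h)) \<in> L2" "L2_norm (\<lambda>x. u (x + h)) = L2_norm u"
    using assms Lp_int_translate[of u 2 h] by (auto simp: L2_def L2_norm_def)
qed

section \<open>Partial derivatives and coinductive smoothness\<close>

lemma pd_eq: "(f has_derivative f') (at x) \<Longrightarrow> pd j f x = f' (axis j 1)"
  by (metis frechet_derivative_at pd_def)

lemma smooth_differentiable: "smooth f \<Longrightarrow> f differentiable (at x)"
  by (erule smooth.cases) simp

lemma smooth_pd: "smooth f \<Longrightarrow> smooth (pd j f)"
  by (erule smooth.cases) simp

lemma smooth_continuous: "smooth f \<Longrightarrow> continuous_on A f"
  by (meson continuous_at_imp_continuous_on differentiable_imp_continuous_within smooth_differentiable)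

lemma smooth_measurable [measurable_dest]: "smooth (f :: R3 \<Rightarrow> 'b::euclidean_space) \<Longrightarrow> f \<in> borel_measurable borel"
  by (intro borel_measurable_continuous_onI smooth_continuous)

lemma differentiable_has_pd:
  fixes f :: "R3 \<Rightarrow> 'b::real_normed_vector"
  assumes "f differentiable (at x)"
  shows "(f has_derivative (\<lambda>h. \<Sum>j\<in>UNIV. h $ j *\<^sub>R pd j f x)) (at x)"
proof -
  let ?D = "frechet_derivative f (at x)"
  have D: "(f has_derivative ?D) (at x)" using assms by (simp add: frechet_derivative_works)
  then have lin: "linear ?D" by (rule has_derivative_linear)
  have "?D = (\<lambda>h. \<Sum>j\<in>UNIV. h $ j *\<^sub>R pd j f x)"
  proof
    fix h :: R3
    have "h = (\<Sum>j\<in>UNIV. h $ j *\<^sub>R axis j 1)"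
      using basis_expansion[of h] by (simp add: scalar_mult_eq_scaleR)
    then have "?D h = ?D (\<Sum>j\<in>UNIV. h $ j *\<^sub>R axis j 1)" by simp
    also have "\<dots> = (\<Sum>j\<in>UNIV. h $ j *\<^sub>R pd j f x)"
      by (simp add: linear_sum[OF lin] linear_scale[OF lin] pd_def)
    finally show "?D h = (\<Sum>j\<in>UNIV. h $ j *\<^sub>R pd j f x)" .
  qed
  with D show ?thesis by simp
qed

lemmas smooth_has_derivative = differentiable_has_pd[OF smooth_differentiable]

lemma sum_axis_scaleR [simp]:
  fixes g :: "3 \<Rightarrow> 'b::real_vector"
  shows "(\<Sum>i\<in>UNIV. (axis j 1 :: R3) $ i *\<^sub>R g i) = g j"
proof -
  have "(axis j 1 :: R3) $ i *\<^sub>R g i = (if i = j then g i else 0)" for i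
    by (simp add: axis_def)
  then show ?thesis by simp
qed

lemma sum_axis_mult [simp]: "(\<Sum>i\<in>UNIV. (axis j 1 :: R3) $ i * g i) = g j"
  using sum_axis_scaleR[of j g] by simp

lemma pd_const [simp]: "pd j (\<lambda>x. c) = (\<lambda>x. 0)"
  by (rule ext, subst pd_eq[OF has_derivative_const]) simp

lemma pd_add: "f differentiable (at x) \<Longrightarrow> g differentiable (at x) \<Longrightarrow> pd j (\<lambda>x. f x + g x) x = pd j f x + pd j g x"
  by (subst pd_eq[OF has_derivative_add[OF differentiable_has_pd differentiable_has_pd]])
     auto

lemma pd_bounded_linear:
  assumes "bounded_linear L" "f differentiable (at x)"
  shows "pd j (\<lambda>x. L (f x)) x = L (pd j f x)"
  using pd_eq[OF bounded_linear.has_derivative[OF assms(1) differentiable_has_pd[OF assms(2)]], of j]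
  by auto

lemma pd_mult:
  fixes f g :: "R3 \<Rightarrow> real"
  shows "f differentiable (at x) \<Longrightarrow> g differentiable (at x) \<Longrightarrow>
    pd j (\<lambda>x. f x * g x) x = f x * pd j g x + pd j f x * g x"
  by (subst pd_eq[OF has_derivative_mult[OF differentiable_has_pd differentiable_has_pd]])
     auto

lemma pd_translate:
  assumes "f differentiable (at (x + h))"
  shows "pd j (\<lambda>x. f (x + h)) x = pd j f (x + h)"
proof -
  have *: "((\<lambda>x. x + h) has_derivative (\<lambda>k. k)) (at x)" by (auto intro!: derivative_eq_intros)
  show ?thesis
    using pd_eq[OF has_derivative_compose[OF * differentiable_has_pd[OF assms]], of j]
    by auto
qed

text \<open>Smoothness is a greatest fixed point, so it follows from any class of differentiable
  functions that is closed under partial derivatives.\<close>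

lemma smooth_coinduct:
  assumes "X f" "\<And>f. X f \<Longrightarrow> (\<forall>x. f differentiable (at x)) \<and> (\<forall>j. X (pd j f))"
  shows "smooth f"
  using assms(1) by (coinduction arbitrary: f rule: smooth.coinduct) (use assms(2) in blast)

lemma smooth_zero: "smooth (\<lambda>x. 0)"
  by (rule smooth_coinduct[where X="\<lambda>f. f = (\<lambda>x. 0)"]) auto

lemma smooth_const: "smooth (\<lambda>x. c)"
  by (rule smooth.intros) (auto simp: smooth_zero)

lemma smooth_add:
  assumes "smooth f" "smooth g" shows "smooth (\<lambda>x. f x + g x)"
proof (rule smooth_coinduct[where X="\<lambda>F. \<exists>f g. smooth f \<and> smooth g \<and> F = (\<lambda>x. f x + g x)"])
  fix F :: "R3 \<Rightarrow> 'a" assume "\<exists>f g. smooth f \<and> smooth g \<and> F = (\<lambda>x. f x + g x)"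
  then obtain f g where fg: "smooth f" "smooth g" "F = (\<lambda>x. f x + g x)" by blast
  have "pd j F = (\<lambda>x. pd j f x + pd j g x)" for j
    unfolding fg(3) using fg by (intro ext pd_add smooth_differentiable) auto
  then show "(\<forall>x. F differentiable (at x)) \<and> (\<forall>j. \<exists>f g. smooth f \<and> smooth g \<and> pd j F = (\<lambda>x. f x + g x))"
    unfolding fg(3) using fg by (blast intro: differentiable_add smooth_differentiable smooth_pd)
qed (use assms in blast)

lemma smooth_bounded_linear:
  assumes "bounded_linear L" "smooth f"
  shows "smooth (\<lambda>x. L (f x))"
proof (rule smooth_coinduct[where X="\<lambda>F. \<exists>f. smooth f \<and> F = (\<lambda>x. L (f x))"])
  fix F assume "\<exists>f. smooth f \<and> F = (\<lambda>x. L (f x))"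
  then obtain f where f: "smooth f" "F = (\<lambda>x. L (f x))" by blast
  have "pd j F = (\<lambda>x. L (pd j f x))" for j
    unfolding f(2) using f by (intro ext pd_bounded_linear assms smooth_differentiable) auto
  moreover have "F differentiable (at x)" for x
    unfolding f(2) using bounded_linear.has_derivative[OF assms(1) smooth_has_derivative[OF f(1)]]
    unfolding differentiable_def by blast
  ultimately show "(\<forall>x. F differentiable (at x)) \<and> (\<forall>j. \<exists>f. smooth f \<and> pd j F = (\<lambda>x. L (f x)))"
    using f by (blast intro: smooth_pd)
qed (use assms in blast)

lemma smooth_scaleR: "smooth f \<Longrightarrow> smooth (\<lambda>x. c *\<^sub>R f x)"
  by (rule smooth_bounded_linear[OF bounded_linear_scaleR_right])

lemma smooth_component: "smooth f \<Longrightarrow> smooth (\<lambda>x. f x $ i)"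
  by (rule smooth_bounded_linear[OF bounded_linear_vec_nth])

lemma smooth_translate:
  assumes "smooth f" shows "smooth (\<lambda>x. f (x + h))"
proof (rule smooth_coinduct[where X="\<lambda>F. \<exists>f. smooth f \<and> F = (\<lambda>x. f (x + h))"])
  fix F :: "R3 \<Rightarrow> 'a" assume "\<exists>f. smooth f \<and> F = (\<lambda>x. f (x + h))"
  then obtain f where f: "smooth f" "F = (\<lambda>x. f (x + h))" by blast
  have "pd j F = (\<lambda>x. pd j f (x + h))" for j
    unfolding f(2) using f by (intro ext pd_translate smooth_differentiable) auto
  moreover have "F differentiable (at x)" for x
  proof -
    have *: "((\<lambda>x. x + h) has_derivative (\<lambda>k. k)) (at x)" by (auto intro!: derivative_eq_intros)
    show ?thesis unfolding f(2) using has_derivative_compose[OF * smooth_has_derivative[OF f(1)]]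
      unfolding differentiable_def by blast
  qed
  ultimately show "(\<forall>x. F differentiable (at x)) \<and> (\<forall>j. \<exists>f. smooth f \<and> pd j F = (\<lambda>x. f (x + h)))"
    using f by (blast intro: smooth_pd)
qed (use assms in blast)

text \<open>The derivative of a product is a sum of products, so products alone are not a class
  closed under differentiation. The algebra generated by \<open>S\<close> is closed as soon as it
  contains the derivatives of the generators.\<close>

inductive gen_alg :: "(R3 \<Rightarrow> real) set \<Rightarrow> (R3 \<Rightarrow> real) \<Rightarrow> bool" for S where
  base: "f \<in> S \<Longrightarrow> gen_alg S f"
| const: "gen_alg S (\<lambda>x. c)"
| add: "gen_alg S f \<Longrightarrow> gen_alg S g \<Longrightarrow> gen_alg S (\<lambda>x. f x + g x)"
| mult: "gen_alg S f \<Longrightarrow> gen_alg S g \<Longrightarrow> gen_alg S (\<lambda>x. f x * g x)"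

text \<open>Coinduction with the generated algebra as invariant; the closure under derivatives is an
  induction over the construction of its elements by the sum and product rules.\<close>

lemma gen_alg_smooth:
  assumes "\<And>f x. f \<in> S \<Longrightarrow> f differentiable (at x)" "\<And>f j. f \<in> S \<Longrightarrow> gen_alg S (pd j f)"
  shows "gen_alg S f \<Longrightarrow> smooth f"
proof (coinduction arbitrary: f rule: smooth.coinduct)
  case smooth
  then have "(\<forall>x. f differentiable (at x)) \<and> (\<forall>j. gen_alg S (pd j f))"
  proof induction
    case (base f) then show ?case using assms by auto
  next
    case (const c) then show ?case by (auto intro: gen_alg.const)
  next
    case (add f g)
    then have "pd j (\<lambda>x. f x + g x) = (\<lambda>x. pd j f x + pd j g x)" for j
      by (intro ext pd_add) auto
    with add show ?case by (auto intro!: differentiable_add gen_alg.add)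
  next
    case (mult f g)
    then have "pd j (\<lambda>x. f x * g x) = (\<lambda>x. f x * pd j g x + pd j f x * g x)" for j
      by (intro ext pd_mult) auto
    with mult show ?case by (auto intro!: differentiable_mult gen_alg.add gen_alg.mult)
  qed
  then show ?case by auto
qed

lemma smooth_mult:
  fixes f g :: "R3 \<Rightarrow> real"
  assumes "smooth f" "smooth g" shows "smooth (\<lambda>x. f x * g x)"
  by (rule gen_alg_smooth[of "{f. smooth f}"])
     (auto intro: gen_alg.intros assms smooth_differentiable smooth_pd)

section \<open>Compact support, difference quotients and integration by parts\<close>

lemma compact_supp_iff: "compact_supp f \<longleftrightarrow> (\<exists>R. \<forall>x. norm x > R \<longrightarrow> f x = 0)"
proof
  assume "compact_supp f"
  then have "bounded {x. f x \<noteq> 0}"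
    unfolding compact_supp_def by (meson bounded_subset closure_subset compact_imp_bounded)
  then obtain R where "\<And>x. f x \<noteq> 0 \<Longrightarrow> norm x \<le> R" by (auto simp: bounded_iff)
  then show "\<exists>R. \<forall>x. norm x > R \<longrightarrow> f x = 0" by (meson not_le)
next
  assume "\<exists>R. \<forall>x. norm x > R \<longrightarrow> f x = 0"
  then have "bounded {x. f x \<noteq> 0}" unfolding bounded_iff by (metis (mono_tags) mem_Collect_eq not_le)
  then show "compact_supp f" by (simp add: compact_supp_def compact_closure)
qed

lemma pd_zero_outside:
  assumes "\<And>x. norm x > R \<Longrightarrow> f x = 0" "norm x > R"
  shows "pd j f x = 0"
proof -
  have "(f has_derivative (\<lambda>h. 0)) (at x)"
  proof (rule has_derivative_transform_within_open[OF has_derivative_const])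
    show "open {x. norm x > R}" by (intro open_Collect_less continuous_intros)
  qed (use assms in auto)
  then show ?thesis by (simp add: pd_eq)
qed

lemma compact_supp_pd: "compact_supp f \<Longrightarrow> compact_supp (pd j f)"
  unfolding compact_supp_iff using pd_zero_outside by metis

lemma continuous_compact_supp_bound:
  fixes f :: "R3 \<Rightarrow> 'b::real_normed_vector"
  assumes "continuous_on UNIV f" "\<And>x. norm x > R \<Longrightarrow> f x = 0"
  shows "\<exists>B\<ge>0. \<forall>x. norm (f x) \<le> B"
proof -
  have "bounded (f ` cball 0 R)"
    by (intro compact_imp_bounded compact_continuous_image continuous_on_subset[OF assms(1)]) auto
  then obtain B where "\<forall>y\<in>f ` cball 0 R. norm y \<le> B" unfolding bounded_iff by blast
  then have "\<And>x. norm x \<le> R \<Longrightarrow> norm (f x) \<le> B" by auto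
  then have "norm (f x) \<le> max B 0" for x using assms(2)[of x] by (cases "norm x \<le> R") (auto intro: max.coboundedI1)
  then show ?thesis by (intro exI[of _ "max B 0"]) auto
qed

lemma integrable_indicator_cball: "integrable lborel (\<lambda>x::R3. B * indicator (cball c R) x :: real)"
  using emeasure_bounded_finite[OF bounded_cball, of c R]
  by (intro integrable_mult_right integrable_real_indicator) auto

lemma integrable_bounded_support:
  fixes f :: "R3 \<Rightarrow> 'b::euclidean_space"
  assumes "f \<in> borel_measurable borel" "\<And>x. norm x > R \<Longrightarrow> f x = 0" "\<And>x. norm (f x) \<le> B"
  shows "integrable lborel f"
proof (rule Bochner_Integration.integrable_bound)
  show "integrable lborel (\<lambda>x::R3. B * indicator (cball 0 R) x :: real)"
    by (rule integrable_indicator_cball)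
  show "AE x in lborel. norm (f x) \<le> norm (B * indicator (cball 0 R) x :: real)"
  proof (rule AE_I2)
    fix x show "norm (f x) \<le> norm (B * indicator (cball 0 R) x :: real)"
      using assms(2)[of x] assms(3)[of x] by (cases "norm x \<le> R") (auto simp: indicator_def)
  qed
qed (use assms in auto)

lemma integrable_continuous_compact_supp:
  fixes f :: "R3 \<Rightarrow> 'b::euclidean_space"
  assumes "continuous_on UNIV f" "compact_supp f"
  shows "integrable lborel f"
proof -
  from assms obtain R where R: "\<And>x. norm x > R \<Longrightarrow> f x = 0" by (auto simp: compact_supp_iff)
  from continuous_compact_supp_bound[OF assms(1) R] obtain B where "\<And>x. norm (f x) \<le> B" by auto
  with R show ?thesis by (intro integrable_bounded_support borel_measurable_continuous_onI assms) auto
qed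

lemma Lp_int_continuous_compact_supp:
  fixes f :: "R3 \<Rightarrow> 'b::euclidean_space"
  assumes "continuous_on UNIV f" "compact_supp f" "p > 0"
  shows "Lp_int p f < \<infinity>"
proof -
  have "integrable lborel (\<lambda>x. norm (f x) powr p)"
    using assms
    by (intro integrable_continuous_compact_supp continuous_on_powr' continuous_on_norm)
       (auto simp: compact_supp_def)
  then show ?thesis unfolding Lp_int_def by (simp add: integrable_iff_bounded)
qed

lemma L2_continuous_compact_supp:
  fixes f :: "R3 \<Rightarrow> 'b::euclidean_space"
  assumes "continuous_on UNIV f" "compact_supp f"
  shows "f \<in> L2"
  using Lp_int_continuous_compact_supp[OF assms, of 2] borel_measurable_continuous_onI[OF assms(1)]
  by (simp add: L2_def)

text \<open>The partial derivatives are continuous with compact support, hence bounded, and the mean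
  value inequality applies. This supplies the majorant for difference quotients.\<close>

lemma smooth_supp_lipschitz:
  fixes f :: "R3 \<Rightarrow> 'b::euclidean_space"
  assumes "smooth f" "compact_supp f"
  shows "\<exists>B\<ge>0. \<forall>x y. norm (f y - f x) \<le> B * norm (y - x)"
proof -
  obtain R where R: "\<And>x. norm x > R \<Longrightarrow> f x = 0" using assms by (auto simp: compact_supp_iff)
  have "\<exists>B\<ge>0. \<forall>x. norm (pd j f x) \<le> B" for j
    using continuous_compact_supp_bound[OF smooth_continuous[OF smooth_pd[OF assms(1)]], of R j] pd_zero_outside[of R f, OF R] by blast
  then obtain B where B: "\<And>j. B j \<ge> 0" "\<And>j x. norm (pd j f x) \<le> B j" by metis
  have "norm (\<Sum>j\<in>UNIV. h $ j *\<^sub>R pd j f x) \<le> sum B UNIV * norm h" for x h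
  proof -
    have "norm (\<Sum>j\<in>UNIV. h $ j *\<^sub>R pd j f x) \<le> (\<Sum>j\<in>UNIV. norm (h $ j *\<^sub>R pd j f x))" by (rule norm_sum)
    also have "\<dots> \<le> (\<Sum>j\<in>UNIV. norm h * B j)"
      by (intro sum_mono) (auto intro!: mult_mono B component_le_norm_cart)
    also have "\<dots> = sum B UNIV * norm h" by (subst sum_distrib_right) (simp add: mult.commute)
    finally show ?thesis .
  qed
  then have "norm (f y - f x) \<le> sum B UNIV * norm (y - x)" for x y
    by (intro differentiable_bound[of UNIV f "\<lambda>x h. \<Sum>j\<in>UNIV. h $ j *\<^sub>R pd j f x"])
       (auto intro!: onorm_le smooth_has_derivative assms)
  moreover have "sum B UNIV \<ge> 0" using B by (intro sum_nonneg) auto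
  ultimately show ?thesis by blast
qed

text \<open>The two hypotheses of dominated convergence in one statement. The restriction to steps
  of modulus at most 1 keeps the supports of all quotients in one ball.\<close>

lemma diff_quotient_dominated:
  fixes f :: "R3 \<Rightarrow> 'b::euclidean_space"
  assumes "smooth f" "compact_supp f" "\<And>n. t n \<noteq> 0" "\<And>n. \<bar>t n\<bar> \<le> 1" "t \<longlonglongrightarrow> (0::real)"
  shows "\<exists>B R. (\<forall>n x. norm ((f (x + t n *\<^sub>R h) - f x) /\<^sub>R t n) \<le> B * indicator (cball 0 R) x)
    \<and> (\<forall>x. (\<lambda>n. (f (x + t n *\<^sub>R h) - f x) /\<^sub>R t n) \<longlonglongrightarrow> (\<Sum>j\<in>UNIV. h $ j *\<^sub>R pd j f x))"
proof -
  obtain R where R: "\<And>x. norm x > R \<Longrightarrow> f x = 0" using assms by (auto simp: compact_supp_iff)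
  obtain B where B: "B \<ge> 0" "\<And>x y. norm (f y - f x) \<le> B * norm (y - x)"
    using smooth_supp_lipschitz[OF assms(1,2)] by auto
  have "norm ((f (x + t n *\<^sub>R h) - f x) /\<^sub>R t n) \<le> (B * norm h) * indicator (cball 0 (R + norm h)) x" for n x
  proof (cases "norm x \<le> R + norm h")
    case True
    have "norm (f (x + t n *\<^sub>R h) - f x) \<le> B * (\<bar>t n\<bar> * norm h)" using B(2)[where x=x and y="x + t n *\<^sub>R h"] by simp
    then have "norm (f (x + t n *\<^sub>R h) - f x) / \<bar>t n\<bar> \<le> B * norm h"
      using assms(3)[of n] by (simp add: field_simps)
    then show ?thesis using True by (simp add: divide_inverse_commute)
  next
    case False
    have "norm (t n *\<^sub>R h) \<le> norm h" using assms(4)[of n] by (simp add: mult_left_le_one_le)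
    then have "norm (x + t n *\<^sub>R h) > R" using False norm_triangle_ineq4[of "x + t n *\<^sub>R h" "t n *\<^sub>R h"] by simp
    moreover have "norm x > R" using False norm_ge_zero[of h] by linarith
    ultimately show ?thesis using R False by simp
  qed
  moreover have "(\<lambda>n. (f (x + t n *\<^sub>R h) - f x) /\<^sub>R t n) \<longlonglongrightarrow> (\<Sum>j\<in>UNIV. h $ j *\<^sub>R pd j f x)" for x
  proof -
    have 1: "((\<lambda>s. x + s *\<^sub>R h) has_derivative (\<lambda>s. s *\<^sub>R h)) (at 0)" by (auto intro!: derivative_eq_intros)
    have "((\<lambda>s. f (x + s *\<^sub>R h)) has_derivative (\<lambda>s. \<Sum>j\<in>UNIV. (s *\<^sub>R h) $ j *\<^sub>R pd j f x)) (at 0)"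
      using has_derivative_compose[OF 1, of f "\<lambda>h. \<Sum>j\<in>UNIV. h $ j *\<^sub>R pd j f x"]
        smooth_has_derivative[OF assms(1), of x] by simp
    then have "((\<lambda>s. norm (f (x + s *\<^sub>R h) - f x - s *\<^sub>R (\<Sum>j\<in>UNIV. h $ j *\<^sub>R pd j f x)) / \<bar>s\<bar>) \<longlongrightarrow> 0) (at 0)"
      by (simp add: has_derivative_at scaleR_sum_right)
    then have "((\<lambda>s. (f (x + s *\<^sub>R h) - f x) /\<^sub>R s - (\<Sum>j\<in>UNIV. h $ j *\<^sub>R pd j f x)) \<longlongrightarrow> 0) (at 0)"
    proof (subst tendsto_norm_zero_iff[symmetric], rule Lim_transform_eventually)
      show "\<forall>\<^sub>F s in at 0. norm (f (x + s *\<^sub>R h) - f x - s *\<^sub>R (\<Sum>j\<in>UNIV. h $ j *\<^sub>R pd j f x)) / \<bar>s\<bar>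
        = norm ((f (x + s *\<^sub>R h) - f x) /\<^sub>R s - (\<Sum>j\<in>UNIV. h $ j *\<^sub>R pd j f x))"
      proof (rule eventually_at_filter[THEN iffD2], rule always_eventually, intro allI impI)
        fix s :: real assume "s \<noteq> 0"
        then have "(f (x + s *\<^sub>R h) - f x) /\<^sub>R s - (\<Sum>j\<in>UNIV. h $ j *\<^sub>R pd j f x)
          = (f (x + s *\<^sub>R h) - f x - s *\<^sub>R (\<Sum>j\<in>UNIV. h $ j *\<^sub>R pd j f x)) /\<^sub>R s"
          by (simp add: scaleR_diff_right)
        then show "norm (f (x + s *\<^sub>R h) - f x - s *\<^sub>R (\<Sum>j\<in>UNIV. h $ j *\<^sub>R pd j f x)) / \<bar>s\<bar>
        = norm ((f (x + s *\<^sub>R h) - f x) /\<^sub>R s - (\<Sum>j\<in>UNIV. h $ j *\<^sub>R pd j f x))"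
          by (simp add: divide_inverse_commute)
      qed
    qed
    then have "((\<lambda>s. (f (x + s *\<^sub>R h) - f x) /\<^sub>R s) \<longlongrightarrow> (\<Sum>j\<in>UNIV. h $ j *\<^sub>R pd j f x)) (at 0)"
      by (rule LIM_zero_cancel)
    then show ?thesis
      by (rule filterlim_compose) (use assms in \<open>auto simp: filterlim_at\<close>)
  qed
  ultimately show ?thesis by blast
qed

text \<open>Each difference quotient has integral zero by translation invariance, and the quotients
  converge boundedly inside a fixed ball to the derivative.\<close>

lemma integral_pd_zero:
  fixes f :: "R3 \<Rightarrow> real"
  assumes "smooth f" "compact_supp f"
  shows "(\<integral>x. pd j f x \<partial>lborel) = 0"
proof -
  define t :: "nat \<Rightarrow> real" where "t n = 1 / real (Suc n)" for n
  have t: "t n \<noteq> 0" "\<bar>t n\<bar> \<le> 1" for n by (auto simp: t_def)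
  have t0: "t \<longlonglongrightarrow> 0" unfolding t_def using LIMSEQ_inverse_real_of_nat by (simp add: inverse_eq_divide)
  let ?q = "\<lambda>n x. (f (x + t n *\<^sub>R axis j 1) - f x) /\<^sub>R t n"
  obtain B R where BR: "\<And>n x. norm (?q n x) \<le> B * indicator (cball 0 R) x"
    and lim: "\<And>x. (\<lambda>n. ?q n x) \<longlonglongrightarrow> (\<Sum>i\<in>UNIV. (axis j 1 :: R3) $ i *\<^sub>R pd i f x)"
    using diff_quotient_dominated[OF assms t t0, of "axis j 1"] by blast
  have lim': "(\<lambda>n. ?q n x) \<longlonglongrightarrow> pd j f x" for x
    using lim[of x] by simp
  note [measurable] = smooth_measurable[OF assms(1)] smooth_measurable[OF smooth_pd[OF assms(1)]]
  have "(\<lambda>n. \<integral>x. ?q n x \<partial>lborel) \<longlonglongrightarrow> (\<integral>x. pd j f x \<partial>lborel)"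
  proof (rule integral_dominated_convergence[where w="\<lambda>x. B * indicator (cball 0 R) x"])
    show "integrable lborel (\<lambda>x::R3. B * indicator (cball 0 R) x :: real)"
      by (rule integrable_indicator_cball)
  qed (use lim' BR in auto)
  moreover have "(\<integral>x. ?q n x \<partial>lborel) = 0" for n
  proof -
    have i: "integrable lborel f" by (intro integrable_continuous_compact_supp smooth_continuous assms)
    have "integrable lborel (\<lambda>x. f (x + t n *\<^sub>R axis j 1))"
      by (rule integrable_lborel_translate[OF i])
    then show ?thesis using i integral_lborel_translate[of f "t n *\<^sub>R axis j 1"] by simp
  qed
  ultimately have "(\<lambda>n. 0) \<longlonglongrightarrow> (\<integral>x. pd j f x \<partial>lborel)" by (simp only:)
  then show ?thesis by (simp add: LIMSEQ_const_iff)
qed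

lemma integral_by_parts_pd:
  fixes f g :: "R3 \<Rightarrow> real"
  assumes "smooth f" "smooth g" "compact_supp g"
  shows "(\<integral>x. f x * pd j g x \<partial>lborel) = - (\<integral>x. pd j f x * g x \<partial>lborel)"
proof -
  have s: "smooth (\<lambda>x. f x * g x)" by (intro smooth_mult assms)
  have c: "compact_supp (\<lambda>x. f x * g x)" using assms(3) by (auto simp: compact_supp_iff)
  have "compact_supp (\<lambda>x. f x * pd j g x)" "compact_supp (\<lambda>x. pd j f x * g x)"
    using assms(3) compact_supp_pd[OF assms(3), of j] by (auto simp: compact_supp_iff)
  then have i: "integrable lborel (\<lambda>x. f x * pd j g x)" "integrable lborel (\<lambda>x. pd j f x * g x)"
    by (auto intro!: integrable_continuous_compact_supp continuous_on_mult intro: smooth_continuous smooth_pd assms(1,2))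
  have "0 = (\<integral>x. pd j (\<lambda>x. f x * g x) x \<partial>lborel)" using integral_pd_zero[OF s c] by simp
  also have "\<dots> = (\<integral>x. f x * pd j g x + pd j f x * g x \<partial>lborel)"
    by (intro Bochner_Integration.integral_cong refl pd_mult smooth_differentiable assms)
  also have "\<dots> = (\<integral>x. f x * pd j g x \<partial>lborel) + (\<integral>x. pd j f x * g x \<partial>lborel)"
    using i by simp
  finally show ?thesis by simp
qed

section \<open>Solenoidal test fields\<close>

lemma VspD:
  assumes "\<phi> \<in> Vsp"
  shows "smooth \<phi>" "compact_supp \<phi>" "divergence \<phi> x = 0"
  using assms by (auto simp: Vsp_def)

lemma pd_component: "f differentiable (at x) \<Longrightarrow> pd j (\<lambda>x. f x $ i) x = pd j f x $ i"
  by (rule pd_bounded_linear[OF bounded_linear_vec_nth])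

lemma grad_add: "smooth u \<Longrightarrow> smooth v \<Longrightarrow> grad (\<lambda>x. u x + v x) = (\<lambda>x. grad u x + grad v x)"
  by (rule ext) (simp add: grad_def pd_add smooth_differentiable vec_eq_iff)

lemma grad_scaleR: "smooth u \<Longrightarrow> grad (\<lambda>x. c *\<^sub>R u x) = (\<lambda>x. c *\<^sub>R grad u x)"
  by (rule ext) (simp add: grad_def pd_bounded_linear[OF bounded_linear_scaleR_right] smooth_differentiable vec_eq_iff)

lemma grad_translate: "smooth u \<Longrightarrow> grad (\<lambda>x. u (x + h)) = (\<lambda>x. grad u (x + h))"
  by (rule ext) (simp add: grad_def pd_translate smooth_differentiable vec_eq_iff)

lemma divergence_grad: "divergence u x = (\<Sum>i\<in>UNIV. grad u x $ i $ i)"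
  by (simp add: divergence_def grad_def)

lemma grad_mult_vec: "grad u x *v h = (\<Sum>j\<in>UNIV. h $ j *\<^sub>R pd j u x)"
  by (simp add: vec_eq_iff matrix_vector_mult_def grad_def mult.commute)

lemma Vsp_zero: "(\<lambda>x. 0) \<in> Vsp"
  by (auto simp: Vsp_def smooth_const divergence_def compact_supp_iff)

lemma Vsp_add: "u \<in> Vsp \<Longrightarrow> v \<in> Vsp \<Longrightarrow> (\<lambda>x. u x + v x) \<in> Vsp"
  unfolding Vsp_def compact_supp_iff divergence_grad
  by (safe, auto simp: smooth_add grad_add sum.distrib)
     (metis add_0_left max.strict_boundedE)

lemma Vsp_scaleR: "u \<in> Vsp \<Longrightarrow> (\<lambda>x. c *\<^sub>R u x) \<in> Vsp"
  unfolding Vsp_def compact_supp_iff divergence_grad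
  by (auto simp: smooth_scaleR grad_scaleR sum_distrib_left[symmetric])

lemma Vsp_diff: "u \<in> Vsp \<Longrightarrow> v \<in> Vsp \<Longrightarrow> (\<lambda>x. u x - v x) \<in> Vsp"
  using Vsp_add[OF _ Vsp_scaleR[of v "-1"], of u] by simp

lemma Vsp_translate: "u \<in> Vsp \<Longrightarrow> (\<lambda>x. u (x + h)) \<in> Vsp"
proof -
  assume u: "u \<in> Vsp"
  then obtain R where R: "\<And>x. norm x > R \<Longrightarrow> u x = 0" by (auto simp: Vsp_def compact_supp_iff)
  have "u (x + h) = 0" if "norm x > R + norm h" for x
    using norm_triangle_ineq4[of "x + h" h] that by (intro R) simp
  then have "compact_supp (\<lambda>x. u (x + h))" unfolding compact_supp_iff by blast
  then show ?thesis using u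
    by (auto simp: Vsp_def smooth_translate divergence_grad grad_translate)
qed

lemma grad_diff: "smooth u \<Longrightarrow> smooth v \<Longrightarrow> grad (\<lambda>x. u x - v x) = (\<lambda>x. grad u x - grad v x)"
  using grad_add[of u "\<lambda>x. (-1) *\<^sub>R v x"] grad_scaleR[of v "-1"] smooth_scaleR[of v "-1"] by simp

lemma smooth_grad_continuous: "smooth u \<Longrightarrow> continuous_on A (grad u)"
  unfolding grad_def by (intro continuous_on_vec_lambda continuous_on_component smooth_continuous smooth_pd)

lemma compact_supp_grad: "compact_supp u \<Longrightarrow> compact_supp (grad u)"
proof -
  assume "compact_supp u"
  then obtain R where R: "\<And>x. norm x > R \<Longrightarrow> u x = 0" by (auto simp: compact_supp_iff)
  then have "grad u x = 0" if "norm x > R" for x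
    using pd_zero_outside[of R u x, OF R that] by (simp add: grad_def vec_eq_iff)
  then show ?thesis by (auto simp: compact_supp_iff)
qed

lemma Vsp_L2: "\<phi> \<in> Vsp \<Longrightarrow> \<phi> \<in> L2"
  by (intro L2_continuous_compact_supp smooth_continuous VspD)

lemma Vsp_grad_L2: "\<phi> \<in> Vsp \<Longrightarrow> grad \<phi> \<in> L2"
  by (intro L2_continuous_compact_supp smooth_grad_continuous compact_supp_grad VspD)

lemma Vsp_measurable: "\<phi> \<in> Vsp \<Longrightarrow> \<phi> \<in> borel_measurable borel"
  by (intro smooth_measurable VspD)

text \<open>The norm on \<open>real^3^3\<close> is the Euclidean norm of all entries, so
  Cauchy-Schwarz applied row by row suffices.\<close>

lemma norm_matrix_vector_mult_le:
  fixes A :: "real^3^3" shows "norm (A *v h) \<le> norm A * norm h"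
proof -
  have "(norm (A *v h))\<^sup>2 = (\<Sum>i\<in>UNIV. (A $ i \<bullet> h)\<^sup>2)"
    unfolding power2_norm_eq_inner inner_vec_def[of "A *v h"]
    by (simp add: matrix_mult_dot power2_eq_square)
  also have "\<dots> \<le> (\<Sum>i\<in>UNIV. (norm (A $ i))\<^sup>2 * (norm h)\<^sup>2)"
    by (intro sum_mono) (metis Cauchy_Schwarz_ineq power2_norm_eq_inner)
  also have "\<dots> = (norm A * norm h)\<^sup>2"
    by (simp add: power_mult_distrib sum_distrib_right norm_vec_def L2_set_def sum_nonneg)
  finally show ?thesis by (rule power2_le_imp_le) simp
qed

lemma borel_measurable_matrix_vector_mult [measurable (raw)]:
  fixes A :: "'a \<Rightarrow> real^3^3"
  assumes [measurable]: "A \<in> borel_measurable M" "f \<in> borel_measurable M"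
  shows "(\<lambda>x. A x *v f x) \<in> borel_measurable M"
proof -
  have "bounded_bilinear ((*v) :: real^3^3 \<Rightarrow> real^3 \<Rightarrow> real^3)"
    by (rule bounded_bilinear.intro)
       (auto simp: matrix_vector_mult_add_rdistrib matrix_vector_right_distrib scaleR_matrix_vector_assoc matrix_vector_mult_scaleR
         intro!: exI[of _ 1] norm_matrix_vector_mult_le)
  then have "continuous_on UNIV (\<lambda>p :: (real^3^3) \<times> (real^3). fst p *v snd p)"
    by (intro bounded_bilinear.continuous_on[where prod="(*v)"] continuous_intros)
  from borel_measurable_continuous_on[OF this, of "\<lambda>x. (A x, f x)" M] show ?thesis by simp
qed

section \<open>Finite differences of test fields in L^2\<close>

definition diff_quot :: "R3 \<Rightarrow> real \<Rightarrow> (R3 \<Rightarrow> 'b::euclidean_space) \<Rightarrow> R3 \<Rightarrow> 'b" where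
  "diff_quot h t u x = (u (x + t *\<^sub>R h) - u x) /\<^sub>R t"

lemma diff_quot_L2:
  assumes "u \<in> L2" shows "diff_quot h t u \<in> L2"
  unfolding diff_quot_def by (intro L2_scale L2_diff L2_translate assms)

lemma Vsp_diff_quot_tendsto:
  assumes "\<phi> \<in> Vsp" "\<And>n. t n \<noteq> 0" "\<And>n. \<bar>t n\<bar> \<le> 1" "t \<longlonglongrightarrow> (0::real)"
  shows "(\<lambda>n. L2_norm (\<lambda>x. diff_quot h (t n) \<phi> x - grad \<phi> x *v h)) \<longlonglongrightarrow> 0"
proof -
  note sm = VspD(1)[OF assms(1)]
  note [measurable] = Vsp_measurable[OF assms(1)] L2_measurable[OF Vsp_grad_L2[OF assms(1)]]
  obtain B R where B: "\<And>n x. norm (diff_quot h (t n) \<phi> x) \<le> B * indicator (cball 0 R) x"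
    and lim: "\<And>x. (\<lambda>n. diff_quot h (t n) \<phi> x) \<longlonglongrightarrow> grad \<phi> x *v h"
    using diff_quotient_dominated[OF sm VspD(2)[OF assms(1)] assms(2-4), of h]
    unfolding diff_quot_def grad_mult_vec by blast
  \<comment> \<open>The majorant of the quotients passes to their limit, so twice it dominates the
    difference.\<close>
  have B': "norm (grad \<phi> x *v h) \<le> B * indicator (cball 0 R) x" for x
    using B by (intro LIMSEQ_le_const2[OF tendsto_norm[OF lim[of x]]]) auto
  have [measurable]: "diff_quot h (t n) \<phi> \<in> borel_measurable borel" for n
    unfolding diff_quot_def by measurable
  have "(\<lambda>n. \<integral>x. (norm (diff_quot h (t n) \<phi> x - grad \<phi> x *v h))\<^sup>2 \<partial>lborel) \<longlonglongrightarrow> (\<integral>x. (0::real) \<partial>(lborel :: R3 measure))"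
  proof (rule integral_dominated_convergence[where w="\<lambda>x. (2*B)\<^sup>2 * indicator (cball 0 R) x"])
    show "AE x in lborel. (\<lambda>n. (norm (diff_quot h (t n) \<phi> x - grad \<phi> x *v h))\<^sup>2) \<longlonglongrightarrow> 0"
    proof (rule AE_I2)
      fix x
      have "(\<lambda>n. (norm (diff_quot h (t n) \<phi> x - grad \<phi> x *v h))\<^sup>2) \<longlonglongrightarrow> (norm (grad \<phi> x *v h - grad \<phi> x *v h))\<^sup>2"
        by (intro tendsto_intros lim)
      then show "(\<lambda>n. (norm (diff_quot h (t n) \<phi> x - grad \<phi> x *v h))\<^sup>2) \<longlonglongrightarrow> 0" by simp
    qed
    show "AE x in lborel. norm ((norm (diff_quot h (t n) \<phi> x - grad \<phi> x *v h))\<^sup>2) \<le> (2*B)\<^sup>2 * indicator (cball 0 R) x" for n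
    proof (rule AE_I2)
      fix x
      have "norm (diff_quot h (t n) \<phi> x - grad \<phi> x *v h) \<le> 2 * B * indicator (cball 0 R) x"
        using norm_triangle_ineq4[of "diff_quot h (t n) \<phi> x" "grad \<phi> x *v h"] B[of n x] B'[of x] by linarith
      then have "(norm (diff_quot h (t n) \<phi> x - grad \<phi> x *v h))\<^sup>2 \<le> (2 * B * indicator (cball 0 R) x)\<^sup>2"
        by (intro power_mono) auto
      then show "norm ((norm (diff_quot h (t n) \<phi> x - grad \<phi> x *v h))\<^sup>2) \<le> (2*B)\<^sup>2 * indicator (cball 0 R) x"
        by (cases "norm x \<le> R") (auto simp: power_mult_distrib)
    qed
    show "integrable lborel (\<lambda>x::R3. (2*B)\<^sup>2 * indicator (cball 0 R) x)" by (rule integrable_indicator_cball)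
  qed auto
  then have "(\<lambda>n. (L2_norm (\<lambda>x. diff_quot h (t n) \<phi> x - grad \<phi> x *v h))\<^sup>2) \<longlonglongrightarrow> 0"
    by (subst L2_norm_sq) auto
  then have "(\<lambda>n. sqrt ((L2_norm (\<lambda>x. diff_quot h (t n) \<phi> x - grad \<phi> x *v h))\<^sup>2)) \<longlonglongrightarrow> sqrt 0"
    by (rule tendsto_real_sqrt)
  then show ?thesis by simp
qed

lemma L2_matrix_vector:
  assumes "G \<in> L2"
  shows "(\<lambda>x. (G x :: real^3^3) *v h) \<in> L2" "L2_norm (\<lambda>x. G x *v h) \<le> norm h * L2_norm G"
proof -
  have "(\<lambda>x. (G x :: real^3^3) *v h) \<in> L2 \<and> L2_norm (\<lambda>x. G x *v h) \<le> norm h * L2_norm G"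
    using L2_measurable[OF assms]
    by (intro L2_dominated[OF assms]) (auto simp: mult.commute[of "norm h"] intro!: norm_matrix_vector_mult_le)
  then show "(\<lambda>x. (G x :: real^3^3) *v h) \<in> L2" "L2_norm (\<lambda>x. G x *v h) \<le> norm h * L2_norm G" by auto
qed

text \<open>Together with the limit of the difference quotients, this bounds finite differences by the gradient.\<close>

lemma L2_translate_chain:
  fixes u :: "R3 \<Rightarrow> 'b::euclidean_space"
  assumes "u \<in> L2"
  shows "L2_norm (\<lambda>x. u (x + real n *\<^sub>R h) - u x) \<le> real n * L2_norm (\<lambda>x. u (x + h) - u x)"
proof (induction n)
  case 0 show ?case by simp
next
  case (Suc n)
  have "L2_norm (\<lambda>x. u (x + real (Suc n) *\<^sub>R h) - u x) \<le>
    L2_norm (\<lambda>x. u (x + real (Suc n) *\<^sub>R h) - u (x + real n *\<^sub>R h)) + L2_norm (\<lambda>x. u (x + real n *\<^sub>R h) - u x)"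
    by (rule L2_norm_triangle3[of "\<lambda>x. u (x + real (Suc n) *\<^sub>R h)" "\<lambda>x. u (x + real n *\<^sub>R h)" u]) (intro L2_translate assms)+
  also have "L2_norm (\<lambda>x. u (x + real (Suc n) *\<^sub>R h) - u (x + real n *\<^sub>R h)) = L2_norm (\<lambda>x. u (x + h) - u x)"
    using L2_translate(2)[OF L2_diff[OF L2_translate(1)[OF assms, of h] assms], of "real n *\<^sub>R h"]
    by (simp add: algebra_simps)
  finally show ?case using Suc by (simp add: algebra_simps)
qed

text \<open>Cutting \<open>h\<close> into n + 1 equal steps compares the increment with the quotient
  of step 1 / (n + 1), which converges to the directional derivative. In this way no integral along
  the segment from x to x + h has to be taken inside the L^2 norm.\<close>

lemma Vsp_translate_bound:
  assumes "\<phi> \<in> Vsp"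
  shows "L2_norm (\<lambda>x. \<phi> (x + h) - \<phi> x) \<le> norm h * L2_norm (grad \<phi>)"
proof -
  define t :: "nat \<Rightarrow> real" where "t n = 1 / real (Suc n)" for n
  have t: "t n \<noteq> 0" "\<bar>t n\<bar> \<le> 1" for n by (auto simp: t_def)
  have t0: "t \<longlonglongrightarrow> 0" unfolding t_def using LIMSEQ_inverse_real_of_nat by (simp add: inverse_eq_divide)
  note L = Vsp_L2[OF assms] Vsp_grad_L2[OF assms]
  have "(\<lambda>n. L2_norm (diff_quot h (t n) \<phi>)) \<longlonglongrightarrow> L2_norm (\<lambda>x. grad \<phi> x *v h)"
    by (intro L2_norm_tendsto diff_quot_L2 L2_matrix_vector L Vsp_diff_quot_tendsto assms t t0)
  moreover have "L2_norm (\<lambda>x. \<phi> (x + h) - \<phi> x) \<le> L2_norm (diff_quot h (t n) \<phi>)" for n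
  proof -
    have "L2_norm (diff_quot h (t n) \<phi>) = real (Suc n) * L2_norm (\<lambda>x. \<phi> (x + t n *\<^sub>R h) - \<phi> x)"
      unfolding diff_quot_def by (subst L2_norm_scale) (auto intro!: L2_diff L2_translate L simp: t_def)
    moreover have "real (Suc n) *\<^sub>R (t n *\<^sub>R h) = h" by (simp add: t_def)
    ultimately show ?thesis using L2_translate_chain[OF L(1), of "Suc n" "t n *\<^sub>R h"] by simp
  qed
  ultimately have "L2_norm (\<lambda>x. \<phi> (x + h) - \<phi> x) \<le> L2_norm (\<lambda>x. grad \<phi> x *v h)"
    by (intro LIMSEQ_le_const) auto
  also have "\<dots> \<le> norm h * L2_norm (grad \<phi>)" by (rule L2_matrix_vector[OF L(2)])
  finally show ?thesis .
qed

section \<open>The closure of the test fields in the energy norm\<close>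

text \<open>The gradient is carried as a second function: \<open>u\<close> need not be
  differentiable anywhere, and it is determined only almost everywhere. The approximating sequence
  is a parameter because functionals known only on test fields are later evaluated as limits along
  it.\<close>

definition H1_approx :: "(R3 \<Rightarrow> R3) \<Rightarrow> (R3 \<Rightarrow> real^3^3) \<Rightarrow> (nat \<Rightarrow> R3 \<Rightarrow> R3) \<Rightarrow> bool" where
  "H1_approx u G \<phi> \<longleftrightarrow> u \<in> L2 \<and> G \<in> L2 \<and> (\<forall>n. \<phi> n \<in> Vsp) \<and>
     (\<lambda>n. L2_norm (\<lambda>x. \<phi> n x - u x)) \<longlonglongrightarrow> 0 \<and> (\<lambda>n. L2_norm (\<lambda>x. grad (\<phi> n) x - G x)) \<longlonglongrightarrow> 0"

definition H1 :: "(R3 \<Rightarrow> R3) \<Rightarrow> (R3 \<Rightarrow> real^3^3) \<Rightarrow> bool" where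
  "H1 u G \<longleftrightarrow> (\<exists>\<phi>. H1_approx u G \<phi>)"

lemma H1_approxD:
  assumes "H1_approx u G \<phi>"
  shows "u \<in> L2" "G \<in> L2" "\<And>n. \<phi> n \<in> Vsp" "\<And>n. \<phi> n \<in> L2" "\<And>n. grad (\<phi> n) \<in> L2"
    "(\<lambda>n. L2_norm (\<lambda>x. \<phi> n x - u x)) \<longlonglongrightarrow> 0" "(\<lambda>n. L2_norm (\<lambda>x. grad (\<phi> n) x - G x)) \<longlonglongrightarrow> 0"
  using assms by (auto simp: H1_approx_def Vsp_L2 Vsp_grad_L2)

lemma H1_L2: "H1 u G \<Longrightarrow> u \<in> L2" "H1 u G \<Longrightarrow> G \<in> L2"
  by (auto simp: H1_def H1_approx_def)

lemma Vsp_H1: "\<phi> \<in> Vsp \<Longrightarrow> H1 \<phi> (grad \<phi>)"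
  unfolding H1_def H1_approx_def by (rule exI[of _ "\<lambda>n. \<phi>"]) (auto simp: Vsp_L2 Vsp_grad_L2)

lemma H1_zero: "H1 (\<lambda>x. 0) (\<lambda>x. 0)"
proof -
  have "grad (\<lambda>x. 0) = (\<lambda>x. 0)" by (rule ext) (simp add: grad_def vec_eq_iff)
  then show ?thesis using Vsp_H1[OF Vsp_zero] by simp
qed

lemma L2_norm_sum_tendsto:
  fixes u v :: "nat \<Rightarrow> R3 \<Rightarrow> 'b::euclidean_space"
  assumes "\<And>n. u n \<in> L2" "U \<in> L2" "\<And>n. v n \<in> L2" "V \<in> L2"
    "(\<lambda>n. L2_norm (\<lambda>x. u n x - U x)) \<longlonglongrightarrow> 0" "(\<lambda>n. L2_norm (\<lambda>x. v n x - V x)) \<longlonglongrightarrow> 0"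
  shows "(\<lambda>n. L2_norm (\<lambda>x. (u n x + c *\<^sub>R v n x) - (U x + c *\<^sub>R V x))) \<longlonglongrightarrow> 0"
proof (rule tendsto_sandwich[OF _ _ tendsto_const])
  show "(\<lambda>n. L2_norm (\<lambda>x. u n x - U x) + \<bar>c\<bar> * L2_norm (\<lambda>x. v n x - V x)) \<longlonglongrightarrow> 0"
    using tendsto_add[OF assms(5) tendsto_mult[OF tendsto_const assms(6)]] by simp
  show "\<forall>\<^sub>F n in sequentially. L2_norm (\<lambda>x. (u n x + c *\<^sub>R v n x) - (U x + c *\<^sub>R V x))
    \<le> L2_norm (\<lambda>x. u n x - U x) + \<bar>c\<bar> * L2_norm (\<lambda>x. v n x - V x)"
  proof (rule always_eventually, rule allI)
    fix n
    have "(\<lambda>x. (u n x + c *\<^sub>R v n x) - (U x + c *\<^sub>R V x)) = (\<lambda>x. (u n x - U x) + c *\<^sub>R (v n x - V x))"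
      by (simp add: algebra_simps)
    moreover have "L2_norm (\<lambda>x. c *\<^sub>R (v n x - V x)) = \<bar>c\<bar> * L2_norm (\<lambda>x. v n x - V x)"
      by (rule L2_norm_scale[OF L2_diff[OF assms(3,4)]])
    ultimately show "L2_norm (\<lambda>x. (u n x + c *\<^sub>R v n x) - (U x + c *\<^sub>R V x))
      \<le> L2_norm (\<lambda>x. u n x - U x) + \<bar>c\<bar> * L2_norm (\<lambda>x. v n x - V x)"
      using L2_norm_triangle[OF L2_diff[OF assms(1,2)] L2_scale[OF L2_diff[OF assms(3,4)]], of n c n] by simp
  qed
qed auto

lemma H1_approx_add_scaleR:
  assumes "H1_approx u G \<phi>" "H1_approx v H \<psi>"
  shows "H1_approx (\<lambda>x. u x + c *\<^sub>R v x) (\<lambda>x. G x + c *\<^sub>R H x) (\<lambda>n x. \<phi> n x + c *\<^sub>R \<psi> n x)"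
proof -
  note u = H1_approxD[OF assms(1)] and v = H1_approxD[OF assms(2)]
  have g: "grad (\<lambda>x. \<phi> n x + c *\<^sub>R \<psi> n x) = (\<lambda>x. grad (\<phi> n) x + c *\<^sub>R grad (\<psi> n) x)" for n
    using u(3) v(3) by (simp add: grad_add grad_scaleR smooth_scaleR VspD)
  show ?thesis unfolding H1_approx_def g
    using L2_norm_sum_tendsto[OF u(4,1) v(4,1) u(6) v(6), of c] L2_norm_sum_tendsto[OF u(5,2) v(5,2) u(7) v(7), of c]
    by (auto intro!: L2_add L2_scale u v Vsp_add Vsp_scaleR)
qed

lemma H1_add_scaleR: "H1 u G \<Longrightarrow> H1 v H \<Longrightarrow> H1 (\<lambda>x. u x + c *\<^sub>R v x) (\<lambda>x. G x + c *\<^sub>R H x)"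
  unfolding H1_def using H1_approx_add_scaleR by blast

lemma H1_diff: "H1 u G \<Longrightarrow> H1 v H \<Longrightarrow> H1 (\<lambda>x. u x - v x) (\<lambda>x. G x - H x)"
  using H1_add_scaleR[of u G v H "-1"] by simp

lemma H1_translate:
  assumes "H1 u G" shows "H1 (\<lambda>x. u (x + h)) (\<lambda>x. G (x + h))"
proof -
  obtain \<phi> where "H1_approx u G \<phi>" using assms by (auto simp: H1_def)
  note u = H1_approxD[OF this]
  have "H1_approx (\<lambda>x. u (x + h)) (\<lambda>x. G (x + h)) (\<lambda>n x. \<phi> n (x + h))"
    unfolding H1_approx_def grad_translate[OF VspD(1)[OF u(3)]]
    using L2_translate(2)[OF L2_diff[OF u(4,1)], of _ h] L2_translate(2)[OF L2_diff[OF u(5,2)], of _ h] u(6,7)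
    by (auto intro!: L2_translate u Vsp_translate)
  then show ?thesis by (auto simp: H1_def)
qed

text \<open>A diagonal argument: the n-th approximating test field is chosen within 1 / (n + 1) of
  the n-th pair.\<close>

lemma H1_closed:
  assumes "\<And>n. H1 (u n) (G n)" "U \<in> L2" "K \<in> L2"
    "(\<lambda>n. L2_norm (\<lambda>x. u n x - U x)) \<longlonglongrightarrow> 0" "(\<lambda>n. L2_norm (\<lambda>x. G n x - K x)) \<longlonglongrightarrow> 0"
  shows "H1 U K"
proof -
  have "\<exists>\<phi>\<in>Vsp. L2_norm (\<lambda>x. \<phi> x - u n x) < 1 / real (Suc n) \<and> L2_norm (\<lambda>x. grad \<phi> x - G n x) < 1 / real (Suc n)" for n
  proof -
    obtain \<phi> where "H1_approx (u n) (G n) \<phi>" using assms(1) by (auto simp: H1_def)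
    note p = H1_approxD[OF this]
    have "\<forall>\<^sub>F k in sequentially. L2_norm (\<lambda>x. \<phi> k x - u n x) < 1 / real (Suc n) \<and> L2_norm (\<lambda>x. grad (\<phi> k) x - G n x) < 1 / real (Suc n)"
      by (intro eventually_conj order_tendstoD(2)[OF p(6)] order_tendstoD(2)[OF p(7)]) auto
    then show ?thesis using p(3) unfolding eventually_sequentially by blast
  qed
  then have "\<exists>\<phi>. \<forall>n. \<phi> n \<in> Vsp \<and> L2_norm (\<lambda>x. \<phi> n x - u n x) < 1 / real (Suc n)
    \<and> L2_norm (\<lambda>x. grad (\<phi> n) x - G n x) < 1 / real (Suc n)"
    by (intro choice) blast
  then obtain \<phi> where \<phi>: "\<And>n. \<phi> n \<in> Vsp" "\<And>n. L2_norm (\<lambda>x. \<phi> n x - u n x) < 1 / real (Suc n)"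
    "\<And>n. L2_norm (\<lambda>x. grad (\<phi> n) x - G n x) < 1 / real (Suc n)" by blast
  have z: "(\<lambda>n. 1 / real (Suc n)) \<longlonglongrightarrow> 0" using LIMSEQ_inverse_real_of_nat by (simp add: inverse_eq_divide)
  have 1: "(\<lambda>n. L2_norm (\<lambda>x. \<phi> n x - U x)) \<longlonglongrightarrow> 0"
  proof (rule tendsto_sandwich[OF _ _ tendsto_const])
    show "(\<lambda>n. 1 / real (Suc n) + L2_norm (\<lambda>x. u n x - U x)) \<longlonglongrightarrow> 0"
      using tendsto_add[OF z assms(4)] by simp
    show "\<forall>\<^sub>F n in sequentially. L2_norm (\<lambda>x. \<phi> n x - U x) \<le> 1 / real (Suc n) + L2_norm (\<lambda>x. u n x - U x)"
    proof (intro always_eventually allI)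
      fix n
      show "L2_norm (\<lambda>x. \<phi> n x - U x) \<le> 1 / real (Suc n) + L2_norm (\<lambda>x. u n x - U x)"
        using \<phi>(2)[of n] L2_norm_triangle3[OF Vsp_L2[OF \<phi>(1)] H1_L2(1)[OF assms(1)] assms(2), of n n] by linarith
    qed
  qed auto
  have 2: "(\<lambda>n. L2_norm (\<lambda>x. grad (\<phi> n) x - K x)) \<longlonglongrightarrow> 0"
  proof (rule tendsto_sandwich[OF _ _ tendsto_const])
    show "(\<lambda>n. 1 / real (Suc n) + L2_norm (\<lambda>x. G n x - K x)) \<longlonglongrightarrow> 0"
      using tendsto_add[OF z assms(5)] by simp
    show "\<forall>\<^sub>F n in sequentially. L2_norm (\<lambda>x. grad (\<phi> n) x - K x) \<le> 1 / real (Suc n) + L2_norm (\<lambda>x. G n x - K x)"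
    proof (intro always_eventually allI)
      fix n
      show "L2_norm (\<lambda>x. grad (\<phi> n) x - K x) \<le> 1 / real (Suc n) + L2_norm (\<lambda>x. G n x - K x)"
        using \<phi>(3)[of n] L2_norm_triangle3[OF Vsp_grad_L2[OF \<phi>(1)] H1_L2(2)[OF assms(1)] assms(3), of n n] by linarith
    qed
  qed auto
  from 1 2 show ?thesis unfolding H1_def H1_approx_def using \<phi>(1) assms(2,3) by blast
qed

lemma H1_translate_bound:
  assumes "H1 u G"
  shows "L2_norm (\<lambda>x. u (x + h) - u x) \<le> norm h * L2_norm G"
proof -
  obtain \<phi> where "H1_approx u G \<phi>" using assms by (auto simp: H1_def)
  note p = H1_approxD[OF this]
  have "(\<lambda>n. L2_norm (\<lambda>x. \<phi> n (x + h) - \<phi> n x)) \<longlonglongrightarrow> L2_norm (\<lambda>x. u (x + h) - u x)"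
  proof (rule L2_norm_tendsto)
    have "(\<lambda>n. L2_norm (\<lambda>x. \<phi> n (x + h) - u (x + h))) \<longlonglongrightarrow> 0"
      using L2_translate(2)[OF L2_diff[OF p(4,1)], of _ h] p(6) by simp
    from L2_norm_sum_tendsto[OF L2_translate(1)[OF p(4)] L2_translate(1)[OF p(1)] p(4,1) this p(6), of "-1"]
    show "(\<lambda>n. L2_norm (\<lambda>x. (\<phi> n (x + h) - \<phi> n x) - (u (x + h) - u x))) \<longlonglongrightarrow> 0" by simp
  qed (intro L2_diff L2_translate p)+
  moreover have "(\<lambda>n. norm h * L2_norm (grad (\<phi> n))) \<longlonglongrightarrow> norm h * L2_norm G"
    by (intro tendsto_mult tendsto_const L2_norm_tendsto p)
  ultimately show ?thesis
    by (rule LIMSEQ_le) (auto intro!: Vsp_translate_bound p)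
qed

text \<open>By \<open>H1_translate_bound\<close> the map from a pair to its difference quotient is
  bounded uniformly in the step, relative to the gradient. Convergence therefore extends from test
  fields to their closure.\<close>

lemma H1_diff_quot_tendsto:
  assumes "H1 u G" "\<And>n. t n \<noteq> 0" "\<And>n. \<bar>t n\<bar> \<le> 1" "t \<longlonglongrightarrow> (0::real)"
  shows "(\<lambda>n. L2_norm (\<lambda>x. diff_quot h (t n) u x - G x *v h)) \<longlonglongrightarrow> 0"
proof (rule LIMSEQ_I)
  fix e :: real assume "e > 0"
  obtain \<phi> where "H1_approx u G \<phi>" using assms by (auto simp: H1_def)
  note p = H1_approxD[OF this]
  have "\<forall>\<^sub>F k in sequentially. L2_norm (\<lambda>x. grad (\<phi> k) x - G x) < e / (4 * (norm h + 1))"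
    by (rule order_tendstoD(2)[OF p(7)]) (use \<open>e > 0\<close> in \<open>auto intro!: divide_pos_pos add_nonneg_pos\<close>)
  \<comment> \<open>The summand 1 keeps the denominator positive for h = 0. Each of the three error
    terms below receives a share of e / 4.\<close>
  then obtain k where k: "L2_norm (\<lambda>x. grad (\<phi> k) x - G x) < e / (4 * (norm h + 1))"
    by (auto simp: eventually_sequentially)
  define d where "d = L2_norm (\<lambda>x. G x - grad (\<phi> k) x)"
  have hd: "norm h * d < e / 4"
  proof -
    have "norm h * d \<le> (norm h + 1) * d" by (intro mult_right_mono) (auto simp: d_def)
    also have "\<dots> < e / 4"
      using k L2_norm_minus_commute[of G "grad (\<phi> k)"] add_nonneg_pos[of "norm h" 1] by (simp add: d_def field_simps)
    finally show ?thesis .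
  qed
  have w: "H1 (\<lambda>x. u x - \<phi> k x) (\<lambda>x. G x - grad (\<phi> k) x)"
    by (intro H1_diff assms(1) Vsp_H1 p)
  have 1: "L2_norm (diff_quot h (t n) (\<lambda>x. u x - \<phi> k x)) \<le> norm h * d" for n
  proof -
    have "L2_norm (diff_quot h (t n) (\<lambda>x. u x - \<phi> k x)) = L2_norm (\<lambda>x. (u (x + t n *\<^sub>R h) - \<phi> k (x + t n *\<^sub>R h)) - (u x - \<phi> k x)) / \<bar>t n\<bar>"
      unfolding diff_quot_def by (subst L2_norm_scale) (auto intro!: L2_diff L2_translate p simp: divide_inverse_commute)
    also have "\<dots> \<le> (\<bar>t n\<bar> * norm h * d) / \<bar>t n\<bar>"
      using H1_translate_bound[OF w, of "t n *\<^sub>R h"] by (intro divide_right_mono) (auto simp: d_def)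
    finally show ?thesis using assms(2)[of n] by simp
  qed
  have 3: "L2_norm (\<lambda>x. (grad (\<phi> k) x - G x) *v h) \<le> norm h * d"
    using L2_matrix_vector(2)[OF L2_diff[OF p(5,2)], of k h] L2_norm_minus_commute[of G "grad (\<phi> k)"] by (simp add: d_def)
  have "\<forall>\<^sub>F n in sequentially. L2_norm (\<lambda>x. diff_quot h (t n) (\<phi> k) x - grad (\<phi> k) x *v h) < e / 4"
    by (rule order_tendstoD(2)[OF Vsp_diff_quot_tendsto[OF p(3) assms(2-4)]]) (use \<open>e > 0\<close> in auto)
  then obtain N where N: "\<And>n. n \<ge> N \<Longrightarrow> L2_norm (\<lambda>x. diff_quot h (t n) (\<phi> k) x - grad (\<phi> k) x *v h) < e / 4"
    by (auto simp: eventually_sequentially)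
  have "L2_norm (\<lambda>x. diff_quot h (t n) u x - G x *v h) < e" if "n \<ge> N" for n
  proof -
    have "(\<lambda>x. diff_quot h (t n) u x - G x *v h) = (\<lambda>x. diff_quot h (t n) (\<lambda>x. u x - \<phi> k x) x +
      ((diff_quot h (t n) (\<phi> k) x - grad (\<phi> k) x *v h) + (grad (\<phi> k) x - G x) *v h))"
      by (rule ext) (simp add: diff_quot_def algebra_simps)
    then have "L2_norm (\<lambda>x. diff_quot h (t n) u x - G x *v h) \<le> L2_norm (diff_quot h (t n) (\<lambda>x. u x - \<phi> k x))
       + (L2_norm (\<lambda>x. diff_quot h (t n) (\<phi> k) x - grad (\<phi> k) x *v h) + L2_norm (\<lambda>x. (grad (\<phi> k) x - G x) *v h))"
      by (simp only:) (intro order_trans[OF L2_norm_triangle] add_left_mono L2_norm_triangle L2_add diff_quot_L2 L2_diff L2_matrix_vector p)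
    then show ?thesis using 1[of n] 3 N[OF that] hd \<open>e > 0\<close> by linarith
  qed
  then show "\<exists>no. \<forall>n\<ge>no. norm (L2_norm (\<lambda>x. diff_quot h (t n) u x - G x *v h) - 0) < e" by auto
qed

section \<open>The Sobolev inequality\<close>

definition vec3 :: "real \<Rightarrow> real \<Rightarrow> real \<Rightarrow> R3" where
  "vec3 a b c = vector [a, b, c]"

lemma vec3_nth [simp]: "vec3 a b c $ 1 = a" "vec3 a b c $ 2 = b" "vec3 a b c $ 3 = c"
  by (simp_all add: vec3_def)

lemma vec3_eq: "vec3 a b c = a *\<^sub>R axis 1 1 + b *\<^sub>R axis 2 1 + c *\<^sub>R axis 3 1"
  by (simp add: vec_eq_iff forall_3 axis_def)

lemma borel_measurable_vec3 [measurable (raw)]: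
  assumes [measurable]: "f \<in> borel_measurable M" "g \<in> borel_measurable M" "h \<in> borel_measurable M"
  shows "(\<lambda>x. vec3 (f x) (g x) (h x)) \<in> borel_measurable M"
  unfolding vec3_eq by measurable

lemma emeasure_lborel_Times:
  fixes A :: "'a::euclidean_space set" and B :: "'b::euclidean_space set"
  assumes "A \<in> sets borel" "B \<in> sets borel"
  shows "emeasure lborel (A \<times> B) = emeasure lborel A * emeasure lborel B"
  unfolding lborel_prod[symmetric] using assms by (intro lborel.emeasure_pair_measure_Times) auto

lemma prod_UNIV_3: "prod f (UNIV :: 3 set) = f 1 * (f 2 * f 3)"
  unfolding UNIV_3 by simp

text \<open>Lebesgue measure is determined by the volume of boxes, and the preimage of a box under
  the coordinate map is a product of three intervals.\<close>

lemma lborel_vec3: "(lborel :: R3 measure) = distr lborel borel (\<lambda>(a, b, c). vec3 a b c)"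
proof (rule lborel_eqI)
  fix l u :: R3 assume le: "\<And>b. b \<in> Basis \<Longrightarrow> l \<bullet> b \<le> u \<bullet> b"
  have le': "l $ i \<le> u $ i" for i
    using le[of "axis i 1"] by (simp add: inner_axis axis_in_Basis_iff)
  have [measurable]: "(\<lambda>(a, b, c). vec3 a b c) \<in> borel_measurable (borel :: (real \<times> real \<times> real) measure)"
    unfolding borel_prod[symmetric] by measurable
  have "emeasure (distr lborel borel (\<lambda>(a, b, c). vec3 a b c)) (box l u)
     = emeasure lborel ((\<lambda>(a, b, c). vec3 a b c) -` box l u)"
    by (subst emeasure_distr) auto
  also have "(\<lambda>(a, b, c). vec3 a b c) -` box l u = {l$1<..<u$1} \<times> {l$2<..<u$2} \<times> {l$3<..<u$3}"
    by (auto simp: mem_box_cart forall_3)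
  also have "emeasure lborel \<dots> = (u$1 - l$1) * ((u$2 - l$2) * (u$3 - l$3))"
  proof -
    have "emeasure lborel ({l$1<..<u$1} \<times> {l$2<..<u$2} \<times> {l$3<..<u$3})
      = emeasure lborel {l$1<..<u$1} * (emeasure lborel {l$2<..<u$2} * emeasure lborel {l$3<..<u$3})"
      by (simp add: emeasure_lborel_Times borel_open open_Times)
    then show ?thesis using le' by (simp add: ennreal_mult)
  qed
  also have "(u$1 - l$1) * ((u$2 - l$2) * (u$3 - l$3)) = (\<Prod>b\<in>Basis. (u - l) \<bullet> b)"
  proof -
    have B: "(Basis :: R3 set) = (\<lambda>i. axis i 1) ` UNIV" by (auto simp: Basis_vec_def)
    have "(\<Prod>b\<in>Basis. (u - l) \<bullet> b) = (\<Prod>i\<in>UNIV. (u - l) $ i)"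
      unfolding B by (subst prod.reindex) (auto simp: inj_on_def axis_eq_axis inner_axis)
    then show ?thesis by (simp add: prod_UNIV_3)
  qed
  finally show "emeasure (distr lborel borel (\<lambda>(a, b, c). vec3 a b c)) (box l u) = ennreal (\<Prod>b\<in>Basis. (u - l) \<bullet> b)" .
qed simp

lemma nn_integral_vec3:
  fixes F :: "R3 \<Rightarrow> ennreal"
  assumes [measurable]: "F \<in> borel_measurable borel"
  shows "(\<integral>\<^sup>+x. F x \<partial>lborel) = (\<integral>\<^sup>+a. \<integral>\<^sup>+b. \<integral>\<^sup>+c. F (vec3 a b c) \<partial>lborel \<partial>lborel \<partial>lborel)"
proof -
  have [measurable]: "(\<lambda>(a, b, c). vec3 a b c) \<in> borel_measurable (borel :: (real \<times> real \<times> real) measure)"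
    unfolding borel_prod[symmetric] by measurable
  have "(\<integral>\<^sup>+x. F x \<partial>lborel) = (\<integral>\<^sup>+p. F (case p of (a, b, c) \<Rightarrow> vec3 a b c) \<partial>lborel)"
    unfolding lborel_vec3 by (subst nn_integral_distr) auto
  also have "\<dots> = (\<integral>\<^sup>+p. F (case p of (a, b, c) \<Rightarrow> vec3 a b c) \<partial>(lborel \<Otimes>\<^sub>M lborel))"
    by (simp add: lborel_prod)
  also have "\<dots> = (\<integral>\<^sup>+a. \<integral>\<^sup>+q. F (case q of (b, c) \<Rightarrow> vec3 a b c) \<partial>lborel \<partial>lborel)"
    by (subst lborel.nn_integral_fst[symmetric]) (simp_all add: lborel_prod)
  also have "\<dots> = (\<integral>\<^sup>+a. \<integral>\<^sup>+q. F (case q of (b, c) \<Rightarrow> vec3 a b c) \<partial>(lborel \<Otimes>\<^sub>M lborel) \<partial>lborel)"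
    by (simp add: lborel_prod)
  also have "\<dots> = (\<integral>\<^sup>+a. \<integral>\<^sup>+b. \<integral>\<^sup>+c. F (vec3 a b c) \<partial>lborel \<partial>lborel \<partial>lborel)"
    by (intro nn_integral_cong, subst lborel.nn_integral_fst[symmetric]) (simp_all add: case_prod_beta')
  finally show ?thesis .
qed

lemma nn_integral_swap_real:
  fixes f :: "real \<Rightarrow> real \<Rightarrow> ennreal"
  assumes "(\<lambda>(x, y). f x y) \<in> borel_measurable (borel \<Otimes>\<^sub>M borel)"
  shows "(\<integral>\<^sup>+x. \<integral>\<^sup>+y. f x y \<partial>lborel \<partial>lborel) = (\<integral>\<^sup>+y. \<integral>\<^sup>+x. f x y \<partial>lborel \<partial>lborel)"
proof -
  note [measurable] = assms
  have "case_prod f \<in> borel_measurable (lborel \<Otimes>\<^sub>M lborel)" by measurable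
  from lborel_pair.Fubini'[OF this] show ?thesis by simp
qed

text \<open>Every factor misses one of the three variables. Cauchy-Schwarz in (b, c) separates
  \<open>f\<close>; Cauchy-Schwarz in a, applied to the remaining inner integral, leaves a function
  of c times a function of b, whose integral factorizes.\<close>

lemma Loomis_Whitney:
  fixes f g h :: "real \<Rightarrow> real \<Rightarrow> ennreal"
  assumes [measurable]: "(\<lambda>(x, y). f x y) \<in> borel_measurable (borel \<Otimes>\<^sub>M borel)"
    "(\<lambda>(x, y). g x y) \<in> borel_measurable (borel \<Otimes>\<^sub>M borel)"
    "(\<lambda>(x, y). h x y) \<in> borel_measurable (borel \<Otimes>\<^sub>M borel)"
  shows "(\<integral>\<^sup>+b. \<integral>\<^sup>+c. \<integral>\<^sup>+a. f b c * (g a c * h a b) \<partial>lborel \<partial>lborel \<partial>lborel)\<^sup>2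
    \<le> (\<integral>\<^sup>+b. \<integral>\<^sup>+c. (f b c)\<^sup>2 \<partial>lborel \<partial>lborel) * ((\<integral>\<^sup>+c. \<integral>\<^sup>+a. (g a c)\<^sup>2 \<partial>lborel \<partial>lborel)
      * (\<integral>\<^sup>+b. \<integral>\<^sup>+a. (h a b)\<^sup>2 \<partial>lborel \<partial>lborel))"
proof -
  let ?M = "lborel \<Otimes>\<^sub>M (lborel :: real measure) :: (real \<times> real) measure"
  let ?k = "\<lambda>b c. \<integral>\<^sup>+a. g a c * h a b \<partial>lborel"
  have "(\<integral>\<^sup>+b. \<integral>\<^sup>+c. \<integral>\<^sup>+a. f b c * (g a c * h a b) \<partial>lborel \<partial>lborel \<partial>lborel)
     = (\<integral>\<^sup>+b. \<integral>\<^sup>+c. f b c * ?k b c \<partial>lborel \<partial>lborel)"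
    by (intro nn_integral_cong nn_integral_cmult) measurable
  also have "\<dots> = (\<integral>\<^sup>+p. f (fst p) (snd p) * ?k (fst p) (snd p) \<partial>?M)"
    by (subst lborel.nn_integral_fst[symmetric]) auto
  finally have "(\<integral>\<^sup>+b. \<integral>\<^sup>+c. \<integral>\<^sup>+a. f b c * (g a c * h a b) \<partial>lborel \<partial>lborel \<partial>lborel)\<^sup>2
     \<le> (\<integral>\<^sup>+p. (f (fst p) (snd p))\<^sup>2 \<partial>?M) * (\<integral>\<^sup>+p. (?k (fst p) (snd p))\<^sup>2 \<partial>?M)"
    by (simp only:) (rule Cauchy_Schwarz_nn_integral, measurable)
  also have "(\<integral>\<^sup>+p. (f (fst p) (snd p))\<^sup>2 \<partial>?M) = (\<integral>\<^sup>+b. \<integral>\<^sup>+c. (f b c)\<^sup>2 \<partial>lborel \<partial>lborel)"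
    by (subst lborel.nn_integral_fst[symmetric]) auto
  also have "(\<integral>\<^sup>+p. (?k (fst p) (snd p))\<^sup>2 \<partial>?M) = (\<integral>\<^sup>+b. \<integral>\<^sup>+c. (?k b c)\<^sup>2 \<partial>lborel \<partial>lborel)"
    by (subst lborel.nn_integral_fst[symmetric]) auto
  also have "(\<integral>\<^sup>+b. \<integral>\<^sup>+c. (?k b c)\<^sup>2 \<partial>lborel \<partial>lborel)
     \<le> (\<integral>\<^sup>+b. \<integral>\<^sup>+c. (\<integral>\<^sup>+a. (g a c)\<^sup>2 \<partial>lborel) * (\<integral>\<^sup>+a. (h a b)\<^sup>2 \<partial>lborel) \<partial>lborel \<partial>lborel)"
    by (intro nn_integral_mono Cauchy_Schwarz_nn_integral) measurable
  also have "\<dots> = (\<integral>\<^sup>+b. (\<integral>\<^sup>+c. \<integral>\<^sup>+a. (g a c)\<^sup>2 \<partial>lborel \<partial>lborel) * (\<integral>\<^sup>+a. (h a b)\<^sup>2 \<partial>lborel) \<partial>lborel)"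
    by (intro nn_integral_cong nn_integral_multc) measurable
  also have "\<dots> = (\<integral>\<^sup>+c. \<integral>\<^sup>+a. (g a c)\<^sup>2 \<partial>lborel \<partial>lborel) * (\<integral>\<^sup>+b. \<integral>\<^sup>+a. (h a b)\<^sup>2 \<partial>lborel \<partial>lborel)"
    by (intro nn_integral_cmult) measurable
  finally show ?thesis by (simp add: mult_left_mono)
qed

section \<open>From line integrals to the Sobolev inequality for test fields\<close>

lemma abs_le_nn_integral_deriv:
  fixes F :: "real \<Rightarrow> real"
  assumes "\<And>s. (F has_real_derivative F' s) (at s)" "continuous_on UNIV F'" "L \<le> a" "F L = 0"
  shows "ennreal \<bar>F a\<bar> \<le> (\<integral>\<^sup>+s. ennreal \<bar>F' s\<bar> \<partial>lborel)"
proof -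
  have 1: "has_bochner_integral lborel (\<lambda>x. indicator {L..a} x *\<^sub>R F' x) (F a - F L)"
    using assms(1) assms(2)
    by (intro has_bochner_integral_FTC_Icc assms(3))
       (auto simp: has_real_derivative_iff_has_vector_derivative intro: has_vector_derivative_at_within continuous_on_subset)
  have "ennreal \<bar>F a\<bar> = ennreal (norm (\<integral>x. indicator {L..a} x *\<^sub>R F' x \<partial>lborel))"
    using has_bochner_integral_integral_eq[OF 1] assms(4) by simp
  also have "\<dots> \<le> (\<integral>\<^sup>+x. ennreal (norm (indicator {L..a} x *\<^sub>R F' x)) \<partial>lborel)"
    using 1 by (intro integral_norm_bound_ennreal) (auto simp: has_bochner_integral_iff)
  also have "\<dots> \<le> (\<integral>\<^sup>+s. ennreal \<bar>F' s\<bar> \<partial>lborel)"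
    by (intro nn_integral_mono) (auto simp: indicator_def)
  finally show ?thesis .
qed

text \<open>The fundamental theorem of calculus along the line through \<open>x\<close> in direction
  \<open>j\<close>. The parameter is the j-th coordinate itself, so the right-hand side depends only
  on the other two coordinates. The fourth power is chosen because its square roots, multiplied over
  three directions, give u^6.\<close>

lemma pow4_le_line_integral:
  fixes u :: "R3 \<Rightarrow> real"
  assumes "smooth u" "compact_supp u"
  shows "ennreal ((u x)^4) \<le> (\<integral>\<^sup>+s. ennreal \<bar>4 * (u (x + (s - x $ j) *\<^sub>R axis j 1))^3 * pd j u (x + (s - x $ j) *\<^sub>R axis j 1)\<bar> \<partial>lborel)"
proof -
  obtain R where R: "\<And>x. norm x > R \<Longrightarrow> u x = 0" using assms by (auto simp: compact_supp_iff)
  let ?y = "\<lambda>s. x + (s - x $ j) *\<^sub>R axis j 1 :: R3"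
  have yj: "?y s $ j = s" for s by (simp add: axis_def)
  \<comment> \<open>A starting point to the left of \<open>x\<close> and beyond radius
    \<open>R\<close>, so \<open>u\<close> vanishes there.\<close>
  define L where "L = min (x $ j) (- \<bar>R\<bar> - 1)"
  have "norm (?y L) \<ge> \<bar>L\<bar>" using component_le_norm_cart[of "?y L" j] yj[of L] by simp
  then have "u (?y L) = 0" by (intro R) (auto simp: L_def)
  have d: "((\<lambda>s. u (?y s)) has_real_derivative pd j u (?y s)) (at s)" for s
  proof -
    have 1: "(?y has_derivative (\<lambda>t. t *\<^sub>R axis j 1)) (at s)"
      by (auto intro!: derivative_eq_intros)
    have "((\<lambda>s. u (?y s)) has_derivative (\<lambda>t. \<Sum>i\<in>UNIV. (t *\<^sub>R axis j 1 :: R3) $ i *\<^sub>R pd i u (?y s))) (at s)"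
      by (rule has_derivative_compose[OF 1 smooth_has_derivative[OF assms(1)]])
    moreover have "(\<Sum>i\<in>UNIV. (t *\<^sub>R axis j 1 :: R3) $ i *\<^sub>R pd i u (?y s)) = pd j u (?y s) * t" for t
    proof -
      have "(\<Sum>i\<in>UNIV. (t *\<^sub>R axis j 1 :: R3) $ i *\<^sub>R pd i u (?y s)) = t * (\<Sum>i\<in>UNIV. (axis j 1 :: R3) $ i * pd i u (?y s))"
        by (simp add: sum_distrib_left mult.assoc del: sum_axis_mult)
      then show ?thesis by simp
    qed
    ultimately show ?thesis by (simp add: has_field_derivative_def mult_commute_abs)
  qed
  have "ennreal \<bar>(u (?y (x $ j)))^4\<bar> \<le> (\<integral>\<^sup>+s. ennreal \<bar>4 * (u (?y s))^3 * pd j u (?y s)\<bar> \<partial>lborel)"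
  proof (rule abs_le_nn_integral_deriv[where F="\<lambda>s. (u (?y s))^4" and L=L])
    show "((\<lambda>s. (u (?y s))^4) has_real_derivative 4 * (u (?y s))^3 * pd j u (?y s)) (at s)" for s
      by (auto intro!: derivative_eq_intros d)
    show "continuous_on UNIV (\<lambda>s. 4 * (u (?y s))^3 * pd j u (?y s))"
      by (intro continuous_intros continuous_on_compose2[OF smooth_continuous[OF assms(1), of UNIV]]
          continuous_on_compose2[OF smooth_continuous[OF smooth_pd[OF assms(1)], of UNIV]]) auto
  qed (use \<open>u (?y L) = 0\<close> in \<open>auto simp: L_def\<close>)
  then show ?thesis by simp
qed

lemma ennreal_sqrt_sq: "x < \<infinity> \<Longrightarrow> (ennreal (sqrt (enn2real x)))\<^sup>2 = x"
  by (simp add: ennreal_power)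

lemma ennreal_power2_le_imp_le: "x\<^sup>2 \<le> y\<^sup>2 \<Longrightarrow> x \<le> (y::ennreal)"
proof (cases x; cases y)
  fix a b assume *: "x\<^sup>2 \<le> y\<^sup>2" "x = ennreal a" "0 \<le> a" "y = ennreal b" "0 \<le> b"
  then have "a\<^sup>2 \<le> b\<^sup>2" by (simp add: ennreal_power)
  then show "x \<le> y" using * by (auto intro: ennreal_leI power2_le_imp_le)
qed (auto simp: power2_eq_square ennreal_mult_top ennreal_top_mult top_unique ennreal_mult_eq_top_iff)

text \<open>In each of the three directions, \<open>u\<^sup>2\<close> is at most the square root of a line integral of the derivative of
  \<open>u^4\<close>; the Loomis--Whitney inequality integrates the product of the three bounds.\<close>

lemma Sobolev_real_aux:
  fixes u :: "R3 \<Rightarrow> real"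
  assumes "smooth u" "compact_supp u"
  defines "D \<equiv> \<lambda>j x. ennreal \<bar>4 * (u x)^3 * pd j u x\<bar>"
  shows "(Lp_int 6 u)\<^sup>2 \<le> (\<integral>\<^sup>+x. D 1 x \<partial>lborel) * ((\<integral>\<^sup>+x. D 2 x \<partial>lborel) * (\<integral>\<^sup>+x. D 3 x \<partial>lborel))"
proof -
  note [measurable] = smooth_measurable[OF assms(1)] smooth_measurable[OF smooth_pd[OF assms(1)]]
  have [measurable]: "D j \<in> borel_measurable borel" for j unfolding D_def by measurable
  obtain R where R: "\<And>x. norm x > R \<Longrightarrow> u x = 0" using assms by (auto simp: compact_supp_iff)
  have cD: "continuous_on UNIV (\<lambda>x. 4 * (u x)^3 * pd j u x)" for j
    by (intro continuous_intros smooth_continuous smooth_pd assms)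
  have fin: "(\<integral>\<^sup>+s. D j (y s) \<partial>lborel) < \<infinity>" if "\<And>s. y s $ i = s" for j and y :: "real \<Rightarrow> R3" and i
  proof -
    obtain B where B: "\<And>x. norm (4 * (u x)^3 * pd j u x) \<le> B"
      using continuous_compact_supp_bound[OF cD, of R j] R by auto
    have "(\<integral>\<^sup>+s. D j (y s) \<partial>lborel) \<le> (\<integral>\<^sup>+s. ennreal B * indicator {-\<bar>R\<bar>..\<bar>R\<bar>} s \<partial>lborel)"
    proof (intro nn_integral_mono)
      fix s
      show "D j (y s) \<le> ennreal B * indicator {-\<bar>R\<bar>..\<bar>R\<bar>} s"
      proof (cases "s \<in> {-\<bar>R\<bar>..\<bar>R\<bar>}")
        case True then show ?thesis using B[of "y s"] by (auto simp: D_def intro!: ennreal_leI)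
      next
        case False
        then have "norm (y s) > R" using component_le_norm_cart[of "y s" i] that[of s] by auto
        then show ?thesis using R by (simp add: D_def)
      qed
    qed
    also have "\<dots> = ennreal B * ennreal (2 * \<bar>R\<bar>)"
      by (subst nn_integral_cmult_indicator) auto
    also have "\<dots> < \<infinity>" by (simp add: ennreal_mult_less_top)
    finally show ?thesis .
  qed
  define A1 where "A1 b c = (\<integral>\<^sup>+s. D 1 (vec3 s b c) \<partial>lborel)" for b c
  define A2 where "A2 a c = (\<integral>\<^sup>+s. D 2 (vec3 a s c) \<partial>lborel)" for a c
  define A3 where "A3 a b = (\<integral>\<^sup>+s. D 3 (vec3 a b s) \<partial>lborel)" for a b
  \<comment> \<open>\<open>enn2real\<close> sends infinity to 0, so \<open>r\<close> is a square
    root only at finite arguments; \<open>fin\<close> provides their finiteness.\<close>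
  define r :: "ennreal \<Rightarrow> ennreal" where "r x = ennreal (sqrt (enn2real x))" for x
  have [measurable]: "(\<lambda>(b, c). A1 b c) \<in> borel_measurable (borel \<Otimes>\<^sub>M borel)"
    "(\<lambda>(b, c). A2 b c) \<in> borel_measurable (borel \<Otimes>\<^sub>M borel)"
    "(\<lambda>(b, c). A3 b c) \<in> borel_measurable (borel \<Otimes>\<^sub>M borel)"
    unfolding A1_def A2_def A3_def by measurable
  have [measurable]: "r \<in> borel_measurable borel" unfolding r_def by measurable
  have rr: "(r (A1 b c))\<^sup>2 = A1 b c" "(r (A2 b c))\<^sup>2 = A2 b c" "(r (A3 b c))\<^sup>2 = A3 b c" for b c
    unfolding r_def A1_def A2_def A3_def
    using ennreal_sqrt_sq[OF fin[of "\<lambda>s. vec3 s b c" 1 1]] ennreal_sqrt_sq[OF fin[of "\<lambda>s. vec3 b s c" 2 2]]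
      ennreal_sqrt_sq[OF fin[of "\<lambda>s. vec3 b c s" 3 3]] by simp_all
  have line: "vec3 a b c + (s - vec3 a b c $ 1) *\<^sub>R axis 1 1 = vec3 s b c"
    "vec3 a b c + (s - vec3 a b c $ 2) *\<^sub>R axis 2 1 = vec3 a s c"
    "vec3 a b c + (s - vec3 a b c $ 3) *\<^sub>R axis 3 1 = vec3 a b s" for a b c s
    by (simp_all add: vec_eq_iff forall_3 axis_def)
  have u4: "ennreal ((u (vec3 a b c))^4) \<le> A1 b c" "ennreal ((u (vec3 a b c))^4) \<le> A2 a c" "ennreal ((u (vec3 a b c))^4) \<le> A3 a b" for a b c
    using pow4_le_line_integral[OF assms(1,2), of "vec3 a b c" 1] pow4_le_line_integral[OF assms(1,2), of "vec3 a b c" 2]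
      pow4_le_line_integral[OF assms(1,2), of "vec3 a b c" 3]
    unfolding line by (simp_all add: A1_def A2_def A3_def D_def)
  have sq: "ennreal (y\<^sup>2) \<le> r z" if "ennreal (y^4) \<le> z" "(r z)\<^sup>2 = z" for y :: real and z
  proof -
    have "(ennreal (y\<^sup>2))\<^sup>2 \<le> (r z)\<^sup>2" using that by (simp add: ennreal_power flip: power_mult)
    then show ?thesis by (rule ennreal_power2_le_imp_le)
  qed
  \<comment> \<open>u^6 is written as a product of three factors u^2, and each is bounded by the
    root of the line integral in a different direction.\<close>
  have p: "ennreal ((norm (u (vec3 a b c)))^6) \<le> r (A1 b c) * (r (A2 a c) * r (A3 a b))" for a b c
  proof -
    have "ennreal ((norm (u (vec3 a b c)))^6) = ennreal ((u (vec3 a b c))\<^sup>2) * (ennreal ((u (vec3 a b c))\<^sup>2) * ennreal ((u (vec3 a b c))\<^sup>2))"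
      by (simp add: ennreal_mult'[symmetric] flip: power_add)
    also have "\<dots> \<le> r (A1 b c) * (r (A2 a c) * r (A3 a b))"
      by (intro mult_mono sq u4 rr) auto
    finally show ?thesis .
  qed
  have "Lp_int 6 u = (\<integral>\<^sup>+a. \<integral>\<^sup>+b. \<integral>\<^sup>+c. ennreal ((norm (u (vec3 a b c)))^6) \<partial>lborel \<partial>lborel \<partial>lborel)"
    unfolding Lp_int_6 by (rule nn_integral_vec3) measurable
  also have "\<dots> \<le> (\<integral>\<^sup>+a. \<integral>\<^sup>+b. \<integral>\<^sup>+c. r (A1 b c) * (r (A2 a c) * r (A3 a b)) \<partial>lborel \<partial>lborel \<partial>lborel)"
    by (intro nn_integral_mono p)
  \<comment> \<open>\<open>Loomis_Whitney\<close> expects the variable a innermost; Tonelli moves it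
    there in two exchanges.\<close>
  also have "\<dots> = (\<integral>\<^sup>+b. \<integral>\<^sup>+a. \<integral>\<^sup>+c. r (A1 b c) * (r (A2 a c) * r (A3 a b)) \<partial>lborel \<partial>lborel \<partial>lborel)"
    by (rule nn_integral_swap_real) measurable
  also have "\<dots> = (\<integral>\<^sup>+b. \<integral>\<^sup>+c. \<integral>\<^sup>+a. r (A1 b c) * (r (A2 a c) * r (A3 a b)) \<partial>lborel \<partial>lborel \<partial>lborel)"
    by (intro nn_integral_cong nn_integral_swap_real) measurable
  finally have "(Lp_int 6 u)\<^sup>2 \<le> (\<integral>\<^sup>+b. \<integral>\<^sup>+c. \<integral>\<^sup>+a. r (A1 b c) * (r (A2 a c) * r (A3 a b)) \<partial>lborel \<partial>lborel \<partial>lborel)\<^sup>2"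
    by (intro power_mono) auto
  also have "\<dots> \<le> (\<integral>\<^sup>+b. \<integral>\<^sup>+c. (r (A1 b c))\<^sup>2 \<partial>lborel \<partial>lborel) * ((\<integral>\<^sup>+c. \<integral>\<^sup>+a. (r (A2 a c))\<^sup>2 \<partial>lborel \<partial>lborel)
      * (\<integral>\<^sup>+b. \<integral>\<^sup>+a. (r (A3 a b))\<^sup>2 \<partial>lborel \<partial>lborel))"
    by (rule Loomis_Whitney) measurable
  also have "\<dots> = (\<integral>\<^sup>+b. \<integral>\<^sup>+c. A1 b c \<partial>lborel \<partial>lborel) * ((\<integral>\<^sup>+c. \<integral>\<^sup>+a. A2 a c \<partial>lborel \<partial>lborel)
      * (\<integral>\<^sup>+b. \<integral>\<^sup>+a. A3 a b \<partial>lborel \<partial>lborel))"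
    by (simp only: rr)
  also have "(\<integral>\<^sup>+b. \<integral>\<^sup>+c. A1 b c \<partial>lborel \<partial>lborel) = (\<integral>\<^sup>+x. D 1 x \<partial>lborel)"
  proof -
    have "(\<integral>\<^sup>+b. \<integral>\<^sup>+c. A1 b c \<partial>lborel \<partial>lborel) = (\<integral>\<^sup>+b. \<integral>\<^sup>+a. \<integral>\<^sup>+c. D 1 (vec3 a b c) \<partial>lborel \<partial>lborel \<partial>lborel)"
      unfolding A1_def by (intro nn_integral_cong nn_integral_swap_real) measurable
    also have "\<dots> = (\<integral>\<^sup>+a. \<integral>\<^sup>+b. \<integral>\<^sup>+c. D 1 (vec3 a b c) \<partial>lborel \<partial>lborel \<partial>lborel)"
      by (rule nn_integral_swap_real) measurable
    finally show ?thesis by (simp add: nn_integral_vec3)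
  qed
  also have "(\<integral>\<^sup>+c. \<integral>\<^sup>+a. A2 a c \<partial>lborel \<partial>lborel) = (\<integral>\<^sup>+x. D 2 x \<partial>lborel)"
  proof -
    have "(\<integral>\<^sup>+c. \<integral>\<^sup>+a. A2 a c \<partial>lborel \<partial>lborel) = (\<integral>\<^sup>+a. \<integral>\<^sup>+c. A2 a c \<partial>lborel \<partial>lborel)"
      by (rule nn_integral_swap_real) measurable
    also have "\<dots> = (\<integral>\<^sup>+a. \<integral>\<^sup>+b. \<integral>\<^sup>+c. D 2 (vec3 a b c) \<partial>lborel \<partial>lborel \<partial>lborel)"
      unfolding A2_def by (intro nn_integral_cong nn_integral_swap_real) measurable
    finally show ?thesis by (simp add: nn_integral_vec3)
  qed
  also have "(\<integral>\<^sup>+b. \<integral>\<^sup>+a. A3 a b \<partial>lborel \<partial>lborel) = (\<integral>\<^sup>+x. D 3 x \<partial>lborel)"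
  proof -
    have "(\<integral>\<^sup>+b. \<integral>\<^sup>+a. A3 a b \<partial>lborel \<partial>lborel) = (\<integral>\<^sup>+a. \<integral>\<^sup>+b. A3 a b \<partial>lborel \<partial>lborel)"
      by (rule nn_integral_swap_real) measurable
    then show ?thesis by (simp add: nn_integral_vec3 A3_def)
  qed
  finally show ?thesis .
qed

text \<open>Cauchy-Schwarz gives D_j^2 \<le> 16 I N_j, where I is the integral of u^6 that is being
  estimated. Squaring \<open>Sobolev_real_aux\<close> yields I^4 \<le> 4096 I^3 N_1 N_2 N_3 with
  4096 = 16^3. Compact support makes I finite, so I^3 may be cancelled when I > 0.\<close>

lemma Sobolev_real:
  fixes u :: "R3 \<Rightarrow> real"
  assumes "smooth u" "compact_supp u"
  shows "(\<integral>x. (u x)^6 \<partial>lborel) \<le> 4096 * (\<Prod>j\<in>UNIV. \<integral>x. (pd j u x)\<^sup>2 \<partial>lborel)"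
proof -
  note [measurable] = smooth_measurable[OF assms(1)] smooth_measurable[OF smooth_pd[OF assms(1)]]
  define I where "I = (\<integral>x. (u x)^6 \<partial>lborel)"
  define N where "N j = (\<integral>x. (pd j u x)\<^sup>2 \<partial>lborel)" for j
  have I0: "I \<ge> 0" "\<And>j. N j \<ge> 0" by (auto simp: I_def N_def)
  have int6: "integrable lborel (\<lambda>x. (u x)^6)"
    using assms(2) by (intro integrable_continuous_compact_supp continuous_intros smooth_continuous assms) (auto simp: compact_supp_iff)
  from int6 have "(\<integral>\<^sup>+x. ennreal ((u x)^6) \<partial>lborel) = ennreal I"
    unfolding I_def by (intro nn_integral_eq_integral) auto
  then have I: "Lp_int 6 u = ennreal I" by (simp add: Lp_int_6)
  have "integrable lborel (\<lambda>x. (pd j u x)\<^sup>2)" for j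
    using compact_supp_pd[OF assms(2), of j]
    by (intro integrable_continuous_compact_supp continuous_intros smooth_continuous smooth_pd assms) (auto simp: compact_supp_iff)
  then have N: "(\<integral>\<^sup>+x. ennreal ((pd j u x)\<^sup>2) \<partial>lborel) = ennreal (N j)" for j
    unfolding N_def by (intro nn_integral_eq_integral) auto
  define D where "D j = (\<integral>\<^sup>+x. ennreal \<bar>4 * (u x)^3 * pd j u x\<bar> \<partial>lborel)" for j
  have D: "(D j)\<^sup>2 \<le> ennreal (16 * I * N j)" for j
  proof -
    have "(D j)\<^sup>2 = (\<integral>\<^sup>+x. ennreal \<bar>4 * (u x)^3\<bar> * ennreal \<bar>pd j u x\<bar> \<partial>lborel)\<^sup>2"
      by (simp add: D_def abs_mult ennreal_mult')
    also have "\<dots> \<le> (\<integral>\<^sup>+x. (ennreal \<bar>4 * (u x)^3\<bar>)\<^sup>2 \<partial>lborel) * (\<integral>\<^sup>+x. (ennreal \<bar>pd j u x\<bar>)\<^sup>2 \<partial>lborel)"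
      by (rule Cauchy_Schwarz_nn_integral) measurable
    also have "(\<integral>\<^sup>+x. (ennreal \<bar>pd j u x\<bar>)\<^sup>2 \<partial>lborel) = ennreal (N j)" by (simp add: ennreal_power N)
    also have "(\<integral>\<^sup>+x. (ennreal \<bar>4 * (u x)^3\<bar>)\<^sup>2 \<partial>lborel) = (\<integral>\<^sup>+x. ennreal (16 * (u x)^6) \<partial>lborel)"
      by (intro nn_integral_cong) (simp add: ennreal_power power_mult_distrib flip: power_mult)
    also have "\<dots> = ennreal (16 * I)"
      unfolding I_def by (subst nn_integral_eq_integral) (auto simp: int6)
    finally show ?thesis by (simp add: ennreal_mult'[symmetric] I0 mult.assoc)
  qed
  have "ennreal (I^4) = ((Lp_int 6 u)\<^sup>2)\<^sup>2" by (simp add: I I0 ennreal_power flip: power_mult)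
  also have "\<dots> \<le> (D 1 * (D 2 * D 3))\<^sup>2"
    using Sobolev_real_aux[OF assms] by (intro power_mono) (auto simp: D_def)
  also have "\<dots> = (D 1)\<^sup>2 * ((D 2)\<^sup>2 * (D 3)\<^sup>2)" by (simp add: power_mult_distrib)
  also have "\<dots> \<le> ennreal (16 * I * N 1) * (ennreal (16 * I * N 2) * ennreal (16 * I * N 3))"
    by (intro mult_mono D) auto
  also have "\<dots> = ennreal (I^3 * (4096 * (N 1 * N 2 * N 3)))"
    using I0 by (simp add: ennreal_mult'[symmetric] power3_eq_cube algebra_simps)
  finally have "I^3 * I \<le> I^3 * (4096 * (N 1 * N 2 * N 3))"
    using I0 by (subst (asm) ennreal_le_iff) (auto simp: power_numeral_reduce algebra_simps)
  then have "I \<le> 4096 * (N 1 * N 2 * N 3)"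
    using I0 by (cases "I = 0") (auto simp: mult_le_cancel_left_pos)
  then show ?thesis by (simp add: I_def N_def prod_UNIV_3 mult.assoc)
qed

lemma norm_matrix_sq: "(norm (A :: real^3^3))\<^sup>2 = (\<Sum>i\<in>UNIV. \<Sum>j\<in>UNIV. (A $ i $ j)\<^sup>2)"
  unfolding power2_norm_eq_inner inner_vec_def by (simp add: power2_eq_square)

lemma norm_R3_sq: "(norm (v :: R3))\<^sup>2 = (\<Sum>i\<in>UNIV. (v $ i)\<^sup>2)"
  unfolding power2_norm_eq_inner inner_vec_def by (simp add: power2_eq_square)

text \<open>The scalar inequality is applied to each component, and the sixth power of the Euclidean
  norm is compared with the sum of the sixth powers of the components.\<close>

lemma Sobolev_Vsp:
  assumes "\<phi> \<in> Vsp"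
  shows "Lp_int 6 \<phi> \<le> ennreal ((7 * L2_norm (grad \<phi>))^6)"
proof -
  note sm = VspD(1)[OF assms]
  note [measurable] = Vsp_measurable[OF assms] L2_measurable[OF Vsp_grad_L2[OF assms]]
  have c: "compact_supp (\<lambda>x. \<phi> x $ i)" for i using VspD(2)[OF assms] unfolding compact_supp_iff by (metis zero_index)
  define S where "S = (L2_norm (grad \<phi>))\<^sup>2"
  have int: "integrable lborel (\<lambda>x. (grad \<phi> x $ i $ j)\<^sup>2)" for i j
  proof -
    have "continuous_on UNIV (\<lambda>x. (grad \<phi> x $ i $ j)\<^sup>2)"
      by (intro continuous_on_power continuous_on_component smooth_grad_continuous sm)
    then show ?thesis
      using compact_supp_grad[OF VspD(2)[OF assms]]
      by (intro integrable_continuous_compact_supp) (auto simp: compact_supp_iff, metis zero_index)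
  qed
  have int6: "integrable lborel (\<lambda>x. (\<phi> x $ i)^6)" for i
  proof -
    have "continuous_on UNIV (\<lambda>x. (\<phi> x $ i)^6)"
      by (intro continuous_on_power smooth_continuous smooth_component sm)
    then show ?thesis
      using VspD(2)[OF assms]
      by (intro integrable_continuous_compact_supp) (auto simp: compact_supp_iff, metis zero_index)
  qed
  define n where "n i j = (\<integral>x. (grad \<phi> x $ i $ j)\<^sup>2 \<partial>lborel)" for i j
  have n0: "n i j \<ge> 0" for i j by (simp add: n_def)
  have S: "S = (\<Sum>i\<in>UNIV. \<Sum>j\<in>UNIV. n i j)"
  proof -
    have "S = (\<integral>x. (\<Sum>i\<in>UNIV. \<Sum>j\<in>UNIV. (grad \<phi> x $ i $ j)\<^sup>2) \<partial>lborel)"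
      unfolding S_def by (subst L2_norm_sq) (simp_all only: measurable_lborel1 norm_matrix_sq, measurable)
    also have "\<dots> = (\<Sum>i\<in>UNIV. \<Sum>j\<in>UNIV. n i j)"
      unfolding n_def by (subst Bochner_Integration.integral_sum, intro Bochner_Integration.integrable_sum int,
         intro sum.cong refl Bochner_Integration.integral_sum int)
    finally show ?thesis .
  qed
  have i6: "(\<integral>x. (\<phi> x $ i)^6 \<partial>lborel) \<le> 4096 * (\<Prod>j\<in>UNIV. n i j)" for i
    using Sobolev_real[OF smooth_component[OF sm] c, of i]
    by (simp add: n_def grad_def pd_component[OF smooth_differentiable[OF sm]])
  \<comment> \<open>Two of the three factors are enlarged to \<open>S\<close>; one is kept, so that
    the sum over i is again at most \<open>S\<close> and not a multiple of it.\<close>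
  have prod_le: "(\<Prod>j\<in>UNIV. n i j) \<le> S\<^sup>2 * n i 1" for i
  proof -
    have le: "n i j \<le> S" for j
    proof -
      have "n i j \<le> (\<Sum>j\<in>UNIV. n i j)" by (intro member_le_sum) (auto simp: n0)
      also have "\<dots> \<le> S" unfolding S by (intro member_le_sum[of i UNIV "\<lambda>i. \<Sum>j\<in>UNIV. n i j"]) (auto intro: sum_nonneg n0)
      finally show ?thesis .
    qed
    have "(\<Prod>j\<in>UNIV. n i j) = n i 1 * (n i 2 * n i 3)" by (rule prod_UNIV_3)
    also have "\<dots> \<le> n i 1 * (S * S)"
      using n0 le order_trans[OF n0 le] by (intro mult_left_mono mult_mono) auto
    finally show ?thesis by (simp add: power2_eq_square mult.commute)
  qed
  have sum1: "(\<Sum>i\<in>UNIV. n i 1) \<le> S"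
    unfolding S by (intro sum_mono member_le_sum) (auto simp: n0)
  \<comment> \<open>The squared norm is at most three times the largest squared component; cubing
    gives 27.\<close>
  have pw: "(norm v)^6 \<le> 27 * (\<Sum>i\<in>UNIV. (v $ i)^6)" for v :: R3
  proof -
    define m where "m = Max (range (\<lambda>i. (v $ i)\<^sup>2))"
    have m: "(v $ i)\<^sup>2 \<le> m" for i unfolding m_def by (intro Max_ge) auto
    have "m \<in> range (\<lambda>i. (v $ i)\<^sup>2)" unfolding m_def by (intro Max_in) auto
    then obtain k where k: "m = (v $ k)\<^sup>2" by auto
    have "(norm v)\<^sup>2 = (\<Sum>i\<in>UNIV. (v $ i)\<^sup>2)" by (rule norm_R3_sq)
    also have "\<dots> \<le> (\<Sum>i\<in>(UNIV :: 3 set). m)" by (intro sum_mono m)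
    finally have "((norm v)\<^sup>2)^3 \<le> (3 * m)^3" by (intro power_mono) auto
    then have "(norm v)^6 \<le> 27 * m^3" by (simp add: power_mult_distrib flip: power_mult)
    also have "m^3 = (v $ k)^6" by (simp add: k flip: power_mult)
    also have "(v $ k)^6 \<le> (\<Sum>i\<in>UNIV. (v $ i)^6)" by (intro member_le_sum) auto
    finally show ?thesis by simp
  qed
  have "(\<integral>x. 27 * (\<Sum>i\<in>UNIV. (\<phi> x $ i)^6) \<partial>lborel) = 27 * (\<Sum>i\<in>UNIV. \<integral>x. (\<phi> x $ i)^6 \<partial>lborel)"
    using int6 by simp
  also have "\<dots> \<le> 27 * (\<Sum>i\<in>UNIV. 4096 * (S\<^sup>2 * n i 1))"
  proof (intro mult_left_mono sum_mono)
    show "(\<integral>x. (\<phi> x $ i)^6 \<partial>lborel) \<le> 4096 * (S\<^sup>2 * n i 1)" for i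
      using i6[of i] prod_le[of i] by linarith
  qed simp
  also have "\<dots> = 110592 * (S\<^sup>2 * (\<Sum>i\<in>UNIV. n i 1))" by (simp add: sum_distrib_left)
  also have "\<dots> \<le> 110592 * (S\<^sup>2 * S)" by (intro mult_left_mono sum1) auto
  \<comment> \<open>27 * 4096 = 110592, and 7^6 = 117649 is the next sixth power of an
    integer.\<close>
  also have "\<dots> \<le> 117649 * (S\<^sup>2 * S)" by (intro mult_right_mono) (auto simp: S_def)
  also have "\<dots> = (7 * L2_norm (grad \<phi>))^6"
    by (simp add: S_def power_mult_distrib flip: power_mult power_add)
  finally have le: "(\<integral>x. 27 * (\<Sum>i\<in>UNIV. (\<phi> x $ i)^6) \<partial>lborel) \<le> (7 * L2_norm (grad \<phi>))^6" .
  have "Lp_int 6 \<phi> \<le> (\<integral>\<^sup>+x. ennreal (27 * (\<Sum>i\<in>UNIV. (\<phi> x $ i)^6)) \<partial>lborel)"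
    unfolding Lp_int_6 by (intro nn_integral_mono ennreal_leI pw)
  also have "\<dots> = ennreal (\<integral>x. 27 * (\<Sum>i\<in>UNIV. (\<phi> x $ i)^6) \<partial>lborel)"
    using int6 by (intro nn_integral_eq_integral) (auto intro!: sum_nonneg)
  also have "\<dots> \<le> ennreal ((7 * L2_norm (grad \<phi>))^6)" by (intro ennreal_leI le)
  finally show ?thesis .
qed

lemma borel_measurable_component [measurable (raw)]:
  fixes f :: "'a \<Rightarrow> ('b::euclidean_space)^'n"
  shows "f \<in> borel_measurable M \<Longrightarrow> (\<lambda>x. f x $ i) \<in> borel_measurable M"
  by (rule borel_measurable_continuous_on[OF continuous_on_component[OF continuous_on_id]])

section \<open>The space L^6 and products with exponents 2, 3 and 6\<close>

definition L6 :: "(R3 \<Rightarrow> 'b::real_normed_vector) set" where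
  "L6 = {u. u \<in> borel_measurable lborel \<and> Lp_int 6 u < \<infinity>}"

definition L6_norm :: "(R3 \<Rightarrow> 'b::real_normed_vector) \<Rightarrow> real" where
  "L6_norm u = root 6 (enn2real (Lp_int 6 u))"

lemma L6_measurable: "u \<in> L6 \<Longrightarrow> u \<in> borel_measurable borel"
  by (simp add: L6_def)

lemma L6_norm_nonneg [simp]: "L6_norm u \<ge> 0"
  by (simp add: L6_norm_def)

lemma Lp_int_6_eq: "u \<in> L6 \<Longrightarrow> Lp_int 6 u = ennreal (L6_norm u ^ 6)"
  by (simp add: L6_def L6_norm_def)

lemma L6_norm_le_iff:
  assumes "u \<in> borel_measurable lborel" "c \<ge> 0"
  shows "Lp_int 6 u \<le> ennreal (c ^ 6) \<longleftrightarrow> u \<in> L6 \<and> L6_norm u \<le> c"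
proof
  assume *: "Lp_int 6 u \<le> ennreal (c ^ 6)"
  then have "Lp_int 6 u < \<infinity>" by (metis ennreal_less_top infinity_ennreal_def order_le_less_trans)
  then have u: "u \<in> L6" using assms by (auto simp: L6_def)
  with * assms(2) have "L6_norm u ^ 6 \<le> c ^ 6" by (simp add: Lp_int_6_eq)
  then show "u \<in> L6 \<and> L6_norm u \<le> c" using u assms by (simp add: power_mono_iff)
next
  assume "u \<in> L6 \<and> L6_norm u \<le> c"
  then show "Lp_int 6 u \<le> ennreal (c ^ 6)"
    by (auto simp: Lp_int_6_eq intro!: ennreal_leI power_mono)
qed

text \<open>A quasi-triangle inequality with factor 2, obtained from (a + b)^6 \<le> 64 (a^6 + b^6)
  pointwise. It replaces Minkowski's inequality and affects only numerical constants.\<close>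

lemma L6_add:
  fixes u :: "R3 \<Rightarrow> 'b::euclidean_space"
  assumes "u \<in> L6" "v \<in> L6"
  shows "(\<lambda>x. u x + v x) \<in> L6 \<and> L6_norm (\<lambda>x. u x + v x) \<le> 2 * (L6_norm u + L6_norm v)"
proof (subst L6_norm_le_iff[symmetric])
  note [measurable] = assms[THEN L6_measurable]
  have *: "(a + b)^6 \<le> 64 * (a^6 + b^6)" if "a \<ge> 0" "b \<ge> 0" for a b :: real
  proof -
    have "(a + b)^6 \<le> (2 * max a b)^6" using that by (intro power_mono) auto
    also have "\<dots> = 64 * (max a b)^6" by (simp add: power_mult_distrib)
    also have "(max a b)^6 \<le> a^6 + b^6" by (auto simp: max_def)
    finally show ?thesis by simp
  qed
  have n: "(norm (a + b))^6 \<le> 64 * ((norm a)^6 + (norm b)^6)" for a b :: 'b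
    by (rule order_trans[OF power_mono[OF norm_triangle_ineq] *]) auto
  have "Lp_int 6 (\<lambda>x. u x + v x) \<le> (\<integral>\<^sup>+x. 64 * (ennreal ((norm (u x))^6) + ennreal ((norm (v x))^6)) \<partial>lborel)"
    unfolding Lp_int_6
  proof (intro nn_integral_mono)
    fix x
    have "ennreal ((norm (u x + v x))^6) \<le> ennreal (64 * ((norm (u x))^6 + (norm (v x))^6))" by (intro ennreal_leI n)
    then show "ennreal ((norm (u x + v x))^6) \<le> 64 * (ennreal ((norm (u x))^6) + ennreal ((norm (v x))^6))"
      by (simp add: ennreal_mult ennreal_plus)
  qed
  also have "\<dots> = 64 * (Lp_int 6 u + Lp_int 6 v)"
    unfolding Lp_int_6 by (subst nn_integral_cmult, measurable, subst nn_integral_add) auto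
  also have "\<dots> = ennreal (64 * (L6_norm u ^ 6 + L6_norm v ^ 6))"
    by (simp add: Lp_int_6_eq assms ennreal_mult ennreal_plus)
  also have "\<dots> \<le> ennreal ((2 * (L6_norm u + L6_norm v)) ^ 6)"
  proof (rule ennreal_leI)
    have "a^6 + b^6 \<le> (a + b)^6" if "a \<ge> 0" "b \<ge> 0" for a b :: real
    proof -
      have "a^6 + b^6 = a^5 * a + b^5 * b" by (simp add: eval_nat_numeral mult_ac)
      also have "\<dots> \<le> (a+b)^5 * a + (a+b)^5 * b"
        using that by (intro add_mono mult_right_mono power_mono) auto
      also have "\<dots> = (a + b)^6" by (simp add: eval_nat_numeral algebra_simps)
      finally show ?thesis .
    qed
    from this[of "L6_norm u" "L6_norm v"]
    show "64 * (L6_norm u ^ 6 + L6_norm v ^ 6) \<le> (2 * (L6_norm u + L6_norm v)) ^ 6"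
      unfolding power_mult_distrib by simp
  qed
  finally show "Lp_int 6 (\<lambda>x. u x + v x) \<le> ennreal ((2 * (L6_norm u + L6_norm v)) ^ 6)" .
qed (use L6_measurable[OF assms(1)] L6_measurable[OF assms(2)] in auto)

lemma L6_scale:
  fixes u :: "R3 \<Rightarrow> 'b::euclidean_space"
  assumes "u \<in> L6"
  shows "(\<lambda>x. c *\<^sub>R u x) \<in> L6 \<and> L6_norm (\<lambda>x. c *\<^sub>R u x) \<le> \<bar>c\<bar> * L6_norm u"
proof (subst L6_norm_le_iff[symmetric])
  note [measurable] = assms[THEN L6_measurable]
  have "Lp_int 6 (\<lambda>x. c *\<^sub>R u x) = (\<integral>\<^sup>+x. ennreal (\<bar>c\<bar>^6) * ennreal ((norm (u x))^6) \<partial>lborel)"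
    unfolding Lp_int_6 by (simp add: power_mult_distrib ennreal_mult)
  also have "\<dots> = ennreal (\<bar>c\<bar>^6) * Lp_int 6 u" unfolding Lp_int_6 by (intro nn_integral_cmult) measurable
  also have "\<dots> = ennreal ((\<bar>c\<bar> * L6_norm u)^6)" by (simp add: Lp_int_6_eq assms power_mult_distrib ennreal_mult)
  finally show "Lp_int 6 (\<lambda>x. c *\<^sub>R u x) \<le> ennreal ((\<bar>c\<bar> * L6_norm u)^6)" by simp
qed (use L6_measurable[OF assms(1)] in auto)

lemma L6_diff:
  fixes u :: "R3 \<Rightarrow> 'b::euclidean_space"
  assumes "u \<in> L6" "v \<in> L6"
  shows "(\<lambda>x. u x - v x) \<in> L6"
  using L6_add[OF assms(1) conjunct1[OF L6_scale[OF assms(2), of "-1"]]] by simp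

lemma L6_tendsto_iff:
  assumes "\<And>n. (\<lambda>x. u n x - v x) \<in> L6"
  shows "(\<lambda>n. Lp_int 6 (\<lambda>x. u n x - v x)) \<longlonglongrightarrow> 0 \<longleftrightarrow> (\<lambda>n. L6_norm (\<lambda>x. u n x - v x)) \<longlonglongrightarrow> 0"
proof -
  have "(\<lambda>n. Lp_int 6 (\<lambda>x. u n x - v x)) = (\<lambda>n. ennreal ((L6_norm (\<lambda>x. u n x - v x))^6))"
    by (intro ext Lp_int_6_eq assms)
  moreover have "(\<lambda>n. ennreal ((L6_norm (\<lambda>x. u n x - v x))^6)) \<longlonglongrightarrow> 0 \<longleftrightarrow> (\<lambda>n. (L6_norm (\<lambda>x. u n x - v x))^6) \<longlonglongrightarrow> 0"
    by (subst ennreal_0[symmetric], subst tendsto_ennreal_iff) auto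
  ultimately show ?thesis by (simp)
qed

lemma Vsp_L6: "\<phi> \<in> Vsp \<Longrightarrow> \<phi> \<in> L6"
  using Lp_int_continuous_compact_supp[of \<phi> 6] Vsp_measurable[of \<phi>] VspD[of \<phi>]
  by (auto simp: L6_def smooth_continuous)

text \<open>Cauchy-Schwarz for |b| times |b| |c|^2 leaves the integral of |b|^2 |c|^4. This is
  Hoelder's inequality with exponents 3 and 3/2 for the functions |b|^2 and |c|^4, proved by
  normalizing both norms and applying Young's inequality.\<close>

lemma L2_L6_mult:
  fixes b :: "R3 \<Rightarrow> 'b::euclidean_space" and c :: "R3 \<Rightarrow> 'c::euclidean_space"
  assumes b: "b \<in> L2" "b \<in> L6" and c: "c \<in> L6"
  shows "(\<lambda>x. norm (b x) * norm (c x)) \<in> L2 \<and>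
    L2_norm (\<lambda>x. norm (b x) * norm (c x)) \<le> sqrt (L2_norm b * L6_norm b) * L6_norm c"
proof (subst L2_norm_le_iff[symmetric])
  note [measurable] = L2_measurable[OF b(1)] L6_measurable[OF c]
  let ?B = "L6_norm b" and ?C = "L6_norm c"
  have 1: "(\<integral>\<^sup>+x. ennreal ((norm (b x) * (norm (c x))\<^sup>2)\<^sup>2) \<partial>lborel) \<le> ennreal ((?B * ?C\<^sup>2)\<^sup>2)"
  \<comment> \<open>The normalization divides by both norms. If one of them is zero, that function
    vanishes almost everywhere and so does the integrand.\<close>
  proof (cases "?B = 0 \<or> ?C = 0")
    case True
    then have "AE x in lborel. norm (b x) * (norm (c x))\<^sup>2 = 0"
    proof
      assume "?B = 0"
      then have "Lp_int 6 b = 0" using b by (simp add: Lp_int_6_eq)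
      then have "AE x in lborel. b x = 0" unfolding Lp_int_6 by (subst (asm) nn_integral_0_iff_AE) auto
      then show ?thesis by eventually_elim simp
    next
      assume "?C = 0"
      then have "Lp_int 6 c = 0" using c by (simp add: Lp_int_6_eq)
      then have "AE x in lborel. c x = 0" unfolding Lp_int_6 by (subst (asm) nn_integral_0_iff_AE) auto
      then show ?thesis by eventually_elim simp
    qed
    then have "(\<integral>\<^sup>+x. ennreal ((norm (b x) * (norm (c x))\<^sup>2)\<^sup>2) \<partial>lborel) = 0"
      by (subst nn_integral_0_iff_AE) auto
    then show ?thesis by simp
  next
    case False
    then have pos: "?B > 0" "?C > 0" using L6_norm_nonneg[of b] L6_norm_nonneg[of c] by linarith+
    \<comment> \<open>With \<open>p\<close> and \<open>q\<close> the normalized squares, p^3 and q^3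
      both have integral 1. Young's bound therefore integrates to 3, which the divisor
      compensates.\<close>
    define K where "K = (?B * ?C\<^sup>2)\<^sup>2 / 3"
    have K: "K \<ge> 0" by (simp add: K_def)
    have young: "(norm (b x) * (norm (c x))\<^sup>2)\<^sup>2 \<le> K / ?B^6 * (norm (b x))^6 + 2 * K / ?C^6 * (norm (c x))^6" for x
    proof -
      have y: "3 * (p * q\<^sup>2) \<le> p^3 + 2 * q^3" if "p \<ge> 0" "q \<ge> 0" for p q :: real
      proof -
        have "p^3 + 2 * q^3 - 3 * (p * q\<^sup>2) = (p - q)\<^sup>2 * (p + 2 * q)"
          by (simp add: power2_eq_square power3_eq_cube algebra_simps)
        then show ?thesis using that by (smt (verit) mult_nonneg_nonneg zero_le_power2)
      qed
      define p q where "p = (norm (b x) / ?B)\<^sup>2" and "q = (norm (c x) / ?C)\<^sup>2"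
      have "(norm (b x) * (norm (c x))\<^sup>2)\<^sup>2 = K * (3 * (p * q\<^sup>2))"
        using pos by (simp add: p_def q_def K_def field_simps power_mult_distrib power_divide flip: power_mult)
      also have "\<dots> \<le> K * (p^3 + 2 * q^3)" by (intro mult_left_mono y K) (auto simp: p_def q_def)
      also have "\<dots> = K / ?B^6 * (norm (b x))^6 + 2 * K / ?C^6 * (norm (c x))^6"
        by (simp add: p_def q_def power_divide algebra_simps flip: power_mult)
      finally show ?thesis .
    qed
    have "(\<integral>\<^sup>+x. ennreal ((norm (b x) * (norm (c x))\<^sup>2)\<^sup>2) \<partial>lborel)
      \<le> (\<integral>\<^sup>+x. ennreal (K / ?B^6) * ennreal ((norm (b x))^6) + ennreal (2 * K / ?C^6) * ennreal ((norm (c x))^6) \<partial>lborel)"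
    proof (intro nn_integral_mono)
      fix x
      have "ennreal ((norm (b x) * (norm (c x))\<^sup>2)\<^sup>2) \<le> ennreal (K / ?B^6 * (norm (b x))^6 + 2 * K / ?C^6 * (norm (c x))^6)"
        by (intro ennreal_leI young)
      also have "\<dots> = ennreal (K / ?B^6) * ennreal ((norm (b x))^6) + ennreal (2 * K / ?C^6) * ennreal ((norm (c x))^6)"
        using K by (subst ennreal_plus) (auto simp flip: ennreal_mult)
      finally show "ennreal ((norm (b x) * (norm (c x))\<^sup>2)\<^sup>2) \<le> ennreal (K / ?B^6) * ennreal ((norm (b x))^6) + ennreal (2 * K / ?C^6) * ennreal ((norm (c x))^6)" .
    qed
    also have "\<dots> = ennreal (K / ?B^6) * Lp_int 6 b + ennreal (2 * K / ?C^6) * Lp_int 6 c"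
      unfolding Lp_int_6 by (subst nn_integral_add, measurable, subst nn_integral_cmult, measurable, subst nn_integral_cmult, measurable)
    also have "\<dots> = ennreal (K / ?B^6 * ?B^6 + 2 * K / ?C^6 * ?C^6)"
      using K by (subst ennreal_plus) (auto simp: Lp_int_6_eq b c simp flip: ennreal_mult)
    also have "K / ?B^6 * ?B^6 + 2 * K / ?C^6 * ?C^6 = (?B * ?C\<^sup>2)\<^sup>2"
      using pos by (simp add: K_def)
    finally show ?thesis .
  qed
  have "(Lp_int 2 (\<lambda>x. norm (b x) * norm (c x)))\<^sup>2 = (\<integral>\<^sup>+x. ennreal (norm (b x)) * ennreal (norm (b x) * (norm (c x))\<^sup>2) \<partial>lborel)\<^sup>2"
    unfolding Lp_int_2 by (simp add: power_mult_distrib power2_eq_square mult_ac flip: ennreal_mult)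
  also have "\<dots> \<le> (\<integral>\<^sup>+x. (ennreal (norm (b x)))\<^sup>2 \<partial>lborel) * (\<integral>\<^sup>+x. (ennreal (norm (b x) * (norm (c x))\<^sup>2))\<^sup>2 \<partial>lborel)"
    by (rule Cauchy_Schwarz_nn_integral) measurable
  also have "\<dots> = Lp_int 2 b * (\<integral>\<^sup>+x. ennreal ((norm (b x) * (norm (c x))\<^sup>2)\<^sup>2) \<partial>lborel)"
    by (simp add: Lp_int_2 ennreal_power)
  also have "\<dots> \<le> ennreal ((L2_norm b)\<^sup>2) * ennreal ((?B * ?C\<^sup>2)\<^sup>2)"
    using 1 by (intro mult_mono) (auto simp: Lp_int_2_eq b)
  also have "\<dots> = (ennreal (L2_norm b * (?B * ?C\<^sup>2)))\<^sup>2"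
    by (simp add: ennreal_power power_mult_distrib flip: ennreal_mult)
  finally have "Lp_int 2 (\<lambda>x. norm (b x) * norm (c x)) \<le> ennreal (L2_norm b * (?B * ?C\<^sup>2))"
    by (rule ennreal_power2_le_imp_le)
  also have "L2_norm b * (?B * ?C\<^sup>2) = (sqrt (L2_norm b * ?B) * ?C)\<^sup>2"
    by (simp add: power_mult_distrib)
  finally show "Lp_int 2 (\<lambda>x. norm (b x) * norm (c x)) \<le> ennreal ((sqrt (L2_norm b * ?B) * ?C)\<^sup>2)" .
qed (use L2_measurable[OF b(1)] L6_measurable[OF c] in auto)

text \<open>An interpolation bound for the $L^3$ norm. Working with it directly, only integer exponents occur, and
  Young's inequality \<open>3 x y\<^sup>2 \<le> x\<^sup>3 + 2 y\<^sup>3\<close> takes the place of Hoelder's.\<close>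

definition L3_bound :: "(R3 \<Rightarrow> 'b::real_normed_vector) \<Rightarrow> real" where
  "L3_bound b = sqrt (L2_norm b * L6_norm b)"

lemma L3_bound_nonneg [simp]: "L3_bound b \<ge> 0" by (simp add: L3_bound_def)

text \<open>Hoelder's inequality with exponents 2, 3, 6 for any integrand dominated by the product.
  The three functions may have values in different spaces, because matrices and vectors exchange
  their roles in the estimates of the convective term.\<close>

lemma triple_bound:
  fixes a :: "R3 \<Rightarrow> 'a::euclidean_space" and b :: "R3 \<Rightarrow> 'b::euclidean_space" and c :: "R3 \<Rightarrow> 'c::euclidean_space"
  assumes "a \<in> L2" "b \<in> L2" "b \<in> L6" "c \<in> L6" "f \<in> borel_measurable borel"
    "\<And>x. \<bar>f x\<bar> \<le> norm (a x) * norm (b x) * norm (c x)"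
  shows "integrable lborel f \<and> \<bar>\<integral>x. f x \<partial>lborel\<bar> \<le> L2_norm a * L3_bound b * L6_norm c"
proof -
  note m = L2_L6_mult[OF assms(2-4)]
  have i: "integrable lborel (\<lambda>x. norm (a x) * (norm (b x) * norm (c x)))"
    using L2_inner_norm_integrable[OF assms(1) conjunct1[OF m]] by simp
  have fi: "integrable lborel f"
    by (rule Bochner_Integration.integrable_bound[OF i]) (use assms(5,6) in \<open>auto simp: mult.assoc\<close>)
  have "\<bar>\<integral>x. f x \<partial>lborel\<bar> \<le> (\<integral>x. \<bar>f x\<bar> \<partial>lborel)" by (rule integral_abs_bound)
  also have "\<dots> \<le> (\<integral>x. norm (a x) * (norm (b x) * norm (c x)) \<partial>lborel)"
    using assms(6) by (intro integral_mono i integrable_abs fi) (auto simp: mult.assoc)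
  also have "\<dots> \<le> L2_norm a * L2_norm (\<lambda>x. norm (b x) * norm (c x))"
    using L2_inner_norm_bound[OF assms(1) conjunct1[OF m]] by simp
  also have "\<dots> \<le> L2_norm a * (L3_bound b * L6_norm c)"
    using m by (intro mult_left_mono) (auto simp: L3_bound_def)
  finally show ?thesis using fi by (simp add: mult.assoc)
qed

text \<open>If \<open>G\<close> is the gradient of \<open>u\<close>, then \<open>G x *v W x\<close> is the derivative of \<open>u\<close> along \<open>W\<close>.\<close>

definition convection :: "(R3 \<Rightarrow> R3) \<Rightarrow> (R3 \<Rightarrow> real^3^3) \<Rightarrow> (R3 \<Rightarrow> R3) \<Rightarrow> real" where
  "convection W G v = (\<integral>x. (G x *v W x) \<bullet> v x \<partial>lborel)"

lemma convection_integrand_bound: "\<bar>(A *v w) \<bullet> (v::R3)\<bar> \<le> norm (A::real^3^3) * norm w * norm v"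
  using Cauchy_Schwarz_ineq2[of "A *v w" v] mult_right_mono[OF norm_matrix_vector_mult_le[of A w], of "norm v"] by simp

text \<open>One of three placements of the exponents. Here the gradient is in L^2 and the
  transporting field takes the exponent 3. The variant with the gradient in L^6 serves the dual
  problem; the one with the transporting field in L^6 serves uniqueness, where that field is the
  difference of two solutions and smallness sits in \<open>v\<close>.\<close>

lemma convection_bound:
  assumes "W \<in> L2" "W \<in> L6" "G \<in> L2" "v \<in> L6"
  shows "integrable lborel (\<lambda>x. (G x *v W x) \<bullet> v x)" "\<bar>convection W G v\<bar> \<le> L2_norm G * L3_bound W * L6_norm v"
  using triple_bound[of G W v "\<lambda>x. (G x *v W x) \<bullet> v x"] assms convection_integrand_bound
    L2_measurable[OF assms(1)] L2_measurable[OF assms(3)] L6_measurable[OF assms(4)] unfolding convection_def by auto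

lemma convection_bound':
  assumes "W \<in> L2" "W \<in> L6" "G \<in> L6" "v \<in> L2"
  shows "integrable lborel (\<lambda>x. (G x *v W x) \<bullet> v x)" "\<bar>convection W G v\<bar> \<le> L2_norm v * L3_bound W * L6_norm G"
  using triple_bound[of v W G "\<lambda>x. (G x *v W x) \<bullet> v x"] assms convection_integrand_bound
    L2_measurable[OF assms(1)] L6_measurable[OF assms(3)] L2_measurable[OF assms(4)] unfolding convection_def
  by (auto simp: mult_ac)

lemma convection_bound'':
  assumes "W \<in> L6" "G \<in> L2" "v \<in> L2" "v \<in> L6"
  shows "integrable lborel (\<lambda>x. (G x *v W x) \<bullet> v x)" "\<bar>convection W G v\<bar> \<le> L2_norm G * L3_bound v * L6_norm W"
  using triple_bound[of G v W "\<lambda>x. (G x *v W x) \<bullet> v x"] assms convection_integrand_bound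
    L6_measurable[OF assms(1)] L2_measurable[OF assms(2)] L6_measurable[OF assms(4)] unfolding convection_def
  by (auto simp: mult_ac)

lemma convection_diff_G:
  assumes "W \<in> L2" "W \<in> L6" "G \<in> L2" "H \<in> L2" "v \<in> L6"
  shows "convection W (\<lambda>x. G x - H x) v = convection W G v - convection W H v"
  unfolding convection_def using convection_bound(1)[OF assms(1,2,3,5)] convection_bound(1)[OF assms(1,2,4,5)]
  by (simp add: matrix_vector_mult_diff_rdistrib inner_diff_left)

lemma convection_diff_v:
  assumes "W \<in> L2" "W \<in> L6" "G \<in> L2" "v \<in> L6" "w \<in> L6"
  shows "convection W G (\<lambda>x. v x - w x) = convection W G v - convection W G w"
  unfolding convection_def using convection_bound(1)[OF assms(1,2,3,4)] convection_bound(1)[OF assms(1,2,3,5)]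
  by (simp add: inner_diff_right)

lemma convection_diff_W:
  assumes "W \<in> L2" "W \<in> L6" "V \<in> L2" "V \<in> L6" "G \<in> L2" "v \<in> L6"
  shows "convection (\<lambda>x. W x - V x) G v = convection W G v - convection V G v"
  unfolding convection_def using convection_bound(1)[OF assms(1,2,5,6)] convection_bound(1)[OF assms(3,4,5,6)]
  by (simp add: matrix_vector_mult_diff_distrib inner_diff_left)

lemma convection_add_scaleR_v:
  assumes "W \<in> L2" "W \<in> L6" "G \<in> L2" "v \<in> L6" "w \<in> L6"
  shows "convection W G (\<lambda>x. v x + c *\<^sub>R w x) = convection W G v + c * convection W G w"
  unfolding convection_def using convection_bound(1)[OF assms(1,2,3,4)] convection_bound(1)[OF assms(1,2,3,5)]
  by (simp add: inner_add_right)

lemma convection_tendsto: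
  assumes W: "W \<in> L2" "W \<in> L6" and G: "\<And>n. Gn n \<in> L2" "G \<in> L2" "(\<lambda>n. L2_norm (\<lambda>x. Gn n x - G x)) \<longlonglongrightarrow> 0"
    and v: "\<And>n. vn n \<in> L6" "v \<in> L6" "(\<lambda>n. L6_norm (\<lambda>x. vn n x - v x)) \<longlonglongrightarrow> 0"
  shows "(\<lambda>n. convection W (Gn n) (vn n)) \<longlonglongrightarrow> convection W G v"
proof (rule LIM_zero_cancel, rule tendsto_rabs_zero_cancel, rule tendsto_sandwich[OF _ _ tendsto_const])
  let ?d = "\<lambda>n. L2_norm (\<lambda>x. Gn n x - G x)" and ?e = "\<lambda>n. L6_norm (\<lambda>x. vn n x - v x)"
  have "(\<lambda>n. ?d n * L3_bound W * (2 * (?e n + L6_norm v)) + L2_norm G * L3_bound W * ?e n) \<longlonglongrightarrow>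
    0 * L3_bound W * (2 * (0 + L6_norm v)) + L2_norm G * L3_bound W * 0"
    by (intro tendsto_intros G v)
  then show "(\<lambda>n. ?d n * L3_bound W * (2 * (?e n + L6_norm v)) + L2_norm G * L3_bound W * ?e n) \<longlonglongrightarrow> 0" by simp
  show "\<forall>\<^sub>F n in sequentially. \<bar>convection W (Gn n) (vn n) - convection W G v\<bar> \<le> ?d n * L3_bound W * (2 * (?e n + L6_norm v)) + L2_norm G * L3_bound W * ?e n"
  proof (rule always_eventually, rule allI)
    fix n
    have "convection W (Gn n) (vn n) - convection W G v = convection W (\<lambda>x. Gn n x - G x) (vn n) + convection W G (\<lambda>x. vn n x - v x)"
      by (simp add: convection_diff_G[OF W G(1,2) v(1)] convection_diff_v[OF W G(2) v(1,2)])
    moreover have "L6_norm (vn n) \<le> 2 * (?e n + L6_norm v)"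
      using L6_add[OF L6_diff[OF v(1,2)] v(2), of n] by simp
    then have "?d n * L3_bound W * L6_norm (vn n) \<le> ?d n * L3_bound W * (2 * (?e n + L6_norm v))"
      by (intro mult_left_mono) auto
    ultimately show "\<bar>convection W (Gn n) (vn n) - convection W G v\<bar> \<le> ?d n * L3_bound W * (2 * (?e n + L6_norm v)) + L2_norm G * L3_bound W * ?e n"
      using convection_bound(2)[OF W L2_diff[OF G(1,2)] v(1), of n n] convection_bound(2)[OF W G(2) L6_diff[OF v(1,2)], of n] by linarith
  qed
qed auto

section \<open>The Sobolev inequality for limits of test fields\<close>

lemma Lp_int_Fatou_tendsto:
  fixes u :: "nat \<Rightarrow> R3 \<Rightarrow> 'b::euclidean_space"
  assumes "\<And>n. u n \<in> borel_measurable lborel" "AE x in lborel. (\<lambda>n. u n x) \<longlonglongrightarrow> v x"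
    "\<And>n. Lp_int p (u n) \<le> c n" "c \<longlonglongrightarrow> C" "p > 0"
  shows "Lp_int p v \<le> C"
proof (rule dense_ge)
  fix D assume "C < D"
  then have "\<forall>\<^sub>F n in sequentially. c n < D" by (rule order_tendstoD(2)[OF assms(4)])
  then obtain N where N: "\<And>n. n \<ge> N \<Longrightarrow> c n < D" by (auto simp: eventually_sequentially)
  show "Lp_int p v \<le> D"
  proof (rule Lp_int_Fatou[where u="\<lambda>n. u (n + N)"])
    show "AE x in lborel. (\<lambda>n. u (n + N) x) \<longlonglongrightarrow> v x"
      using assms(2) by eventually_elim (rule LIMSEQ_ignore_initial_segment)
    show "Lp_int p (u (n + N)) \<le> D" for n using assms(3)[of "n + N"] N[of "n + N"] by simp
  qed (use assms in auto)
qed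

text \<open>The analogue of \<open>H1_approx\<close> with L^6 in place of L^2. This is the sense in
  which elements of \<open>Hdot1sig\<close> are approximated, and a competitor in the uniqueness
  statement has no better approximation at hand.\<close>

definition Hdot1_approx :: "(R3 \<Rightarrow> R3) \<Rightarrow> (R3 \<Rightarrow> real^3^3) \<Rightarrow> (nat \<Rightarrow> R3 \<Rightarrow> R3) \<Rightarrow> bool" where
  "Hdot1_approx u G \<phi> \<longleftrightarrow> u \<in> L6 \<and> G \<in> L2 \<and> (\<forall>n. \<phi> n \<in> Vsp) \<and>
     (\<lambda>n. L6_norm (\<lambda>x. \<phi> n x - u x)) \<longlonglongrightarrow> 0 \<and> (\<lambda>n. L2_norm (\<lambda>x. grad (\<phi> n) x - G x)) \<longlonglongrightarrow> 0"

lemma Hdot1_approxD: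
  assumes "Hdot1_approx u G \<phi>"
  shows "u \<in> L6" "G \<in> L2" "\<And>n. \<phi> n \<in> Vsp" "\<And>n. \<phi> n \<in> L6" "\<And>n. grad (\<phi> n) \<in> L2"
    "(\<lambda>n. L6_norm (\<lambda>x. \<phi> n x - u x)) \<longlonglongrightarrow> 0" "(\<lambda>n. L2_norm (\<lambda>x. grad (\<phi> n) x - G x)) \<longlonglongrightarrow> 0"
  using assms by (auto simp: Hdot1_approx_def Vsp_L6 Vsp_grad_L2)

text \<open>The inequality for test fields passes to an almost everywhere limit by Fatou's lemma,
  since the gradient norms converge.\<close>

lemma Sobolev_AE_limit:
  assumes "\<And>n. \<phi> n \<in> Vsp" "AE x in lborel. (\<lambda>n. \<phi> n x) \<longlonglongrightarrow> u x" "u \<in> borel_measurable borel"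
    "G \<in> L2" "(\<lambda>n. L2_norm (\<lambda>x. grad (\<phi> n) x - G x)) \<longlonglongrightarrow> 0"
  shows "u \<in> L6 \<and> L6_norm u \<le> 7 * L2_norm G"
proof (subst L6_norm_le_iff[symmetric])
  show "Lp_int 6 u \<le> ennreal ((7 * L2_norm G)^6)"
  proof (rule Lp_int_Fatou_tendsto[OF _ assms(2)])
    show "(\<lambda>n. ennreal ((7 * L2_norm (grad (\<phi> n)))^6)) \<longlonglongrightarrow> ennreal ((7 * L2_norm G)^6)"
      by (intro tendsto_ennrealI tendsto_power tendsto_mult tendsto_const L2_norm_tendsto assms Vsp_grad_L2)
    show "Lp_int 6 (\<phi> n) \<le> ennreal ((7 * L2_norm (grad (\<phi> n)))^6)" for n by (rule Sobolev_Vsp[OF assms(1)])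
  qed (use Vsp_measurable[OF assms(1)] in auto)
qed (use assms(3) in auto)

text \<open>Convergence in L^6 follows from the Sobolev inequality for \<phi> n - \<phi> (r k): as k
  grows along an almost everywhere convergent subsequence, this difference tends to \<phi> n - u,
  and its gradient norm tends to the distance of the gradients.\<close>

lemma H1_approx_imp_Hdot1_approx:
  assumes "H1_approx u G \<phi>" shows "Hdot1_approx u G \<phi>" "L6_norm u \<le> 7 * L2_norm G"
proof -
  note p = H1_approxD[OF assms]
  have um: "u \<in> borel_measurable borel" by (rule L2_measurable[OF p(1)])
  obtain r where r: "strict_mono r" "AE x in lborel. (\<lambda>n. \<phi> (r n) x) \<longlonglongrightarrow> u x"
    using Lp_int_AE_subseq[of \<phi> u 2] p(6) um Vsp_measurable[OF p(3)] L2_tendsto_iff[OF p(4,1)] by auto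
  have gr: "(\<lambda>n. L2_norm (\<lambda>x. grad (\<phi> (r n)) x - G x)) \<longlonglongrightarrow> 0"
    using LIMSEQ_subseq_LIMSEQ[OF p(7) r(1)] by (simp add: o_def)
  have u: "u \<in> L6 \<and> L6_norm u \<le> 7 * L2_norm G"
    by (rule Sobolev_AE_limit[of "\<lambda>n. \<phi> (r n)"]) (use p r um gr in auto)
  have d: "L6_norm (\<lambda>x. \<phi> n x - u x) \<le> 7 * L2_norm (\<lambda>x. grad (\<phi> n) x - G x)" for n
  proof -
    have g: "grad (\<lambda>x. \<phi> n x - \<phi> (r k) x) = (\<lambda>x. grad (\<phi> n) x - grad (\<phi> (r k)) x)" for k
      by (intro grad_diff VspD p)
    have "(\<lambda>k. L2_norm (\<lambda>x. (grad (\<phi> n) x + (-1) *\<^sub>R grad (\<phi> (r k)) x) - (grad (\<phi> n) x + (-1) *\<^sub>R G x))) \<longlonglongrightarrow> 0"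
      by (rule L2_norm_sum_tendsto) (use p gr in auto)
    then have "(\<lambda>x. \<phi> n x - u x) \<in> L6 \<and> L6_norm (\<lambda>x. \<phi> n x - u x) \<le> 7 * L2_norm (\<lambda>x. grad (\<phi> n) x - G x)"
    proof (intro Sobolev_AE_limit[of "\<lambda>k x. \<phi> n x - \<phi> (r k) x"])
      show "AE x in lborel. (\<lambda>k. \<phi> n x - \<phi> (r k) x) \<longlonglongrightarrow> \<phi> n x - u x"
        using r(2) by eventually_elim (intro tendsto_intros)
    qed (use um Vsp_measurable[OF p(3)] in \<open>auto simp: g intro!: Vsp_diff L2_diff p\<close>)
    then show ?thesis by simp
  qed
  have "(\<lambda>n. 7 * L2_norm (\<lambda>x. grad (\<phi> n) x - G x)) \<longlonglongrightarrow> 0"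
    using tendsto_mult[OF tendsto_const p(7), of 7] by simp
  then have "(\<lambda>n. L6_norm (\<lambda>x. \<phi> n x - u x)) \<longlonglongrightarrow> 0"
    by (rule tendsto_sandwich[OF _ _ tendsto_const, rotated 2]) (auto intro!: always_eventually d)
  then show "Hdot1_approx u G \<phi>" "L6_norm u \<le> 7 * L2_norm G" using u p by (auto simp: Hdot1_approx_def)
qed

lemma H1_L6: "H1 u G \<Longrightarrow> u \<in> L6" "H1 u G \<Longrightarrow> L6_norm u \<le> 7 * L2_norm G"
  unfolding H1_def using H1_approx_imp_Hdot1_approx Hdot1_approxD(1) by blast+

lemma Hdot1_approx_Sobolev:
  assumes "Hdot1_approx u G \<phi>" shows "L6_norm u \<le> 7 * L2_norm G"
proof -
  note p = Hdot1_approxD[OF assms]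
  obtain r where r: "strict_mono r" "AE x in lborel. (\<lambda>n. \<phi> (r n) x) \<longlonglongrightarrow> u x"
    using Lp_int_AE_subseq[of \<phi> u 6] p(6) L6_measurable[OF p(1)] Vsp_measurable[OF p(3)] L6_tendsto_iff[OF L6_diff[OF p(4,1)]] by auto
  have "(\<lambda>n. L2_norm (\<lambda>x. grad (\<phi> (r n)) x - G x)) \<longlonglongrightarrow> 0"
    using LIMSEQ_subseq_LIMSEQ[OF p(7) r(1)] by (simp add: o_def)
  then show ?thesis
    using Sobolev_AE_limit[of "\<lambda>n. \<phi> (r n)" u G] p r L6_measurable[OF p(1)] by auto
qed

lemma Hdot1_approx_diff:
  assumes "Hdot1_approx u G \<phi>" "Hdot1_approx v H \<psi>"
  shows "Hdot1_approx (\<lambda>x. u x - v x) (\<lambda>x. G x - H x) (\<lambda>n x. \<phi> n x - \<psi> n x)"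
proof -
  note u = Hdot1_approxD[OF assms(1)] and v = Hdot1_approxD[OF assms(2)]
  have g: "grad (\<lambda>x. \<phi> n x - \<psi> n x) = (\<lambda>x. grad (\<phi> n) x - grad (\<psi> n) x)" for n
    by (intro grad_diff VspD u v)
  have 2: "(\<lambda>n. L2_norm (\<lambda>x. (grad (\<phi> n) x - grad (\<psi> n) x) - (G x - H x))) \<longlonglongrightarrow> 0"
    using L2_norm_sum_tendsto[OF u(5,2) v(5,2) u(7) v(7), of "-1"] by simp
  have 6: "(\<lambda>n. L6_norm (\<lambda>x. (\<phi> n x - \<psi> n x) - (u x - v x))) \<longlonglongrightarrow> 0"
  proof (rule tendsto_sandwich[OF _ _ tendsto_const])
    have "(\<lambda>n. 2 * (L6_norm (\<lambda>x. \<phi> n x - u x) + L6_norm (\<lambda>x. \<psi> n x - v x))) \<longlonglongrightarrow> 2 * (0 + 0)"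
      by (intro tendsto_intros u v)
    then show "(\<lambda>n. 2 * (L6_norm (\<lambda>x. \<phi> n x - u x) + L6_norm (\<lambda>x. \<psi> n x - v x))) \<longlonglongrightarrow> 0" by simp
    show "\<forall>\<^sub>F n in sequentially. L6_norm (\<lambda>x. (\<phi> n x - \<psi> n x) - (u x - v x))
      \<le> 2 * (L6_norm (\<lambda>x. \<phi> n x - u x) + L6_norm (\<lambda>x. \<psi> n x - v x))"
    proof (intro always_eventually allI)
      fix n
      have "(\<lambda>x. (\<phi> n x - \<psi> n x) - (u x - v x)) = (\<lambda>x. (\<phi> n x - u x) + (-1) *\<^sub>R (\<psi> n x - v x))" by (simp add: algebra_simps)
      then show "L6_norm (\<lambda>x. (\<phi> n x - \<psi> n x) - (u x - v x))
        \<le> 2 * (L6_norm (\<lambda>x. \<phi> n x - u x) + L6_norm (\<lambda>x. \<psi> n x - v x))"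
        using L6_add[OF L6_diff[OF u(4,1)] conjunct1[OF L6_scale[OF L6_diff[OF v(4,1)]]], of n "-1" n]
          L6_scale[OF L6_diff[OF v(4,1)], of "-1" n] by simp
    qed
  qed auto
  show ?thesis unfolding Hdot1_approx_def g using 2 6 by (auto intro!: L6_diff L2_diff Vsp_diff u v)
qed

section \<open>Antisymmetry of the convective term\<close>

text \<open>Incompressibility in the weak form, the property of the transporting field from which
  antisymmetry is derived; it is available for limits of test fields as well.\<close>

definition wdiv_free :: "(R3 \<Rightarrow> R3) \<Rightarrow> bool" where
  "wdiv_free W \<longleftrightarrow> (\<forall>\<psi>\<in>test_fun. (\<integral>x. (\<Sum>j\<in>UNIV. W x $ j * pd j \<psi> x) \<partial>lborel) = 0)"

text \<open>The sum of both sides is the integral of \<open>W\<close> against the gradient of the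
  scalar product of \<phi> and \<psi>. Each product of components is a test function, so weak
  incompressibility applies to it.\<close>

lemma convection_antisym_Vsp:
  assumes W: "W \<in> L2" "W \<in> L6" "wdiv_free W" and V: "\<phi> \<in> Vsp" "\<psi> \<in> Vsp"
  shows "convection W (grad \<phi>) \<psi> = - convection W (grad \<psi>) \<phi>"
proof -
  note sm = VspD(1)[OF V(1)] VspD(1)[OF V(2)]
  note [measurable] = L2_measurable[OF W(1)]
  have t: "(\<lambda>x. \<phi> x $ i * \<psi> x $ i) \<in> test_fun" for i
    using VspD(2)[OF V(1)] sm
    by (auto simp: test_fun_def compact_supp_iff intro!: smooth_mult smooth_component) (metis zero_index)
  have pd: "pd j (\<lambda>x. \<phi> x $ i * \<psi> x $ i) x = \<phi> x $ i * grad \<psi> x $ i $ j + grad \<phi> x $ i $ j * \<psi> x $ i" for i j x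
    using sm by (simp add: pd_mult pd_component smooth_differentiable smooth_component grad_def)
  have int: "integrable lborel (\<lambda>x. \<Sum>j\<in>UNIV. W x $ j * pd j (\<lambda>x. \<phi> x $ i * \<psi> x $ i) x)" for i
  proof (intro Bochner_Integration.integrable_sum)
    fix j
    have L: "pd j (\<lambda>x. \<phi> x $ i * \<psi> x $ i) \<in> L2"
      using t[of i] by (intro L2_continuous_compact_supp smooth_continuous smooth_pd compact_supp_pd) (auto simp: test_fun_def)
    have "(\<lambda>x. W x $ j) \<in> L2"
      using L2_dominated[OF W(1), of "\<lambda>x. W x $ j" 1] by (simp add: component_le_norm_cart)
    from L2_inner_integrable[OF this L] show "integrable lborel (\<lambda>x. W x $ j * pd j (\<lambda>x. \<phi> x $ i * \<psi> x $ i) x)" by simp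
  qed
  have "convection W (grad \<phi>) \<psi> + convection W (grad \<psi>) \<phi> = (\<integral>x. (grad \<phi> x *v W x) \<bullet> \<psi> x + (grad \<psi> x *v W x) \<bullet> \<phi> x \<partial>lborel)"
    unfolding convection_def by (intro Bochner_Integration.integral_add[symmetric] convection_bound W Vsp_grad_L2 Vsp_L6 V)
  also have "\<dots> = (\<integral>x. (\<Sum>i\<in>UNIV. \<Sum>j\<in>UNIV. W x $ j * pd j (\<lambda>x. \<phi> x $ i * \<psi> x $ i) x) \<partial>lborel)"
    by (intro Bochner_Integration.integral_cong refl)
       (simp add: pd matrix_vector_mult_def inner_vec_def sum_distrib_right sum_distrib_left sum.distrib[symmetric] algebra_simps)
  also have "\<dots> = (\<Sum>i\<in>UNIV. (\<integral>x. (\<Sum>j\<in>UNIV. W x $ j * pd j (\<lambda>x. \<phi> x $ i * \<psi> x $ i) x) \<partial>lborel))"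
    by (intro Bochner_Integration.integral_sum int)
  also have "\<dots> = 0" using W(3) t unfolding wdiv_free_def by (intro sum.neutral) blast
  finally show ?thesis by simp
qed

text \<open>\<open>W\<close> is fixed, so both sides are continuous in the L^2 norm of the gradient
  and the L^6 norm of the other argument. That is the convergence \<open>Hdot1_approx\<close>
  provides.\<close>

lemma convection_antisym:
  assumes W: "W \<in> L2" "W \<in> L6" "wdiv_free W" and u: "Hdot1_approx u G \<phi>" and v: "Hdot1_approx v H \<psi>"
  shows "convection W G v = - convection W H u"
proof -
  note p = Hdot1_approxD[OF u] and q = Hdot1_approxD[OF v]
  have "(\<lambda>n. convection W (grad (\<phi> n)) (\<psi> n)) \<longlonglongrightarrow> convection W G v" by (intro convection_tendsto W p q)
  moreover have "(\<lambda>n. - convection W (grad (\<psi> n)) (\<phi> n)) \<longlonglongrightarrow> - convection W H u" by (intro tendsto_minus convection_tendsto W p q)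
  ultimately show ?thesis using LIMSEQ_unique by (simp add: convection_antisym_Vsp[OF W p(3) q(3)])
qed

text \<open>The trace is a bounded linear function of the matrix, and the gradients of the
  approximating fields have trace zero.\<close>

lemma trace_zero_limit:
  assumes "\<And>n. \<phi> n \<in> Vsp" "G \<in> L2" "(\<lambda>n. L2_norm (\<lambda>x. grad (\<phi> n) x - G x)) \<longlonglongrightarrow> 0"
  shows "AE x in lborel. (\<Sum>i\<in>UNIV. G x $ i $ i) = 0"
proof -
  note [measurable] = L2_measurable[OF assms(2)]
  let ?t = "\<lambda>A :: real^3^3. (\<Sum>i\<in>UNIV. A $ i $ i)"
  have tb: "norm (?t A) \<le> 3 * norm A" for A
  proof -
    have "norm (?t A) \<le> (\<Sum>i\<in>UNIV. norm (A $ i $ i))" by (rule norm_sum)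
    also have "\<dots> \<le> (\<Sum>i\<in>(UNIV::3 set). norm A)"
      by (intro sum_mono) (simp add: order_trans[OF component_le_norm_cart Finite_Cartesian_Product.norm_nth_le])
    finally show ?thesis by simp
  qed
  have t: "(\<lambda>x. ?t (G x)) \<in> L2"
    using L2_dominated[OF assms(2), of "\<lambda>x. ?t (G x)" 3] tb by auto
  have "L2_norm (\<lambda>x. ?t (G x)) \<le> 3 * L2_norm (\<lambda>x. grad (\<phi> n) x - G x)" for n
  proof -
    have "?t (G x) = ?t (G x - grad (\<phi> n) x)" for x
      using VspD(3)[OF assms(1)[of n], of x] by (simp add: divergence_grad sum_subtractf)
    then have "norm (?t (G x)) \<le> 3 * norm (grad (\<phi> n) x - G x)" for x
      using tb[of "G x - grad (\<phi> n) x"] by (simp add: norm_minus_commute)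
    then show ?thesis
      using L2_dominated[OF L2_diff[OF Vsp_grad_L2[OF assms(1)] assms(2)], of "\<lambda>x. ?t (G x)" 3 n] by auto
  qed
  moreover have "(\<lambda>n. 3 * L2_norm (\<lambda>x. grad (\<phi> n) x - G x)) \<longlonglongrightarrow> 0"
    using tendsto_mult[OF tendsto_const assms(3), of 3] by simp
  ultimately have "L2_norm (\<lambda>x. ?t (G x)) \<le> 0" using LIMSEQ_le_const by blast
  then show ?thesis by (intro L2_norm_eq_0[OF t] antisym) auto
qed

lemma H1_weak_grad:
  assumes "H1 u G" shows "weak_grad u G"
proof -
  obtain \<phi> where "H1_approx u G \<phi>" using assms by (auto simp: H1_def)
  note p = H1_approxD[OF this]
  note [measurable] = L2_measurable[OF p(1)] L2_measurable[OF p(2)]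
  show ?thesis unfolding weak_grad_def
  proof (intro conjI ballI allI)
    fix \<psi> :: "R3 \<Rightarrow> real" and i j assume \<psi>: "\<psi> \<in> test_fun"
    then have s: "smooth \<psi>" "compact_supp \<psi>" by (auto simp: test_fun_def)
    have L: "\<psi> \<in> L2" "pd j \<psi> \<in> L2"
      by (intro L2_continuous_compact_supp smooth_continuous smooth_pd compact_supp_pd s)+
    have cu: "(\<lambda>x. w x $ i) \<in> L2 \<and> L2_norm (\<lambda>x. w x $ i) \<le> L2_norm w" if "w \<in> L2" for w :: "R3 \<Rightarrow> R3"
      using L2_dominated[OF that, of "\<lambda>x. w x $ i" 1] L2_measurable[OF that] by (simp add: component_le_norm_cart)
    have cG: "(\<lambda>x. A x $ i $ j) \<in> L2 \<and> L2_norm (\<lambda>x. A x $ i $ j) \<le> L2_norm A" if "A \<in> L2" for A :: "R3 \<Rightarrow> real^3^3"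
      using L2_dominated[OF that, of "\<lambda>x. A x $ i $ j" 1] L2_measurable[OF that]
      by (simp add: order_trans[OF component_le_norm_cart Finite_Cartesian_Product.norm_nth_le])
    show "integrable lborel (\<lambda>x. u x $ i * pd j \<psi> x)" "integrable lborel (\<lambda>x. G x $ i $ j * \<psi> x)"
      using L2_inner_integrable[OF conjunct1[OF cu[OF p(1)]] L(2)] L2_inner_integrable[OF conjunct1[OF cG[OF p(2)]] L(1)] by auto
    have 1: "(\<lambda>n. L2_norm (\<lambda>x. \<phi> n x $ i - u x $ i)) \<longlonglongrightarrow> 0"
      by (rule tendsto_sandwich[OF _ _ tendsto_const p(6)]) (use cu[OF L2_diff[OF p(4,1)]] in auto)
    have 2: "(\<lambda>n. L2_norm (\<lambda>x. grad (\<phi> n) x $ i $ j - G x $ i $ j)) \<longlonglongrightarrow> 0"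
      by (rule tendsto_sandwich[OF _ _ tendsto_const p(7)]) (use cG[OF L2_diff[OF p(5,2)]] in auto)
    have "(\<lambda>n. \<integral>x. (\<phi> n x $ i) \<bullet> pd j \<psi> x \<partial>lborel) \<longlonglongrightarrow> (\<integral>x. (u x $ i) \<bullet> pd j \<psi> x \<partial>lborel)"
      by (rule L2_inner_tendsto) (use cu p L 1 in auto)
    moreover have "(\<lambda>n. - (\<integral>x. (grad (\<phi> n) x $ i $ j) \<bullet> \<psi> x \<partial>lborel)) \<longlonglongrightarrow> - (\<integral>x. (G x $ i $ j) \<bullet> \<psi> x \<partial>lborel)"
      by (rule tendsto_minus, rule L2_inner_tendsto) (use cG p L 2 in auto)
    moreover have "(\<integral>x. (\<phi> n x $ i) \<bullet> pd j \<psi> x \<partial>lborel) = - (\<integral>x. (grad (\<phi> n) x $ i $ j) \<bullet> \<psi> x \<partial>lborel)" for n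
      using integral_by_parts_pd[OF smooth_component[OF VspD(1)[OF p(3)]] s, of n i j]
      by (simp add: grad_def pd_component smooth_differentiable VspD(1)[OF p(3)])
    ultimately show "(\<integral>x. u x $ i * pd j \<psi> x \<partial>lborel) = - (\<integral>x. G x $ i $ j * \<psi> x \<partial>lborel)"
      using LIMSEQ_unique by simp
  qed auto
qed

lemma weak_grad_wdiv_free:
  assumes "weak_grad u G" "AE x in lborel. (\<Sum>i\<in>UNIV. G x $ i $ i) = 0"
  shows "wdiv_free u"
  unfolding wdiv_free_def
proof
  fix \<psi> :: "R3 \<Rightarrow> real" assume \<psi>: "\<psi> \<in> test_fun"
  have w: "integrable lborel (\<lambda>x. u x $ i * pd j \<psi> x)" "integrable lborel (\<lambda>x. G x $ i $ j * \<psi> x)"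
    "(\<integral>x. u x $ i * pd j \<psi> x \<partial>lborel) = - (\<integral>x. G x $ i $ j * \<psi> x \<partial>lborel)" for i j
    using assms(1) \<psi> by (auto simp: weak_grad_def)
  have [measurable]: "G \<in> borel_measurable borel" "\<psi> \<in> borel_measurable borel"
    using assms(1) \<psi> by (auto simp: weak_grad_def test_fun_def)
  have "(\<integral>x. (\<Sum>j\<in>UNIV. u x $ j * pd j \<psi> x) \<partial>lborel) = (\<Sum>j\<in>UNIV. - (\<integral>x. G x $ j $ j * \<psi> x \<partial>lborel))"
    using w by (simp add: Bochner_Integration.integral_sum)
  also have "\<dots> = - (\<integral>x. (\<Sum>j\<in>UNIV. G x $ j $ j * \<psi> x) \<partial>lborel)"
    using w(2) by (simp add: sum_negf Bochner_Integration.integral_sum)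
  also have "(\<integral>x. (\<Sum>j\<in>UNIV. G x $ j $ j * \<psi> x) \<partial>lborel) = (\<integral>x. 0 \<partial>(lborel :: R3 measure))"
  proof (rule integral_cong_AE)
    show "AE x in lborel. (\<Sum>j\<in>UNIV. G x $ j $ j * \<psi> x) = 0"
      using assms(2) by eventually_elim (simp add: sum_distrib_right[symmetric])
  qed measurable
  finally show "(\<integral>x. (\<Sum>j\<in>UNIV. u x $ j * pd j \<psi> x) \<partial>lborel) = 0" by simp
qed

lemma H1_wdiv_free: "H1 u G \<Longrightarrow> wdiv_free u"
  using H1_weak_grad[of u G] weak_grad_wdiv_free trace_zero_limit by (auto simp: H1_def H1_approx_def)

lemma H1_H1sig:
  assumes "H1 u G" shows "u \<in> H1sig"
proof -
  obtain \<phi> where c: "H1_approx u G \<phi>" using assms by (auto simp: H1_def)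
  note p = H1_approxD[OF c] and q = Hdot1_approxD[OF H1_approx_imp_Hdot1_approx(1)[OF c]]
  have "(\<lambda>n. Lp_int 2 (\<lambda>x. \<phi> n x - u x)) \<longlonglongrightarrow> 0" "(\<lambda>n. Lp_int 2 (\<lambda>x. grad (\<phi> n) x - G x)) \<longlonglongrightarrow> 0"
    using L2_tendsto_iff[OF p(4,1)] L2_tendsto_iff[OF p(5,2)] p by auto
  moreover have "(\<lambda>n. Lp_int 6 (\<lambda>x. \<phi> n x - u x)) \<longlonglongrightarrow> 0"
    using L6_tendsto_iff[OF L6_diff[OF q(4,1)]] q by auto
  ultimately show ?thesis
    unfolding H1sig_def L2sig_def Hdot1sig_def using p H1_weak_grad[OF assms] by blast
qed

lemma Hdot1sig_Hdot1_approx: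
  assumes "u \<in> Hdot1sig"
  obtains G \<phi> where "weak_grad u G" "Hdot1_approx u G \<phi>"
proof -
  obtain G \<phi> where g: "weak_grad u G" "G \<in> L2" "\<And>n. \<phi> n \<in> Vsp"
    "(\<lambda>n. Lp_int 2 (\<lambda>x. grad (\<phi> n) x - G x)) \<longlonglongrightarrow> 0" "(\<lambda>n. Lp_int 6 (\<lambda>x. \<phi> n x - u x)) \<longlonglongrightarrow> 0"
    using assms unfolding Hdot1sig_def by blast
  have [measurable]: "u \<in> borel_measurable borel" using g(1) by (simp add: weak_grad_def)
  note [measurable] = Vsp_measurable[OF g(3)]
  have "\<forall>\<^sub>F n in sequentially. Lp_int 6 (\<lambda>x. \<phi> n x - u x) < \<infinity>"
    using order_tendstoD(2)[OF g(5), of \<infinity>] by simp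
  \<comment> \<open>\<open>Hdot1sig\<close> does not state that \<open>u\<close> itself lies in L^6.
    One approximation at finite distance suffices, because test fields lie in L^6.\<close>
  then obtain n where "Lp_int 6 (\<lambda>x. \<phi> n x - u x) < \<infinity>" by (auto simp: eventually_sequentially)
  then have "(\<lambda>x. \<phi> n x - u x) \<in> L6" by (simp add: L6_def)
  from L6_diff[OF Vsp_L6[OF g(3)[of n]] this] have u: "u \<in> L6" by simp
  have "Hdot1_approx u G \<phi>" unfolding Hdot1_approx_def
    using u g L6_tendsto_iff[OF L6_diff[OF Vsp_L6[OF g(3)] u]] L2_tendsto_iff[OF Vsp_grad_L2[OF g(3)] g(2)] by auto
  with g(1) that show ?thesis by blast
qed

section \<open>The linear problem\<close>

definition Vsp_linear :: "((R3 \<Rightarrow> R3) \<Rightarrow> real) \<Rightarrow> bool" where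
  "Vsp_linear l \<longleftrightarrow> (\<forall>\<phi>\<in>Vsp. \<forall>\<psi>\<in>Vsp. \<forall>c. l (\<lambda>x. \<phi> x + c *\<^sub>R \<psi> x) = l \<phi> + c * l \<psi>)"

text \<open>The bilinear form of the Stokes operator with the zero-order term \<epsilon> u added.
  For \<epsilon> > 0 it is coercive in both the L^2 norm and the gradient norm.\<close>

definition energy_form :: "real \<Rightarrow> real \<Rightarrow> (R3 \<Rightarrow> R3) \<Rightarrow> (R3 \<Rightarrow> real^3^3) \<Rightarrow> (R3 \<Rightarrow> R3) \<Rightarrow> (R3 \<Rightarrow> real^3^3) \<Rightarrow> real" where
  "energy_form \<epsilon> \<nu> u G v H = \<epsilon> * (\<integral>x. u x \<bullet> v x \<partial>lborel) + \<nu> * (\<integral>x. G x \<bullet> H x \<partial>lborel)"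

lemma energy_form_self: "u \<in> L2 \<Longrightarrow> G \<in> L2 \<Longrightarrow> energy_form \<epsilon> \<nu> u G u G = \<epsilon> * (L2_norm u)\<^sup>2 + \<nu> * (L2_norm G)\<^sup>2"
  by (simp add: energy_form_def L2_norm_sq_inner)

lemma energy_form_commute: "energy_form \<epsilon> \<nu> u G v H = energy_form \<epsilon> \<nu> v H u G"
  by (simp add: energy_form_def inner_commute)

lemma L2_inner_add_scaleR:
  fixes u v w :: "R3 \<Rightarrow> 'b::euclidean_space"
  assumes "u \<in> L2" "v \<in> L2" "w \<in> L2"
  shows "(\<integral>x. w x \<bullet> (u x + c *\<^sub>R v x) \<partial>lborel) = (\<integral>x. w x \<bullet> u x \<partial>lborel) + c * (\<integral>x. w x \<bullet> v x \<partial>lborel)"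
    "(\<integral>x. (u x + c *\<^sub>R v x) \<bullet> w x \<partial>lborel) = (\<integral>x. u x \<bullet> w x \<partial>lborel) + c * (\<integral>x. v x \<bullet> w x \<partial>lborel)"
  using assms by (simp_all add: inner_add_right inner_add_left L2_inner_integrable)

lemma L2_inner_diff:
  fixes u v w :: "R3 \<Rightarrow> 'b::euclidean_space"
  assumes "u \<in> L2" "v \<in> L2" "w \<in> L2"
  shows "(\<integral>x. w x \<bullet> (u x - v x) \<partial>lborel) = (\<integral>x. w x \<bullet> u x \<partial>lborel) - (\<integral>x. w x \<bullet> v x \<partial>lborel)"
    "(\<integral>x. (u x - v x) \<bullet> w x \<partial>lborel) = (\<integral>x. u x \<bullet> w x \<partial>lborel) - (\<integral>x. v x \<bullet> w x \<partial>lborel)"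
  using assms by (simp_all add: inner_diff_right inner_diff_left L2_inner_integrable)

lemma energy_form_tendsto:
  assumes "u \<in> L2" "G \<in> L2" "H1_approx v H \<psi>"
  shows "(\<lambda>n. energy_form \<epsilon> \<nu> u G (\<psi> n) (grad (\<psi> n))) \<longlonglongrightarrow> energy_form \<epsilon> \<nu> u G v H"
  unfolding energy_form_def
  by (intro tendsto_intros L2_inner_tendsto H1_approxD[OF assms(3)] assms) simp_all

text \<open>The Riesz representation by direct minimization of the quadratic functional
  \<open>J\<close> over test fields. Strict convexity makes a minimizing sequence Cauchy, and the
  vanishing first variation at its limit is the equation.\<close>

lemma Vsp_Riesz:
  assumes "\<epsilon> > 0" "\<nu> > 0" "Vsp_linear l"
    and bound: "\<And>\<phi>. \<phi> \<in> Vsp \<Longrightarrow> \<bar>l \<phi>\<bar> \<le> K0 * L2_norm \<phi> + K1 * L2_norm (grad \<phi>)"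
  shows "\<exists>u G. H1 u G \<and> (\<forall>\<phi>\<in>Vsp. energy_form \<epsilon> \<nu> u G \<phi> (grad \<phi>) = l \<phi>)"
proof -
  define a where "a \<phi> = \<epsilon> * (L2_norm \<phi>)\<^sup>2 + \<nu> * (L2_norm (grad \<phi>))\<^sup>2" for \<phi>
  define J where "J \<phi> = a \<phi> - 2 * l \<phi>" for \<phi>
  let ?B = "\<lambda>\<phi> \<psi>. energy_form \<epsilon> \<nu> \<phi> (grad \<phi>) \<psi> (grad \<psi>)"
  have a0: "a \<phi> \<ge> 0" for \<phi> using assms by (simp add: a_def)
  have expand: "J (\<lambda>x. \<phi> x + t *\<^sub>R \<psi> x) = J \<phi> + 2 * t * (?B \<phi> \<psi> - l \<psi>) + t\<^sup>2 * a \<psi>" if "\<phi> \<in> Vsp" "\<psi> \<in> Vsp" for \<phi> \<psi> t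
  proof -
    have g: "grad (\<lambda>x. \<phi> x + t *\<^sub>R \<psi> x) = (\<lambda>x. grad \<phi> x + t *\<^sub>R grad \<psi> x)"
      using that by (simp add: grad_add grad_scaleR smooth_scaleR VspD)
    have sq': "(L2_norm (\<lambda>x. u x + t *\<^sub>R v x))\<^sup>2 = (L2_norm u)\<^sup>2 + 2 * t * (\<integral>x. u x \<bullet> v x \<partial>lborel) + t\<^sup>2 * (L2_norm v)\<^sup>2"
      if "u \<in> L2" "v \<in> L2" for u v :: "R3 \<Rightarrow> R3"
      using that by (simp add: L2_norm_sq_add L2_scale L2_norm_scale power_mult_distrib)
    have sq'': "(L2_norm (\<lambda>x. u x + t *\<^sub>R v x))\<^sup>2 = (L2_norm u)\<^sup>2 + 2 * t * (\<integral>x. u x \<bullet> v x \<partial>lborel) + t\<^sup>2 * (L2_norm v)\<^sup>2"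
      if "u \<in> L2" "v \<in> L2" for u v :: "R3 \<Rightarrow> real^3^3"
      using that by (simp add: L2_norm_sq_add L2_scale L2_norm_scale power_mult_distrib)
    have "l (\<lambda>x. \<phi> x + t *\<^sub>R \<psi> x) = l \<phi> + t * l \<psi>" using assms(3) that by (auto simp: Vsp_linear_def)
    then show ?thesis
      unfolding J_def a_def g sq'[OF Vsp_L2[OF that(1)] Vsp_L2[OF that(2)]]
        sq''[OF Vsp_grad_L2[OF that(1)] Vsp_grad_L2[OF that(2)]] energy_form_def
      by (simp add: algebra_simps)
  qed
  \<comment> \<open>Young's inequality absorbs the linear part into the two quadratic terms, so the
    infimum of \<open>J\<close> is finite.\<close>
  have low: "J \<phi> \<ge> - (K0\<^sup>2 / \<epsilon>) - K1\<^sup>2 / \<nu>" if "\<phi> \<in> Vsp" for \<phi>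
  proof -
    have q: "2 * K * p \<le> e * p\<^sup>2 + K\<^sup>2 / e" if "e > 0" for K p e :: real
    proof -
      have "0 \<le> (e * p - K)\<^sup>2 / e" using that by simp
      also have "\<dots> = e * p\<^sup>2 + K\<^sup>2 / e - 2 * K * p"
        using that by (simp add: power2_diff power2_eq_square field_simps)
      finally show ?thesis by simp
    qed
    have "2 * l \<phi> \<le> 2 * K0 * L2_norm \<phi> + 2 * K1 * L2_norm (grad \<phi>)" using bound[OF that] by linarith
    also have "\<dots> \<le> (\<epsilon> * (L2_norm \<phi>)\<^sup>2 + K0\<^sup>2 / \<epsilon>) + (\<nu> * (L2_norm (grad \<phi>))\<^sup>2 + K1\<^sup>2 / \<nu>)"
      by (intro add_mono q assms)
    finally show ?thesis by (simp add: J_def a_def)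
  qed
  define m where "m = Inf (J ` Vsp)"
  have m: "m \<le> J \<phi>" if "\<phi> \<in> Vsp" for \<phi>
    unfolding m_def using that low by (intro cInf_lower bdd_belowI2[where m="- (K0\<^sup>2 / \<epsilon>) - K1\<^sup>2 / \<nu>"]) auto
  have "\<exists>\<phi>. \<phi> \<in> Vsp \<and> J \<phi> < m + 1 / real (Suc n)" for n
    using cInf_lessD[of "J ` Vsp" "m + 1 / real (Suc n)"] Vsp_zero by (auto simp: m_def)
  then obtain \<phi> where \<phi>: "\<And>n. \<phi> n \<in> Vsp" "\<And>n. J (\<phi> n) < m + 1 / real (Suc n)" by metis
  have z: "(\<lambda>n. 1 / real (Suc n)) \<longlonglongrightarrow> 0" using LIMSEQ_inverse_real_of_nat by (simp add: inverse_eq_divide)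
  \<comment> \<open>The parallelogram identity: the midpoint of two almost minimizers is itself a
    competitor with energy at least \<open>m\<close>.\<close>
  have ad: "a (\<lambda>x. \<phi> i x - \<phi> j x) \<le> 2 / real (Suc i) + 2 / real (Suc j)" for i j
  proof -
    let ?w = "\<lambda>x. \<phi> i x - \<phi> j x"
    have w: "?w \<in> Vsp" by (intro Vsp_diff \<phi>)
    have 1: "J (\<phi> i) = J (\<phi> j) + 2 * (?B (\<phi> j) ?w - l ?w) + a ?w"
      using expand[OF \<phi>(1) w, of j 1] by simp
    have 2: "J (\<lambda>x. \<phi> j x + (1/2) *\<^sub>R ?w x) = J (\<phi> j) + (?B (\<phi> j) ?w - l ?w) + a ?w / 4"
      using expand[OF \<phi>(1) w, of j "1/2"] by (simp add: power2_eq_square)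
    have "m \<le> J (\<lambda>x. \<phi> j x + (1/2) *\<^sub>R ?w x)" by (intro m Vsp_add Vsp_scaleR w \<phi>)
    moreover have "a ?w = 2 * J (\<phi> i) + 2 * J (\<phi> j) - 4 * J (\<lambda>x. \<phi> j x + (1/2) *\<^sub>R ?w x)"
      unfolding 1 2 by (simp add: algebra_simps)
    ultimately show ?thesis using \<phi>(2)[of i] \<phi>(2)[of j] by linarith
  qed
  have cauchy: "\<exists>N. \<forall>i\<ge>N. \<forall>j\<ge>N. L2_norm (\<lambda>x. \<phi> i x - \<phi> j x) < e \<and> L2_norm (\<lambda>x. grad (\<phi> i) x - grad (\<phi> j) x) < e"
    if "e > 0" for e :: real
  proof -
    define d where "d = min \<epsilon> \<nu> * e\<^sup>2"
    have "d > 0" using assms that by (simp add: d_def)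
    then have "\<forall>\<^sub>F n in sequentially. 1 / real (Suc n) < d / 4" by (intro order_tendstoD(2)[OF z]) auto
    then obtain N where N: "\<And>n. n \<ge> N \<Longrightarrow> 1 / real (Suc n) < d / 4" by (auto simp: eventually_sequentially)
    have "L2_norm (\<lambda>x. \<phi> i x - \<phi> j x) < e \<and> L2_norm (\<lambda>x. grad (\<phi> i) x - grad (\<phi> j) x) < e" if "i \<ge> N" "j \<ge> N" for i j
    proof -
      let ?p = "(L2_norm (\<lambda>x. \<phi> i x - \<phi> j x))\<^sup>2" and ?q = "(L2_norm (\<lambda>x. grad (\<phi> i) x - grad (\<phi> j) x))\<^sup>2"
      have "2 / real (Suc i) = 2 * (1 / real (Suc i))" "2 / real (Suc j) = 2 * (1 / real (Suc j))" by auto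
      then have "\<epsilon> * ?p + \<nu> * ?q < d"
        using ad[of i j] N[OF that(1)] N[OF that(2)] grad_diff[OF VspD(1)[OF \<phi>(1)] VspD(1)[OF \<phi>(1)], of i j]
        by (simp add: a_def)
      moreover have "0 \<le> \<epsilon> * ?p" "0 \<le> \<nu> * ?q" using assms by auto
      ultimately have "\<epsilon> * ?p < d" "\<nu> * ?q < d" by linarith+
      moreover have "d \<le> \<epsilon> * e\<^sup>2" "d \<le> \<nu> * e\<^sup>2" unfolding d_def by (intro mult_right_mono; simp)+
      ultimately have "\<epsilon> * ?p < \<epsilon> * e\<^sup>2" "\<nu> * ?q < \<nu> * e\<^sup>2" by linarith+
      then have "?p < e\<^sup>2" "?q < e\<^sup>2" using assms by auto
      then show ?thesis using \<open>e > 0\<close> by (auto intro: power2_less_imp_less)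
    qed
    then show ?thesis by blast
  qed
  have "\<exists>u\<in>L2. (\<lambda>n. L2_norm (\<lambda>x. \<phi> n x - u x)) \<longlonglongrightarrow> 0"
    by (rule L2_complete) (use cauchy in \<open>blast intro: Vsp_L2 \<phi>\<close>)+
  moreover have "\<exists>G\<in>L2. (\<lambda>n. L2_norm (\<lambda>x. grad (\<phi> n) x - G x)) \<longlonglongrightarrow> 0"
    by (rule L2_complete) (use cauchy in \<open>blast intro: Vsp_grad_L2 \<phi>\<close>)+
  ultimately obtain u G where uG: "H1_approx u G \<phi>" unfolding H1_approx_def using \<phi>(1) by blast
  have "energy_form \<epsilon> \<nu> u G \<psi> (grad \<psi>) = l \<psi>" if "\<psi> \<in> Vsp" for \<psi>
  proof -
    define X where "X = energy_form \<epsilon> \<nu> u G \<psi> (grad \<psi>) - l \<psi>"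
    have lim: "(\<lambda>n. ?B (\<phi> n) \<psi> - l \<psi>) \<longlonglongrightarrow> X"
      unfolding X_def using energy_form_tendsto[OF Vsp_L2[OF that] Vsp_grad_L2[OF that] uG]
      by (subst (1 2) energy_form_commute) (intro tendsto_intros)
    \<comment> \<open>Moving from \<phi> n in direction \<psi> cannot go below \<open>m\<close>. In
      the limit a quadratic polynomial in t with value 0 at t = 0 is nonnegative, so its linear
      coefficient must vanish.\<close>
    have quad: "0 \<le> 2 * t * X + t\<^sup>2 * a \<psi>" for t
    proof (rule LIMSEQ_le_const)
      show "(\<lambda>n. 2 * t * (?B (\<phi> n) \<psi> - l \<psi>) + t\<^sup>2 * a \<psi> + 1 / real (Suc n)) \<longlonglongrightarrow> 2 * t * X + t\<^sup>2 * a \<psi>"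
        using tendsto_add[OF tendsto_add[OF tendsto_mult[OF tendsto_const lim] tendsto_const] z, of "2 * t" "t\<^sup>2 * a \<psi>"] by simp
      have "0 \<le> 2 * t * (?B (\<phi> n) \<psi> - l \<psi>) + t\<^sup>2 * a \<psi> + 1 / real (Suc n)" for n
        using m[OF Vsp_add[OF \<phi>(1) Vsp_scaleR[OF that]], of n t] expand[OF \<phi>(1) that, of n t] \<phi>(2)[of n] by linarith
      then show "\<exists>N. \<forall>n\<ge>N. 0 \<le> 2 * t * (?B (\<phi> n) \<psi> - l \<psi>) + t\<^sup>2 * a \<psi> + 1 / real (Suc n)" by blast
    qed
    have "X = 0"
    proof (rule ccontr)
      assume "X \<noteq> 0"
      \<comment> \<open>The summand 1 makes t = - X / s admissible also when \<psi> has energy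
        zero.\<close>
      define s where "s = a \<psi> + 1"
      have s: "s > 0" using a0[of \<psi>] by (simp add: s_def)
      have "0 \<le> 2 * (- X / s) * X + (- X / s)\<^sup>2 * (s - 1)" using quad[of "- X / s"] by (simp add: s_def)
      also have "\<dots> = - (X\<^sup>2 * (s + 1)) / s\<^sup>2" using s by (simp add: field_simps power2_eq_square)
      also have "\<dots> < 0" using s \<open>X \<noteq> 0\<close> by (simp add: divide_neg_pos)
      finally show False by simp
    qed
    then show ?thesis by (simp add: X_def)
  qed
  then show ?thesis using uG by (auto simp: H1_def)
qed

lemma energy_form_test_limit:
  assumes "u \<in> L2" "G \<in> L2" "\<And>\<phi>. \<phi> \<in> Vsp \<Longrightarrow> energy_form \<epsilon> \<nu> u G \<phi> (grad \<phi>) = l \<phi>" "H1_approx v H \<psi>"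
  shows "(\<lambda>n. l (\<psi> n)) \<longlonglongrightarrow> energy_form \<epsilon> \<nu> u G v H"
  using energy_form_tendsto[OF assms(1,2,4), of \<epsilon> \<nu>] assms(3) H1_approxD(3)[OF assms(4)] by simp

text \<open>Elliptic regularity for the dual problem, by testing with second differences.\<close>

lemma dual_problem:
  assumes "\<epsilon> > 0" "\<nu> > 0" "g \<in> L2"
  obtains v H where "H1 v H" "\<And>w K. H1 w K \<Longrightarrow> energy_form \<epsilon> \<nu> v H w K = (\<integral>x. g x \<bullet> w x \<partial>lborel)"
    "\<And>h. L2_norm (\<lambda>x. H (x + h) - H x) \<le> L2_norm g / \<nu> * norm h"
proof -
  let ?l = "\<lambda>\<phi>. \<integral>x. g x \<bullet> \<phi> x \<partial>lborel"
  have "Vsp_linear ?l" unfolding Vsp_linear_def using L2_inner_add_scaleR(1)[OF _ _ assms(3)] Vsp_L2 by blast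
  moreover have "\<bar>?l \<phi>\<bar> \<le> L2_norm g * L2_norm \<phi> + 0 * L2_norm (grad \<phi>)" if "\<phi> \<in> Vsp" for \<phi>
    using L2_Cauchy_Schwarz[OF assms(3) Vsp_L2[OF that]] by simp
  ultimately obtain v H where vH: "H1 v H" "\<And>\<phi>. \<phi> \<in> Vsp \<Longrightarrow> energy_form \<epsilon> \<nu> v H \<phi> (grad \<phi>) = ?l \<phi>"
    using Vsp_Riesz[OF assms(1,2)] by blast
  note L = H1_L2[OF vH(1)]
  have eq: "energy_form \<epsilon> \<nu> v H w K = ?l w" if w: "H1 w K" for w K
  proof -
    obtain \<psi> where c: "H1_approx w K \<psi>" using w by (auto simp: H1_def)
    note p = H1_approxD[OF c]
    have "(\<lambda>n. ?l (\<psi> n)) \<longlonglongrightarrow> energy_form \<epsilon> \<nu> v H w K" by (rule energy_form_test_limit[OF L vH(2) c])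
    moreover have "(\<lambda>n. ?l (\<psi> n)) \<longlonglongrightarrow> ?l w"
      by (rule L2_inner_tendsto) (use p assms(3) in auto)
    ultimately show ?thesis by (rule LIMSEQ_unique)
  qed
  have "L2_norm (\<lambda>x. H (x + h) - H x) \<le> L2_norm g / \<nu> * norm h" for h
  proof -
    define w K where "w = (\<lambda>x. v (x + h) - v x)" and "K = (\<lambda>x. H (x + h) - H x)"
    \<comment> \<open>\<open>z\<close> is minus the second difference of \<open>v\<close>. Shifting
      one of its two differences onto \<open>v\<close> turns the form at (v, z) into the energy of
      the first difference \<open>w\<close>.\<close>
    define z Z where "z = (\<lambda>x. w (x - h) - w x)" and "Z = (\<lambda>x. K (x - h) - K x)"
    have wK: "H1 w K" unfolding w_def K_def by (intro H1_diff H1_translate vH)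
    note wL = H1_L2[OF wK]
    have zZ: "H1 z Z" unfolding z_def Z_def using H1_diff[OF H1_translate[OF wK, of "-h"] wK] by simp
    have shift1: "(\<integral>x. v x \<bullet> z x \<partial>lborel) = (\<integral>x. w x \<bullet> w x \<partial>lborel)"
    proof -
      note [measurable] = L2_measurable[OF L(1)] L2_measurable[OF wL(1)]
      have "(\<lambda>x. w (x - h)) \<in> L2" using L2_translate(1)[OF wL(1), of "-h"] by simp
      moreover have "(\<integral>x. v (x + h) \<bullet> w x \<partial>lborel) = (\<integral>x. v x \<bullet> w (x - h) \<partial>lborel)"
        using integral_lborel_translate[of "\<lambda>x. v x \<bullet> w (x - h)" h] by simp
      moreover have "(\<integral>x. w x \<bullet> w x \<partial>lborel) = (\<integral>x. (v (x + h) - v x) \<bullet> w x \<partial>lborel)" by (simp add: w_def)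
      ultimately show ?thesis unfolding z_def
        using L2_inner_diff(1)[of "\<lambda>x. w (x - h)" w v] L2_inner_diff(2)[of "\<lambda>x. v (x + h)" v w] L(1) wL(1)
          L2_translate(1)[OF L(1), of h] by simp
    qed
    have shift2: "(\<integral>x. H x \<bullet> Z x \<partial>lborel) = (\<integral>x. K x \<bullet> K x \<partial>lborel)"
    proof -
      note [measurable] = L2_measurable[OF L(2)] L2_measurable[OF wL(2)]
      have "(\<lambda>x. K (x - h)) \<in> L2" using L2_translate(1)[OF wL(2), of "-h"] by simp
      moreover have "(\<integral>x. H (x + h) \<bullet> K x \<partial>lborel) = (\<integral>x. H x \<bullet> K (x - h) \<partial>lborel)"
        using integral_lborel_translate[of "\<lambda>x. H x \<bullet> K (x - h)" h] by simp
      moreover have "(\<integral>x. K x \<bullet> K x \<partial>lborel) = (\<integral>x. (H (x + h) - H x) \<bullet> K x \<partial>lborel)" by (simp add: K_def)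
      ultimately show ?thesis unfolding Z_def
        using L2_inner_diff(1)[of "\<lambda>x. K (x - h)" K H] L2_inner_diff(2)[of "\<lambda>x. H (x + h)" H K] L(2) wL(2)
          L2_translate(1)[OF L(2), of h] by simp
    qed
    \<comment> \<open>The \<epsilon>-term is nonnegative and dropped, so the bound does not depend
      on \<epsilon>. On the right \<open>z\<close> is a first difference of \<open>w\<close>, which
      produces a factor \<open>L2_norm K\<close> that cancels one on the left.\<close>
    have "\<nu> * (L2_norm K)\<^sup>2 \<le> energy_form \<epsilon> \<nu> w K w K" using assms by (simp add: energy_form_self wL)
    also have "\<dots> = energy_form \<epsilon> \<nu> v H z Z" by (simp add: energy_form_def shift1 shift2)
    also have "\<dots> = ?l z" by (rule eq[OF zZ])
    also have "\<dots> \<le> L2_norm g * L2_norm z" using L2_Cauchy_Schwarz[OF assms(3) H1_L2(1)[OF zZ]] by linarith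
    also have "\<dots> \<le> L2_norm g * (norm h * L2_norm K)"
      using H1_translate_bound[OF wK, of "-h"] by (intro mult_left_mono) (auto simp: z_def)
    finally have "L2_norm K * (\<nu> * L2_norm K) \<le> L2_norm K * (L2_norm g * norm h)"
      by (simp add: power2_eq_square mult_ac)
    then have "\<nu> * L2_norm K \<le> L2_norm g * norm h"
      using L2_norm_nonneg[of K] by (cases "L2_norm K = 0") (auto simp: mult_le_cancel_left)
    then show ?thesis using assms by (simp add: K_def field_simps)
  qed
  with vH(1) eq that show ?thesis by blast
qed

text \<open>The $L^2$ bound comes from duality: \<open>(L2_norm u)\<^sup>2\<close> is the value of \<open>l\<close> at the solution of the dual
  problem with right-hand side \<open>u\<close>.\<close>

lemma regularized_problem:
  assumes "\<epsilon> > 0" "\<nu> > 0" "Vsp_linear l" "K1 \<ge> 0"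
    and b1: "\<And>\<phi>. \<phi> \<in> Vsp \<Longrightarrow> \<bar>l \<phi>\<bar> \<le> K1 * L2_norm (grad \<phi>)"
    and b2: "\<And>v H \<psi> R L. H1_approx v H \<psi> \<Longrightarrow> R \<ge> 0 \<Longrightarrow> (\<And>h. L2_norm (\<lambda>x. H (x + h) - H x) \<le> R * norm h) \<Longrightarrow>
      (\<lambda>n. l (\<psi> n)) \<longlonglongrightarrow> L \<Longrightarrow> \<bar>L\<bar> \<le> K2 * R"
    and "K2 \<ge> 0"
  shows "\<exists>u G. H1 u G \<and> (\<forall>\<phi>\<in>Vsp. energy_form \<epsilon> \<nu> u G \<phi> (grad \<phi>) = l \<phi>) \<and>
    L2_norm G \<le> K1 / \<nu> \<and> L2_norm u \<le> K2 / \<nu>"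
proof -
  have "\<bar>l \<phi>\<bar> \<le> 0 * L2_norm \<phi> + K1 * L2_norm (grad \<phi>)" if "\<phi> \<in> Vsp" for \<phi> using b1[OF that] by simp
  then obtain u G where uG: "H1 u G" "\<And>\<phi>. \<phi> \<in> Vsp \<Longrightarrow> energy_form \<epsilon> \<nu> u G \<phi> (grad \<phi>) = l \<phi>"
    using Vsp_Riesz[OF assms(1-3)] by blast
  note L = H1_L2[OF uG(1)]
  obtain \<psi> where c: "H1_approx u G \<psi>" using uG(1) by (auto simp: H1_def)
  note p = H1_approxD[OF c]
  have "energy_form \<epsilon> \<nu> u G u G \<le> K1 * L2_norm G"
  proof (rule LIMSEQ_le)
    show "(\<lambda>n. l (\<psi> n)) \<longlonglongrightarrow> energy_form \<epsilon> \<nu> u G u G" by (rule energy_form_test_limit[OF L uG(2) c])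
    show "(\<lambda>n. K1 * L2_norm (grad (\<psi> n))) \<longlonglongrightarrow> K1 * L2_norm G"
      by (intro tendsto_intros L2_norm_tendsto p)
    show "\<exists>N. \<forall>n\<ge>N. l (\<psi> n) \<le> K1 * L2_norm (grad (\<psi> n))" using b1[OF p(3)] abs_le_D1 by blast
  qed
  moreover have "\<nu> * (L2_norm G)\<^sup>2 \<le> energy_form \<epsilon> \<nu> u G u G" using assms by (simp add: energy_form_self L)
  ultimately have "L2_norm G * (\<nu> * L2_norm G) \<le> L2_norm G * K1" by (simp add: power2_eq_square mult_ac)
  then have "\<nu> * L2_norm G \<le> K1"
    using L2_norm_nonneg[of G] assms(4) by (cases "L2_norm G = 0") (auto simp: mult_le_cancel_left)
  then have G: "L2_norm G \<le> K1 / \<nu>" using assms by (simp add: field_simps)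
  obtain v H where vH: "H1 v H" "\<And>w K. H1 w K \<Longrightarrow> energy_form \<epsilon> \<nu> v H w K = (\<integral>x. u x \<bullet> w x \<partial>lborel)"
    "\<And>h. L2_norm (\<lambda>x. H (x + h) - H x) \<le> L2_norm u / \<nu> * norm h"
    using dual_problem[OF assms(1,2) L(1)] by blast
  obtain \<xi> where d: "H1_approx v H \<xi>" using vH(1) by (auto simp: H1_def)
  \<comment> \<open>\<open>l\<close> is defined through its values on test fields; its value at
    \<open>v\<close> exists as the limit along an approximation, which is why \<open>b2\<close> is
    phrased with a limit.\<close>
  have lim: "(\<lambda>n. l (\<xi> n)) \<longlonglongrightarrow> energy_form \<epsilon> \<nu> u G v H" by (rule energy_form_test_limit[OF L uG(2) d])
  have "\<bar>energy_form \<epsilon> \<nu> u G v H\<bar> \<le> K2 * (L2_norm u / \<nu>)"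
    by (rule b2[OF d _ _ lim]) (use assms(2) vH(3) in auto)
  moreover have "energy_form \<epsilon> \<nu> u G v H = (L2_norm u)\<^sup>2"
    using vH(2)[OF uG(1)] by (simp only: energy_form_commute[of \<epsilon> \<nu> u G v H] L2_norm_sq_inner[OF L(1)])
  ultimately have *: "L2_norm u * L2_norm u \<le> L2_norm u * (K2 / \<nu>)" by (simp add: power2_eq_square mult_ac)
  have "L2_norm u \<le> K2 / \<nu>"
  proof (cases "L2_norm u = 0")
    case True then show ?thesis using assms(2) \<open>K2 \<ge> 0\<close> by simp
  next
    case False
    then have "L2_norm u > 0" using L2_norm_nonneg[of u] by linarith
    then show ?thesis by (rule mult_left_le_imp_le[OF *])
  qed
  with uG G show ?thesis by (intro exI[of _ u] exI[of _ G] conjI ballI)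
qed

text \<open>Of two regularized solutions, the one with the smaller parameter has the larger $L^2$ norm, and the
  difference of the squared norms controls the squared distance. Boundedness therefore gives convergence
  in norm, without weak compactness.\<close>

lemma linear_problem:
  assumes "\<nu> > 0" "Vsp_linear l" "K1 \<ge> 0" "K2 \<ge> 0"
    and b1: "\<And>\<phi>. \<phi> \<in> Vsp \<Longrightarrow> \<bar>l \<phi>\<bar> \<le> K1 * L2_norm (grad \<phi>)"
    and b2: "\<And>v H \<psi> R L. H1_approx v H \<psi> \<Longrightarrow> R \<ge> 0 \<Longrightarrow> (\<And>h. L2_norm (\<lambda>x. H (x + h) - H x) \<le> R * norm h) \<Longrightarrow>
      (\<lambda>n. l (\<psi> n)) \<longlonglongrightarrow> L \<Longrightarrow> \<bar>L\<bar> \<le> K2 * R"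
  shows "\<exists>u G. H1 u G \<and> (\<forall>\<phi>\<in>Vsp. \<nu> * (\<integral>x. G x \<bullet> grad \<phi> x \<partial>lborel) = l \<phi>) \<and>
    L2_norm G \<le> K1 / \<nu> \<and> L2_norm u \<le> K2 / \<nu>"
proof -
  define e :: "nat \<Rightarrow> real" where "e k = 1 / real (Suc k)" for k
  have e0: "e k > 0" "e k \<le> 1" for k by (auto simp: e_def)
  have ez: "e \<longlonglongrightarrow> 0" unfolding e_def using LIMSEQ_inverse_real_of_nat by (simp add: inverse_eq_divide)
  have "\<exists>p. H1 (fst p) (snd p) \<and> (\<forall>\<phi>\<in>Vsp. energy_form (e k) \<nu> (fst p) (snd p) \<phi> (grad \<phi>) = l \<phi>) \<and>
    L2_norm (snd p) \<le> K1 / \<nu> \<and> L2_norm (fst p) \<le> K2 / \<nu>" for k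
  proof -
    have "\<exists>u G. H1 u G \<and> (\<forall>\<phi>\<in>Vsp. energy_form (e k) \<nu> u G \<phi> (grad \<phi>) = l \<phi>) \<and>
      L2_norm G \<le> K1 / \<nu> \<and> L2_norm u \<le> K2 / \<nu>"
    proof (rule regularized_problem[OF e0(1) assms(1-3)])
      show "\<bar>l \<phi>\<bar> \<le> K1 * L2_norm (grad \<phi>)" if "\<phi> \<in> Vsp" for \<phi> using that by (rule b1)
      show "\<bar>L\<bar> \<le> K2 * R" if "H1_approx v H \<psi>" "R \<ge> 0" "\<And>h. L2_norm (\<lambda>x. H (x + h) - H x) \<le> R * norm h"
        "(\<lambda>n. l (\<psi> n)) \<longlonglongrightarrow> L" for v H \<psi> R L using that by (rule b2)
    qed (rule assms(4))
    then obtain u G where "H1 u G" "\<forall>\<phi>\<in>Vsp. energy_form (e k) \<nu> u G \<phi> (grad \<phi>) = l \<phi>"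
      "L2_norm G \<le> K1 / \<nu>" "L2_norm u \<le> K2 / \<nu>" by blast
    then show ?thesis by (intro exI[of _ "(u, G)"]) auto
  qed
  then have "\<exists>p. \<forall>k. H1 (fst (p k)) (snd (p k)) \<and> (\<forall>\<phi>\<in>Vsp. energy_form (e k) \<nu> (fst (p k)) (snd (p k)) \<phi> (grad \<phi>) = l \<phi>) \<and>
    L2_norm (snd (p k)) \<le> K1 / \<nu> \<and> L2_norm (fst (p k)) \<le> K2 / \<nu>" by (intro choice allI)
  then obtain p where p: "\<And>k. H1 (fst (p k)) (snd (p k))"
    "\<And>k \<phi>. \<phi> \<in> Vsp \<Longrightarrow> energy_form (e k) \<nu> (fst (p k)) (snd (p k)) \<phi> (grad \<phi>) = l \<phi>"
    "\<And>k. L2_norm (snd (p k)) \<le> K1 / \<nu>" "\<And>k. L2_norm (fst (p k)) \<le> K2 / \<nu>" by blast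
  define u where "u k = fst (p k)" for k
  define G where "G k = snd (p k)" for k
  have H: "H1 (u k) (G k)" and eq: "\<phi> \<in> Vsp \<Longrightarrow> energy_form (e k) \<nu> (u k) (G k) \<phi> (grad \<phi>) = l \<phi>"
    and G1: "L2_norm (G k) \<le> K1 / \<nu>" and u2: "L2_norm (u k) \<le> K2 / \<nu>" for k \<phi>
    using p by (auto simp: u_def G_def)
  note L = H1_L2[OF H]
  have key: "(L2_norm (\<lambda>x. u j x - u k x))\<^sup>2 \<le> (L2_norm (u k))\<^sup>2 - (L2_norm (u j))\<^sup>2 \<and>
    \<nu> * (L2_norm (\<lambda>x. G j x - G k x))\<^sup>2 \<le> K2 / \<nu> * L2_norm (\<lambda>x. u j x - u k x)" if "j \<le> k" for j k
  proof (cases "j = k")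
    case True then show ?thesis by simp
  next
    case False
    then have lt: "e k < e j" using that by (simp add: e_def field_simps)
    define w W where "w = (\<lambda>x. u j x - u k x)" and "W = (\<lambda>x. G j x - G k x)"
    have wW: "H1 w W" unfolding w_def W_def by (intro H1_diff H)
    note wL = H1_L2[OF wW]
    obtain \<psi> where c: "H1_approx w W \<psi>" using wW by (auto simp: H1_def)
    \<comment> \<open>Both regularized equations have the same right-hand side \<open>l\<close>, so
      their left-hand sides agree at the difference \<open>w\<close> of the solutions.\<close>
    have "energy_form (e j) \<nu> (u j) (G j) w W = energy_form (e k) \<nu> (u k) (G k) w W"
      by (rule LIMSEQ_unique[OF energy_form_test_limit[OF L eq c] energy_form_test_limit[OF L eq c]])
    moreover have "(\<integral>x. G j x \<bullet> W x \<partial>lborel) - (\<integral>x. G k x \<bullet> W x \<partial>lborel) = (L2_norm W)\<^sup>2"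
      using L2_inner_diff(2)[OF L(2) L(2) wL(2), of j k] L2_norm_sq_inner[OF wL(2)] by (simp add: W_def)
    then have "\<nu> * (\<integral>x. G j x \<bullet> W x \<partial>lborel) = \<nu> * (\<integral>x. G k x \<bullet> W x \<partial>lborel) + \<nu> * (L2_norm W)\<^sup>2"
      by (simp add: algebra_simps)
    moreover have uw: "(\<integral>x. u k x \<bullet> w x \<partial>lborel) = (\<integral>x. u j x \<bullet> w x \<partial>lborel) - (L2_norm w)\<^sup>2"
      using L2_inner_diff(2)[OF L(1) L(1) wL(1), of j k] L2_norm_sq_inner[OF wL(1)] by (simp add: w_def)
    ultimately have id: "\<nu> * (L2_norm W)\<^sup>2 + e k * (L2_norm w)\<^sup>2 = - ((e j - e k) * (\<integral>x. u j x \<bullet> w x \<partial>lborel))"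
      unfolding energy_form_def uw by (simp add: algebra_simps)
    \<comment> \<open>The left-hand side of \<open>id\<close> is nonnegative, which fixes the sign
      of the pairing of \<open>u j\<close> with \<open>w\<close>. Expanding \<open>u k\<close> =
      \<open>u j\<close> - \<open>w\<close> then gives both the monotonicity of the norms and the
      bound for the squared distance.\<close>
    have "(e j - e k) * (\<integral>x. u j x \<bullet> w x \<partial>lborel) \<le> 0"
      using id e0[of k] assms(1) by (smt (verit) mult_nonneg_nonneg zero_le_power2)
    then have neg: "(\<integral>x. u j x \<bullet> w x \<partial>lborel) \<le> 0" using lt by (simp add: mult_le_0_iff)
    have "(L2_norm (u k))\<^sup>2 = (L2_norm (\<lambda>x. u j x + (-1) *\<^sub>R w x))\<^sup>2" by (simp add: w_def)
    also have "\<dots> = (L2_norm (u j))\<^sup>2 - 2 * (\<integral>x. u j x \<bullet> w x \<partial>lborel) + (L2_norm w)\<^sup>2"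
      by (subst L2_norm_sq_add[OF L(1) L2_scale[OF wL(1)]]) (simp add: L2_norm_uminus)
    finally have 1: "(L2_norm w)\<^sup>2 \<le> (L2_norm (u k))\<^sup>2 - (L2_norm (u j))\<^sup>2" using neg by linarith
    have "\<nu> * (L2_norm W)\<^sup>2 \<le> - ((e j - e k) * (\<integral>x. u j x \<bullet> w x \<partial>lborel))"
      using id e0[of k] by (smt (verit) mult_nonneg_nonneg zero_le_power2)
    also have "\<dots> = (e j - e k) * - (\<integral>x. u j x \<bullet> w x \<partial>lborel)" by simp
    also have "\<dots> \<le> 1 * (L2_norm (u j) * L2_norm w)"
      using e0[of j] e0[of k] lt neg L2_Cauchy_Schwarz[OF L(1) wL(1), of j] by (intro mult_mono) auto
    also have "\<dots> \<le> K2 / \<nu> * L2_norm w" using mult_right_mono[OF u2[of j] L2_norm_nonneg[of w]] by simp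
    finally show ?thesis using 1 by (simp add: w_def W_def)
  qed
  define n where "n k = (L2_norm (u k))\<^sup>2" for k
  have "incseq n"
  proof (rule incseq_SucI)
    fix k show "n k \<le> n (Suc k)"
      unfolding n_def
      using conjunct1[OF key[of k "Suc k"]] zero_le_power2[of "L2_norm (\<lambda>x. u k x - u (Suc k) x)"] by linarith
  qed
  moreover have "n k \<le> (K2 / \<nu>)\<^sup>2" for k unfolding n_def by (intro power_mono u2) auto
  ultimately obtain n\<^sub>0 where "n \<longlonglongrightarrow> n\<^sub>0"
    using incseq_convergent[of n "(K2 / \<nu>)\<^sup>2"] by blast
  then have "Cauchy n" by (rule LIMSEQ_imp_Cauchy)
  then have nC: "\<exists>N. \<forall>i\<ge>N. \<forall>j\<ge>N. \<bar>n i - n j\<bar> < d" if "d > 0" for d :: real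
    using that unfolding Cauchy_def by (auto simp: dist_real_def)
  have uC: "\<exists>N. \<forall>i\<ge>N. \<forall>j\<ge>N. L2_norm (\<lambda>x. u i x - u j x) < d" if "d > 0" for d :: real
  proof -
    have "d\<^sup>2 > 0" using that by simp
    from nC[OF this] obtain N where N: "\<And>i j. i \<ge> N \<Longrightarrow> j \<ge> N \<Longrightarrow> \<bar>n i - n j\<bar> < d\<^sup>2" by blast
    have "L2_norm (\<lambda>x. u i x - u j x) < d" if "i \<ge> N" "j \<ge> N" "i \<le> j" for i j
    proof -
      have "(L2_norm (\<lambda>x. u i x - u j x))\<^sup>2 < d\<^sup>2"
        using key[OF that(3)] N[OF that(1,2)] by (auto simp: n_def)
      then show ?thesis using \<open>d > 0\<close> by (auto intro: power2_less_imp_less)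
    qed
    note le = this
    have "L2_norm (\<lambda>x. u i x - u j x) < d" if "i \<ge> N" "j \<ge> N" for i j
    proof (cases "i \<le> j")
      case True show ?thesis by (rule le[OF that True])
    next
      case False
      then have "j \<le> i" by simp
      from le[OF that(2,1) this] show ?thesis using L2_norm_minus_commute[of "u i" "u j"] by linarith
    qed
    then show ?thesis by blast
  qed
  have GC: "\<exists>N. \<forall>i\<ge>N. \<forall>j\<ge>N. L2_norm (\<lambda>x. G i x - G j x) < d" if "d > 0" for d :: real
  proof -
    \<comment> \<open>The summand 1 keeps the denominator positive also for \<open>K2\<close> =
      0.\<close>
    define c where "c = \<nu> * d\<^sup>2 / (K2 / \<nu> + 1)"
    have K: "K2 / \<nu> + 1 > 0" using assms by (intro add_nonneg_pos) auto
    then have "c > 0" using that assms by (simp add: c_def)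
    then obtain N where N: "\<And>i j. i \<ge> N \<Longrightarrow> j \<ge> N \<Longrightarrow> L2_norm (\<lambda>x. u i x - u j x) < c" using uC by blast
    have "L2_norm (\<lambda>x. G i x - G j x) < d" if "i \<ge> N" "j \<ge> N" "i \<le> j" for i j
    proof -
      have "\<nu> * (L2_norm (\<lambda>x. G i x - G j x))\<^sup>2 \<le> K2 / \<nu> * L2_norm (\<lambda>x. u i x - u j x)" using key[OF that(3)] by simp
      also have "\<dots> \<le> (K2 / \<nu> + 1) * L2_norm (\<lambda>x. u i x - u j x)" by (intro mult_right_mono) auto
      also have "\<dots> < (K2 / \<nu> + 1) * c" by (intro mult_strict_left_mono N that K)
      also have "\<dots> = \<nu> * d\<^sup>2" using K by (simp add: c_def)
      finally have "(L2_norm (\<lambda>x. G i x - G j x))\<^sup>2 < d\<^sup>2" using assms by simp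
      then show ?thesis using \<open>d > 0\<close> by (auto intro: power2_less_imp_less)
    qed
    note le = this
    have "L2_norm (\<lambda>x. G i x - G j x) < d" if "i \<ge> N" "j \<ge> N" for i j
    proof (cases "i \<le> j")
      case True show ?thesis by (rule le[OF that True])
    next
      case False
      then have "j \<le> i" by simp
      from le[OF that(2,1) this] show ?thesis using L2_norm_minus_commute[of "G i" "G j"] by linarith
    qed
    then show ?thesis by blast
  qed
  obtain U where U: "U \<in> L2" "(\<lambda>k. L2_norm (\<lambda>x. u k x - U x)) \<longlonglongrightarrow> 0" using L2_complete[OF L(1) uC] by blast
  obtain K where K: "K \<in> L2" "(\<lambda>k. L2_norm (\<lambda>x. G k x - K x)) \<longlonglongrightarrow> 0" using L2_complete[OF L(2) GC] by blast
  have "H1 U K" by (rule H1_closed[OF H U(1) K(1) U(2) K(2)])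
  moreover have "\<nu> * (\<integral>x. K x \<bullet> grad \<phi> x \<partial>lborel) = l \<phi>" if "\<phi> \<in> Vsp" for \<phi>
  proof -
    have "(\<lambda>k. energy_form (e k) \<nu> (u k) (G k) \<phi> (grad \<phi>)) \<longlonglongrightarrow> 0 * (\<integral>x. U x \<bullet> \<phi> x \<partial>lborel) + \<nu> * (\<integral>x. K x \<bullet> grad \<phi> x \<partial>lborel)"
      unfolding energy_form_def
      by (intro tendsto_intros ez L2_inner_tendsto L U K Vsp_L2 Vsp_grad_L2 that) simp_all
    then show ?thesis using eq[OF that] by (simp add: LIMSEQ_const_iff)
  qed
  moreover have "L2_norm K \<le> K1 / \<nu>"
    using LIMSEQ_le_const2[OF L2_norm_tendsto[OF L(2) K]] G1 by blast
  moreover have "L2_norm U \<le> K2 / \<nu>"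
    using LIMSEQ_le_const2[OF L2_norm_tendsto[OF L(1) U]] u2 by blast
  ultimately show ?thesis by blast
qed

section \<open>The convective term as a right-hand side\<close>

lemma L6_dominated:
  assumes "v \<in> L6" "u \<in> borel_measurable borel" "\<And>x. norm (u x) \<le> norm (v x)"
  shows "u \<in> L6 \<and> L6_norm u \<le> L6_norm v"
proof (subst L6_norm_le_iff[symmetric])
  have "Lp_int 6 u \<le> Lp_int 6 v" using assms(3) by (intro Lp_int_mono) auto
  then show "Lp_int 6 u \<le> ennreal (L6_norm v ^ 6)" using Lp_int_6_eq[OF assms(1)] by simp
qed (use assms in auto)

text \<open>A difference quotient of \<open>v\<close> is an \<open>H1\<close> field whose gradient,
  the quotient of \<open>G\<close>, is bounded by R. The Sobolev inequality bounds the quotients in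
  L^6, and Fatou's lemma transfers the bound to each column of \<open>G\<close>.\<close>

lemma gradient_L6:
  assumes "H1 v G" "R \<ge> 0" "\<And>h. L2_norm (\<lambda>x. G (x + h) - G x) \<le> R * norm h"
  shows "G \<in> L6 \<and> L6_norm G \<le> 70 * R"
proof -
  define t :: "nat \<Rightarrow> real" where "t n = 1 / real (Suc n)" for n
  have t: "t n \<noteq> 0" "\<bar>t n\<bar> \<le> 1" "t n > 0" for n by (auto simp: t_def)
  have t0: "t \<longlonglongrightarrow> 0" unfolding t_def using LIMSEQ_inverse_real_of_nat by (simp add: inverse_eq_divide)
  note L = H1_L2[OF assms(1)]
  note [measurable] = L2_measurable[OF L(1)] L2_measurable[OF L(2)]
  have col: "(\<lambda>x. G x *v axis j 1) \<in> L6 \<and> L6_norm (\<lambda>x. G x *v axis j 1) \<le> 7 * R" for j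
  proof -
    let ?D = "\<lambda>n. diff_quot (axis j 1) (t n) v"
    have H: "H1 (?D n) (diff_quot (axis j 1) (t n) G)" for n
    proof -
      have "H1 (\<lambda>x. 0 + inverse (t n) *\<^sub>R (v (x + t n *\<^sub>R axis j 1) - v x)) (\<lambda>x. 0 + inverse (t n) *\<^sub>R (G (x + t n *\<^sub>R axis j 1) - G x))"
        by (intro H1_add_scaleR H1_zero H1_diff H1_translate assms)
      then show ?thesis by (simp add: diff_quot_def[abs_def])
    qed
    have b: "L6_norm (?D n) \<le> 7 * R" for n
    proof -
      have "L2_norm (diff_quot (axis j 1) (t n) G) = inverse (t n) * L2_norm (\<lambda>x. G (x + t n *\<^sub>R axis j 1) - G x)"
        unfolding diff_quot_def using t(3)[of n] by (subst L2_norm_scale) (auto intro!: L2_diff L2_translate L)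
      also have "\<dots> \<le> inverse (t n) * (R * norm (t n *\<^sub>R (axis j 1 :: R3)))"
        using t(3)[of n] by (intro mult_left_mono assms(3)) auto
      also have "\<dots> = R" using t(3)[of n] by (simp)
      finally show ?thesis using H1_L6(2)[OF H, of n] by linarith
    qed
    have "(\<lambda>n. L2_norm (\<lambda>x. ?D n x - G x *v axis j 1)) \<longlonglongrightarrow> 0"
      by (rule H1_diff_quot_tendsto[OF assms(1) t(1,2) t0])
    then have "(\<lambda>n. Lp_int 2 (\<lambda>x. ?D n x - G x *v axis j 1)) \<longlonglongrightarrow> 0"
      by (subst L2_tendsto_iff) (auto intro: diff_quot_L2 L2_matrix_vector L)
    then obtain r where r: "strict_mono r" "AE x in lborel. (\<lambda>n. ?D (r n) x) \<longlonglongrightarrow> G x *v axis j 1"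
      using Lp_int_AE_subseq[of ?D "\<lambda>x. G x *v axis j 1" 2] L2_measurable[OF diff_quot_L2[OF L(1)]] by auto
    show ?thesis
    proof (subst L6_norm_le_iff[symmetric])
      show "Lp_int 6 (\<lambda>x. G x *v axis j 1) \<le> ennreal ((7 * R)^6)"
      proof (rule Lp_int_Fatou[OF _ r(2)])
        show "Lp_int 6 (?D (r n)) \<le> ennreal ((7 * R)^6)" for n
          using L6_norm_le_iff[of "?D (r n)" "7 * R"] b H1_L6(1)[OF H] assms(2) L6_measurable[OF H1_L6(1)[OF H]] by simp
      qed (use L6_measurable[OF H1_L6(1)[OF H]] in auto)
    qed (use assms in auto)
  qed
  let ?c = "\<lambda>j x. norm (G x *v axis j 1)"
  have c: "?c j \<in> L6 \<and> L6_norm (?c j) \<le> 7 * R" for j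
    using L6_dominated[OF conjunct1[OF col[of j]], of "?c j"] col[of j] by auto
  \<comment> \<open>The factor 2 of \<open>L6_add\<close> enters twice: 2 (7 + 7) = 28 here and 2 (7
    + 28) = 70 in the next step.\<close>
  have 23: "(\<lambda>x. ?c 2 x + ?c 3 x) \<in> L6 \<and> L6_norm (\<lambda>x. ?c 2 x + ?c 3 x) \<le> 28 * R"
    using L6_add[OF conjunct1[OF c] conjunct1[OF c], of 2 3] c[of 2] c[of 3] by auto
  have 123: "(\<lambda>x. ?c 1 x + (?c 2 x + ?c 3 x)) \<in> L6 \<and> L6_norm (\<lambda>x. ?c 1 x + (?c 2 x + ?c 3 x)) \<le> 70 * R"
    using L6_add[OF conjunct1[OF c] conjunct1[OF 23], of 1] c[of 1] 23 by auto
  have "norm A \<le> norm (A *v axis 1 1) + (norm (A *v axis 2 1) + norm (A *v axis 3 1))" for A :: "real^3^3"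
  proof -
    let ?n = "\<lambda>j. norm (A *v axis j 1)"
    have "(A *v axis j 1) $ i = A $ i $ j" for i j
      by (simp add: matrix_vector_mult_def axis_def if_distrib cong: if_cong)
    then have "(norm A)\<^sup>2 = (\<Sum>j\<in>UNIV. (?n j)\<^sup>2)"
      unfolding norm_matrix_sq norm_R3_sq by (subst sum.swap) simp
    also have "\<dots> = (?n 1)\<^sup>2 + (?n 2)\<^sup>2 + (?n 3)\<^sup>2" by (simp add: sum_3)
    also have "\<dots> \<le> (?n 1 + (?n 2 + ?n 3))\<^sup>2" by (simp add: power2_sum)
    finally show ?thesis by (rule power2_le_imp_le) simp
  qed
  then show ?thesis using L6_dominated[OF conjunct1[OF 123], of G] 123 by fastforce
qed

definition H1_norm :: "(R3 \<Rightarrow> R3) \<Rightarrow> (R3 \<Rightarrow> real^3^3) \<Rightarrow> real" where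
  "H1_norm u G = L2_norm u + L2_norm G"

lemma H1_norm_nonneg [simp]: "H1_norm u G \<ge> 0" by (simp add: H1_norm_def)

lemma H1_L3_bound: assumes "H1 u G" shows "L3_bound u \<le> 7 * H1_norm u G" "L6_norm u \<le> 7 * H1_norm u G"
proof -
  have 6: "L6_norm u \<le> 7 * H1_norm u G" by (rule order_trans[OF H1_L6(2)[OF assms]]) (simp add: H1_norm_def)
  have 2: "L2_norm u \<le> 7 * H1_norm u G" unfolding H1_norm_def distrib_left using L2_norm_nonneg[of u] L2_norm_nonneg[of G] by linarith
  have "L2_norm u * L6_norm u \<le> (7 * H1_norm u G) * (7 * H1_norm u G)" using 2 6 by (intro mult_mono) auto
  then have "L3_bound u \<le> sqrt ((7 * H1_norm u G) * (7 * H1_norm u G))" unfolding L3_bound_def by (rule real_sqrt_le_mono)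
  also have "sqrt ((7 * H1_norm u G) * (7 * H1_norm u G)) = 7 * H1_norm u G"
    by (metis abs_of_nonneg mult_nonneg_nonneg H1_norm_nonneg real_sqrt_abs2 zero_le_numeral)
  finally show "L3_bound u \<le> 7 * H1_norm u G" .
  show "L6_norm u \<le> 7 * H1_norm u G" by fact
qed

lemma Vsp_Hdot1_approx: "\<phi> \<in> Vsp \<Longrightarrow> Hdot1_approx \<phi> (grad \<phi>) (\<lambda>n. \<phi>)"
proof -
  assume "\<phi> \<in> Vsp"
  moreover have "L6_norm (\<lambda>x::R3. 0 :: R3) = 0" by (simp add: L6_norm_def Lp_int_def)
  ultimately show ?thesis by (auto simp: Hdot1_approx_def Vsp_L6 Vsp_grad_L2)
qed

text \<open>Antisymmetry moves the derivative from \<open>b\<close> to the test field. For a field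
  whose gradient has difference quotients bounded by R, the gradient is then in L^6 with norm at
  most 70 R, and the exponent 3 on \<open>a\<close> costs another 7, hence 490. The bound by the
  gradient norm has 7 * 7 and is stated with the same constant.\<close>

lemma convection_functional:
  assumes a: "H1 a A" and b: "H1 b B"
  shows "\<phi> \<in> Vsp \<Longrightarrow> \<bar>convection a B \<phi>\<bar> \<le> 490 * (H1_norm a A * H1_norm b B) * L2_norm (grad \<phi>)"
    and "H1_approx v G \<psi> \<Longrightarrow> R \<ge> 0 \<Longrightarrow> (\<And>h. L2_norm (\<lambda>x. G (x + h) - G x) \<le> R * norm h) \<Longrightarrow>
      (\<lambda>n. convection a B (\<psi> n)) \<longlonglongrightarrow> L \<Longrightarrow> \<bar>L\<bar> \<le> 490 * (H1_norm a A * H1_norm b B) * R"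
    and "Vsp_linear (convection a B)"
proof -
  note aL = H1_L2(1)[OF a] H1_L6(1)[OF a] and bL = H1_L2[OF b]
  obtain \<beta> where \<beta>: "Hdot1_approx b B \<beta>" using b H1_approx_imp_Hdot1_approx(1) by (auto simp: H1_def)
  show "\<bar>convection a B \<phi>\<bar> \<le> 490 * (H1_norm a A * H1_norm b B) * L2_norm (grad \<phi>)" if "\<phi> \<in> Vsp"
  proof -
    have "\<bar>convection a B \<phi>\<bar> = \<bar>convection a (grad \<phi>) b\<bar>"
      using convection_antisym[OF aL H1_wdiv_free[OF a] \<beta> Vsp_Hdot1_approx[OF that]] by simp
    also have "\<dots> \<le> L2_norm (grad \<phi>) * L3_bound a * L6_norm b" by (intro convection_bound aL Vsp_grad_L2 that H1_L6(1)[OF b])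
    also have "\<dots> \<le> L2_norm (grad \<phi>) * (7 * H1_norm a A) * (7 * H1_norm b B)"
      by (intro mult_mono mult_left_mono H1_L3_bound a b) auto
    also have "\<dots> \<le> 490 * (H1_norm a A * H1_norm b B) * L2_norm (grad \<phi>)" by simp
    finally show ?thesis .
  qed
  show "Vsp_linear (convection a B)" unfolding Vsp_linear_def using convection_add_scaleR_v[OF aL bL(2)] Vsp_L6 by blast
  show "\<bar>L\<bar> \<le> 490 * (H1_norm a A * H1_norm b B) * R"
    if v: "H1_approx v G \<psi>" and R: "R \<ge> 0" "\<And>h. L2_norm (\<lambda>x. G (x + h) - G x) \<le> R * norm h"
      and lim: "(\<lambda>n. convection a B (\<psi> n)) \<longlonglongrightarrow> L"
  proof -
    note c = H1_approx_imp_Hdot1_approx(1)[OF v]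
    have vG: "H1 v G" using v by (auto simp: H1_def)
    have "(\<lambda>n. convection a B (\<psi> n)) \<longlonglongrightarrow> convection a B v"
      by (intro convection_tendsto aL bL Hdot1_approxD[OF c]) auto
    then have "L = convection a B v" using lim LIMSEQ_unique by blast
    then have "\<bar>L\<bar> = \<bar>convection a G b\<bar>" using convection_antisym[OF aL H1_wdiv_free[OF a] \<beta> c] by simp
    also have "\<dots> \<le> L2_norm b * L3_bound a * L6_norm G"
      by (intro convection_bound' aL bL conjunct1[OF gradient_L6[OF vG R]])
    also have "\<dots> \<le> H1_norm b B * (7 * H1_norm a A) * (70 * R)"
      using gradient_L6[OF vG R] R(1) by (intro mult_mono H1_L3_bound a mult_nonneg_nonneg) (auto simp: H1_norm_def)
    finally show ?thesis by (simp add: mult_ac)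
  qed
qed

section \<open>The spectral gap\<close>

text \<open>Truncation to a ball makes an L^2 function integrable, so the integral defining its
  transform converges absolutely.\<close>

definition trunc_transform :: "(R3 \<Rightarrow> real) \<Rightarrow> real \<Rightarrow> R3 \<Rightarrow> complex" where
  "trunc_transform f R \<xi> = (\<integral>x. (indicator (cball 0 R) x * f x) *\<^sub>R cis (- 2 * pi * (x \<bullet> \<xi>)) \<partial>lborel)"

text \<open>The vanishing of the L^2 Fourier transform on the ball of radius \<open>r\<close>,
  expressed by the truncated transforms alone. In this form it can be followed through
  multiplication by a kernel without Plancherel's theorem.\<close>

definition spectral_gap :: "real \<Rightarrow> (R3 \<Rightarrow> real) \<Rightarrow> bool" where
  "spectral_gap r f \<longleftrightarrow> f \<in> L2 \<and>
     ((\<lambda>R. \<integral>\<^sup>+\<xi>. indicator (ball 0 r) \<xi> * ennreal ((norm (trunc_transform f R \<xi>))\<^sup>2) \<partial>lborel) \<longlongrightarrow> 0) at_top"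

lemma borel_measurable_cis [measurable (raw)]:
  "f \<in> borel_measurable M \<Longrightarrow> (\<lambda>x. cis (f x)) \<in> borel_measurable M"
  by (rule borel_measurable_continuous_on[of cis]) (auto intro!: continuous_intros)

lemma sets_borel_balls [measurable]:
  fixes c :: R3
  shows "ball c r \<in> sets borel" "cball c r \<in> sets borel"
  by auto

lemma borel_measurable_trunc_transform [measurable (raw)]:
  assumes [measurable]: "f \<in> borel_measurable borel" "g \<in> borel_measurable M"
  shows "(\<lambda>x. trunc_transform f R (g x)) \<in> borel_measurable M"
proof -
  define k where "k x = indicator (cball 0 R) x * f x" for x
  have [measurable]: "k \<in> borel_measurable borel" unfolding k_def by measurable
  have "trunc_transform f R \<in> borel_measurable borel" unfolding trunc_transform_def[abs_def] k_def[symmetric] by measurable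
  then show ?thesis by measurable
qed

lemma L2_component:
  fixes u :: "R3 \<Rightarrow> R3"
  assumes "u \<in> L2" shows "(\<lambda>x. u x $ i) \<in> L2"
  using L2_dominated[OF assms, of "\<lambda>x. u x $ i" 1] L2_measurable[OF assms] by (simp add: component_le_norm_cart)

lemma Xsp_L2: "f \<in> Xsp \<Longrightarrow> f \<in> L2"
  by (simp add: Xsp_def L2sig_def)

text \<open>On the ball of radius \<rho> the transform vanishes almost everywhere, so there the
  truncated transform coincides with its distance to the limit.\<close>

lemma assumptionA_spectral_gap:
  assumes "assumptionA \<rho> f"
  shows "spectral_gap \<rho> (\<lambda>x. f x $ i)"
proof -
  have fL: "f \<in> L2" using assms by (simp add: assumptionA_def Xsp_L2)
  obtain F where F: "is_fourier_L2 f F" "AE \<xi> in lborel. norm \<xi> < \<rho> \<longrightarrow> (\<forall>i. F i \<xi> = 0)"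
    using assms by (auto simp: assumptionA_def)
  have tr: "trunc_fourier f i R \<xi> = trunc_transform (\<lambda>x. f x $ i) R \<xi>" for R \<xi> by (simp add: trunc_fourier_def trunc_transform_def)
  have lim: "((\<lambda>R. Lp_int 2 (\<lambda>\<xi>. trunc_transform (\<lambda>x. f x $ i) R \<xi> - F i \<xi>)) \<longlongrightarrow> 0) at_top"
    using F(1)[unfolded is_fourier_L2_def, rule_format, of i] unfolding tr by blast
  have "((\<lambda>R. \<integral>\<^sup>+\<xi>. indicator (ball 0 \<rho>) \<xi> * ennreal ((norm (trunc_transform (\<lambda>x. f x $ i) R \<xi>))\<^sup>2) \<partial>lborel) \<longlongrightarrow> 0) at_top"
  proof (rule tendsto_sandwich[OF _ _ tendsto_const lim])
    show "\<forall>\<^sub>F R in at_top. (\<integral>\<^sup>+\<xi>. indicator (ball 0 \<rho>) \<xi> * ennreal ((norm (trunc_transform (\<lambda>x. f x $ i) R \<xi>))\<^sup>2) \<partial>lborel)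
      \<le> Lp_int 2 (\<lambda>\<xi>. trunc_transform (\<lambda>x. f x $ i) R \<xi> - F i \<xi>)"
      unfolding Lp_int_2
    proof (rule always_eventually, rule allI, rule nn_integral_mono_AE)
      fix R
      show "AE \<xi> in lborel. indicator (ball 0 \<rho>) \<xi> * ennreal ((norm (trunc_transform (\<lambda>x. f x $ i) R \<xi>))\<^sup>2)
        \<le> ennreal ((norm (trunc_transform (\<lambda>x. f x $ i) R \<xi> - F i \<xi>))\<^sup>2)"
        using F(2) by eventually_elim (auto simp: indicator_def)
    qed
  qed auto
  then show ?thesis using L2_component[OF fL] by (simp add: spectral_gap_def)
qed

text \<open>The Fourier transform of the indicator function of \<open>{-a..a}\<close>.\<close>

definition box_kernel :: "real \<Rightarrow> real \<Rightarrow> real" where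
  "box_kernel a t = (if t = 0 then 2 * a else sin (2 * pi * a * t) / (pi * t))"

lemma box_kernel_integral:
  assumes "a \<ge> 0"
  shows "complex_of_real (box_kernel a t) = (\<integral>s. indicator {-a..a} s *\<^sub>R cis (- 2 * pi * (t * s)) \<partial>lborel)"
proof (cases "t = 0")
  case True
  have "(\<integral>s. indicator {-a..a} s *\<^sub>R (1 :: complex) \<partial>lborel) = measure lborel {-a..a} *\<^sub>R 1"
    by (subst integral_scaleR_left) (auto intro!: integrable_real_indicator simp: emeasure_lborel_Icc_eq)
  then show ?thesis using True assms by (simp add: box_kernel_def scaleR_conv_of_real)
next
  case False
  define c where "c = - 2 * pi * t"
  have c: "c \<noteq> 0" using False by (simp add: c_def)
  define F where "F s = cis (c * s) / (\<i> * c)" for s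
  have "has_bochner_integral lborel (\<lambda>s. indicator {-a..a} s *\<^sub>R cis (c * s)) (F a - F (-a))"
  proof (rule has_bochner_integral_FTC_Icc)
    fix s
    have "((\<lambda>s. exp (\<i> * c * s) / (\<i> * c)) has_vector_derivative exp (\<i> * c * s)) (at s within {-a..a})"
      using c by (intro has_vector_derivative_real_field) (auto intro!: derivative_eq_intros)
    then show "(F has_vector_derivative cis (c * s)) (at s within {-a..a})"
      by (simp add: F_def[abs_def] cis_conv_exp mult.assoc)
  qed (use assms in \<open>auto intro!: continuous_intros\<close>)
  then have "(\<integral>s. indicator {-a..a} s *\<^sub>R cis (c * s) \<partial>lborel) = F a - F (-a)"
    by (rule has_bochner_integral_integral_eq)
  also have "F a - F (-a) = of_real (2 * sin (c * a) / c)"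
    using c by (simp add: F_def complex_eq_iff Re_divide Im_divide power2_eq_square)
  also have "2 * sin (c * a) / c = box_kernel a t"
    using False by (simp add: box_kernel_def c_def field_simps)
  finally show ?thesis by (simp add: c_def mult.assoc)
qed

lemma box_kernel_bound1: "a \<ge> 0 \<Longrightarrow> \<bar>box_kernel a t\<bar> \<le> 2 * a"
proof -
  assume a: "a \<ge> 0"
  have "\<bar>sin (2 * pi * a * t)\<bar> \<le> \<bar>2 * pi * a * t\<bar>" by (rule abs_sin_x_le_abs_x)
  then show ?thesis using a by (auto simp: box_kernel_def abs_mult divide_le_eq mult_ac)
qed

lemma box_kernel_bound2: "(t * box_kernel a t)\<^sup>2 \<le> 1"
proof -
  have "\<bar>t * box_kernel a t\<bar> \<le> 1"
  proof (cases "t = 0")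
    case False
    then have "\<bar>t * box_kernel a t\<bar> = \<bar>sin (2 * pi * a * t)\<bar> / pi" by (simp add: box_kernel_def abs_mult)
    also have "\<dots> \<le> 1 / pi" by (intro divide_right_mono) auto
    also have "\<dots> \<le> 1" using pi_gt3 by simp
    finally show ?thesis .
  qed simp
  then show ?thesis using abs_square_le_1 by blast
qed

lemma box_kernel_measurable [measurable]: "box_kernel a \<in> borel_measurable borel"
  unfolding box_kernel_def[abs_def] by measurable

lemma box_kernel_minus: "box_kernel a (- t) = box_kernel a t"
  by (simp add: box_kernel_def)

lemma box_kernel_sq_bound: "a \<ge> 0 \<Longrightarrow> (1 + t\<^sup>2) * (box_kernel a t)\<^sup>2 \<le> 4 * a\<^sup>2 + 1"
proof -
  assume a: "a \<ge> 0"
  have "(box_kernel a t)\<^sup>2 \<le> (2 * a)\<^sup>2" using box_kernel_bound1[OF a, of t] by (metis abs_ge_zero power2_abs power_mono)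
  moreover have "t\<^sup>2 * (box_kernel a t)\<^sup>2 \<le> 1" using box_kernel_bound2[of t a] by (simp add: power_mult_distrib)
  ultimately show ?thesis by (simp add: algebra_simps)
qed

lemma trunc_transform_integrable:
  fixes f :: "R3 \<Rightarrow> real"
  assumes "f \<in> L2"
  shows "integrable lborel (\<lambda>x. indicator (cball 0 R) x * f x)"
proof -
  have "(\<lambda>x. indicator (cball 0 R) x :: real) \<in> L2"
  proof -
    have "(norm (indicator (cball 0 R) x :: real))\<^sup>2 = 1 * indicator (cball 0 R) x" for x :: R3 by (simp add: indicator_def)
    then show ?thesis using integrable_indicator_cball[of 1 0 R] by (simp add: L2_iff)
  qed
  from L2_inner_integrable[OF this assms] show ?thesis by simp
qed

text \<open>Multiplication in space becomes averaging in frequency: \<open>box_kernel\<close> is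
  written as an integral of characters, the order of integration is exchanged, and each character
  shifts the transform by s in direction i. The centre y only contributes a factor of modulus
  1.\<close>

lemma trunc_transform_box_kernel:
  fixes f :: "R3 \<Rightarrow> real"
  assumes "f \<in> L2" "a \<ge> 0"
  shows "trunc_transform (\<lambda>x. f x * box_kernel a (x $ i - y)) R \<xi> =
    (\<integral>s. indicator {-a..a} s *\<^sub>R (cis (2 * pi * (y * s)) * trunc_transform f R (\<xi> + s *\<^sub>R axis i 1)) \<partial>lborel)"
proof -
  note [measurable] = L2_measurable[OF assms(1)]
  define g where "g x = indicator (cball 0 R) x * f x" for x
  have [measurable]: "g \<in> borel_measurable borel" unfolding g_def by measurable
  let ?g = g
  let ?h = "\<lambda>x s. (indicator {-a..a} s * ?g x) *\<^sub>R (cis (- 2 * pi * ((x $ i - y) * s)) * cis (- 2 * pi * (x \<bullet> \<xi>)))"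
  have int: "integrable (lborel \<Otimes>\<^sub>M lborel) (\<lambda>(x, s). ?h x s)"
    unfolding integrable_iff_bounded
  proof
    show "(\<lambda>(x, s). ?h x s) \<in> borel_measurable (lborel \<Otimes>\<^sub>M lborel)" by measurable
    have "(\<integral>\<^sup>+p. ennreal (norm (case p of (x, s) \<Rightarrow> ?h x s)) \<partial>(lborel \<Otimes>\<^sub>M lborel))
       = (\<integral>\<^sup>+x. \<integral>\<^sup>+s. ennreal (norm (?h x s)) \<partial>lborel \<partial>lborel)"
      by (subst lborel.nn_integral_fst[symmetric]) (auto, measurable)
    also have "\<dots> = (\<integral>\<^sup>+x. \<integral>\<^sup>+s. ennreal \<bar>?g x\<bar> * indicator {-a..a} s \<partial>lborel \<partial>lborel)"
      by (intro nn_integral_cong) (auto simp: norm_mult abs_mult indicator_def)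
    also have "\<dots> = (\<integral>\<^sup>+x. ennreal \<bar>?g x\<bar> * ennreal (2 * a) \<partial>lborel)"
      using assms(2) by (intro nn_integral_cong) (simp add: nn_integral_cmult_indicator)
    also have "\<dots> = (\<integral>\<^sup>+x. ennreal (norm (?g x)) \<partial>lborel) * ennreal (2 * a)"
      by (subst nn_integral_multc) auto
    also have "\<dots> < \<infinity>"
      using trunc_transform_integrable[OF assms(1), of R] unfolding integrable_iff_bounded g_def by (simp add: ennreal_mult_less_top)
    finally show "(\<integral>\<^sup>+p. ennreal (norm (case p of (x, s) \<Rightarrow> ?h x s)) \<partial>(lborel \<Otimes>\<^sub>M lborel)) < \<infinity>" .
  qed
  have "trunc_transform (\<lambda>x. f x * box_kernel a (x $ i - y)) R \<xi> = (\<integral>x. \<integral>s. ?h x s \<partial>lborel \<partial>lborel)"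
    unfolding trunc_transform_def
  proof (intro Bochner_Integration.integral_cong refl)
    fix x
    have "(\<integral>s. ?h x s \<partial>lborel) = (\<integral>s. (?g x *\<^sub>R cis (- 2 * pi * (x \<bullet> \<xi>))) * (indicator {-a..a} s *\<^sub>R cis (- 2 * pi * ((x $ i - y) * s))) \<partial>lborel)"
      by (intro Bochner_Integration.integral_cong refl) (simp add: indicator_def)
    also have "\<dots> = (?g x *\<^sub>R cis (- 2 * pi * (x \<bullet> \<xi>))) * complex_of_real (box_kernel a (x $ i - y))"
      unfolding box_kernel_integral[OF assms(2)] by (rule integral_mult_right_zero)
    finally have e: "(\<integral>s. ?h x s \<partial>lborel) = (?g x *\<^sub>R cis (- 2 * pi * (x \<bullet> \<xi>))) * complex_of_real (box_kernel a (x $ i - y))" .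
    show "(indicator (cball 0 R) x * (f x * box_kernel a (x $ i - y))) *\<^sub>R cis (- 2 * pi * (x \<bullet> \<xi>)) = (\<integral>s. ?h x s \<partial>lborel)"
      unfolding e by (simp add: scaleR_conv_of_real mult_ac g_def)
  qed
  also have "\<dots> = (\<integral>s. \<integral>x. ?h x s \<partial>lborel \<partial>lborel)"
    using lborel_pair.Fubini_integral[OF int] by simp
  also have "\<dots> = (\<integral>s. indicator {-a..a} s *\<^sub>R (cis (2 * pi * (y * s)) * trunc_transform f R (\<xi> + s *\<^sub>R axis i 1)) \<partial>lborel)"
  proof (intro Bochner_Integration.integral_cong refl)
    fix s
    have "(\<integral>x. ?h x s \<partial>lborel) = (\<integral>x. (indicator {-a..a} s *\<^sub>R cis (2 * pi * (y * s))) * (?g x *\<^sub>R cis (- 2 * pi * (x \<bullet> (\<xi> + s *\<^sub>R axis i 1)))) \<partial>lborel)"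
    proof (intro Bochner_Integration.integral_cong refl)
      fix x
      have "cis (- 2 * pi * ((x $ i - y) * s)) * cis (- 2 * pi * (x \<bullet> \<xi>)) = cis (2 * pi * (y * s)) * cis (- 2 * pi * (x \<bullet> (\<xi> + s *\<^sub>R axis i 1)))"
        unfolding cis_mult by (simp add: inner_add_right inner_axis algebra_simps)
      then show "?h x s = (indicator {-a..a} s *\<^sub>R cis (2 * pi * (y * s))) * (?g x *\<^sub>R cis (- 2 * pi * (x \<bullet> (\<xi> + s *\<^sub>R axis i 1))))"
        by simp
    qed
    also have "\<dots> = (indicator {-a..a} s *\<^sub>R cis (2 * pi * (y * s))) * trunc_transform f R (\<xi> + s *\<^sub>R axis i 1)"
      unfolding trunc_transform_def g_def by (rule integral_mult_right_zero)
    finally show "(\<integral>x. ?h x s \<partial>lborel) = indicator {-a..a} s *\<^sub>R (cis (2 * pi * (y * s)) * trunc_transform f R (\<xi> + s *\<^sub>R axis i 1))"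
      by simp
  qed
  finally show ?thesis .
qed

lemma integral_norm_bound_nn:
  fixes f :: "'a \<Rightarrow> 'b::{banach, second_countable_topology}"
  shows "ennreal (norm (integral\<^sup>L M f)) \<le> (\<integral>\<^sup>+x. ennreal (norm (f x)) \<partial>M)"
  by (cases "integrable M f") (auto intro: integral_norm_bound_ennreal simp: not_integrable_integral_eq)

text \<open>Multiplying by \<open>box_kernel a\<close> averages the transform over shifts of length at most \<open>a\<close>.\<close>

lemma spectral_gap_box_kernel:
  assumes g: "spectral_gap r f" and a: "a \<ge> 0"
  shows "spectral_gap (r - a) (\<lambda>x. f x * box_kernel a (x $ i - y))"
proof -
  have fL: "f \<in> L2" using g by (simp add: spectral_gap_def)
  note [measurable] = L2_measurable[OF fL]
  have "(\<lambda>x. f x * box_kernel a (x $ i - y)) \<in> L2"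
  proof -
    have "norm (f x * box_kernel a (x $ i - y)) \<le> (2 * a) * norm (f x)" for x
      using mult_right_mono[OF box_kernel_bound1[OF a, of "x $ i - y"], of "\<bar>f x\<bar>"] by (simp add: abs_mult mult_ac)
    then show ?thesis using L2_dominated[OF fL, of "\<lambda>x. f x * box_kernel a (x $ i - y)" "2 * a"] a by simp
  qed
  moreover have "((\<lambda>R. \<integral>\<^sup>+\<xi>. indicator (ball 0 (r - a)) \<xi> * ennreal ((norm (trunc_transform (\<lambda>x. f x * box_kernel a (x $ i - y)) R \<xi>))\<^sup>2) \<partial>lborel) \<longlongrightarrow> 0) at_top"
  proof (rule tendsto_sandwich[OF _ _ tendsto_const])
    define g where "g R = (\<integral>\<^sup>+\<xi>. indicator (ball 0 r) \<xi> * ennreal ((norm (trunc_transform f R \<xi>))\<^sup>2) \<partial>lborel)" for R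
    have "(g \<longlongrightarrow> 0) at_top" using assms(1) by (simp add: spectral_gap_def g_def[abs_def])
    then have "((\<lambda>R. ennreal (2 * a) * (ennreal (2 * a) * g R)) \<longlongrightarrow> ennreal (2 * a) * (ennreal (2 * a) * 0)) at_top"
      by (intro ennreal_tendsto_cmult) auto
    then show "((\<lambda>R. ennreal (2 * a) * (ennreal (2 * a) * g R)) \<longlongrightarrow> 0) at_top" by simp
    show "\<forall>\<^sub>F R in at_top. (\<integral>\<^sup>+\<xi>. indicator (ball 0 (r - a)) \<xi> * ennreal ((norm (trunc_transform (\<lambda>x. f x * box_kernel a (x $ i - y)) R \<xi>))\<^sup>2) \<partial>lborel)
       \<le> ennreal (2 * a) * (ennreal (2 * a) * g R)"
    proof (intro always_eventually allI)
      fix R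
      let ?I = "\<lambda>s. indicator {-a..a} s :: ennreal"
      let ?t = "\<lambda>\<xi> s. ennreal (norm (trunc_transform f R (\<xi> + s *\<^sub>R axis i 1)))"
      have pt: "ennreal ((norm (trunc_transform (\<lambda>x. f x * box_kernel a (x $ i - y)) R \<xi>))\<^sup>2) \<le> ennreal (2 * a) * (\<integral>\<^sup>+s. (?I s * ?t \<xi> s)\<^sup>2 \<partial>lborel)" for \<xi>
      proof -
        have "ennreal (norm (trunc_transform (\<lambda>x. f x * box_kernel a (x $ i - y)) R \<xi>)) \<le>
          (\<integral>\<^sup>+s. ennreal (norm (indicator {-a..a} s *\<^sub>R (cis (2 * pi * (y * s)) * trunc_transform f R (\<xi> + s *\<^sub>R axis i 1)))) \<partial>lborel)"
          unfolding trunc_transform_box_kernel[OF fL a] by (rule integral_norm_bound_nn)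
        also have "\<dots> = (\<integral>\<^sup>+s. ?I s * (?I s * ?t \<xi> s) \<partial>lborel)"
          by (intro nn_integral_cong) (auto simp: indicator_def norm_mult)
        finally have "(ennreal (norm (trunc_transform (\<lambda>x. f x * box_kernel a (x $ i - y)) R \<xi>)))\<^sup>2 \<le> (\<integral>\<^sup>+s. ?I s * (?I s * ?t \<xi> s) \<partial>lborel)\<^sup>2"
          by (intro power_mono) auto
        \<comment> \<open>Cauchy-Schwarz in s costs the length 2 a of the interval; the later
          integration over s costs the same factor again.\<close>
        also have "\<dots> \<le> (\<integral>\<^sup>+s. (?I s)\<^sup>2 \<partial>lborel) * (\<integral>\<^sup>+s. (?I s * ?t \<xi> s)\<^sup>2 \<partial>lborel)"
          by (rule Cauchy_Schwarz_nn_integral) measurable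
        also have "(\<integral>\<^sup>+s. (?I s)\<^sup>2 \<partial>lborel) = (\<integral>\<^sup>+s. ?I s \<partial>lborel)" by (intro nn_integral_cong) (auto simp: indicator_def)
        also have "\<dots> = ennreal (2 * a)" using a by simp
        finally show ?thesis by (simp add: ennreal_power)
      qed
      have "(\<integral>\<^sup>+\<xi>. indicator (ball 0 (r - a)) \<xi> * ennreal ((norm (trunc_transform (\<lambda>x. f x * box_kernel a (x $ i - y)) R \<xi>))\<^sup>2) \<partial>lborel)
        \<le> (\<integral>\<^sup>+\<xi>. indicator (ball 0 (r - a)) \<xi> * (ennreal (2 * a) * (\<integral>\<^sup>+s. (?I s * ?t \<xi> s)\<^sup>2 \<partial>lborel)) \<partial>lborel)"
        by (intro nn_integral_mono mult_left_mono pt) auto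
      also have "\<dots> = (\<integral>\<^sup>+\<xi>. ennreal (2 * a) * (\<integral>\<^sup>+s. indicator (ball 0 (r - a)) \<xi> * (?I s * ?t \<xi> s)\<^sup>2 \<partial>lborel) \<partial>lborel)"
        by (intro nn_integral_cong) (simp add: nn_integral_cmult mult_ac)
      also have "\<dots> = ennreal (2 * a) * (\<integral>\<^sup>+\<xi>. \<integral>\<^sup>+s. indicator (ball 0 (r - a)) \<xi> * (?I s * ?t \<xi> s)\<^sup>2 \<partial>lborel \<partial>lborel)"
        by (intro nn_integral_cmult) measurable
      also have "(\<integral>\<^sup>+\<xi>. \<integral>\<^sup>+s. indicator (ball 0 (r - a)) \<xi> * (?I s * ?t \<xi> s)\<^sup>2 \<partial>lborel \<partial>lborel)
        = (\<integral>\<^sup>+s. \<integral>\<^sup>+\<xi>. indicator (ball 0 (r - a)) \<xi> * (?I s * ?t \<xi> s)\<^sup>2 \<partial>lborel \<partial>lborel)"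
        by (rule lborel_pair.Fubini'[symmetric]) measurable
      also have "\<dots> \<le> (\<integral>\<^sup>+s. g R * ?I s \<partial>lborel)"
      proof (intro nn_integral_mono)
        fix s :: real
        show "(\<integral>\<^sup>+\<xi>. indicator (ball 0 (r - a)) \<xi> * (?I s * ?t \<xi> s)\<^sup>2 \<partial>lborel) \<le> g R * ?I s"
        proof (cases "s \<in> {-a..a}")
          case True
          have "(\<integral>\<^sup>+\<xi>. indicator (ball 0 (r - a)) \<xi> * (?I s * ?t \<xi> s)\<^sup>2 \<partial>lborel)
            \<le> (\<integral>\<^sup>+\<xi>. indicator (ball 0 r) (\<xi> + s *\<^sub>R axis i 1) * ennreal ((norm (trunc_transform f R (\<xi> + s *\<^sub>R axis i 1)))\<^sup>2) \<partial>lborel)"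
          proof (intro nn_integral_mono)
            fix \<xi> :: R3
            \<comment> \<open>A shift by at most a carries the ball of radius r - a into the ball of
              radius r.\<close>
            have "norm (\<xi> + s *\<^sub>R axis i 1) < r" if "norm \<xi> < r - a"
              using norm_triangle_ineq[of \<xi> "s *\<^sub>R axis i 1"] that True by (auto simp: abs_le_iff)
            then show "indicator (ball 0 (r - a)) \<xi> * (?I s * ?t \<xi> s)\<^sup>2
              \<le> indicator (ball 0 r) (\<xi> + s *\<^sub>R axis i 1) * ennreal ((norm (trunc_transform f R (\<xi> + s *\<^sub>R axis i 1)))\<^sup>2)"
              using True by (auto simp: indicator_def ennreal_power)
          qed
          also have "\<dots> = g R" unfolding g_def
            by (rule nn_integral_lborel_translate[of "\<lambda>\<xi>. indicator (ball 0 r) \<xi> * ennreal ((norm (trunc_transform f R \<xi>))\<^sup>2)"]) measurable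
          finally show ?thesis using True by simp
        qed simp
      qed
      also have "\<dots> = ennreal (2 * a) * g R" using a by (simp add: nn_integral_cmult_indicator mult.commute)
      finally show "(\<integral>\<^sup>+\<xi>. indicator (ball 0 (r - a)) \<xi> * ennreal ((norm (trunc_transform (\<lambda>x. f x * box_kernel a (x $ i - y)) R \<xi>))\<^sup>2) \<partial>lborel)
         \<le> ennreal (2 * a) * (ennreal (2 * a) * g R)"
        by (simp add: mult_left_mono)
    qed
  qed auto
  ultimately show ?thesis by (simp add: spectral_gap_def)
qed

text \<open>For integrable \<open>g\<close> the truncated transforms converge pointwise to a
  continuous transform, which by Fatou's lemma vanishes almost everywhere on the ball. By continuity
  it vanishes at frequency 0, where its value is the integral of \<open>g\<close>.\<close>

lemma spectral_gap_integral_zero: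
  fixes g :: "R3 \<Rightarrow> real"
  assumes "spectral_gap r g" "integrable lborel g" "r > 0"
  shows "(\<integral>x. g x \<partial>lborel) = 0"
proof -
  have [measurable]: "g \<in> borel_measurable borel" using assms(2) by auto
  define T where "T \<xi> = (\<integral>x. g x *\<^sub>R cis (- 2 * pi * (x \<bullet> \<xi>)) \<partial>lborel)" for \<xi>
  have [measurable]: "T \<in> borel_measurable borel" unfolding T_def[abs_def] by measurable
  have lim: "(\<lambda>n. trunc_transform g (real n) \<xi>) \<longlonglongrightarrow> T \<xi>" for \<xi>
    unfolding trunc_transform_def T_def
  proof (rule integral_dominated_convergence[where w="\<lambda>x. norm (g x)"])
    show "AE x in lborel. (\<lambda>n. (indicator (cball 0 (real n)) x * g x) *\<^sub>R cis (- 2 * pi * (x \<bullet> \<xi>)))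
      \<longlonglongrightarrow> g x *\<^sub>R cis (- 2 * pi * (x \<bullet> \<xi>))"
    proof (rule AE_I2, rule tendsto_eventually)
      fix x :: R3
      obtain N :: nat where "norm x \<le> N" using real_arch_simple by blast
      then have "(indicator (cball 0 (real n)) x * g x) *\<^sub>R cis (- 2 * pi * (x \<bullet> \<xi>)) = g x *\<^sub>R cis (- 2 * pi * (x \<bullet> \<xi>))" if "n \<ge> N" for n
        using that by (simp add: indicator_def)
      then show "\<forall>\<^sub>F n in sequentially. (indicator (cball 0 (real n)) x * g x) *\<^sub>R cis (- 2 * pi * (x \<bullet> \<xi>)) = g x *\<^sub>R cis (- 2 * pi * (x \<bullet> \<xi>))"
        by (auto simp: eventually_sequentially)
    qed
  qed (use assms(2) in \<open>auto simp: indicator_def\<close>)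
  define G where "G R = (\<integral>\<^sup>+\<xi>. indicator (ball 0 r) \<xi> * ennreal ((norm (trunc_transform g R \<xi>))\<^sup>2) \<partial>lborel)" for R
  have "(\<lambda>n. G (real n)) \<longlonglongrightarrow> 0"
    using assms(1) unfolding spectral_gap_def G_def by (intro filterlim_compose[OF _ filterlim_real_sequentially]) auto
  have "(\<integral>\<^sup>+\<xi>. indicator (ball 0 r) \<xi> * ennreal ((norm (T \<xi>))\<^sup>2) \<partial>lborel)
    = (\<integral>\<^sup>+\<xi>. liminf (\<lambda>n. indicator (ball 0 r) \<xi> * ennreal ((norm (trunc_transform g (real n) \<xi>))\<^sup>2)) \<partial>lborel)"
  proof (intro nn_integral_cong)
    fix \<xi>
    have "(\<lambda>n. ennreal (indicator (ball 0 r) \<xi> * (norm (trunc_transform g (real n) \<xi>))\<^sup>2)) \<longlonglongrightarrow> ennreal (indicator (ball 0 r) \<xi> * (norm (T \<xi>))\<^sup>2)"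
      by (intro tendsto_ennrealI tendsto_intros lim)
    then have "(\<lambda>n. indicator (ball 0 r) \<xi> * ennreal ((norm (trunc_transform g (real n) \<xi>))\<^sup>2)) \<longlonglongrightarrow> indicator (ball 0 r) \<xi> * ennreal ((norm (T \<xi>))\<^sup>2)"
      by (cases "norm \<xi> < r") auto
    from lim_imp_Liminf[OF _ this]
    show "indicator (ball 0 r) \<xi> * ennreal ((norm (T \<xi>))\<^sup>2) = liminf (\<lambda>n. indicator (ball 0 r) \<xi> * ennreal ((norm (trunc_transform g (real n) \<xi>))\<^sup>2))"
      by simp
  qed
  also have "\<dots> \<le> liminf (\<lambda>n. G (real n))" unfolding G_def by (intro nn_integral_liminf) measurable
  also have "\<dots> = 0" using lim_imp_Liminf[OF _ \<open>(\<lambda>n. G (real n)) \<longlonglongrightarrow> 0\<close>] by simp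
  finally have "(\<integral>\<^sup>+\<xi>. indicator (ball 0 r) \<xi> * ennreal ((norm (T \<xi>))\<^sup>2) \<partial>lborel) = 0" by simp
  then have AE0: "AE \<xi> in lborel. indicator (ball 0 r) \<xi> * ennreal ((norm (T \<xi>))\<^sup>2) = 0"
    by (subst (asm) nn_integral_0_iff_AE) auto
  \<comment> \<open>A small ball around 0 has positive measure, so the exceptional null set cannot
    contain it; zeros of \<open>T\<close> accumulate at 0.\<close>
  have "\<exists>\<xi>. norm \<xi> < 1 / real (Suc n) \<and> T \<xi> = 0" for n
  proof (rule ccontr)
    assume *: "\<not> ?thesis"
    define d where "d = min r (1 / real (Suc n))"
    have d: "d > 0" using assms(3) by (simp add: d_def)
    have "AE \<xi> in lborel. \<xi> \<notin> ball (0::R3) d"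
      using AE0 by eventually_elim (use * in \<open>auto simp: d_def indicator_def\<close>)
    then have "emeasure lborel (ball (0::R3) d) = 0"
      using AE_iff_null_sets[of "ball (0::R3) d" lborel] by (auto dest: null_setsD1)
    moreover have "emeasure lborel (ball (0::R3) d) \<noteq> 0"
      using d open_not_negligible[of "ball (0::R3) d"] by (auto simp: negligible_iff_null_sets null_sets_def)
    ultimately show False by simp
  qed
  then have "\<exists>\<zeta>. \<forall>n. norm (\<zeta> n) < 1 / real (Suc n) \<and> T (\<zeta> n) = 0" by (intro choice) blast
  then obtain \<zeta> where z: "\<And>n. norm (\<zeta> n) < 1 / real (Suc n)" "\<And>n. T (\<zeta> n) = 0" by blast
  have z0: "\<zeta> \<longlonglongrightarrow> 0"
  proof (rule tendsto_norm_zero_cancel, rule tendsto_sandwich[OF _ _ tendsto_const])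
    show "(\<lambda>n. 1 / real (Suc n)) \<longlonglongrightarrow> 0" using LIMSEQ_inverse_real_of_nat by (simp add: inverse_eq_divide)
  qed (use z(1) in \<open>auto intro!: always_eventually less_imp_le\<close>)
  have "(\<lambda>n. T (\<zeta> n)) \<longlonglongrightarrow> T 0"
    unfolding T_def
  proof (rule integral_dominated_convergence[where w="\<lambda>x. norm (g x)"])
    show "AE x in lborel. (\<lambda>n. g x *\<^sub>R cis (- 2 * pi * (x \<bullet> \<zeta> n))) \<longlonglongrightarrow> g x *\<^sub>R cis (- 2 * pi * (x \<bullet> 0))"
      by (intro AE_I2 tendsto_intros z0)
  qed (use assms(2) in auto)
  then have "T 0 = 0" by (simp add: z(2) LIMSEQ_const_iff)
  moreover have "T 0 = complex_of_real (\<integral>x. g x \<partial>lborel)" by (simp add: T_def scaleR_conv_of_real)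
  ultimately show ?thesis by simp
qed

text \<open>The transform of this kernel is supported in a ball of radius \<open>12 * a\<close>; the fourth powers provide the
  decay needed for finite second moments.\<close>

definition gap_kernel :: "real \<Rightarrow> R3 \<Rightarrow> real" where
  "gap_kernel a z = (box_kernel a (z $ 1))^4 * ((box_kernel a (z $ 2))^4 * (box_kernel a (z $ 3))^4)"

lemma spectral_gap_box_kernel_power:
  assumes "spectral_gap r f" "a \<ge> 0"
  shows "spectral_gap (r - real n * a) (\<lambda>x. f x * (box_kernel a (x $ i - y))^n)"
proof (induction n)
  case 0 then show ?case using assms by simp
next
  case (Suc n)
  from spectral_gap_box_kernel[OF this assms(2), of i y] show ?case by (simp add: algebra_simps)
qed

text \<open>The kernel has twelve factors, four for each coordinate, and each of them shrinks the
  gap by a.\<close>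

lemma spectral_gap_gap_kernel:
  assumes "spectral_gap r f" "a \<ge> 0"
  shows "spectral_gap (r - 12 * a) (\<lambda>x. f x * gap_kernel a (x - y))"
  using spectral_gap_box_kernel_power[OF spectral_gap_box_kernel_power[OF spectral_gap_box_kernel_power[OF assms, of 4 1 "y $ 1"] assms(2), of 4 2 "y $ 2"] assms(2), of 4 3 "y $ 3"]
  by (simp add: gap_kernel_def mult.assoc algebra_simps)

lemma gap_kernel_nonneg: "gap_kernel a z \<ge> 0" by (simp add: gap_kernel_def)

lemma gap_kernel_measurable [measurable]: "gap_kernel a \<in> borel_measurable borel"
  unfolding gap_kernel_def[abs_def] by measurable

lemma gap_kernel_minus: "gap_kernel a (- z) = gap_kernel a z" by (simp add: gap_kernel_def box_kernel_minus)

lemma gap_kernel_bound: "a \<ge> 0 \<Longrightarrow> gap_kernel a z \<le> (2 * a)^12"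
proof -
  assume a: "a \<ge> 0"
  have m: "(box_kernel a t)^4 \<le> (2 * a)^4" for t
    using power_mono[OF box_kernel_bound1[OF a, of t], of 4] by simp
  have "gap_kernel a z \<le> (2 * a)^4 * ((2 * a)^4 * (2 * a)^4)" unfolding gap_kernel_def using a by (intro mult_mono m) auto
  then show ?thesis by (simp flip: power_add)
qed

lemma nn_integral_inverse_1_plus_square: "(\<integral>\<^sup>+t. ennreal (1 / (1 + t\<^sup>2)) \<partial>(lborel :: real measure)) < \<infinity>"
proof -
  let ?f = "\<lambda>t::real. ennreal (1 / (1 + t\<^sup>2))"
  have half: "(\<integral>\<^sup>+t. ?f t * indicator {0..} t \<partial>lborel) = pi / 2 - arctan 0"
    by (rule nn_integral_FTC_atLeast)
       (auto intro!: derivative_eq_intros tendsto_arctan_at_top simp: inverse_eq_divide)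
  have neg: "(\<integral>\<^sup>+t. ?f t * indicator {..0} t \<partial>lborel) = (\<integral>\<^sup>+t. ?f t * indicator {0..} t \<partial>lborel)"
    by (subst nn_integral_real_affine[where c="-1" and t=0]) (auto simp: indicator_def intro!: nn_integral_cong)
  have "(\<integral>\<^sup>+t. ?f t \<partial>lborel) \<le> (\<integral>\<^sup>+t. ?f t * indicator {0..} t + ?f t * indicator {..0} t \<partial>lborel)"
    by (intro nn_integral_mono) (auto simp: indicator_def)
  also have "\<dots> = (\<integral>\<^sup>+t. ?f t * indicator {0..} t \<partial>lborel) + (\<integral>\<^sup>+t. ?f t * indicator {..0} t \<partial>lborel)"
    by (intro nn_integral_add) auto
  also have "\<dots> < \<infinity>" unfolding neg half by simp
  finally show ?thesis .
qed

text \<open>The fourth power of \<open>box_kernel\<close> decays like (1 + t^2)^-2. One factor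
  absorbs the weight, since 1 + |z|^2 is at most the product of the 1 + z_i^2, and the other leaves
  the integrable function 1 / (1 + t^2) in each coordinate.\<close>

lemma gap_kernel_moment_integrable:
  assumes "a \<ge> 0"
  shows "integrable lborel (\<lambda>z. (1 + (norm z)\<^sup>2) * gap_kernel a z)"
  unfolding integrable_iff_bounded
proof
  define C where "C = 4 * a\<^sup>2 + 1"
  have C: "C > 0" unfolding C_def by (intro add_nonneg_pos) auto
  define q where "q t = 1 / (1 + t\<^sup>2)" for t :: real
  have q0: "q t \<ge> 0" for t by (simp add: q_def)
  have [measurable]: "q \<in> borel_measurable borel" unfolding q_def by measurable
  have m4: "(1 + t\<^sup>2) * (box_kernel a t)^4 \<le> C\<^sup>2 * q t" for t
  proof -
    have pos: "1 + t\<^sup>2 > 0" by (intro add_pos_nonneg) auto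
    have b: "(1 + t\<^sup>2) * (box_kernel a t)\<^sup>2 \<le> C" using box_kernel_sq_bound[OF assms] by (simp add: C_def)
    have "((1 + t\<^sup>2) * (box_kernel a t)\<^sup>2)\<^sup>2 \<le> C\<^sup>2" using b by (intro power_mono) auto
    then have "(1 + t\<^sup>2) * ((1 + t\<^sup>2) * (box_kernel a t)^4) \<le> C\<^sup>2"
      by (simp add: power_mult_distrib power2_eq_square[of "1 + t\<^sup>2"] mult.assoc flip: power_mult)
    then show ?thesis using pos by (simp add: q_def field_simps)
  qed
  show "(\<lambda>z. (1 + (norm z)\<^sup>2) * gap_kernel a z) \<in> borel_measurable lborel" by measurable
  have pt: "ennreal (norm ((1 + (norm z)\<^sup>2) * gap_kernel a z)) \<le> ennreal (C^6) * (ennreal (q (z $ 1)) * (ennreal (q (z $ 2)) * ennreal (q (z $ 3))))" for z :: R3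
  proof -
    have "norm ((1 + (norm z)\<^sup>2) * gap_kernel a z) = (1 + (norm z)\<^sup>2) * gap_kernel a z"
      using gap_kernel_nonneg[of a z] by (simp add: abs_mult)
    also have "\<dots> \<le> ((1 + (z $ 1)\<^sup>2) * ((1 + (z $ 2)\<^sup>2) * (1 + (z $ 3)\<^sup>2))) * gap_kernel a z"
    proof (intro mult_right_mono gap_kernel_nonneg)
      have "1 + (norm z)\<^sup>2 = 1 + (z $ 1)\<^sup>2 + (z $ 2)\<^sup>2 + (z $ 3)\<^sup>2" by (simp add: norm_R3_sq sum_3)
      also have "\<dots> \<le> (1 + (z $ 1)\<^sup>2) * ((1 + (z $ 2)\<^sup>2) * (1 + (z $ 3)\<^sup>2))" by (simp add: algebra_simps)
      finally show "1 + (norm z)\<^sup>2 \<le> (1 + (z $ 1)\<^sup>2) * ((1 + (z $ 2)\<^sup>2) * (1 + (z $ 3)\<^sup>2))" .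
    qed
    also have "\<dots> = ((1 + (z $ 1)\<^sup>2) * (box_kernel a (z $ 1))^4) * (((1 + (z $ 2)\<^sup>2) * (box_kernel a (z $ 2))^4) * ((1 + (z $ 3)\<^sup>2) * (box_kernel a (z $ 3))^4))"
      by (simp add: gap_kernel_def mult_ac)
    also have "\<dots> \<le> (C\<^sup>2 * q (z $ 1)) * ((C\<^sup>2 * q (z $ 2)) * (C\<^sup>2 * q (z $ 3)))"
      by (intro mult_mono m4 mult_nonneg_nonneg) (auto simp: q0)
    also have "\<dots> = C^6 * (q (z $ 1) * (q (z $ 2) * q (z $ 3)))" by (simp add: eval_nat_numeral mult_ac)
    finally have "ennreal (norm ((1 + (norm z)\<^sup>2) * gap_kernel a z)) \<le> ennreal (C^6 * (q (z $ 1) * (q (z $ 2) * q (z $ 3))))"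
      by (rule ennreal_leI)
    also have "\<dots> = ennreal (C^6) * (ennreal (q (z $ 1)) * (ennreal (q (z $ 2)) * ennreal (q (z $ 3))))"
      using C q0 by (simp add: ennreal_mult)
    finally show ?thesis .
  qed
  define I where "I = (\<integral>\<^sup>+t. ennreal (q t) \<partial>lborel)"
  have I: "I < \<infinity>" using nn_integral_inverse_1_plus_square by (simp add: I_def q_def)
  have "(\<integral>\<^sup>+z. ennreal (norm ((1 + (norm z)\<^sup>2) * gap_kernel a z)) \<partial>lborel)
    \<le> (\<integral>\<^sup>+z. ennreal (C^6) * (ennreal (q (z $ 1)) * (ennreal (q (z $ 2)) * ennreal (q (z $ 3)))) \<partial>(lborel :: R3 measure))"
    by (intro nn_integral_mono pt)
  also have "\<dots> = ennreal (C^6) * (\<integral>\<^sup>+z. ennreal (q (z $ 1)) * (ennreal (q (z $ 2)) * ennreal (q (z $ 3))) \<partial>(lborel :: R3 measure))"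
    by (intro nn_integral_cmult) measurable
  also have "(\<integral>\<^sup>+z. ennreal (q (z $ 1)) * (ennreal (q (z $ 2)) * ennreal (q (z $ 3))) \<partial>(lborel :: R3 measure))
    = (\<integral>\<^sup>+a. \<integral>\<^sup>+b. \<integral>\<^sup>+c. ennreal (q a) * (ennreal (q b) * ennreal (q c)) \<partial>lborel \<partial>lborel \<partial>lborel)"
    by (subst nn_integral_vec3) auto
  also have "\<dots> = I * (I * I)"
    unfolding I_def by (simp add: nn_integral_cmult nn_integral_multc)
  also have "ennreal (C^6) * (I * (I * I)) < \<infinity>" using I by (simp add: ennreal_mult_less_top)
  finally show "(\<integral>\<^sup>+z. ennreal (norm ((1 + (norm z)\<^sup>2) * gap_kernel a z)) \<partial>lborel) < \<infinity>" .
qed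

lemma gap_kernel_integrable: "a \<ge> 0 \<Longrightarrow> integrable lborel (gap_kernel a)"
  by (rule Bochner_Integration.integrable_bound[OF gap_kernel_moment_integrable])
     (auto simp: abs_mult mult_le_cancel_right1)

lemma gap_kernel_sq_integrable: "a \<ge> 0 \<Longrightarrow> integrable lborel (\<lambda>z. (norm z)\<^sup>2 * gap_kernel a z)"
  by (rule Bochner_Integration.integrable_bound[OF gap_kernel_moment_integrable])
     (auto simp: abs_mult intro!: mult_right_mono)

lemma gap_kernel_L2:
  assumes "a \<ge> 0" shows "gap_kernel a \<in> L2"
proof -
  have "integrable lborel (\<lambda>z. (norm (gap_kernel a z))\<^sup>2)"
  proof (rule Bochner_Integration.integrable_bound)
    show "integrable lborel (\<lambda>z. (2 * a)^12 * gap_kernel a z)" by (intro integrable_mult_right gap_kernel_integrable assms)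
    show "AE z in lborel. norm ((norm (gap_kernel a z))\<^sup>2) \<le> norm ((2 * a)^12 * gap_kernel a z)"
      using gap_kernel_nonneg[of a] gap_kernel_bound[OF assms] by (intro AE_I2) (auto simp: power2_eq_square abs_mult intro!: mult_right_mono)
  qed measurable
  then show ?thesis by (simp add: L2_iff)
qed

lemma gap_kernel_integral_pos:
  assumes "a > 0" shows "(\<integral>z. gap_kernel a z \<partial>lborel) > 0"
proof -
  have "(\<integral>z. gap_kernel a z \<partial>lborel) \<noteq> 0"
  proof
    assume "(\<integral>z. gap_kernel a z \<partial>lborel) = 0"
    then have AE: "AE z in lborel. gap_kernel a z = 0"
      using integral_nonneg_eq_0_iff_AE[OF gap_kernel_integrable] assms gap_kernel_nonneg by auto
    let ?S = "box 0 (\<chi> i. 1 / (2 * a)) :: R3 set"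
    have pos: "box_kernel a t \<noteq> 0" if "0 < t" "t < 1 / (2 * a)" for t
    proof -
      have "0 < 2 * pi * a * t" "2 * pi * a * t < pi" using that assms by (auto simp: field_simps)
      then have "sin (2 * pi * a * t) > 0" by (intro sin_gt_zero)
      then show ?thesis using that by (auto simp: box_kernel_def)
    qed
    have "AE z in lborel. z \<notin> ?S"
      using AE by eventually_elim (use pos in \<open>auto simp: gap_kernel_def mem_box_cart\<close>)
    then have "?S \<in> null_sets lborel" using AE_iff_null_sets[of ?S lborel] by auto
    then have "negligible ?S" by (simp add: negligible_iff_null_sets null_sets_completionI)
    moreover have "(\<chi> i. 1 / (4 * a)) \<in> ?S" using assms by (auto simp: mem_box_cart field_simps)
    then have "?S \<noteq> {}" by blast
    ultimately show False using open_not_negligible[OF open_box] by blast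
  qed
  moreover have "(\<integral>z. gap_kernel a z \<partial>lborel) \<ge> 0" using gap_kernel_nonneg by (intro Bochner_Integration.integral_nonneg) auto
  ultimately show ?thesis by linarith
qed

section \<open>Pairing a field that has a spectral gap\<close>

lemma integral_lborel_reflect:
  fixes g :: "R3 \<Rightarrow> real"
  assumes [measurable]: "g \<in> borel_measurable borel"
  shows "(\<integral>x. g (- x) \<partial>lborel) = (\<integral>x. g x \<partial>lborel)"
proof -
  have l: "(lborel :: R3 measure) = distr lborel borel uminus"
    using lborel_affine[of "-1" "0::R3"] by (simp add: density_1)
  have "(\<integral>x. g x \<partial>lborel) = (\<integral>x. g x \<partial>distr lborel borel uminus)" using l by simp
  also have "\<dots> = (\<integral>x. g (- x) \<partial>lborel)" by (subst integral_distr) auto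
  finally show ?thesis by simp
qed

text \<open>Since a field with a spectral gap convolves to zero with \<open>gap_kernel\<close>, such a field only sees the
  difference between \<open>v\<close> and its even average, which is of second order.\<close>

lemma spectral_gap_pair_bound:
  assumes "\<rho> > 0"
  shows "\<exists>c\<ge>0. \<forall>f v R. assumptionA \<rho> f \<longrightarrow> v \<in> L2 \<longrightarrow>
    (\<forall>y. L2_norm (\<lambda>x. (v (x + y) - v x) - (v x - v (x - y))) \<le> R * (norm y)\<^sup>2) \<longrightarrow>
    \<bar>pair f v\<bar> \<le> c * L2_norm f * R"
proof -
  \<comment> \<open>The kernel consumes 12 a = \<rho> / 2, so a gap of radius \<rho> / 2 > 0
    remains.\<close>
  define a where "a = \<rho> / 24"
  have a: "a > 0" "a \<ge> 0" using assms by (auto simp: a_def)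
  define c0 where "c0 = (\<integral>z. gap_kernel a z \<partial>lborel)"
  define c2 where "c2 = (\<integral>z. (norm z)\<^sup>2 * gap_kernel a z \<partial>lborel)"
  have c0: "c0 > 0" using gap_kernel_integral_pos[OF a(1)] by (simp add: c0_def)
  have c2: "c2 \<ge> 0" unfolding c2_def using gap_kernel_nonneg by (intro Bochner_Integration.integral_nonneg) auto
  have "\<bar>pair f v\<bar> \<le> c2 / (2 * c0) * L2_norm f * R"
    if A: "assumptionA \<rho> f" and v: "v \<in> L2"
      and sd: "\<And>y. L2_norm (\<lambda>x. (v (x + y) - v x) - (v x - v (x - y))) \<le> R * (norm y)\<^sup>2" for f v R
  proof -
    have f: "f \<in> L2" using A by (simp add: assumptionA_def Xsp_L2)
    note [measurable] = L2_measurable[OF f] L2_measurable[OF v]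
    have comp0: "(\<integral>x. f x $ i * gap_kernel a (x - w) \<partial>lborel) = 0" "integrable lborel (\<lambda>x. f x $ i * gap_kernel a (x - w))" for i w
    proof -
      have "(\<lambda>x. gap_kernel a (x - w)) \<in> L2" using L2_translate(1)[OF gap_kernel_L2[OF a(2)], of "- w"] by simp
      from L2_inner_integrable[OF L2_component[OF f] this]
      show int: "integrable lborel (\<lambda>x. f x $ i * gap_kernel a (x - w))" by simp
      have "spectral_gap (\<rho> - 12 * a) (\<lambda>x. f x $ i * gap_kernel a (x - w))" by (rule spectral_gap_gap_kernel[OF assumptionA_spectral_gap[OF A] a(2)])
      then show "(\<integral>x. f x $ i * gap_kernel a (x - w) \<partial>lborel) = 0"
        by (rule spectral_gap_integral_zero[OF _ int]) (use assms in \<open>simp add: a_def\<close>)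
    qed
    let ?h = "\<lambda>y w. gap_kernel a y * (f (w + y) \<bullet> v w)"
    \<comment> \<open>For fixed w this is the integral of \<open>f\<close>, weighted by the kernel
      centred at w, against the constant vector \<open>v w\<close>; it vanishes by the spectral
      gap.\<close>
    have h0: "(\<integral>y. ?h y w \<partial>lborel) = 0" for w
    proof -
      have "(\<integral>y. ?h y w \<partial>lborel) = (\<integral>y. (\<lambda>x. gap_kernel a (x - w) * (f x \<bullet> v w)) (y + w) \<partial>lborel)"
        by (simp add: add.commute)
      also have "\<dots> = (\<integral>x. gap_kernel a (x - w) * (f x \<bullet> v w) \<partial>lborel)"
        by (rule integral_lborel_translate) measurable
      also have "\<dots> = (\<integral>x. (\<Sum>i\<in>UNIV. v w $ i * (f x $ i * gap_kernel a (x - w))) \<partial>lborel)"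
        by (intro Bochner_Integration.integral_cong refl) (simp add: inner_vec_def sum_distrib_left mult_ac)
      also have "\<dots> = (\<Sum>i\<in>UNIV. v w $ i * (\<integral>x. f x $ i * gap_kernel a (x - w) \<partial>lborel))"
        using comp0(2) by (subst Bochner_Integration.integral_sum) auto
      also have "\<dots> = 0" by (simp add: comp0(1))
      finally show ?thesis .
    qed
    have fy: "(\<lambda>w. f (w + y)) \<in> L2" "L2_norm (\<lambda>w. f (w + y)) = L2_norm f" for y
      using L2_translate[OF f] by auto
    have int: "integrable (lborel \<Otimes>\<^sub>M lborel) (\<lambda>(y, w). ?h y w)"
      unfolding integrable_iff_bounded
    proof
      show "(\<lambda>(y, w). ?h y w) \<in> borel_measurable (lborel \<Otimes>\<^sub>M lborel)" by measurable
      have "(\<integral>\<^sup>+p. ennreal (norm (case p of (y, w) \<Rightarrow> ?h y w)) \<partial>(lborel \<Otimes>\<^sub>M lborel))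
         = (\<integral>\<^sup>+y. \<integral>\<^sup>+w. ennreal (norm (?h y w)) \<partial>lborel \<partial>lborel)"
        by (subst lborel.nn_integral_fst[symmetric]) (auto, measurable)
      also have "\<dots> \<le> (\<integral>\<^sup>+y. ennreal (gap_kernel a y) * ennreal (L2_norm f * L2_norm v) \<partial>lborel)"
      proof (intro nn_integral_mono)
        fix y :: R3
        have "(\<integral>\<^sup>+w. ennreal (norm (?h y w)) \<partial>lborel) \<le> (\<integral>\<^sup>+w. ennreal (gap_kernel a y) * ennreal (norm (f (w + y)) * norm (v w)) \<partial>lborel)"
          using gap_kernel_nonneg[of a y]
          by (intro nn_integral_mono) (auto simp: abs_mult ennreal_mult'[symmetric] intro!: ennreal_leI mult_left_mono Cauchy_Schwarz_ineq2)
        also have "\<dots> = ennreal (gap_kernel a y) * (\<integral>\<^sup>+w. ennreal (norm (f (w + y)) * norm (v w)) \<partial>lborel)"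
          by (intro nn_integral_cmult) measurable
        also have "(\<integral>\<^sup>+w. ennreal (norm (f (w + y)) * norm (v w)) \<partial>lborel) = ennreal (\<integral>w. norm (f (w + y)) * norm (v w) \<partial>lborel)"
          by (intro nn_integral_eq_integral L2_inner_norm_integrable fy v) auto
        also have "ennreal (gap_kernel a y) * \<dots> \<le> ennreal (gap_kernel a y) * ennreal (L2_norm f * L2_norm v)"
          using L2_inner_norm_bound[OF fy(1) v, of y] fy(2) by (intro mult_left_mono ennreal_leI) auto
        finally show "(\<integral>\<^sup>+w. ennreal (norm (?h y w)) \<partial>lborel) \<le> ennreal (gap_kernel a y) * ennreal (L2_norm f * L2_norm v)" .
      qed
      also have "\<dots> = (\<integral>\<^sup>+y. ennreal (norm (gap_kernel a y)) \<partial>lborel) * ennreal (L2_norm f * L2_norm v)"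
        using gap_kernel_nonneg[of a] by (subst nn_integral_multc) auto
      also have "\<dots> < \<infinity>" using gap_kernel_integrable[OF a(2)] unfolding integrable_iff_bounded by (simp add: ennreal_mult_less_top)
      finally show "(\<integral>\<^sup>+p. ennreal (norm (case p of (y, w) \<Rightarrow> ?h y w)) \<partial>(lborel \<Otimes>\<^sub>M lborel)) < \<infinity>" .
    qed
    \<comment> \<open>The correlation of \<open>f\<close> and \<open>v\<close>; \<open>Q 0\<close>
      is the pairing to be estimated. By Fubini and \<open>h0\<close> its average against the kernel
      is zero.\<close>
    define Q where "Q y = (\<integral>w. f (w + y) \<bullet> v w \<partial>lborel)" for y
    have [measurable]: "Q \<in> borel_measurable borel" unfolding Q_def[abs_def] by measurable
    have iQ: "integrable lborel (\<lambda>y. gap_kernel a y * Q y)"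
      using lborel_pair.integrable_fst'[OF int] by (simp add: Q_def)
    have Q0: "(\<integral>y. gap_kernel a y * Q y \<partial>lborel) = 0"
      using lborel_pair.Fubini_integral[OF int] by (simp add: Q_def h0)
    \<comment> \<open>Evenness of the kernel gives the same for the reflected correlation, so that
      second differences of \<open>Q\<close> at 0 can be formed.\<close>
    have Qm0: "(\<integral>y. gap_kernel a y * Q (- y) \<partial>lborel) = 0"
      using integral_lborel_reflect[of "\<lambda>y. gap_kernel a y * Q y"] Q0 by (simp add: gap_kernel_minus)
    have Qb: "\<bar>Q y\<bar> \<le> L2_norm f * L2_norm v" for y
      using L2_Cauchy_Schwarz[OF fy(1) v, of y] fy(2) by (simp add: Q_def)
    have iQm: "integrable lborel (\<lambda>y. gap_kernel a y * Q (- y))"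
      by (rule Bochner_Integration.integrable_bound[of lborel "\<lambda>y. (L2_norm f * L2_norm v) * gap_kernel a y"])
         (use gap_kernel_nonneg[of a] Qb gap_kernel_integrable[OF a(2)] in \<open>auto simp: abs_mult mult.commute[of "gap_kernel a _"] intro!: mult_right_mono\<close>)
    have Qs: "\<bar>2 * Q 0 - Q y - Q (- y)\<bar> \<le> L2_norm f * (R * (norm y)\<^sup>2)" for y
    proof -
      have vt: "(\<lambda>x. v (x + y)) \<in> L2" "(\<lambda>x. v (x - y)) \<in> L2"
        using L2_translate(1)[OF v, of y] L2_translate(1)[OF v, of "- y"] by auto
      have "Q y = (\<integral>x. f x \<bullet> v (x - y) \<partial>lborel)"
        using integral_lborel_translate[of "\<lambda>x. f x \<bullet> v (x - y)" y] by (simp add: Q_def)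
      moreover have "Q (- y) = (\<integral>x. f x \<bullet> v (x + y) \<partial>lborel)"
        using integral_lborel_translate[of "\<lambda>x. f x \<bullet> v (x + y)" "- y"] by (simp add: Q_def)
      moreover have "(\<integral>x. f x \<bullet> ((v (x + y) - v x) - (v x - v (x - y))) \<partial>lborel) =
        (\<integral>x. f x \<bullet> v (x + y) \<partial>lborel) - Q 0 - (Q 0 - (\<integral>x. f x \<bullet> v (x - y) \<partial>lborel))"
        using L2_inner_diff(1)[OF L2_diff[OF vt(1) v] L2_diff[OF v vt(2)] f] L2_inner_diff(1)[OF vt(1) v f]
          L2_inner_diff(1)[OF v vt(2) f] by (simp add: Q_def)
      ultimately have "2 * Q 0 - Q y - Q (- y) = - (\<integral>x. f x \<bullet> ((v (x + y) - v x) - (v x - v (x - y))) \<partial>lborel)" by simp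
      then have "\<bar>2 * Q 0 - Q y - Q (- y)\<bar> \<le> L2_norm f * L2_norm (\<lambda>x. (v (x + y) - v x) - (v x - v (x - y)))"
        using L2_Cauchy_Schwarz[OF f L2_diff[OF L2_diff[OF vt(1) v] L2_diff[OF v vt(2)]]] by simp
      also have "\<dots> \<le> L2_norm f * (R * (norm y)\<^sup>2)" by (intro mult_left_mono sd) auto
      finally show ?thesis .
    qed
    \<comment> \<open>Averaging the second difference leaves only 2 \<open>Q 0\<close> times the
      mass \<open>c0\<close>. Its pointwise bound is quadratic in y and is integrated by the second
      moment \<open>c2\<close>.\<close>
    have "(\<integral>y. gap_kernel a y * (2 * Q 0 - Q y - Q (- y)) \<partial>lborel) = (\<integral>y. 2 * Q 0 * gap_kernel a y - gap_kernel a y * Q y - gap_kernel a y * Q (- y) \<partial>lborel)"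
      by (simp add: algebra_simps)
    also have "\<dots> = 2 * Q 0 * c0"
      using iQ iQm gap_kernel_integrable[OF a(2)] Q0 Qm0 by (simp add: c0_def)
    finally have "\<bar>2 * Q 0 * c0\<bar> = \<bar>\<integral>y. gap_kernel a y * (2 * Q 0 - Q y - Q (- y)) \<partial>lborel\<bar>" by simp
    also have "\<dots> \<le> (\<integral>y. \<bar>gap_kernel a y * (2 * Q 0 - Q y - Q (- y))\<bar> \<partial>lborel)" by (rule integral_abs_bound)
    also have "\<dots> \<le> (\<integral>y. (L2_norm f * R) * ((norm y)\<^sup>2 * gap_kernel a y) \<partial>lborel)"
    proof (rule integral_mono)
      show "integrable lborel (\<lambda>y. \<bar>gap_kernel a y * (2 * Q 0 - Q y - Q (- y))\<bar>)"
      proof -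
        have "integrable lborel (\<lambda>y. 2 * Q 0 * gap_kernel a y - gap_kernel a y * Q y - gap_kernel a y * Q (- y))"
          using iQ iQm gap_kernel_integrable[OF a(2)] by auto
        then show ?thesis by (intro integrable_abs) (simp add: algebra_simps)
      qed
      show "integrable lborel (\<lambda>y. (L2_norm f * R) * ((norm y)\<^sup>2 * gap_kernel a y))"
        by (intro integrable_mult_right gap_kernel_sq_integrable a)
      show "\<bar>gap_kernel a y * (2 * Q 0 - Q y - Q (- y))\<bar> \<le> (L2_norm f * R) * ((norm y)\<^sup>2 * gap_kernel a y)" for y
        using mult_left_mono[OF Qs gap_kernel_nonneg[of a y], of y] gap_kernel_nonneg[of a y] by (simp add: abs_mult mult_ac)
    qed
    also have "\<dots> = L2_norm f * R * c2" by (simp add: c2_def)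
    finally have "2 * c0 * \<bar>Q 0\<bar> \<le> L2_norm f * R * c2" using c0 by (simp add: abs_mult mult_ac)
    moreover have "Q 0 = pair f v" by (simp add: Q_def pair_def)
    ultimately show ?thesis using c0 by (simp add: field_simps)
  qed
  then show ?thesis using c0 c2 by (intro exI[of _ "c2 / (2 * c0)"]) auto
qed

text \<open>A second difference of \<open>v\<close> is a first difference of the field v (x + y) - v
  x, whose gradient is an increment of \<open>G\<close> and at most R |y|. The increment bound
  contributes the second factor |y|.\<close>

lemma spectral_gap_functional:
  assumes "\<rho> > 0"
  obtains c where "c \<ge> 0" "\<And>f v G R. assumptionA \<rho> f \<Longrightarrow> H1 v G \<Longrightarrow> (\<And>h. L2_norm (\<lambda>x. G (x + h) - G x) \<le> R * norm h) \<Longrightarrow>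
    \<bar>pair f v\<bar> \<le> c * L2_norm f * R"
proof -
  obtain c where c: "c \<ge> 0" "\<And>f v R. assumptionA \<rho> f \<Longrightarrow> v \<in> L2 \<Longrightarrow>
    (\<And>y. L2_norm (\<lambda>x. (v (x + y) - v x) - (v x - v (x - y))) \<le> R * (norm y)\<^sup>2) \<Longrightarrow> \<bar>pair f v\<bar> \<le> c * L2_norm f * R"
    using spectral_gap_pair_bound[OF assms] by blast
  have "\<bar>pair f v\<bar> \<le> c * L2_norm f * R" if A: "assumptionA \<rho> f" and v: "H1 v G"
    and R: "\<And>h. L2_norm (\<lambda>x. G (x + h) - G x) \<le> R * norm h" for f v G R
  proof (rule c(2)[OF A H1_L2(1)[OF v]])
    fix y
    have w: "H1 (\<lambda>x. v (x + y) - v x) (\<lambda>x. G (x + y) - G x)" by (intro H1_diff H1_translate v)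
    have "L2_norm (\<lambda>x. (v (x + y) - v x) - (v x - v (x - y))) \<le> norm (- y) * L2_norm (\<lambda>x. G (x + y) - G x)"
      using H1_translate_bound[OF w, of "- y"] L2_norm_minus_commute[of "\<lambda>x. v (x + y) - v x" "\<lambda>x. v x - v (x - y)"] by simp
    also have "\<dots> \<le> norm (- y) * (R * norm y)" by (intro mult_left_mono R) auto
    finally show "L2_norm (\<lambda>x. (v (x + y) - v x) - (v x - v (x - y))) \<le> R * (norm y)\<^sup>2"
      by (simp add: power2_eq_square mult_ac)
  qed
  with c(1) that show ?thesis by blast
qed

section \<open>The fundamental lemma of the calculus of variations\<close>

text \<open>The family \<open>exp (-1/t) / t^n\<close> is closed under differentiation up to linear combinations.\<close>

definition flat :: "nat \<Rightarrow> real \<Rightarrow> real" where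
  "flat n t = (if t > 0 then exp (- inverse t) * inverse t ^ n else 0)"

text \<open>Only t = 0 needs an argument: the quotient is zero on the left, and on the right the
  exponential dominates every power of 1 / t.\<close>

lemma flat_deriv: "(flat n has_real_derivative flat (n + 2) t - real n * flat (n + 1) t) (at t)"
proof -
  consider "t > 0" | "t < 0" | "t = 0" by linarith
  then show ?thesis
  proof cases
    case 1
    have "((\<lambda>t. exp (- inverse t) * inverse t ^ n) has_real_derivative flat (n + 2) t - real n * flat (n + 1) t) (at t)"
    proof -
      have i: "(inverse has_real_derivative - ((inverse t)\<^sup>2)) (at t)"
        using 1 by (auto intro!: derivative_eq_intros simp: power2_eq_square)
      have e: "((\<lambda>t. exp (- inverse t)) has_real_derivative exp (- inverse t) * (inverse t)\<^sup>2) (at t)"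
        using DERIV_fun_exp[OF DERIV_minus[OF i]] by simp
      have "((\<lambda>t. exp (- inverse t) * inverse t ^ n) has_real_derivative
        (exp (- inverse t) * (inverse t)\<^sup>2) * inverse t ^ n + (real n * (- ((inverse t)\<^sup>2) * inverse t ^ (n - Suc 0))) * exp (- inverse t)) (at t)"
        by (rule DERIV_mult[OF e DERIV_power[OF i, of n]])
      moreover have "(exp (- inverse t) * (inverse t)\<^sup>2) * inverse t ^ n + (real n * (- ((inverse t)\<^sup>2) * inverse t ^ (n - Suc 0))) * exp (- inverse t)
        = flat (n + 2) t - real n * flat (n + 1) t"
        using 1 by (cases n) (simp_all add: flat_def power2_eq_square algebra_simps)
      ultimately show ?thesis by simp
    qed
    then show ?thesis
      by (rule has_field_derivative_transform_within_open[where S="{0<..}"]) (use 1 in \<open>auto simp: flat_def\<close>)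
  next
    case 2
    have "((\<lambda>t. 0) has_real_derivative flat (n + 2) t - real n * flat (n + 1) t) (at t)"
      using 2 by (simp add: flat_def)
    then show ?thesis
      by (rule has_field_derivative_transform_within_open[where S="{..<0}"]) (use 2 in \<open>auto simp: flat_def\<close>)
  next
    case 3
    have "((\<lambda>h. flat n h / h) \<longlongrightarrow> 0) (at 0)"
    proof (rule filterlim_split_at)
      show "((\<lambda>h. flat n h / h) \<longlongrightarrow> 0) (at_left 0)"
        by (rule tendsto_eventually) (auto simp: eventually_at_filter flat_def)
      have "((\<lambda>h::real. inverse h ^ (n + 1) / exp (inverse h)) \<longlongrightarrow> 0) (at_right 0)"
        by (rule filterlim_compose[OF tendsto_power_div_exp_0 filterlim_inverse_at_top_right])
      then show "((\<lambda>h. flat n h / h) \<longlongrightarrow> 0) (at_right 0)"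
        by (rule Lim_transform_eventually) (auto simp: eventually_at_filter flat_def exp_minus field_simps)
    qed
    then show ?thesis using 3 by (simp add: has_field_derivative_iff flat_def)
  qed
qed

text \<open>Differentiation raises the index by one and by two, so the generators of the algebra
  comprise all indices together with all affine functions of one coordinate.\<close>

lemma flat_coordinate_smooth: "smooth (\<lambda>x. flat n (\<alpha> * x $ i + \<beta>))"
proof -
  let ?S = "{(\<lambda>x::R3. flat n (\<alpha> * x $ i + \<beta>)) |n \<alpha> i \<beta>. True}"
  have d: "((\<lambda>x::R3. flat n (\<alpha> * x $ i + \<beta>)) has_derivative
    (\<lambda>h. (flat (n + 2) (\<alpha> * x $ i + \<beta>) - real n * flat (n + 1) (\<alpha> * x $ i + \<beta>)) * (\<alpha> * h $ i))) (at x)" for n \<alpha> i \<beta> x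
  proof -
    have 1: "((\<lambda>x::R3. \<alpha> * x $ i + \<beta>) has_derivative (\<lambda>h. \<alpha> * h $ i)) (at x)"
      by (auto intro!: derivative_eq_intros bounded_linear_imp_has_derivative bounded_linear_vec_nth)
    show ?thesis using has_derivative_compose[OF 1 flat_deriv[of n, unfolded has_field_derivative_def]] by simp
  qed
  show ?thesis
  proof (rule gen_alg_smooth[of ?S])
    fix f j assume "f \<in> ?S"
    then obtain n \<alpha> i \<beta> where f: "f = (\<lambda>x::R3. flat n (\<alpha> * x $ i + \<beta>))" by blast
    have "pd j f = (\<lambda>x. (flat (n + 2) (\<alpha> * x $ i + \<beta>) + (- real n) * flat (n + 1) (\<alpha> * x $ i + \<beta>)) * (\<alpha> * axis j 1 $ i))"
      unfolding f by (rule ext, subst pd_eq[OF d]) simp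
    moreover have "gen_alg ?S (\<lambda>x. (flat (n + 2) (\<alpha> * x $ i + \<beta>) + (- real n) * flat (n + 1) (\<alpha> * x $ i + \<beta>)) * (\<alpha> * axis j 1 $ i))"
      by (rule gen_alg.mult, rule gen_alg.add, rule gen_alg.base, blast, rule gen_alg.mult, rule gen_alg.const,
          rule gen_alg.base, blast, rule gen_alg.const)
    ultimately show "gen_alg ?S (pd j f)" by simp
  next
    fix f :: "R3 \<Rightarrow> real" and x assume "f \<in> ?S"
    then show "f differentiable (at x)" using d unfolding differentiable_def by blast
  next
    show "gen_alg ?S (\<lambda>x. flat n (\<alpha> * x $ i + \<beta>))" by (rule gen_alg.base) blast
  qed
qed

text \<open>Positive in the open box with corners a and b and zero outside it when n > 0. The
  parameter n is the steepness: \<open>flat 0 (n * s)\<close> = exp (- 1 / (n s)) tends to 1 for s >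
  0, so the functions approach the indicator of the box.\<close>

definition bump :: "real \<Rightarrow> R3 \<Rightarrow> R3 \<Rightarrow> R3 \<Rightarrow> real" where
  "bump n a b x = (\<Prod>i\<in>UNIV. flat 0 (n * (x $ i - a $ i)) * flat 0 (n * (b $ i - x $ i)))"

lemma bump_test_fun:
  assumes "n > 0" shows "bump n a b \<in> test_fun"
proof -
  have s: "smooth (\<lambda>x::R3. flat 0 (n * (x $ i - a $ i)))" "smooth (\<lambda>x::R3. flat 0 (n * (b $ i - x $ i)))" for i
    using flat_coordinate_smooth[of 0 n i "- n * a $ i"] flat_coordinate_smooth[of 0 "- n" i "n * b $ i"]
    by (simp_all add: algebra_simps)
  have eq: "bump n a b = (\<lambda>x. (flat 0 (n * (x $ 1 - a $ 1)) * flat 0 (n * (b $ 1 - x $ 1))) * ((flat 0 (n * (x $ 2 - a $ 2)) * flat 0 (n * (b $ 2 - x $ 2)))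
     * (flat 0 (n * (x $ 3 - a $ 3)) * flat 0 (n * (b $ 3 - x $ 3)))))"
    unfolding bump_def by (rule ext, rule prod_UNIV_3)
  have "smooth (bump n a b)" unfolding eq by (intro smooth_mult s)
  moreover have "compact_supp (bump n a b)"
  proof -
    have "bounded (box a b)" by (rule bounded_box)
    then obtain R where R: "\<And>x. x \<in> box a b \<Longrightarrow> norm x \<le> R" by (auto simp: bounded_iff)
    have "bump n a b x = 0" if "norm x > R" for x
    proof -
      have "x \<notin> box a b" using R[of x] that by auto
      then obtain i where "\<not> (a $ i < x $ i \<and> x $ i < b $ i)" by (auto simp: mem_box_cart)
      then have "n * (x $ i - a $ i) \<le> 0 \<or> n * (b $ i - x $ i) \<le> 0" using assms by (auto simp: mult_le_0_iff)
      then have "flat 0 (n * (x $ i - a $ i)) * flat 0 (n * (b $ i - x $ i)) = 0" by (auto simp: flat_def)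
      then show ?thesis unfolding bump_def by (intro prod_zero bexI[of _ i]) auto
    qed
    then show ?thesis by (auto simp: compact_supp_iff)
  qed
  ultimately show ?thesis by (simp add: test_fun_def)
qed

lemma flat_0_bounds: "0 \<le> flat 0 t" "flat 0 t \<le> 1" "t \<ge> 1 \<Longrightarrow> exp (-1) \<le> flat 0 t"
  by (auto simp: flat_def inverse_le_1_iff)

lemma bump_bounds: "0 \<le> bump n a b x" "bump n a b x \<le> 1"
  unfolding bump_def by (auto intro!: prod_nonneg prod_le_1 mult_le_one mult_nonneg_nonneg flat_0_bounds)

text \<open>The steep bumps are test functions between 0 and the indicator of the box and converge
  to it, so dominated convergence applies once \<open>D\<close> is integrable over the box.
  Integrability is obtained by comparing with a single test function that is bounded below
  there.\<close>

lemma fundamental_lemma_box: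
  fixes D :: "R3 \<Rightarrow> real"
  assumes [measurable]: "D \<in> borel_measurable borel"
    and D: "\<And>\<psi>. \<psi> \<in> test_fun \<Longrightarrow> integrable lborel (\<lambda>x. D x * \<psi> x) \<and> (\<integral>x. D x * \<psi> x \<partial>lborel) = 0"
  shows "integrable lborel (\<lambda>x. indicator (box a b) x * D x)" "(\<integral>x. indicator (box a b) x * D x \<partial>lborel) = 0"
proof -
  \<comment> \<open>The corners are moved outwards by 1, so on the original box each of the six
    factors is evaluated at an argument at least 1 and is at least exp (-1).\<close>
  let ?\<psi> = "bump 1 (a - (\<chi> i. 1)) (b + (\<chi> i. 1))"
  have low: "exp (-1) ^ 6 \<le> ?\<psi> x" if "x \<in> box a b" for x
  proof -
    have "(\<Prod>i\<in>(UNIV :: 3 set). exp (-1) * exp (-1)) \<le> ?\<psi> x"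
      unfolding bump_def using that by (intro prod_mono) (auto intro!: mult_mono flat_0_bounds simp: mem_box_cart less_imp_le)
    then show ?thesis by (simp flip: power2_eq_square power_mult)
  qed
  have meas: "(\<lambda>x. indicator (box a b) x * D x) \<in> borel_measurable lborel" by measurable
  have dom: "norm (indicator (box a b) x * D x) \<le> norm (exp 1 ^ 6 * (D x * ?\<psi> x))" for x
  proof (cases "x \<in> box a b")
    case True
    have "1 = exp 1 ^ 6 * exp (-1::real) ^ 6" by (simp add: power_mult_distrib[symmetric] exp_minus)
    also have "\<dots> \<le> exp 1 ^ 6 * ?\<psi> x" using low[OF True] by (intro mult_left_mono) auto
    finally have "\<bar>D x\<bar> * 1 \<le> \<bar>D x\<bar> * (exp 1 ^ 6 * ?\<psi> x)" by (intro mult_left_mono) auto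
    then show ?thesis using True bump_bounds(1)[of 1 _ _ x] by (simp add: abs_mult mult_ac)
  qed simp
  have t1: "?\<psi> \<in> test_fun" by (rule bump_test_fun) simp
  have i1: "integrable lborel (\<lambda>x. exp 1 ^ 6 * (D x * ?\<psi> x))" using D[OF t1] by simp
  show int: "integrable lborel (\<lambda>x. indicator (box a b) x * D x)"
    by (rule Bochner_Integration.integrable_bound[OF i1 meas]) (intro AE_I2 dom)
  let ?b = "\<lambda>n. bump (real (Suc n)) a b"
  have tn: "?b n \<in> test_fun" for n by (rule bump_test_fun) simp
  have [measurable]: "?b n \<in> borel_measurable borel" for n
    using tn[of n] by (auto simp: test_fun_def intro: smooth_measurable)
  have zero: "?b n x = 0" if "x \<notin> box a b" for n x
  proof -
    from that obtain i where "\<not> (a $ i < x $ i \<and> x $ i < b $ i)" by (auto simp: mem_box_cart)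
    then have "real (Suc n) * (x $ i - a $ i) \<le> 0 \<or> real (Suc n) * (b $ i - x $ i) \<le> 0" by (auto simp: mult_le_0_iff)
    then have "flat 0 (real (Suc n) * (x $ i - a $ i)) * flat 0 (real (Suc n) * (b $ i - x $ i)) = 0" by (auto simp: flat_def)
    then show ?thesis unfolding bump_def by (intro prod_zero bexI[of _ i]) auto
  qed
  have one: "(\<lambda>n. ?b n x) \<longlonglongrightarrow> 1" if "x \<in> box a b" for x
  proof -
    have f1: "(\<lambda>n. flat 0 (real (Suc n) * s)) \<longlonglongrightarrow> 1" if "s > 0" for s
    proof -
      have "(\<lambda>n. inverse (real (Suc n)) * inverse s) \<longlonglongrightarrow> 0 * inverse s"
        by (intro tendsto_intros LIMSEQ_inverse_real_of_nat)
      then have "(\<lambda>n. exp (- (inverse (real (Suc n)) * inverse s))) \<longlonglongrightarrow> exp (- (0 * inverse s))"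
        by (rule tendsto_exp[OF tendsto_minus])
      moreover have "flat 0 (real (Suc n) * s) = exp (- (inverse (real (Suc n)) * inverse s))" for n
        using that by (simp add: flat_def)
      ultimately show ?thesis by simp
    qed
    have "(\<lambda>n. ?b n x) \<longlonglongrightarrow> (\<Prod>i\<in>(UNIV :: 3 set). 1 * 1)"
      unfolding bump_def using that by (intro tendsto_prod tendsto_mult f1) (auto simp: mem_box_cart)
    then show ?thesis by simp
  qed
  have "(\<lambda>n. \<integral>x. D x * ?b n x \<partial>lborel) \<longlonglongrightarrow> (\<integral>x. indicator (box a b) x * D x \<partial>lborel)"
  proof (rule integral_dominated_convergence[where w="\<lambda>x. \<bar>indicator (box a b) x * D x\<bar>"])
    show "integrable lborel (\<lambda>x. \<bar>indicator (box a b) x * D x\<bar>)" by (intro integrable_abs int)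
    show "AE x in lborel. (\<lambda>n. D x * ?b n x) \<longlonglongrightarrow> indicator (box a b) x * D x"
    proof (rule AE_I2)
      fix x show "(\<lambda>n. D x * ?b n x) \<longlonglongrightarrow> indicator (box a b) x * D x"
      proof (cases "x \<in> box a b")
        case True
        then show ?thesis using tendsto_mult[OF tendsto_const one[OF True], of "D x"] by simp
      next
        case False then show ?thesis using zero[OF False] by simp
      qed
    qed
    show "AE x in lborel. norm (D x * ?b n x) \<le> \<bar>indicator (box a b) x * D x\<bar>" for n
    proof (rule AE_I2)
      fix x show "norm (D x * ?b n x) \<le> \<bar>indicator (box a b) x * D x\<bar>"
      proof (cases "x \<in> box a b")
        case True
        then show ?thesis using bump_bounds[of "real (Suc n)" a b x] by (simp add: abs_mult mult_left_le)
      next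
        case False then show ?thesis using zero[OF False] by simp
      qed
    qed
  qed measurable
  then show "(\<integral>x. indicator (box a b) x * D x \<partial>lborel) = 0" using D[OF tn] by (simp add: LIMSEQ_const_iff)
qed

text \<open>The positive and the negative part of \<open>D\<close> on a bounded box are densities of
  two finite measures. They agree on all open boxes, a generating family stable under intersection,
  so the measures and hence the densities coincide.\<close>

lemma fundamental_lemma:
  fixes D :: "R3 \<Rightarrow> real"
  assumes [measurable]: "D \<in> borel_measurable borel"
    and D: "\<And>\<psi>. \<psi> \<in> test_fun \<Longrightarrow> integrable lborel (\<lambda>x. D x * \<psi> x) \<and> (\<integral>x. D x * \<psi> x \<partial>lborel) = 0"
  shows "AE x in lborel. D x = 0"
proof -
  let ?A = "\<lambda>n::nat. box (- (real n *\<^sub>R One)) (real n *\<^sub>R One) :: R3 set"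
  note fl = fundamental_lemma_box[OF assms]
  have AEn: "AE x in lborel. x \<in> ?A N \<longrightarrow> D x = 0" for N
  proof -
    define p where "p x = max 0 (indicator (?A N) x * D x)" for x
    define q where "q x = max 0 (- (indicator (?A N) x * D x))" for x
    have pq: "p x \<ge> 0" "q x \<ge> 0" "p x - q x = indicator (?A N) x * D x" for x by (auto simp: p_def q_def)
    have ip: "integrable lborel p" "integrable lborel q"
      unfolding p_def[abs_def] q_def[abs_def] using fl(1) by (auto intro!: Bochner_Integration.integrable_max)
    have [measurable]: "p \<in> borel_measurable borel" "q \<in> borel_measurable borel" using ip by auto
    have em: "emeasure (density lborel (\<lambda>x. ennreal (g x))) X = ennreal (\<integral>x. indicator X x * g x \<partial>lborel)"
      if "integrable lborel g" "\<And>x. g x \<ge> 0" "X \<in> sets borel" for g :: "R3 \<Rightarrow> real" and X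
    proof -
      have [measurable]: "g \<in> borel_measurable borel" "X \<in> sets borel" using that by auto
      have "integrable lborel (\<lambda>x. indicator X x * g x)"
        using integrable_mult_indicator[of X lborel g] that by simp
      then have "(\<integral>\<^sup>+x. ennreal (indicator X x * g x) \<partial>lborel) = ennreal (\<integral>x. indicator X x * g x \<partial>lborel)"
        using that by (intro nn_integral_eq_integral) auto
      moreover have "(\<integral>\<^sup>+x. ennreal (g x) * indicator X x \<partial>lborel) = (\<integral>\<^sup>+x. ennreal (indicator X x * g x) \<partial>lborel)"
        by (intro nn_integral_cong) (auto simp: indicator_def)
      ultimately show ?thesis by (subst emeasure_density) auto
    qed
    have "density lborel (\<lambda>x. ennreal (p x)) = density lborel (\<lambda>x. ennreal (q x))"
    proof (rule measure_eqI_generator_eq)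
      let ?E = "range (\<lambda>(a, b). box a b :: R3 set)"
      show "Int_stable ?E" by (auto simp: Int_stable_def box_Int_box)
      show "?E \<subseteq> Pow UNIV" "sets (density lborel (\<lambda>x. ennreal (p x))) = sigma_sets UNIV ?E"
        "sets (density lborel (\<lambda>x. ennreal (q x))) = sigma_sets UNIV ?E"
        by (simp_all add: borel_eq_box)
      show "range ?A \<subseteq> ?E" "(\<Union>i. ?A i) = UNIV" unfolding UN_box_eq_UNIV by auto
      show "emeasure (density lborel (\<lambda>x. ennreal (p x))) (?A i) \<noteq> \<infinity>" for i
        using em[OF ip(1) pq(1), of "?A i"] by simp
      fix X assume "X \<in> ?E"
      then obtain a b where X: "X = box a b" by auto
      \<comment> \<open>Restricting to \<open>?A N\<close> turns a box into a box again, so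
        \<open>fundamental_lemma_box\<close> applies to the intersection.\<close>
      obtain c d where cd: "box a b \<inter> ?A N = box c d" unfolding box_Int_box by blast
      have "(\<integral>x. indicator X x * p x \<partial>lborel) - (\<integral>x. indicator X x * q x \<partial>lborel) = (\<integral>x. indicator X x * p x - indicator X x * q x \<partial>lborel)"
        using integrable_mult_indicator[of X lborel p] integrable_mult_indicator[of X lborel q] ip X
        by (intro Bochner_Integration.integral_diff[symmetric]) auto
      also have "\<dots> = (\<integral>x. indicator (box c d) x * D x \<partial>lborel)"
        unfolding cd[symmetric] X
        by (intro Bochner_Integration.integral_cong refl) (auto simp: indicator_def pq(3) right_diff_distrib[symmetric])
      also have "\<dots> = 0" by (rule fl(2))
      finally show "emeasure (density lborel (\<lambda>x. ennreal (p x))) X = emeasure (density lborel (\<lambda>x. ennreal (q x))) X"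
        using em[OF ip(1) pq(1), of X] em[OF ip(2) pq(2), of X] X by simp
    qed
    then have "AE x in lborel. ennreal (p x) = ennreal (q x)"
      by (intro sigma_finite_measure.density_unique[OF sigma_finite_lborel]) auto
    then show ?thesis
    proof eventually_elim
      fix x assume "ennreal (p x) = ennreal (q x)"
      then have "indicator (?A N) x * D x = 0" using pq[of x] by simp
      then show "x \<in> ?A N \<longrightarrow> D x = 0" by auto
    qed
  qed
  have "AE x in lborel. \<forall>N. x \<in> ?A N \<longrightarrow> D x = 0" unfolding AE_all_countable using AEn by blast
  then show ?thesis
  proof eventually_elim
    fix x assume "\<forall>N. x \<in> ?A N \<longrightarrow> D x = 0"
    moreover have "x \<in> (\<Union>i. ?A i)" unfolding UN_box_eq_UNIV by auto
    ultimately show "D x = 0" by blast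
  qed
qed

text \<open>A competitor comes with a weak gradient of its own, while its approximation by test
  fields produces another one; they must be identified before the equation can be used.\<close>

lemma weak_grad_unique:
  assumes "weak_grad u G" "weak_grad u H"
  shows "AE x in lborel. G x = H x"
proof -
  have [measurable]: "G \<in> borel_measurable borel" "H \<in> borel_measurable borel" using assms by (auto simp: weak_grad_def)
  have "AE x in lborel. G x $ i $ j - H x $ i $ j = 0" for i j
  proof (rule fundamental_lemma)
    fix \<psi> :: "R3 \<Rightarrow> real" assume "\<psi> \<in> test_fun"
    then have *: "integrable lborel (\<lambda>x. G x $ i $ j * \<psi> x)" "integrable lborel (\<lambda>x. H x $ i $ j * \<psi> x)"
      "(\<integral>x. G x $ i $ j * \<psi> x \<partial>lborel) = (\<integral>x. H x $ i $ j * \<psi> x \<partial>lborel)"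
      using assms by (auto simp: weak_grad_def)
    then show "integrable lborel (\<lambda>x. (G x $ i $ j - H x $ i $ j) * \<psi> x) \<and>
      (\<integral>x. (G x $ i $ j - H x $ i $ j) * \<psi> x \<partial>lborel) = 0"
      by (simp add: left_diff_distrib)
  qed measurable
  then have "AE x in lborel. \<forall>i j. G x $ i $ j - H x $ i $ j = 0" unfolding AE_all_countable by blast
  then show ?thesis by eventually_elim (simp add: vec_eq_iff)
qed

section \<open>Existence and uniqueness for small data\<close>

lemma Vsp_linear_pair: "f \<in> L2 \<Longrightarrow> Vsp_linear (pair f)"
  unfolding Vsp_linear_def pair_def using L2_inner_add_scaleR(1) Vsp_L2 by blast

lemma Hdual_bound:
  assumes "f \<in> Xsp"
  shows "\<phi> \<in> Vsp \<Longrightarrow> \<bar>pair f \<phi>\<bar> \<le> Hdual_norm f * L2_norm (grad \<phi>)" "Hdual_norm f \<ge> 0"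
proof -
  let ?S = "{\<bar>pair f \<phi>\<bar> | \<phi>. \<phi> \<in> Vsp \<and> L2_norm (grad \<phi>) \<le> 1}"
  obtain K where K: "\<And>\<phi>. \<phi> \<in> Vsp \<Longrightarrow> \<bar>pair f \<phi>\<bar> \<le> K * L2_norm (grad \<phi>)"
    using assms by (auto simp: Xsp_def in_Hdual_def)
  have bdd: "bdd_above ?S"
  proof (rule bdd_aboveI[of _ "\<bar>K\<bar>"])
    fix s assume "s \<in> ?S"
    then obtain \<phi> where p: "s = \<bar>pair f \<phi>\<bar>" "\<phi> \<in> Vsp" "L2_norm (grad \<phi>) \<le> 1" by blast
    have "s \<le> K * L2_norm (grad \<phi>)" using K[OF p(2)] p(1) by simp
    also have "\<dots> \<le> \<bar>K\<bar> * 1" using p(3) by (intro mult_mono) auto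
    finally show "s \<le> \<bar>K\<bar>" by simp
  qed
  have sup: "\<bar>pair f \<phi>\<bar> \<le> Hdual_norm f" if "\<phi> \<in> Vsp" "L2_norm (grad \<phi>) \<le> 1" for \<phi>
    unfolding Hdual_norm_def using that by (intro cSup_upper bdd) blast
  have g0: "grad (\<lambda>x. 0) = (\<lambda>x. 0)" by (rule ext) (simp add: grad_def vec_eq_iff)
  show "Hdual_norm f \<ge> 0" using order_trans[OF abs_ge_zero sup[OF Vsp_zero]] by (simp add: g0)
  show "\<bar>pair f \<phi>\<bar> \<le> Hdual_norm f * L2_norm (grad \<phi>)" if "\<phi> \<in> Vsp"
  proof (cases "L2_norm (grad \<phi>) = 0")
    \<comment> \<open>A field with gradient norm zero cannot be normalized; here the constant
      \<open>K\<close> from the definition of the dual space shows that the pairing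
      vanishes.\<close>
    case True then show ?thesis using K[OF that] by simp
  next
    case False
    define n where "n = L2_norm (grad \<phi>)"
    have n: "n > 0" using False L2_norm_nonneg[of "grad \<phi>"] unfolding n_def by linarith
    have "L2_norm (grad (\<lambda>x. inverse n *\<^sub>R \<phi> x)) = 1"
      using n by (simp add: grad_scaleR[OF VspD(1)[OF that]] L2_norm_scale[OF Vsp_grad_L2[OF that]] n_def)
    then have "\<bar>pair f (\<lambda>x. inverse n *\<^sub>R \<phi> x)\<bar> \<le> Hdual_norm f" by (intro sup Vsp_scaleR that) simp
    then have "\<bar>pair f \<phi>\<bar> / n \<le> Hdual_norm f" using n by (simp add: pair_def abs_mult divide_inverse_commute)
    then show ?thesis using n by (simp add: n_def field_simps)
  qed
qed

lemma X_norm_bounds: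
  assumes "f \<in> Xsp"
  shows "L2_norm f \<le> X_norm f" "Hdual_norm f \<le> X_norm f" "0 \<le> X_norm f"
  using L2_norm_nonneg[of f] unfolding X_norm_def by linarith+

lemma pair_tendsto:
  assumes "f \<in> L2" "H1_approx v G \<psi>"
  shows "(\<lambda>n. pair f (\<psi> n)) \<longlonglongrightarrow> pair f v"
  unfolding pair_def using H1_approxD[OF assms(2)] assms(1) by (intro L2_inner_tendsto) auto

text \<open>Testing with \<open>w\<close> itself makes the gradient zero, and the Sobolev inequality
  then makes \<open>w\<close> zero. The lemma identifies a given solution with the one whose
  existence and bounds \<open>linear_problem\<close> asserts.\<close>

lemma homogeneous_linear_problem:
  assumes "H1 w W" "\<nu> > 0" "\<And>\<phi>. \<phi> \<in> Vsp \<Longrightarrow> \<nu> * (\<integral>x. W x \<bullet> grad \<phi> x \<partial>lborel) = 0"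
  shows "L2_norm w = 0 \<and> L2_norm W = 0"
proof -
  note L = H1_L2[OF assms(1)]
  obtain \<psi> where c: "H1_approx w W \<psi>" using assms(1) by (auto simp: H1_def)
  note p = H1_approxD[OF c]
  have "(\<lambda>n. \<integral>x. W x \<bullet> grad (\<psi> n) x \<partial>lborel) \<longlonglongrightarrow> (\<integral>x. W x \<bullet> W x \<partial>lborel)"
    by (rule L2_inner_tendsto) (use p in auto)
  moreover have "(\<integral>x. W x \<bullet> grad (\<psi> n) x \<partial>lborel) = 0" for n using assms(2) assms(3)[OF p(3)] by simp
  ultimately have "(L2_norm W)\<^sup>2 = 0" by (simp add: L2_norm_sq_inner L LIMSEQ_const_iff)
  then have W: "L2_norm W = 0" by simp
  then have "L6_norm w = 0" using H1_L6(2)[OF assms(1)] L6_norm_nonneg[of w] by simp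
  then have "Lp_int 6 w = 0" using H1_L6(1)[OF assms(1)] by (simp add: Lp_int_6_eq)
  then have "AE x in lborel. w x = 0"
    using L2_measurable[OF L(1)] unfolding Lp_int_6 by (subst (asm) nn_integral_0_iff_AE) auto
  then have "L2_norm w = L2_norm (\<lambda>x::R3. 0::R3)" by (intro L2_norm_cong_AE) auto
  then show ?thesis using W by simp
qed

section \<open>Picard iteration\<close>

lemma convection_diff_both:
  assumes "H1 a A" "H1 b B" "\<phi> \<in> L6"
  shows "convection a A \<phi> - convection b B \<phi> = convection (\<lambda>x. a x - b x) A \<phi> + convection b (\<lambda>x. A x - B x) \<phi>"
  using convection_diff_W[of a b A \<phi>] convection_diff_G[of b A B \<phi>] assms H1_L2 H1_L6 by simp

text \<open>The forcing enters the gradient bound through its dual norm and the L^2 bound through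
  the spectral gap with constant \<open>c\<close>. The convective term contributes 490 to each of
  the two, hence 980 in their sum.\<close>

lemma Picard_step:
  assumes "\<nu> > 0" "f \<in> Xsp" "c \<ge> 0" "H1 a A"
    and spectral_gap: "\<forall>v G R. H1 v G \<longrightarrow> (\<forall>h. L2_norm (\<lambda>x. G (x + h) - G x) \<le> R * norm h) \<longrightarrow> \<bar>pair f v\<bar> \<le> c * L2_norm f * R"
  shows "\<exists>u G. H1 u G \<and> (\<forall>\<phi>\<in>Vsp. \<nu> * (\<integral>x. G x \<bullet> grad \<phi> x \<partial>lborel) = pair f \<phi> - convection a A \<phi>) \<and>
    H1_norm u G \<le> ((1 + c) * X_norm f + 980 * (H1_norm a A)\<^sup>2) / \<nu>"
proof -
  define K1 where "K1 = X_norm f + 490 * (H1_norm a A * H1_norm a A)"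
  define K2 where "K2 = c * X_norm f + 490 * (H1_norm a A * H1_norm a A)"
  have f: "f \<in> L2" using assms(2) by (rule Xsp_L2)
  note X = X_norm_bounds[OF assms(2)] and t = convection_functional[OF assms(4) assms(4)]
  have "\<exists>u G. H1 u G \<and> (\<forall>\<phi>\<in>Vsp. \<nu> * (\<integral>x. G x \<bullet> grad \<phi> x \<partial>lborel) = pair f \<phi> - convection a A \<phi>) \<and>
    L2_norm G \<le> K1 / \<nu> \<and> L2_norm u \<le> K2 / \<nu>"
  proof (rule linear_problem[OF assms(1)])
    show "Vsp_linear (\<lambda>\<phi>. pair f \<phi> - convection a A \<phi>)"
      using Vsp_linear_pair[OF f] t(3) unfolding Vsp_linear_def by (simp add: algebra_simps)
    show "K1 \<ge> 0" "K2 \<ge> 0" using X(3) assms(3) by (auto simp: K1_def K2_def)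
    show "\<bar>pair f \<phi> - convection a A \<phi>\<bar> \<le> K1 * L2_norm (grad \<phi>)" if "\<phi> \<in> Vsp" for \<phi>
    proof -
      have "\<bar>pair f \<phi>\<bar> \<le> X_norm f * L2_norm (grad \<phi>)"
        using Hdual_bound(1)[OF assms(2) that] mult_right_mono[OF X(2), of "L2_norm (grad \<phi>)"] by simp
      moreover have "K1 * L2_norm (grad \<phi>) = X_norm f * L2_norm (grad \<phi>) + 490 * (H1_norm a A * H1_norm a A) * L2_norm (grad \<phi>)"
        by (simp add: K1_def distrib_right)
      ultimately show ?thesis using t(1)[OF that] by linarith
    qed
    show "\<bar>L\<bar> \<le> K2 * R" if v: "H1_approx v H \<psi>" and R: "R \<ge> 0" "\<And>h. L2_norm (\<lambda>x. H (x + h) - H x) \<le> R * norm h"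
      and lim: "(\<lambda>n. pair f (\<psi> n) - convection a A (\<psi> n)) \<longlonglongrightarrow> L" for v H \<psi> R L
    proof -
      have vH: "H1 v H" using v by (auto simp: H1_def)
      have "(\<lambda>n. pair f (\<psi> n) - (pair f (\<psi> n) - convection a A (\<psi> n))) \<longlonglongrightarrow> pair f v - L"
        by (intro tendsto_diff pair_tendsto[OF f v] lim)
      then have "\<bar>pair f v - L\<bar> \<le> 490 * (H1_norm a A * H1_norm a A) * R" by (intro t(2)[OF v R]) simp
      moreover have "\<bar>pair f v\<bar> \<le> c * L2_norm f * R" using spectral_gap vH R(2) by blast
      moreover have "c * L2_norm f * R \<le> c * X_norm f * R" using X(1) assms(3) R(1) by (intro mult_right_mono mult_left_mono)
      moreover have "K2 * R = c * X_norm f * R + 490 * (H1_norm a A * H1_norm a A) * R" by (simp add: K2_def distrib_right)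
      ultimately show ?thesis by linarith
    qed
  qed
  then obtain u G where u: "H1 u G" "\<forall>\<phi>\<in>Vsp. \<nu> * (\<integral>x. G x \<bullet> grad \<phi> x \<partial>lborel) = pair f \<phi> - convection a A \<phi>"
    "L2_norm G \<le> K1 / \<nu>" "L2_norm u \<le> K2 / \<nu>" by blast
  have "H1_norm u G \<le> K2 / \<nu> + K1 / \<nu>" using u(3,4) by (simp add: H1_norm_def)
  also have "\<dots> = ((1 + c) * X_norm f + 980 * (H1_norm a A)\<^sup>2) / \<nu>"
    by (simp add: K1_def K2_def add_divide_distrib[symmetric] algebra_simps power2_eq_square)
  finally show ?thesis using u by blast
qed

text \<open>In the difference of the equations \<open>l\<close> cancels and the quadratic term
  splits into two terms linear in the difference. \<open>linear_problem\<close> asserts the L^2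
  bound only for some solution \<open>w\<close>, so \<open>w\<close> is afterwards shown to agree
  with the given difference.\<close>

lemma Picard_contraction:
  assumes "\<nu> > 0" "H1 a A" "H1 b B" "H1 u G" "H1 v H"
    and eu: "\<And>\<phi>. \<phi> \<in> Vsp \<Longrightarrow> \<nu> * (\<integral>x. G x \<bullet> grad \<phi> x \<partial>lborel) = l \<phi> - convection a A \<phi>"
    and ev: "\<And>\<phi>. \<phi> \<in> Vsp \<Longrightarrow> \<nu> * (\<integral>x. H x \<bullet> grad \<phi> x \<partial>lborel) = l \<phi> - convection b B \<phi>"
  shows "H1_norm (\<lambda>x. v x - u x) (\<lambda>x. H x - G x)
    \<le> 980 * (H1_norm a A + H1_norm b B) / \<nu> * H1_norm (\<lambda>x. b x - a x) (\<lambda>x. B x - A x)"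
proof -
  define d D where "d = (\<lambda>x. a x - b x)" and "D = (\<lambda>x. A x - B x)"
  have dD: "H1 d D" unfolding d_def D_def by (intro H1_diff assms)
  have nd: "H1_norm (\<lambda>x. b x - a x) (\<lambda>x. B x - A x) = H1_norm d D"
    by (simp add: H1_norm_def d_def D_def L2_norm_minus_commute[of a b] L2_norm_minus_commute[of A B])
  note t1 = convection_functional[OF dD assms(2)] and t2 = convection_functional[OF assms(3) dD]
  define K where "K = 490 * (H1_norm a A + H1_norm b B) * H1_norm d D"
  have K: "490 * (H1_norm d D * H1_norm a A) * R + 490 * (H1_norm b B * H1_norm d D) * R = K * R" for R
    by (simp add: K_def algebra_simps)
  have "\<exists>w W. H1 w W \<and> (\<forall>\<phi>\<in>Vsp. \<nu> * (\<integral>x. W x \<bullet> grad \<phi> x \<partial>lborel) = convection d A \<phi> + convection b D \<phi>) \<and>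
    L2_norm W \<le> K / \<nu> \<and> L2_norm w \<le> K / \<nu>"
  proof (rule linear_problem[OF assms(1)])
    show "Vsp_linear (\<lambda>\<phi>. convection d A \<phi> + convection b D \<phi>)"
      using t1(3) t2(3) unfolding Vsp_linear_def by (simp add: algebra_simps)
    show "K \<ge> 0" "K \<ge> 0" by (auto simp: K_def)
    show "\<bar>convection d A \<phi> + convection b D \<phi>\<bar> \<le> K * L2_norm (grad \<phi>)" if "\<phi> \<in> Vsp" for \<phi>
      using t1(1)[OF that] t2(1)[OF that] K[of "L2_norm (grad \<phi>)"] by linarith
    show "\<bar>L\<bar> \<le> K * R" if p: "H1_approx p P \<psi>" and R: "R \<ge> 0" "\<And>h. L2_norm (\<lambda>x. P (x + h) - P x) \<le> R * norm h"
      and lim: "(\<lambda>n. convection d A (\<psi> n) + convection b D (\<psi> n)) \<longlonglongrightarrow> L" for p P \<psi> R L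
    proof -
      note h = Hdot1_approxD[OF H1_approx_imp_Hdot1_approx(1)[OF p]]
      have l1: "(\<lambda>n. convection d A (\<psi> n)) \<longlonglongrightarrow> convection d A p"
        by (intro convection_tendsto H1_L2[OF dD] H1_L6[OF dD] H1_L2[OF assms(2)] h) auto
      have l2: "(\<lambda>n. convection b D (\<psi> n)) \<longlonglongrightarrow> convection b D p"
        by (intro convection_tendsto H1_L2[OF assms(3)] H1_L6[OF assms(3)] H1_L2[OF dD] h) auto
      have "L = convection d A p + convection b D p" using LIMSEQ_unique[OF lim tendsto_add[OF l1 l2]] .
      then show ?thesis using t1(2)[OF p R l1] t2(2)[OF p R l2] K[of R] by linarith
    qed
  qed
  then obtain w W where w: "H1 w W" "\<And>\<phi>. \<phi> \<in> Vsp \<Longrightarrow> \<nu> * (\<integral>x. W x \<bullet> grad \<phi> x \<partial>lborel) = convection d A \<phi> + convection b D \<phi>"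
    "L2_norm W \<le> K / \<nu>" "L2_norm w \<le> K / \<nu>" by blast
  have vu: "H1 (\<lambda>x. v x - u x) (\<lambda>x. H x - G x)" by (intro H1_diff assms)
  have z: "L2_norm (\<lambda>x. (v x - u x) - w x) = 0 \<and> L2_norm (\<lambda>x. (H x - G x) - W x) = 0"
  proof (rule homogeneous_linear_problem[OF H1_diff[OF vu w(1)] assms(1)])
    fix \<phi> assume p: "\<phi> \<in> Vsp"
    have "(\<integral>x. ((H x - G x) - W x) \<bullet> grad \<phi> x \<partial>lborel) =
      (\<integral>x. H x \<bullet> grad \<phi> x \<partial>lborel) - (\<integral>x. G x \<bullet> grad \<phi> x \<partial>lborel) - (\<integral>x. W x \<bullet> grad \<phi> x \<partial>lborel)"
      using L2_inner_diff(2)[OF H1_L2(2)[OF vu] H1_L2(2)[OF w(1)] Vsp_grad_L2[OF p]]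
        L2_inner_diff(2)[OF H1_L2(2)[OF assms(5)] H1_L2(2)[OF assms(4)] Vsp_grad_L2[OF p]] by simp
    then show "\<nu> * (\<integral>x. ((H x - G x) - W x) \<bullet> grad \<phi> x \<partial>lborel) = 0"
      using eu[OF p] ev[OF p] w(2)[OF p] convection_diff_both[OF assms(2,3) Vsp_L6[OF p]]
      by (simp add: right_diff_distrib d_def D_def)
  qed
  have "L2_norm (\<lambda>x. v x - u x) \<le> L2_norm w" "L2_norm (\<lambda>x. H x - G x) \<le> L2_norm W"
    using L2_norm_triangle[OF H1_L2(1)[OF H1_diff[OF vu w(1)]] H1_L2(1)[OF w(1)]]
      L2_norm_triangle[OF H1_L2(2)[OF H1_diff[OF vu w(1)]] H1_L2(2)[OF w(1)]] z by auto
  then have "H1_norm (\<lambda>x. v x - u x) (\<lambda>x. H x - G x) \<le> 2 * (K / \<nu>)" using w(3,4) by (simp add: H1_norm_def)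
  also have "\<dots> = 980 * (H1_norm a A + H1_norm b B) / \<nu> * H1_norm d D" by (simp add: K_def)
  finally show ?thesis by (simp add: nd)
qed

lemma H1_norm_triangle:
  assumes "H1 a A" "H1 b B" "H1 d D"
  shows "H1_norm (\<lambda>x. a x - d x) (\<lambda>x. A x - D x) \<le> H1_norm (\<lambda>x. a x - b x) (\<lambda>x. A x - B x) + H1_norm (\<lambda>x. b x - d x) (\<lambda>x. B x - D x)"
  using L2_norm_triangle3[of a b d] L2_norm_triangle3[of A B D] H1_L2 assms by (simp add: H1_norm_def)

text \<open>\<open>H1_norm\<close> is only a seminorm on functions, and a step merely asserts that a
  next iterate exists. The iterates are therefore chosen one by one, and their convergence is
  derived from the geometric decay of the increments.\<close>

lemma Picard_fixed_point:
  assumes "\<nu> > 0" "f \<in> Xsp" "c \<ge> 0" "\<delta> > 0" "3920 * \<delta> \<le> \<nu>" "2 * (1 + c) * X_norm f \<le> \<nu> * \<delta>"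
    and spectral_gap: "\<forall>v G R. H1 v G \<longrightarrow> (\<forall>h. L2_norm (\<lambda>x. G (x + h) - G x) \<le> R * norm h) \<longrightarrow> \<bar>pair f v\<bar> \<le> c * L2_norm f * R"
  shows "\<exists>U K. H1 U K \<and> H1_norm U K \<le> \<delta> \<and>
    (\<forall>\<phi>\<in>Vsp. convection U K \<phi> + \<nu> * (\<integral>x. K x \<bullet> grad \<phi> x \<partial>lborel) = pair f \<phi>)"
proof -
  let ?P = "\<lambda>p. H1 (fst p) (snd p) \<and> H1_norm (fst p) (snd p) \<le> \<delta>"
  let ?Q = "\<lambda>p q. \<forall>\<phi>\<in>Vsp. \<nu> * (\<integral>x. snd q x \<bullet> grad \<phi> x \<partial>lborel) = pair f \<phi> - convection (fst p) (snd p) \<phi>"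
  have "\<exists>p. \<forall>n. ?P (p n) \<and> ?Q (p n) (p (Suc n))"
  proof (rule dependent_nat_choice)
    show "\<exists>p. ?P p" using H1_zero assms(4) by (intro exI[of _ "(\<lambda>x. 0, \<lambda>x. 0)"]) (simp add: H1_norm_def)
    fix p :: "(R3 \<Rightarrow> R3) \<times> (R3 \<Rightarrow> real^3^3)" and n :: nat
    assume p: "?P p"
    obtain u G where u: "H1 u G" "\<forall>\<phi>\<in>Vsp. \<nu> * (\<integral>x. G x \<bullet> grad \<phi> x \<partial>lborel) = pair f \<phi> - convection (fst p) (snd p) \<phi>"
      "H1_norm u G \<le> ((1 + c) * X_norm f + 980 * (H1_norm (fst p) (snd p))\<^sup>2) / \<nu>"
      using Picard_step[OF assms(1-3) conjunct1[OF p] spectral_gap] by blast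
    have "(H1_norm (fst p) (snd p))\<^sup>2 \<le> \<delta>\<^sup>2" using p by (intro power_mono) auto
    moreover have "3920 * \<delta>\<^sup>2 \<le> \<nu> * \<delta>" using mult_right_mono[OF assms(5), of \<delta>] assms(4) by (simp add: power2_eq_square)
    moreover have "0 \<le> \<nu> * \<delta>" using assms(1,4) by simp
    \<comment> \<open>The forcing uses half of \<nu> \<delta> and the quadratic term a quarter of
      it, since 3920 = 4 * 980.\<close>
    ultimately have "(1 + c) * X_norm f + 980 * (H1_norm (fst p) (snd p))\<^sup>2 \<le> \<nu> * \<delta>"
      using assms(6) by linarith
    then have "((1 + c) * X_norm f + 980 * (H1_norm (fst p) (snd p))\<^sup>2) / \<nu> \<le> \<delta>" using assms(1) by (simp add: field_simps)
    then have "H1_norm u G \<le> \<delta>" using u(3) by linarith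
    with u show "\<exists>q. ?P q \<and> ?Q p q" by (intro exI[of _ "(u, G)"]) simp
  qed
  then obtain p where p: "\<And>n. ?P (p n)" "\<And>n. ?Q (p n) (p (Suc n))" by blast
  define u G where "u = (\<lambda>n. fst (p n))" and "G = (\<lambda>n. snd (p n))"
  have H: "H1 (u n) (G n)" and nd: "H1_norm (u n) (G n) \<le> \<delta>" for n using p(1) by (auto simp: u_def G_def)
  have eq: "\<nu> * (\<integral>x. G (Suc n) x \<bullet> grad \<phi> x \<partial>lborel) = pair f \<phi> - convection (u n) (G n) \<phi>" if "\<phi> \<in> Vsp" for n \<phi>
    using p(2)[of n] that by (simp add: u_def G_def)
  note L = H1_L2[OF H]
  let ?n = "\<lambda>m n. H1_norm (\<lambda>x. u m x - u n x) (\<lambda>x. G m x - G n x)"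
  have step: "?n (Suc (Suc n)) (Suc n) \<le> 1/2 * ?n (Suc n) n" for n
  proof -
    have "?n (Suc (Suc n)) (Suc n) \<le> 980 * (H1_norm (u n) (G n) + H1_norm (u (Suc n)) (G (Suc n))) / \<nu> * ?n (Suc n) n"
      by (rule Picard_contraction[OF assms(1) H H H H eq eq])
    also have "\<dots> \<le> 1/2 * ?n (Suc n) n"
    proof (rule mult_right_mono)
      \<comment> \<open>Two iterates of norm at most \<delta> give 1960 \<delta> \<le> \<nu> / 2,
        hence the contraction factor 1/2.\<close>
      have "980 * (H1_norm (u n) (G n) + H1_norm (u (Suc n)) (G (Suc n))) \<le> \<nu> / 2"
        unfolding distrib_left using nd[of n] nd[of "Suc n"] assms(5) by linarith
      then show "980 * (H1_norm (u n) (G n) + H1_norm (u (Suc n)) (G (Suc n))) / \<nu> \<le> 1/2" using assms(1) by (simp add: field_simps)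
    qed simp
    finally show ?thesis .
  qed
  define D where "D = ?n 1 0"
  have D: "D \<ge> 0" by (simp add: D_def)
  have geo: "?n (Suc n) n \<le> (1/2)^n * D" for n
  proof (induction n)
    case 0 show ?case by (simp add: D_def)
  next
    case (Suc n) then show ?case using step[of n] by simp
  qed
  \<comment> \<open>The bound is the exact partial sum of the geometric series; the subtracted term
    lets the induction on k close.\<close>
  have tail: "?n (n + k) n \<le> 2 * (1/2)^n * D - 2 * (1/2)^(n + k) * D" for n k
  proof (induction k)
    case 0 show ?case by (simp add: H1_norm_def)
  next
    case (Suc k)
    have "?n (n + Suc k) n \<le> ?n (Suc (n + k)) (n + k) + ?n (n + k) n"
      using H1_norm_triangle[OF H[of "n + Suc k"] H[of "n + k"] H[of n]] by simp
    also have "\<dots> \<le> (1/2)^(n + k) * D + (2 * (1/2)^n * D - 2 * (1/2)^(n + k) * D)"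
      by (intro add_mono geo Suc)
    also have "\<dots> = 2 * (1/2)^n * D - 2 * (1/2)^(n + Suc k) * D" by (simp add: algebra_simps)
    finally show ?case .
  qed
  have tail': "?n m n \<le> 2 * (1/2)^n * D" if "m \<ge> n" for m n
  proof -
    have "0 \<le> 2 * (1/2)^m * D" using D by simp
    moreover have "?n m n \<le> 2 * (1/2)^n * D - 2 * (1/2)^m * D" using tail[of n "m - n"] that by simp
    ultimately show ?thesis by linarith
  qed
  have sym: "?n m n = ?n n m" for m n
    by (simp add: H1_norm_def L2_norm_minus_commute[of "u m" "u n"] L2_norm_minus_commute[of "G m" "G n"])
  have C: "\<exists>N. \<forall>m\<ge>N. \<forall>n\<ge>N. ?n m n < e" if "e > 0" for e :: real
  proof -
    have "(\<lambda>N. 2 * (1/2)^N * D) \<longlonglongrightarrow> 2 * 0 * D"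
      by (intro tendsto_intros LIMSEQ_realpow_zero) auto
    then have "\<forall>\<^sub>F N in sequentially. 2 * (1/2)^N * D < e / 2" using that by (intro order_tendstoD(2)) auto
    then obtain N where N: "2 * (1/2)^N * D < e / 2" by (auto simp: eventually_sequentially)
    have "?n m n < e" if "m \<ge> N" "n \<ge> N" for m n
    proof -
      have "?n m n \<le> ?n m N + ?n N n" by (rule H1_norm_triangle[OF H H H])
      then show ?thesis using tail'[OF that(1)] tail'[OF that(2)] sym[of N n] N by linarith
    qed
    then show ?thesis by blast
  qed
  have le: "L2_norm (\<lambda>x. u m x - u n x) \<le> ?n m n" "L2_norm (\<lambda>x. G m x - G n x) \<le> ?n m n" for m n
    by (auto simp: H1_norm_def)
  have Cu: "\<exists>N. \<forall>m\<ge>N. \<forall>n\<ge>N. L2_norm (\<lambda>x. u m x - u n x) < e"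
    and CG: "\<exists>N. \<forall>m\<ge>N. \<forall>n\<ge>N. L2_norm (\<lambda>x. G m x - G n x) < e" if e: "e > 0" for e :: real
  proof -
    obtain N where N: "\<And>m n. m \<ge> N \<Longrightarrow> n \<ge> N \<Longrightarrow> ?n m n < e" using C[OF e] by blast
    show "\<exists>N. \<forall>m\<ge>N. \<forall>n\<ge>N. L2_norm (\<lambda>x. u m x - u n x) < e"
      by (intro exI[of _ N] allI impI) (rule le_less_trans[OF le(1) N])
    show "\<exists>N. \<forall>m\<ge>N. \<forall>n\<ge>N. L2_norm (\<lambda>x. G m x - G n x) < e"
      by (intro exI[of _ N] allI impI) (rule le_less_trans[OF le(2) N])
  qed
  obtain U where U: "U \<in> L2" "(\<lambda>n. L2_norm (\<lambda>x. u n x - U x)) \<longlonglongrightarrow> 0"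
    using L2_complete[OF L(1) Cu] by blast
  obtain K where K: "K \<in> L2" "(\<lambda>n. L2_norm (\<lambda>x. G n x - K x)) \<longlonglongrightarrow> 0"
    using L2_complete[OF L(2) CG] by blast
  have UK: "H1 U K" by (rule H1_closed[OF H U(1) K(1) U(2) K(2)])
  have "(\<lambda>n. H1_norm (u n) (G n)) \<longlonglongrightarrow> H1_norm U K"
    unfolding H1_norm_def by (intro tendsto_add L2_norm_tendsto L U K)
  then have nUK: "H1_norm U K \<le> \<delta>" using nd LIMSEQ_le_const2 by blast
  have "convection U K \<phi> + \<nu> * (\<integral>x. K x \<bullet> grad \<phi> x \<partial>lborel) = pair f \<phi>" if \<phi>: "\<phi> \<in> Vsp" for \<phi>
  proof -
    let ?d = "\<lambda>n. H1_norm (\<lambda>x. u n x - U x) (\<lambda>x. G n x - K x)"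
    have d0: "?d \<longlonglongrightarrow> 0" using tendsto_add[OF U(2) K(2)] by (simp add: H1_norm_def)
    have "(\<lambda>n. convection (u n) (G n) \<phi>) \<longlonglongrightarrow> convection U K \<phi>"
    proof (rule LIM_zero_cancel, rule tendsto_rabs_zero_cancel, rule tendsto_sandwich[OF _ _ tendsto_const])
      have "(\<lambda>n. 490 * (?d n * \<delta>) * L2_norm (grad \<phi>) + 490 * (\<delta> * ?d n) * L2_norm (grad \<phi>)) \<longlonglongrightarrow>
        490 * (0 * \<delta>) * L2_norm (grad \<phi>) + 490 * (\<delta> * 0) * L2_norm (grad \<phi>)"
        by (intro tendsto_intros d0)
      then show "(\<lambda>n. 490 * (?d n * \<delta>) * L2_norm (grad \<phi>) + 490 * (\<delta> * ?d n) * L2_norm (grad \<phi>)) \<longlonglongrightarrow> 0" by simp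
      show "\<forall>\<^sub>F n in sequentially. \<bar>convection (u n) (G n) \<phi> - convection U K \<phi>\<bar>
        \<le> 490 * (?d n * \<delta>) * L2_norm (grad \<phi>) + 490 * (\<delta> * ?d n) * L2_norm (grad \<phi>)"
      proof (intro always_eventually allI)
        fix n
        have dn: "H1 (\<lambda>x. u n x - U x) (\<lambda>x. G n x - K x)" by (intro H1_diff H UK)
        have "\<bar>convection (\<lambda>x. u n x - U x) (G n) \<phi>\<bar> \<le> 490 * (?d n * H1_norm (u n) (G n)) * L2_norm (grad \<phi>)"
          by (rule convection_functional(1)[OF dn H \<phi>])
        also have "\<dots> \<le> 490 * (?d n * \<delta>) * L2_norm (grad \<phi>)"
          using nd[of n] by (intro mult_right_mono mult_left_mono) auto
        finally have 1: "\<bar>convection (\<lambda>x. u n x - U x) (G n) \<phi>\<bar> \<le> 490 * (?d n * \<delta>) * L2_norm (grad \<phi>)" .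
        have "\<bar>convection U (\<lambda>x. G n x - K x) \<phi>\<bar> \<le> 490 * (H1_norm U K * ?d n) * L2_norm (grad \<phi>)"
          by (rule convection_functional(1)[OF UK dn \<phi>])
        also have "\<dots> \<le> 490 * (\<delta> * ?d n) * L2_norm (grad \<phi>)"
          using nUK by (intro mult_right_mono mult_left_mono) auto
        finally show "\<bar>convection (u n) (G n) \<phi> - convection U K \<phi>\<bar>
          \<le> 490 * (?d n * \<delta>) * L2_norm (grad \<phi>) + 490 * (\<delta> * ?d n) * L2_norm (grad \<phi>)"
          using 1 convection_diff_both[OF H UK Vsp_L6[OF \<phi>], of n] by linarith
      qed
    qed auto
    then have "(\<lambda>n. pair f \<phi> - convection (u n) (G n) \<phi>) \<longlonglongrightarrow> pair f \<phi> - convection U K \<phi>" by (intro tendsto_intros)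
    moreover have "(\<lambda>n. \<nu> * (\<integral>x. G (Suc n) x \<bullet> grad \<phi> x \<partial>lborel)) \<longlonglongrightarrow> \<nu> * (\<integral>x. K x \<bullet> grad \<phi> x \<partial>lborel)"
      by (intro tendsto_mult tendsto_const L2_inner_tendsto L K LIMSEQ_Suc[OF K(2)] Vsp_grad_L2 \<phi>) simp
    ultimately have "\<nu> * (\<integral>x. K x \<bullet> grad \<phi> x \<partial>lborel) = pair f \<phi> - convection U K \<phi>"
      using LIMSEQ_unique by (simp add: eq[OF \<phi>])
    then show ?thesis by simp
  qed
  with UK nUK show ?thesis by blast
qed

section \<open>The energy bound and uniqueness\<close>

lemma energy_bound:
  assumes "\<nu> > 0" "f \<in> Xsp" "H1 U K"
    and eq: "\<And>\<phi>. \<phi> \<in> Vsp \<Longrightarrow> convection U K \<phi> + \<nu> * (\<integral>x. K x \<bullet> grad \<phi> x \<partial>lborel) = pair f \<phi>"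
  shows "L2_norm K \<le> X_norm f / \<nu>"
proof -
  note L = H1_L2[OF assms(3)] H1_L6(1)[OF assms(3)]
  obtain \<psi> where c: "H1_approx U K \<psi>" using assms(3) by (auto simp: H1_def)
  note p = H1_approxD[OF c] and hc = H1_approx_imp_Hdot1_approx(1)[OF c]
  note h = Hdot1_approxD[OF hc]
  have "convection U K U = - convection U K U" by (rule convection_antisym[OF L(1,3) H1_wdiv_free[OF assms(3)] hc hc])
  then have t0: "convection U K U = 0" by simp
  have "(\<lambda>n. convection U K (\<psi> n) + \<nu> * (\<integral>x. K x \<bullet> grad (\<psi> n) x \<partial>lborel)) \<longlonglongrightarrow> convection U K U + \<nu> * (\<integral>x. K x \<bullet> K x \<partial>lborel)"
    by (intro tendsto_add tendsto_mult tendsto_const convection_tendsto L2_inner_tendsto L p h) simp_all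
  then have lim: "(\<lambda>n. pair f (\<psi> n)) \<longlonglongrightarrow> \<nu> * (L2_norm K)\<^sup>2"
    by (simp add: eq[OF p(3)] t0 L2_norm_sq_inner[OF L(2)])
  have "\<nu> * (L2_norm K)\<^sup>2 \<le> X_norm f * L2_norm K"
  proof (rule LIMSEQ_le[OF lim])
    show "(\<lambda>n. X_norm f * L2_norm (grad (\<psi> n))) \<longlonglongrightarrow> X_norm f * L2_norm K"
      by (intro tendsto_mult tendsto_const L2_norm_tendsto p)
    have "pair f (\<psi> n) \<le> X_norm f * L2_norm (grad (\<psi> n))" for n
      using Hdual_bound(1)[OF assms(2) p(3), of n] mult_right_mono[OF X_norm_bounds(2)[OF assms(2)], of "L2_norm (grad (\<psi> n))"] by simp
    then show "\<exists>N. \<forall>n\<ge>N. pair f (\<psi> n) \<le> X_norm f * L2_norm (grad (\<psi> n))" by blast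
  qed
  then have *: "L2_norm K * (\<nu> * L2_norm K) \<le> L2_norm K * X_norm f" by (simp add: power2_eq_square mult_ac)
  have "\<nu> * L2_norm K \<le> X_norm f"
  proof (cases "L2_norm K = 0")
    case True then show ?thesis using X_norm_bounds(3)[OF assms(2)] by simp
  next
    case False
    then have "L2_norm K > 0" using L2_norm_nonneg[of K] by linarith
    then show ?thesis by (rule mult_left_le_imp_le[OF *])
  qed
  then show ?thesis using assms(1) by (simp add: field_simps)
qed

text \<open>Testing with the difference \<open>W\<close> leaves one convective term in which the
  constructed solution is paired with the gradient of \<open>W\<close>. It is at most 49
  \<open>H1_norm U K\<close> times the squared gradient norm of \<open>W\<close>, less than the
  factor \<nu> of the viscous term.\<close>

lemma weak_solution_unique:
  assumes "\<nu> > 0" "H1 U K" "49 * H1_norm U K < \<nu>"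
    and eqU: "\<And>\<phi>. \<phi> \<in> Vsp \<Longrightarrow> convection U K \<phi> + \<nu> * (\<integral>x. K x \<bullet> grad \<phi> x \<partial>lborel) = pair f \<phi>"
    and V: "V \<in> Hdot1sig" "V \<in> L2" "weak_solution \<nu> f V H"
  shows "AE x in lborel. V x = U x"
proof -
  obtain G \<xi> where G: "weak_grad V G" "Hdot1_approx V G \<xi>" using Hdot1sig_Hdot1_approx[OF V(1)] .
  note g = Hdot1_approxD[OF G(2)]
  have wH: "weak_grad V H" using V(3) by (simp add: weak_solution_def)
  \<comment> \<open>From here on the gradient \<open>G\<close> belonging to the approximation takes
    the place of \<open>H\<close>, so that limits along test fields are available.\<close>
  have HG: "AE x in lborel. H x = G x" by (rule weak_grad_unique[OF wH G(1)])
  have [measurable]: "H \<in> borel_measurable borel" using wH by (simp add: weak_grad_def)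
  note [measurable] = L2_measurable[OF V(2)] L2_measurable[OF g(2)]
  have eqV: "convection V G \<phi> + \<nu> * (\<integral>x. G x \<bullet> grad \<phi> x \<partial>lborel) = pair f \<phi>" if \<phi>: "\<phi> \<in> Vsp" for \<phi>
  proof -
    note [measurable] = Vsp_measurable[OF \<phi>] L2_measurable[OF Vsp_grad_L2[OF \<phi>]]
    have "(\<integral>x. (H x *v V x) \<bullet> \<phi> x \<partial>lborel) = convection V G \<phi>" unfolding convection_def
      by (rule integral_cong_AE, measurable) (use HG in \<open>auto elim!: eventually_mono\<close>)
    moreover have "(\<integral>x. H x \<bullet> grad \<phi> x \<partial>lborel) = (\<integral>x. G x \<bullet> grad \<phi> x \<partial>lborel)"
      by (rule integral_cong_AE, measurable) (use HG in \<open>auto elim!: eventually_mono\<close>)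
    moreover have "(\<integral>x. (H x *v V x) \<bullet> \<phi> x \<partial>lborel) + \<nu> * (\<integral>x. H x \<bullet> grad \<phi> x \<partial>lborel) = pair f \<phi>"
      using V(3) \<phi> unfolding weak_solution_def by blast
    ultimately show ?thesis by simp
  qed
  have Vdiv: "wdiv_free V" by (rule weak_grad_wdiv_free[OF G(1) trace_zero_limit[OF g(3,2,7)]])
  note UL = H1_L2[OF assms(2)] H1_L6(1)[OF assms(2)]
  obtain \<psi> where cU: "H1_approx U K \<psi>" using assms(2) by (auto simp: H1_def)
  note hU = H1_approx_imp_Hdot1_approx(1)[OF cU]
  define W D where "W = (\<lambda>x. V x - U x)" and "D = (\<lambda>x. G x - K x)"
  have hW: "Hdot1_approx W D (\<lambda>n x. \<xi> n x - \<psi> n x)" unfolding W_def D_def by (rule Hdot1_approx_diff[OF G(2) hU])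
  note w = Hdot1_approxD[OF hW]
  have WL: "W \<in> L2" unfolding W_def by (intro L2_diff V UL)
  have Wdiv: "wdiv_free W"
    unfolding wdiv_free_def
  proof
    fix \<psi> :: "R3 \<Rightarrow> real" assume t: "\<psi> \<in> test_fun"
    have i: "integrable lborel (\<lambda>x. \<Sum>j\<in>UNIV. V x $ j * pd j \<psi> x)" "integrable lborel (\<lambda>x. \<Sum>j\<in>UNIV. U x $ j * pd j \<psi> x)"
      using G(1) H1_weak_grad[OF assms(2)] t by (auto simp: weak_grad_def)
    have "(\<integral>x. (\<Sum>j\<in>UNIV. W x $ j * pd j \<psi> x) \<partial>lborel) =
      (\<integral>x. (\<Sum>j\<in>UNIV. V x $ j * pd j \<psi> x) - (\<Sum>j\<in>UNIV. U x $ j * pd j \<psi> x) \<partial>lborel)"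
      by (simp add: W_def sum_subtractf left_diff_distrib)
    also have "\<dots> = 0"
      using Vdiv H1_wdiv_free[OF assms(2)] t i by (simp add: wdiv_free_def)
    finally show "(\<integral>x. (\<Sum>j\<in>UNIV. W x $ j * pd j \<psi> x) \<partial>lborel) = 0" .
  qed
  \<comment> \<open>The quadratic terms are split so that the competitor \<open>V\<close> transports
    the difference and the difference transports \<open>U\<close>. The former drops out by
    antisymmetry; the latter involves the small solution.\<close>
  have eqW: "convection V D \<phi> + convection W K \<phi> + \<nu> * (\<integral>x. D x \<bullet> grad \<phi> x \<partial>lborel) = 0" if \<phi>: "\<phi> \<in> Vsp" for \<phi>
  proof -
    note \<phi>6 = Vsp_L6[OF \<phi>]
    have "convection V D \<phi> = convection V G \<phi> - convection V K \<phi>" unfolding D_def by (rule convection_diff_G[OF V(2) g(1,2) UL(2) \<phi>6])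
    moreover have "convection W K \<phi> = convection V K \<phi> - convection U K \<phi>" unfolding W_def by (rule convection_diff_W[OF V(2) g(1) UL(1,3,2) \<phi>6])
    moreover have "(\<integral>x. D x \<bullet> grad \<phi> x \<partial>lborel) = (\<integral>x. G x \<bullet> grad \<phi> x \<partial>lborel) - (\<integral>x. K x \<bullet> grad \<phi> x \<partial>lborel)"
      unfolding D_def by (rule L2_inner_diff(2)[OF g(2) UL(2) Vsp_grad_L2[OF \<phi>]])
    ultimately show ?thesis using eqV[OF \<phi>] eqU[OF \<phi>] by (simp add: right_diff_distrib)
  qed
  have "(\<lambda>n. convection V D (\<lambda>x. \<xi> n x - \<psi> n x) + convection W K (\<lambda>x. \<xi> n x - \<psi> n x) + \<nu> * (\<integral>x. D x \<bullet> grad (\<lambda>x. \<xi> n x - \<psi> n x) x \<partial>lborel))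
    \<longlonglongrightarrow> convection V D W + convection W K W + \<nu> * (\<integral>x. D x \<bullet> D x \<partial>lborel)"
    by (intro tendsto_add tendsto_mult tendsto_const convection_tendsto L2_inner_tendsto V g WL UL w) simp_all
  then have "convection V D W + convection W K W + \<nu> * (L2_norm D)\<^sup>2 = 0"
    by (simp add: eqW[OF w(3)] LIMSEQ_const_iff L2_norm_sq_inner[OF w(2)])
  moreover have "convection V D W = - convection V D W" by (rule convection_antisym[OF V(2) g(1) Vdiv hW hW])
  \<comment> \<open>The derivative is moved from \<open>U\<close> to the difference, so that
    \<open>U\<close> itself appears and can take the exponent 3. The bounds for \<open>U\<close> in
    L^3 and for \<open>W\<close> in L^6 contribute 7 each.\<close>
  moreover have "convection W K W = - convection W D U" by (rule convection_antisym[OF WL w(1) Wdiv hU hW])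
  ultimately have "\<nu> * (L2_norm D)\<^sup>2 = convection W D U" by linarith
  also have "\<dots> \<le> L2_norm D * L3_bound U * L6_norm W"
    using convection_bound''(2)[OF w(1,2) UL(1,3)] by linarith
  also have "\<dots> \<le> L2_norm D * (7 * H1_norm U K) * (7 * L2_norm D)"
    by (intro mult_mono mult_left_mono H1_L3_bound[OF assms(2)] Hdot1_approx_Sobolev[OF hW]) auto
  also have "\<dots> = 49 * H1_norm U K * (L2_norm D)\<^sup>2" by (simp add: power2_eq_square)
  finally have "(\<nu> - 49 * H1_norm U K) * (L2_norm D)\<^sup>2 \<le> 0" by (simp add: algebra_simps)
  then have "(L2_norm D)\<^sup>2 \<le> 0" using assms(3) by (simp add: mult_le_0_iff)
  then have "L2_norm D = 0" by simp
  then have "L6_norm W = 0" using Hdot1_approx_Sobolev[OF hW] L6_norm_nonneg[of W] by simp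
  then have "Lp_int 6 W = 0" using w(1) by (simp add: Lp_int_6_eq)
  then have "AE x in lborel. W x = 0"
    using L2_measurable[OF WL] unfolding Lp_int_6 by (subst (asm) nn_integral_0_iff_AE) auto
  then show ?thesis by eventually_elim (simp add: W_def)
qed

theorem theorem1p1:
  fixes \<nu> M \<rho>0 :: real
  assumes "\<nu> > 0" and "M > 0" and "\<rho>0 > 0"
  shows "\<exists>C>0. \<forall>f. f \<in> Xsp \<and> assumptionA \<rho>0 f \<and> X_norm f \<le> C \<longrightarrow>
     (\<exists>U G. U \<in> H1sig \<and> weak_grad U G \<and> weak_solution \<nu> f U G \<and>
        L2_norm U \<le> M \<and> L2_norm G \<le> X_norm f / \<nu> \<and>
        (\<forall>V H. V \<in> Hdot1sig \<and> V \<in> L2 \<and> weak_grad V H \<and> weak_solution \<nu> f V H \<and>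
               L2_norm H \<le> X_norm f / \<nu> \<longrightarrow> (AE x in lborel. V x = U x)))"
proof -
  obtain c where c: "c \<ge> 0" "\<And>f v G R. assumptionA \<rho>0 f \<Longrightarrow> H1 v G \<Longrightarrow>
    (\<And>h. L2_norm (\<lambda>x. G (x + h) - G x) \<le> R * norm h) \<Longrightarrow> \<bar>pair f v\<bar> \<le> c * L2_norm f * R"
    using spectral_gap_functional[OF assms(3)] by blast
  \<comment> \<open>One radius serves both purposes: M bounds the L^2 norm of the solution, and
    \<nu> / 3920 is the contraction threshold.\<close>
  define \<delta> where "\<delta> = min M (\<nu> / 3920)"
  have \<delta>: "\<delta> > 0" "3920 * \<delta> \<le> \<nu>" "\<delta> \<le> M" using assms by (auto simp: \<delta>_def)
  \<comment> \<open>Chosen so that 2 (1 + c) C = \<nu> \<delta>. Since \<open>c\<close> was obtained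
    from \<rho>0 before any \<open>f\<close> is given, C depends only on \<rho>0, \<nu> and
    M.\<close>
  define C where "C = \<nu> * \<delta> / (2 * (1 + c))"
  have "C > 0" using assms \<delta> c(1) by (auto simp: C_def intro!: divide_pos_pos)
  moreover have "\<exists>U G. U \<in> H1sig \<and> weak_grad U G \<and> weak_solution \<nu> f U G \<and>
        L2_norm U \<le> M \<and> L2_norm G \<le> X_norm f / \<nu> \<and>
        (\<forall>V H. V \<in> Hdot1sig \<and> V \<in> L2 \<and> weak_grad V H \<and> weak_solution \<nu> f V H \<and>
               L2_norm H \<le> X_norm f / \<nu> \<longrightarrow> (AE x in lborel. V x = U x))"
    if f: "f \<in> Xsp" "assumptionA \<rho>0 f" "X_norm f \<le> C" for f
  proof -
    have "2 * (1 + c) * X_norm f \<le> 2 * (1 + c) * C" using f(3) c(1) by (intro mult_left_mono) auto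
    also have "\<dots> = \<nu> * \<delta>" using c(1) by (simp add: C_def)
    finally have small: "2 * (1 + c) * X_norm f \<le> \<nu> * \<delta>" .
    obtain U K where U: "H1 U K" "H1_norm U K \<le> \<delta>"
      "\<And>\<phi>. \<phi> \<in> Vsp \<Longrightarrow> convection U K \<phi> + \<nu> * (\<integral>x. K x \<bullet> grad \<phi> x \<partial>lborel) = pair f \<phi>"
      using Picard_fixed_point[OF assms(1) f(1) c(1) \<delta>(1,2) small] c(2)[OF f(2)] by blast
    have "weak_solution \<nu> f U K"
      unfolding weak_solution_def using H1_weak_grad[OF U(1)] U(3) by (simp add: convection_def)
    moreover have "L2_norm U \<le> M" using U(2) \<delta>(3) L2_norm_nonneg[of K] unfolding H1_norm_def by linarith
    moreover have "L2_norm K \<le> X_norm f / \<nu>" by (rule energy_bound[OF assms(1) f(1) U(1,3)])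
    \<comment> \<open>The smallness for uniqueness is implied by the contraction threshold, because
      49 < 3920.\<close>
    moreover have "49 * H1_norm U K < \<nu>" using U(2) \<delta> assms(1) by linarith
    then have "AE x in lborel. V x = U x" if "V \<in> Hdot1sig" "V \<in> L2" "weak_solution \<nu> f V H" for V H
      by (rule weak_solution_unique[OF assms(1) U(1) _ U(3) that])
    ultimately show ?thesis using H1_H1sig[OF U(1)] H1_weak_grad[OF U(1)]
      by (intro exI[of _ U] exI[of _ K]) blast
  qed
  ultimately show ?thesis by blast
qed

end
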